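(* Let $2<p\le\infty$. Let $f$ be a continuous complex-valued function on an open subset $\Omega$ of $\mathbf{C}^n$. Assume that there is a constant $M>0$ such that for each $j=1,\dots,n$ and for every complex line $L$ parallel to the $z_j$-axis (and intersecting $\Omega$), there is a $(0,1)$-form $A_L$ on $L\cap\Omega$ such that, in the sense of distributions, $$\overline\partial(f|_L)=A_L f\ \text{ on } L\cap\Omega,\qquad \|A_L\|_{L^p(L\cap\Omega)}\le M .$$ Then $f^{-1}(0)$ is a complex variety (a closed complex analytic subset of $\Omega$). Moreover, $e^{-u}f$ is holomorphic for some locally defined $u\in C^{\alpha}_{loc}$, with $\alpha=1-\frac2p$ if $2<p<\infty$, and with any $\alpha<1$ if $p=\infty$; that is, every point of $\Omega$ has a neighborhood on which there is such a function $u$ with $e^{-u}f$ holomorphic there.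
   Context: A complex line parallel to the $z_j$-axis is a set obtained by fixing all coordinates other than $z_j$; it is identified with $\mathbf{C}$ via the coordinate $z_j$, and the $L^p$ norm of $A_L=a_L\,d\overline z_j$ on $L\cap\Omega$ is that of $a_L$ with respect to Lebesgue measure in $z_j$. The constant $M$ does not depend on $L$. $C^\alpha_{loc}$ denotes locally Hölder continuous functions of exponent $\alpha$. *)

theory Defs
  imports "HOL-Analysis.Analysis" "HOL-Probability.Essential_Supremum"
begin

section \<open>Holomorphic functions and analytic subsets in several variables\<close>

definition holo_on :: "(complex ^ 'n \<Rightarrow> complex) \<Rightarrow> (complex ^ 'n) set \<Rightarrow> bool" where
  "holo_on g U \<longleftrightarrow> open U \<and>
     (\<forall>z\<in>U. \<exists>D. (g has_derivative D) (at z) \<and> (\<forall>c v. D (c *s v) = c * D v))"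

text \<open>The local equations are required near every point of \<open>\<Omega>\<close>, not merely of \<open>A\<close>, so \<open>A\<close> is
  automatically relatively closed in \<open>\<Omega>\<close>.\<close>

definition analytic_subset :: "(complex ^ 'n) set \<Rightarrow> (complex ^ 'n) set \<Rightarrow> bool" where
  "analytic_subset \<Omega> A \<longleftrightarrow> A \<subseteq> \<Omega> \<and>
     (\<forall>a\<in>\<Omega>. \<exists>U G. open U \<and> a \<in> U \<and> U \<subseteq> \<Omega> \<and> finite G \<and> (\<forall>g\<in>G. holo_on g U) \<and>
        A \<inter> U = {z\<in>U. \<forall>g\<in>G. g z = 0})"

section \<open>Locally Hoelder continuous functions\<close>

definition holder_loc :: "real \<Rightarrow> ('a::metric_space) set \<Rightarrow> ('a \<Rightarrow> 'b::metric_space) \<Rightarrow> bool" where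
  "holder_loc \<alpha> U u \<longleftrightarrow>
     (\<forall>a\<in>U. \<exists>V C. open V \<and> a \<in> V \<and> V \<subseteq> U \<and>
        (\<forall>x\<in>V. \<forall>y\<in>V. dist (u x) (u y) \<le> C * dist x y powr \<alpha>))"

section \<open>Lebesgue norms for exponents up to infinity\<close>

text \<open>Only used for \<open>p > 0\<close> and measurable \<open>a\<close>. The case distinction on the integral is needed
  because \<open>powr\<close> is not available on \<open>ennreal\<close>.\<close>

definition Lp_norm :: "ennreal \<Rightarrow> 'a measure \<Rightarrow> ('a \<Rightarrow> complex) \<Rightarrow> ennreal" where
  "Lp_norm p \<mu> a =
     (if p = \<infinity> then esssup \<mu> (\<lambda>x. ennreal (norm (a x)))
      else let I = (\<integral>\<^sup>+ x. ennreal (norm (a x) powr enn2real p) \<partial>\<mu>)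
           in if I = \<infinity> then \<infinity> else ennreal (enn2real I powr (1 / enn2real p)))"

section \<open>The distributional Cauchy-Riemann operator in the plane\<close>

primrec Ck_fun :: "nat \<Rightarrow> (complex \<Rightarrow> complex) \<Rightarrow> bool" where
  "Ck_fun 0 \<phi> \<longleftrightarrow> continuous_on UNIV \<phi>"
| "Ck_fun (Suc k) \<phi> \<longleftrightarrow> (\<forall>z. \<phi> differentiable (at z)) \<and>
     (\<forall>v. Ck_fun k (\<lambda>z. frechet_derivative \<phi> (at z) v))"

text \<open>Here \<open>differentiable\<close> is over the reals. Compactly supported functions on \<open>W\<close> are extended
  by \<open>0\<close> to the whole plane.\<close>

definition test_fun :: "complex set \<Rightarrow> (complex \<Rightarrow> complex) \<Rightarrow> bool" where
  "test_fun W \<phi> \<longleftrightarrow> (\<forall>k. Ck_fun k \<phi>) \<and>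
     compact (closure {z. \<phi> z \<noteq> 0}) \<and> closure {z. \<phi> z \<noteq> 0} \<subseteq> W"

definition dbar :: "(complex \<Rightarrow> complex) \<Rightarrow> complex \<Rightarrow> complex" where
  "dbar \<phi> z = (frechet_derivative \<phi> (at z) 1 + \<i> * frechet_derivative \<phi> (at z) \<i>) / 2"

definition loc_integrable :: "complex set \<Rightarrow> (complex \<Rightarrow> complex) \<Rightarrow> bool" where
  "loc_integrable W g \<longleftrightarrow> (\<forall>K. compact K \<and> K \<subseteq> W \<longrightarrow> set_integrable lebesgue K g)"

text \<open>\<open>has_weak_dbar W g h\<close>: on the open set \<open>W\<close>, the derivative of \<open>g\<close> with respect to
  \<open>cnj z\<close> equals \<open>h\<close> in the sense of distributions. Local integrability makes \<open>g\<close> and \<open>h\<close>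
  distributions and keeps the integrals below from taking the default value \<open>0\<close>.\<close>

definition has_weak_dbar :: "complex set \<Rightarrow> (complex \<Rightarrow> complex) \<Rightarrow> (complex \<Rightarrow> complex) \<Rightarrow> bool" where
  "has_weak_dbar W g h \<longleftrightarrow> loc_integrable W g \<and> loc_integrable W h \<and>
     (\<forall>\<phi>. test_fun W \<phi> \<longrightarrow>
        - (LINT z|lebesgue_on W. g z * dbar \<phi> z) = (LINT z|lebesgue_on W. h z * \<phi> z))"

section \<open>Complex lines parallel to a coordinate axis\<close>

text \<open>\<open>on_line j w\<close> parametrises the line through \<open>w\<close> parallel to the \<open>j\<close>-th axis by its \<open>j\<close>-th
  coordinate (so the \<open>j\<close>-th coordinate of \<open>w\<close> is irrelevant); \<open>line_slice\<close> is the part of the line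
  inside \<open>\<Omega>\<close> in this coordinate.\<close>

definition on_line :: "'n \<Rightarrow> complex ^ 'n \<Rightarrow> complex \<Rightarrow> complex ^ 'n" where
  "on_line j w \<zeta> = (\<chi> i. if i = j then \<zeta> else w $ i)"

definition line_slice :: "'n \<Rightarrow> complex ^ 'n \<Rightarrow> (complex ^ 'n) set \<Rightarrow> complex set" where
  "line_slice j w \<Omega> = {\<zeta>. on_line j w \<zeta> \<in> \<Omega>}"

end

theory Submission
  imports Defs "HOL-Complex_Analysis.Complex_Analysis"
begin

text \<open>
  Work near a point, on a polydisc. On every line parallel to an axis the equation
  \<open>dbar f = A f\<close> with \<open>A\<close> in \<open>L\<^sup>q\<close>, \<open>q > 2\<close>, says that \<open>exp (- V) * f\<close> is holomorphic, where \<open>V\<close> is the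
  Cauchy transform of \<open>A\<close>. Hoelder's inequality bounds the Hoelder constant of \<open>V\<close> (exponent \<open>1 - 2 / q\<close>) by
  the norm of \<open>A\<close>, hence uniformly in the line; this is \<open>weak_to_exp\<close>. For \<open>p = \<infinity>\<close> every \<open>q > 2\<close> may be used.
  The logarithms \<open>V\<close> of different lines are unrelated, and the task is to replace them by one function \<open>u\<close>.

  The coordinates are processed one after the other. Suppose that a bounded \<open>u\<close> makes \<open>exp (- u) * f\<close>
  holomorphic along the lines of some directions, and let \<open>j\<close> be a new direction. Let \<open>K\<close> be the Cauchy integral
  over a circle in the \<open>j\<close>-th variable. Then \<open>u' = (V - K V) + K u\<close> works for the old directions and for \<open>j\<close>.
  Along \<open>j\<close> this is clear, because Cauchy integrals are holomorphic. The summand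
  \<open>V - K V\<close> does not depend on the choice of \<open>V\<close>. Along an old direction \<open>z\<close>, write
  \<open>f = W * exp \<Lambda>\<close>, where \<open>W\<close> is the monic polynomial in the \<open>j\<close>-th variable \<open>s\<close> whose roots are the zeros of \<open>f\<close> in
  a disc, and \<open>\<Lambda>\<close> is jointly continuous. Then \<open>V - K V = \<Lambda> - K \<Lambda>\<close>, and so
  \<open>exp (- u') * f = W * exp (K (\<Lambda> - u))\<close>. The function \<open>\<Lambda> - u\<close> is a logarithm of the quotient of \<open>exp (- u) * f\<close> and
  \<open>W\<close>, so it is holomorphic in \<open>z\<close> as soon as \<open>W\<close> is, and its Cauchy integral is holomorphic as well. The step is
  \<open>cross_line_step\<close>, and the recursion is \<open>solves_along_insert\<close>.

  It remains to see that \<open>W\<close> is holomorphic in \<open>z\<close>, that is, that the power sums of the zeros are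
  (\<open>P_differentiable\<close>). They are continuous by Hurwitz's argument, since the functions \<open>exp (- V) * f\<close> of the lines
  form a normal family. Near a parameter where the zeros split, induction on their number applies. If all zeros
  coincide in a neighbourhood, the common zero is compared with an \<open>n\<close>-th root of a holomorphic
  function, using the equation in the direction \<open>z\<close>. The parameters where all zeros coincide form, by Rado's
  theorem, a discrete set in the remaining case, and are removable.

  Finally \<open>g = exp (- u) * f\<close> is bounded and separately holomorphic, hence holomorphic, and it has the zeros
  of \<open>f\<close>. This \<open>u\<close> need not be Hoelder continuous at the zeros. However, \<open>f / g\<close> is so along every line, where it
  equals \<open>exp V\<close> times a zero-free bounded holomorphic function. Changing one coordinate at a time gives the Hoelder
  estimate off the zero set, \<open>f / g\<close> extends to the closure, and its logarithm is the required exponent.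
\<close>

section \<open>Rado's theorem and removable zero sets\<close>

text \<open>The boundary values of harmonic polynomials. They form an algebra on the circle because \<open>cnj z = 1 / z\<close> there.\<close>
definition circ_harm :: "(complex \<Rightarrow> complex) \<Rightarrow> bool" where
  "circ_harm u \<longleftrightarrow> (\<exists>p q. \<forall>z\<in>sphere 0 1. u z = poly p z + cnj (poly q z))"

lemma circ_harm_const: "circ_harm (\<lambda>z. c)"
  unfolding circ_harm_def by (rule exI[of _ "[:c:]"], rule exI[of _ 0]) simp

lemma circ_harm_add: "circ_harm u ==> circ_harm v ==> circ_harm (\<lambda>z. u z + v z)"
  unfolding circ_harm_def
proof (elim exE)
  fix p q p' q'
  assume *: "\<forall>z\<in>sphere 0 1. u z = poly p z + cnj (poly q z)" "\<forall>z\<in>sphere 0 1. v z = poly p' z + cnj (poly q' z)"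
  show "\<exists>p q. \<forall>z\<in>sphere 0 1. u z + v z = poly p z + cnj (poly q z)"
    by (rule exI[of _ "p+p'"], rule exI[of _ "q+q'"]) (use * in auto)
qed

lemma circ_harm_cmult: "circ_harm u ==> circ_harm (\<lambda>z. c * u z)"
  unfolding circ_harm_def
proof (elim exE)
  fix p q
  assume *: "\<forall>z\<in>sphere 0 1. u z = poly p z + cnj (poly q z)"
  show "\<exists>p q. \<forall>z\<in>sphere 0 1. c * u z = poly p z + cnj (poly q z)"
    by (rule exI[of _ "smult c p"], rule exI[of _ "smult (cnj c) q"]) (use * in \<open>auto simp: algebra_simps\<close>)
qed

lemma circ_harm_cnj: "circ_harm u ==> circ_harm (\<lambda>z. cnj (u z))"
  unfolding circ_harm_def
proof (elim exE)
  fix p q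
  assume *: "\<forall>z\<in>sphere 0 1. u z = poly p z + cnj (poly q z)"
  show "\<exists>p q. \<forall>z\<in>sphere 0 1. cnj (u z) = poly p z + cnj (poly q z)"
    by (rule exI[of _ q], rule exI[of _ p]) (use * in \<open>auto simp: algebra_simps\<close>)
qed

lemma circ_harm_times_z: assumes "circ_harm u" shows "circ_harm (\<lambda>z. z * u z)"
proof -
  obtain p q where *: "\<forall>z\<in>sphere 0 1. u z = poly p z + cnj (poly q z)"
    using assms unfolding circ_harm_def by blast
  obtain a q' where q: "q = pCons a q'" by (cases q)
  have "z * u z = poly (pCons 0 p + [:0, cnj a:]) z + cnj (poly q' z)" if "z \<in> sphere 0 1" for z
  proof -
    have "z * cnj z = 1" using that by (simp add: complex_norm_square[symmetric])
    have "z * u z = z * poly p z + z * cnj a + (z * cnj z) * cnj (poly q' z)"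
      using * that by (simp add: q algebra_simps)
    thus ?thesis using \<open>z * cnj z = 1\<close> by (simp add: algebra_simps)
  qed
  thus ?thesis unfolding circ_harm_def by blast
qed

lemma circ_harm_times_poly: assumes "circ_harm u" shows "circ_harm (\<lambda>z. poly p z * u z)"
proof (induction p)
  case 0 thus ?case using circ_harm_const[of 0] by simp
next
  case (pCons a p)
  have "circ_harm (\<lambda>z. a * u z + z * (poly p z * u z))"
    by (intro circ_harm_add circ_harm_cmult circ_harm_times_z assms pCons.IH)
  thus ?case by (simp add: algebra_simps)
qed

lemma circ_harm_times: assumes "circ_harm u" "circ_harm v" shows "circ_harm (\<lambda>z. u z * v z)"
proof -
  obtain p q where *: "\<forall>z\<in>sphere 0 1. u z = poly p z + cnj (poly q z)"
    using assms unfolding circ_harm_def by blast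
  have "circ_harm (\<lambda>z. cnj (poly q z * cnj (v z)))"
    by (intro circ_harm_cnj circ_harm_times_poly assms)
  moreover have "circ_harm (\<lambda>z. poly p z * v z)"
    by (intro circ_harm_times_poly assms)
  ultimately have "circ_harm (\<lambda>z. poly p z * v z + cnj (poly q z * cnj (v z)))"
    by (intro circ_harm_add)
  moreover have "u z * v z = poly p z * v z + cnj (poly q z * cnj (v z))" if "z \<in> sphere 0 1" for z
    using * that by (simp add: algebra_simps)
  ultimately show ?thesis unfolding circ_harm_def by metis
qed

text \<open>Stone--Weierstrass for the algebra of harmonic polynomials; a real function only needs real parts.\<close>
lemma Re_poly_approx_on_circle:
  fixes g :: "complex \<Rightarrow> real"
  assumes "continuous_on (sphere 0 1) g" "e > 0"
  shows "\<exists>q. \<forall>z\<in>sphere 0 1. \<bar>g z - Re (poly q z)\<bar> < e"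
proof -
  have "\<exists>h. (circ_harm (\<lambda>z. of_real (h z)) \<and> continuous_on (sphere 0 1) h) \<and> (\<forall>x \<in> sphere 0 1. \<bar>g x - h x\<bar> < e)"
  proof (rule Stone_Weierstrass_HOL[where P = "\<lambda>h::complex\<Rightarrow>real. circ_harm (\<lambda>z. of_real (h z)) \<and> continuous_on (sphere 0 1) h"])
    show "compact (sphere 0 1 :: complex set)" by simp
    show "continuous_on (sphere 0 1) g" "0 < e" by fact+
    fix x y :: complex assume xy: "x \<in> sphere 0 1 \<and> y \<in> sphere 0 1 \<and> x \<noteq> y"
    have R: "circ_harm (\<lambda>z. of_real (Re z))"
      unfolding circ_harm_def
      by (rule exI[of _ "[:0,1/2:]"], rule exI[of _ "[:0,1/2:]"]) (auto simp: complex_eq_iff)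
    have I: "circ_harm (\<lambda>z. of_real (Im z))"
      unfolding circ_harm_def
      by (rule exI[of _ "[:0,-\<i>/2:]"], rule exI[of _ "[:0,-\<i>/2:]"]) (auto simp: complex_eq_iff)
    show "\<exists>f. (circ_harm (\<lambda>z. complex_of_real (f z)) \<and> continuous_on (sphere 0 1) f) \<and> f x \<noteq> f y"
    proof (cases "Re x = Re y")
      case True
      thus ?thesis using xy I by (intro exI[of _ Im]) (auto simp: complex_eq_iff intro!: continuous_intros)
    next
      case False
      thus ?thesis using R by (intro exI[of _ Re]) (auto intro!: continuous_intros)
    qed
  qed (auto intro!: continuous_intros circ_harm_const circ_harm_add circ_harm_times simp: o_def)
  then obtain h where h: "circ_harm (\<lambda>z. of_real (h z))" "\<And>x. x \<in> sphere 0 1 ==> \<bar>g x - h x\<bar> < e" by blast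
  then obtain p q where pq: "\<And>z. z\<in>sphere 0 1 ==> of_real (h z) = poly p z + cnj (poly q z)"
    unfolding circ_harm_def by blast
  have "h z = Re (poly (p + q) z)" if "z \<in> sphere 0 1" for z
    using arg_cong[OF pq[OF that], of Re] by simp
  with h(2) show ?thesis by metis
qed

text \<open>The zero set of \<open>F\<close> does not count for the maximum principle. For large \<open>n\<close>, apply it to
  \<open>F * exp (n * (F - G))\<close>, which extends continuously by \<open>0\<close> to the zeros of \<open>F\<close>; taking \<open>n\<close>-th roots removes the
  factor \<open>F\<close>.\<close>
lemma Re_diff_bound_off_zeros:
  assumes F: "continuous_on (cball 0 1) F" and hol: "F holomorphic_on {z\<in>ball 0 1. F z \<noteq> 0}"
    and G: "G holomorphic_on UNIV"
    and bd: "\<And>z. z \<in> sphere 0 1 ==> Re (F z - G z) \<le> e"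
    and w: "w \<in> ball 0 1" "F w \<noteq> 0"
  shows "Re (F w - G w) \<le> e"
proof (rule ccontr)
  assume neg: "\<not> Re (F w - G w) \<le> e"
  define d where "d = Re (F w - G w) - e"
  have d: "d > 0" using neg d_def by simp
  define U where "U = {z\<in>ball 0 1. F z \<noteq> 0}"
  have U: "U = ball 0 1 \<inter> (F -` (-{0}))" by (auto simp: U_def)
  have opU: "open U" unfolding U
    by (rule continuous_open_preimage) (auto intro: continuous_on_subset[OF F])
  have clU: "closure U \<subseteq> cball 0 1"
    by (rule closure_minimal) (auto simp: U_def)
  have "bounded U" by (rule bounded_subset[of "cball 0 1"]) (auto simp: U_def)
  have "compact (F ` cball 0 1)" by (intro compact_continuous_image F) auto
  then obtain B where B: "\<And>z. z \<in> cball 0 1 ==> norm (F z) \<le> B"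
    by (meson compact_imp_bounded bounded_iff imageI)
  have B0: "B > 0" using B[of w] w by (auto intro: less_le_trans[of 0 "norm (F w)"])
  have key: "exp (real n * d) * norm (F w) \<le> B" for n
  proof -
    define Hn where "Hn = (\<lambda>z. exp (of_nat n * (F z - G z - of_real e)) * F z)"
    have contG: "continuous_on A G" for A
      using holomorphic_on_imp_continuous_on[OF G] continuous_on_subset by blast
    have "norm (Hn w) \<le> B"
    proof (rule maximum_modulus_frontier[of Hn U])
      show "Hn holomorphic_on interior U"
        unfolding Hn_def interior_open[OF opU]
        using hol holomorphic_on_subset[OF G, of U] by (auto simp: U_def intro!: holomorphic_intros)
      show "continuous_on (closure U) Hn"
        unfolding Hn_def using continuous_on_subset[OF F clU] contG[of "closure U"]
        by (intro continuous_intros) auto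
      show "w \<in> U" using w by (simp add: U_def)
      fix z assume "z \<in> frontier U"
      hence z: "z \<in> closure U" "z \<notin> U" using opU by (auto simp: frontier_def interior_open)
      show "norm (Hn z) \<le> B"
      proof (cases "z \<in> sphere 0 1")
        case True
        have "norm (Hn z) = exp (real n * (Re (F z - G z) - e)) * norm (F z)"
          by (simp add: Hn_def norm_mult)
        also have "\<dots> \<le> 1 * norm (F z)"
          using bd[OF True] by (intro mult_right_mono) (auto simp: mult_le_0_iff)
        also have "\<dots> \<le> B" using B[of z] True by simp
        finally show ?thesis .
      next
        case False
        hence "z \<in> ball 0 1" using z clU by (auto simp: less_le)
        hence "F z = 0" using z by (auto simp: U_def)
        thus ?thesis using B0 by (simp add: Hn_def)
      qed
    qed fact+
    thus ?thesis by (simp add: Hn_def norm_mult d_def)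
  qed
  have "norm (F w) > 0" using w by simp
  obtain n where n: "real n * d > B / norm (F w)" using reals_Archimedean3[OF d] by blast
  have "B / norm (F w) < exp (real n * d)" using n exp_ge_add_one_self[of "real n * d"] by linarith
  hence "B < exp (real n * d) * norm (F w)" using \<open>norm (F w) > 0\<close> by (simp add: field_simps)
  with key[of n] show False by simp
qed

text \<open>Approximate \<open>Re (c * F)\<close> on the circle by real parts of polynomials. By the previous
  estimate they converge uniformly to it off the zeros, and they converge to a harmonic function on the whole disc.\<close>
lemma holomorphic_real_part_extension:
  assumes F: "continuous_on (cball 0 1) F" and hol: "F holomorphic_on {z\<in>ball 0 1. F z \<noteq> 0}"
    and c: "c \<noteq> 0"
  obtains L where "L holomorphic_on ball 0 1" "\<And>z. z \<in> ball 0 1 ==> F z \<noteq> 0 ==> Re (L z) = Re (c * F z)"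
proof -
  define F' where "F' = (\<lambda>z. c * F z)"
  have F': "continuous_on (cball 0 1) F'" "F' holomorphic_on {z\<in>ball 0 1. F' z \<noteq> 0}"
    using F hol c by (auto simp: F'_def intro!: continuous_intros holomorphic_intros)
  have mF': "continuous_on (cball 0 1) (\<lambda>z. - F' z)" "(\<lambda>z. -F' z) holomorphic_on {z\<in>ball 0 1. -F' z \<noteq> 0}"
    using F' by (auto intro!: continuous_intros holomorphic_intros)
  have "\<exists>q. \<forall>z\<in>sphere 0 1. \<bar>Re (F' z) - Re (poly q z)\<bar> < inverse (real (Suc n))" for n
    by (rule Re_poly_approx_on_circle)
       (auto intro!: continuous_intros continuous_on_subset[OF F'(1)])
  then obtain q where q: "\<And>n z. z\<in>sphere 0 1 ==> \<bar>Re (F' z) - Re (poly (q n) z)\<bar> < inverse (real (Suc n))" by metis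
  have in_O: "\<bar>Re (F' z) - Re (poly (q n) z)\<bar> \<le> inverse (real (Suc n))" if "z \<in> ball 0 1" "F' z \<noteq> 0" for n z
  proof -
    have "Re (F' z - poly (q n) z) \<le> inverse (real (Suc n))"
      by (rule Re_diff_bound_off_zeros[OF F' _ _ that])
         (use q[of _ n] in \<open>auto intro!: holomorphic_intros simp del: of_nat_Suc simp: abs_less_iff intro: less_imp_le\<close>)
    moreover have "Re (- F' z - poly (- q n) z) \<le> inverse (real (Suc n))"
      by (rule Re_diff_bound_off_zeros[OF mF'])
         (use q[of _ n] that in \<open>auto intro!: holomorphic_intros simp del: of_nat_Suc simp: abs_less_iff intro: less_imp_le\<close>)
    ultimately show ?thesis by (simp add: abs_le_iff)
  qed
  have "compact (F' ` cball 0 1)" by (intro compact_continuous_image F') auto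
  then obtain B where B: "\<And>z. z \<in> cball 0 1 ==> norm (F' z) \<le> B"
    by (meson compact_imp_bounded bounded_iff imageI)
  have qs: "\<bar>Re (poly (q n) z)\<bar> \<le> B + 1" if "z \<in> sphere 0 1" for n z
  proof -
    have "\<bar>Re (F' z)\<bar> \<le> B" using B[of z] that abs_Re_le_cmod[of "F' z"] by simp
    moreover have "inverse (real (Suc n)) \<le> 1" by (simp add: field_simps)
    ultimately show ?thesis using q[OF that, of n] by linarith
  qed
  have ball_bd: "\<bar>Re (poly (q n) z)\<bar> \<le> B + 1" if z: "z \<in> ball 0 1" for n z
  proof -
    have "norm (exp (poly s z)) \<le> exp (B + 1)" if s: "s = q n \<or> s = - q n" for s
    proof (rule maximum_modulus_frontier[of "\<lambda>z. exp (poly s z)" "ball 0 1"])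
      fix w :: complex assume "w \<in> frontier (ball 0 1)"
      hence "w \<in> sphere 0 1" by simp
      from qs[OF this, of n] s show "cmod (exp (poly s w)) \<le> exp (B + 1)" by (auto simp: abs_le_iff)
    qed (use z in \<open>auto intro!: holomorphic_intros continuous_intros\<close>)
    from this[of "q n"] this[of "- q n"] show ?thesis by (simp add: abs_le_iff)
  qed
  define EE where "EE = (\<lambda>n z. exp (poly (q n) z))"
  obtain E r where E: "E holomorphic_on ball 0 1" "strict_mono (r :: nat \<Rightarrow> nat)"
          "\<And>x. x \<in> ball 0 1 ==> ((\<lambda>n. EE (r n) x) \<longlongrightarrow> E x) sequentially"
  proof (rule Montel[of "ball 0 1" "range EE" EE])
    show "h holomorphic_on ball 0 1" if "h \<in> range EE" for h
      using that by (auto simp: EE_def intro!: holomorphic_intros)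
    show "\<exists>B. \<forall>h\<in>range EE. \<forall>z\<in>K. cmod (h z) \<le> B" if "compact K" "K \<subseteq> ball 0 1" for K
    proof (intro exI ballI)
      fix h z assume "h \<in> range EE" "z \<in> K"
      then obtain n where "h = EE n" by auto
      thus "cmod (h z) \<le> exp (B + 1)" using ball_bd[of z n] that \<open>z \<in> K\<close> by (auto simp: EE_def abs_le_iff)
    qed
  qed auto
  have lim: "(\<lambda>n. exp (Re (poly (q (r n)) z))) \<longlonglongrightarrow> norm (E z)" if "z \<in> ball 0 1" for z
    using tendsto_norm[OF E(3)[OF that]] by (simp add: EE_def)
  have E0: "E z \<noteq> 0" if "z \<in> ball 0 1" for z
  proof -
    have "norm (E z) \<ge> exp (-(B+1))"
      using ball_bd[OF that] by (intro LIMSEQ_le_const[OF lim[OF that]] exI[of _ 0]) (auto simp: abs_le_iff minus_le_iff)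
    moreover have "exp (-(B+1)) > 0" by simp
    ultimately show ?thesis by force
  qed
  obtain L where L: "L holomorphic_on ball 0 1" "\<And>z. z \<in> ball 0 1 ==> E z = exp (L z)"
    using contractible_imp_holomorphic_log[OF E(1) convex_imp_contractible[OF convex_ball] E0] by blast
  show ?thesis
  proof (rule that[OF L(1)])
    fix z :: complex assume z: "z \<in> ball 0 1" "F z \<noteq> 0"
    hence z': "F' z \<noteq> 0" using c by (simp add: F'_def)
    have "(\<lambda>n. Re (poly (q n) z)) \<longlonglongrightarrow> Re (F' z)"
    proof (rule LIMSEQ_I)
      fix e :: real assume "e > 0"
      then obtain N where N: "inverse (real (Suc N)) < e" using reals_Archimedean by blast
      show "\<exists>no. \<forall>n\<ge>no. norm (Re (poly (q n) z) - Re (F' z)) < e"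
      proof (intro exI allI impI)
        fix n assume "n \<ge> N"
        hence "inverse (real (Suc n)) \<le> inverse (real (Suc N))" by (simp add: field_simps)
        with in_O[OF z(1) z', of n] N show "norm (Re (poly (q n) z) - Re (F' z)) < e" unfolding real_norm_def by linarith
      qed
    qed
    hence "(\<lambda>n. Re (poly (q (r n)) z)) \<longlonglongrightarrow> Re (F' z)"
      using LIMSEQ_subseq_LIMSEQ[OF _ E(2)] by (auto simp: o_def)
    hence "(\<lambda>n. exp (Re (poly (q (r n)) z))) \<longlonglongrightarrow> exp (Re (F' z))" by (rule tendsto_exp)
    from LIMSEQ_unique[OF this lim[OF z(1)]] L(2)[OF z(1)] show "Re (L z) = Re (c * F z)"
      by (simp add: F'_def)
  qed
qed

text \<open>The extensions for \<open>c = 1\<close> and \<open>c = \<i>\<close> give two harmonic candidates for the real and the imaginary part of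
  \<open>F\<close>. Together they form one holomorphic function that agrees with \<open>F\<close> also at its zeros.\<close>
lemma Rado_unit_disc:
  assumes F: "continuous_on (cball 0 1) F" and hol: "F holomorphic_on {z\<in>ball 0 1. F z \<noteq> 0}"
  shows "F holomorphic_on ball 0 1"
proof -
  define U where "U = {z\<in>ball 0 1. F z \<noteq> 0}"
  have U: "U = ball 0 1 \<inter> (F -` (-{0}))" by (auto simp: U_def)
  have opU: "open U" unfolding U
    by (rule continuous_open_preimage) (auto intro: continuous_on_subset[OF F])
  have holU: "F holomorphic_on U" using hol by (simp add: U_def)
  show ?thesis
  proof (cases "U = {}")
    case True
    hence "F z = 0" if "z \<in> ball 0 1" for z using that by (auto simp: U_def)
    thus ?thesis by (metis holomorphic_on_const holomorphic_transform)
  next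
    case False
    then obtain w where w: "w \<in> U" by blast
    obtain L1 where L1: "L1 holomorphic_on ball 0 1" "\<And>z. z \<in> U ==> Re (L1 z) = Re (F z)"
      by (rule holomorphic_real_part_extension[OF F hol, of 1]) (auto simp: U_def)
    obtain L2 where L2: "L2 holomorphic_on ball 0 1" "\<And>z. z \<in> U ==> Re (L2 z) = Im (F z)"
      by (rule holomorphic_real_part_extension[OF F hol, of "-\<i>"]) (auto simp: U_def)
    have Usub: "U \<subseteq> ball 0 1" by (auto simp: U_def)
    obtain r where r: "r > 0" "ball w r \<subseteq> U" using opU w openE by blast
    have L1': "L1 holomorphic_on ball w r" and L2': "L2 holomorphic_on ball w r" and Fr: "F holomorphic_on ball w r"
      using L1(1) L2(1) holU r(2) Usub holomorphic_on_subset by blast+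
    have imag_const: "G constant_on ball w r" if "G holomorphic_on ball w r" "\<And>z. z \<in> ball w r ==> Re (G z) = 0" for G
    proof (rule ccontr)
      assume "\<not> G constant_on ball w r"
      hence "open (G ` ball w r)"
        using that by (intro open_mapping_thm[of G "ball w r" "ball w r"]) auto
      moreover have "G w \<in> G ` ball w r" using r by auto
      ultimately obtain e where e: "e > 0" "ball (G w) e \<subseteq> G ` ball w r" using openE by blast
      have "G w + of_real (e/2) \<in> ball (G w) e" using e by (simp add: dist_norm)
      then obtain z' where "z' \<in> ball w r" "G w + of_real (e/2) = G z'" using e(2) by blast
      hence "Re (G w + of_real (e/2)) = 0" using that(2) by simp
      moreover have "Re (G w) = 0" using that r by auto
      ultimately show False using e by simp
    qed
    have "(\<lambda>z. F z - L1 z) constant_on ball w r"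
      by (rule imag_const) (use Fr L1' L1(2) r in \<open>auto intro!: holomorphic_intros\<close>)
    then obtain c1 where c1: "\<And>z. z \<in> ball w r ==> F z - L1 z = c1" by (auto simp: constant_on_def)
    have "(\<lambda>z. F z - \<i> * L2 z) constant_on ball w r"
    proof -
      have "(\<lambda>z. - \<i> * F z - L2 z) constant_on ball w r"
        by (rule imag_const) (use Fr L2' L2(2) r in \<open>auto intro!: holomorphic_intros\<close>)
      then obtain c where c: "\<And>z. z \<in> ball w r ==> - \<i> * F z - L2 z = c" by (auto simp: constant_on_def)
      have "F z - \<i> * L2 z = \<i> * c" if "z \<in> ball w r" for z
        using c[OF that] by (auto simp: complex_eq_iff)
      thus ?thesis by (auto simp: constant_on_def)
    qed
    then obtain c2 where c2: "\<And>z. z \<in> ball w r ==> F z - \<i> * L2 z = c2" by (auto simp: constant_on_def)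
    have LL: "L1 z - \<i> * L2 z - (c2 - c1) = 0" if "z \<in> ball 0 1" for z
    proof (rule analytic_continuation_open[of "ball w r" "ball 0 1" "\<lambda>z. L1 z - \<i> * L2 z - (c2 - c1)" "\<lambda>_. 0"])
      show "ball w r \<subseteq> ball 0 1" using r Usub by blast
      fix z assume z: "z \<in> ball w r"
      show "L1 z - \<i> * L2 z - (c2 - c1) = 0"
        using c1[OF z] c2[OF z] by (simp add: algebra_simps)
    qed (use r L1(1) L2(1) that in \<open>auto intro!: holomorphic_intros\<close>)
    define H where "H = (\<lambda>z. L1 z - \<i> * of_real (Im (c2 - c1)))"
    have holH: "H holomorphic_on ball 0 1" unfolding H_def by (intro holomorphic_intros L1)
    have L1eq: "L1 z = \<i> * L2 z + (c2 - c1)" if "z \<in> ball 0 1" for z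
      using LL[OF that] by (simp add: algebra_simps)
    have FH: "F z = H z" if z: "z \<in> U" for z
    proof -
      have "Im (L1 z) = Re (L2 z) + Im (c2 - c1)"
        using L1eq[of z] z Usub by auto
      thus ?thesis using L1(2)[OF z] L2(2)[OF z] by (simp add: H_def complex_eq_iff)
    qed
    have contH: "continuous_on (ball 0 1) H" by (rule holomorphic_on_imp_continuous_on[OF holH])
    have FHcl: "F z = H z" if z: "z \<in> closure U" "z \<in> ball 0 1" for z
    proof -
      obtain x where x: "\<And>n. x n \<in> U" "x \<longlonglongrightarrow> z" using z(1) closure_sequential by blast
      have "(\<lambda>n. F (x n)) \<longlonglongrightarrow> F z"
        by (rule continuous_on_tendsto_compose[OF F x(2)]) (use z(2) x(1) in \<open>auto intro!: always_eventually less_imp_le simp: U_def\<close>)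
      moreover have "(\<lambda>n. H (x n)) \<longlonglongrightarrow> H z"
        by (rule continuous_on_tendsto_compose[OF contH x(2)]) (use z(2) x(1) in \<open>auto intro!: always_eventually simp: U_def\<close>)
      ultimately show ?thesis using FH x(1) LIMSEQ_unique by auto
    qed
    have Hw: "H w \<noteq> 0" using FH[OF w] w by (auto simp: U_def)
    \<comment> \<open>The zeros of H are countable, so they cannot separate the disc.\<close>
    have "ball 0 1 \<subseteq> closure U"
    proof (cases "H constant_on ball 0 1")
      case True
      then obtain c where c: "\<And>z. z \<in> ball 0 1 ==> H z = c" by (auto simp: constant_on_def)
      show ?thesis
      proof (rule ccontr)
        assume "\<not> ball 0 1 \<subseteq> closure U"
        then obtain y where y: "y \<in> ball 0 1" "y \<notin> closure U" by blast
        have "closedin (top_of_set (ball 0 1)) (closure U \<inter> ball 0 1)" by (metis Int_commute closed_closure closedin_closed_Int)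
        moreover have "closure U \<inter> ball 0 1 = U"
        proof
          show "U \<subseteq> closure U \<inter> ball 0 1" using Usub closure_subset by blast
          show "closure U \<inter> ball 0 1 \<subseteq> U"
          proof
            fix z assume "z \<in> closure U \<inter> ball 0 1"
            hence "F z = c" using FHcl[of z] c[of z] by auto
            moreover have "c \<noteq> 0" using Hw c[of w] w Usub by auto
            ultimately show "z \<in> U" using \<open>z \<in> closure U \<inter> ball 0 1\<close> by (auto simp: U_def)
          qed
        qed
        moreover have "openin (top_of_set (ball 0 1)) U" using opU Usub by (simp add: open_subset)
        ultimately have "U = {} \<or> U = ball 0 1"
          using connected_ball[of "0::complex" 1] by (metis connected_clopen)
        thus False using w y closure_subset by blast
      qed
    next
      case False
      define T where "T = {z\<in>ball 0 1. H z = 0}"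
      have ctT: "countable T" unfolding T_def
      proof (rule holomorphic_countable_zeros[OF holH _ _ _ False])
        obtain C :: "nat \<Rightarrow> complex set" where "\<And>n. compact (C n)" "\<Union>(range C) = ball 0 1"
          by (rule open_Union_compact_subsets[of "ball (0::complex) 1"]) auto
        thus "fsigma (ball (0::complex) 1)" unfolding fsigma_Union_compact by blast
      qed auto
      have conn: "connected (ball 0 1 - T)"
        by (rule connected_open_diff_countable) (use ctT in auto)
      show ?thesis
      proof (rule ccontr)
        assume "\<not> ball 0 1 \<subseteq> closure U"
        then obtain y where y: "y \<in> ball 0 1" "y \<notin> closure U" by blast
        have opV: "open (ball 0 1 - closure U)" by (intro open_Diff) auto
        then obtain e where e: "e > 0" "ball y e \<subseteq> ball 0 1 - closure U" using y openE[of "ball 0 1 - closure U" y] by blast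
        have "uncountable (ball y e)" using e by (simp add: uncountable_ball)
        hence "\<not> ball y e \<subseteq> T" using ctT countable_subset by blast
        then obtain y' where y': "y' \<in> ball y e" "y' \<notin> T" by blast
        have cover: "ball 0 1 - T \<subseteq> U \<union> (ball 0 1 - closure U)"
        proof
          fix z assume z: "z \<in> ball 0 1 - T"
          show "z \<in> U \<union> (ball 0 1 - closure U)"
          proof (cases "z \<in> closure U")
            case True
            hence "F z = H z" using FHcl z by blast
            thus ?thesis using z by (auto simp: T_def U_def)
          qed (use z in auto)
        qed
        have "w \<in> U \<inter> (ball 0 1 - T)" using w Hw Usub by (auto simp: T_def)
        moreover have "y' \<in> (ball 0 1 - closure U) \<inter> (ball 0 1 - T)" using y' e by blast
        moreover have "U \<inter> (ball 0 1 - closure U) \<inter> (ball 0 1 - T) = {}" using closure_subset by blast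
        ultimately show False using connectedD[OF conn opU opV _ cover] by blast
      qed
    qed
    hence "F z = H z" if "z \<in> ball 0 1" for z using FHcl that by blast
    thus ?thesis using holH by (metis holomorphic_transform)
  qed
qed

theorem Rado:
  assumes F: "continuous_on S F" and S: "open S" and hol: "F holomorphic_on {z\<in>S. F z \<noteq> 0}"
  shows "F holomorphic_on S"
proof -
  have "F field_differentiable at w" if w: "w \<in> S" for w
  proof -
    obtain \<rho> where \<rho>: "\<rho> > 0" "cball w \<rho> \<subseteq> S" using w S open_contains_cball by blast
    define G where "G = (\<lambda>z. F (w + of_real \<rho> * z))"
    have im: "w + of_real \<rho> * z \<in> cball w \<rho>" if "norm z \<le> 1" for z
      using that \<rho> by (auto simp: dist_norm norm_mult intro: mult_left_le)
    have "G holomorphic_on ball 0 1"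
    proof (rule Rado_unit_disc)
      show "continuous_on (cball 0 1) G" unfolding G_def
        by (rule continuous_on_compose2[OF F]) (use im \<rho> in \<open>auto intro!: continuous_intros\<close>)
      have "(F \<circ> (\<lambda>z. w + of_real \<rho> * z)) holomorphic_on {z\<in>ball 0 1. G z \<noteq> 0}"
      proof (rule holomorphic_on_compose_gen[OF _ hol])
        show "(\<lambda>z. w + of_real \<rho> * z) ` {z \<in> ball 0 1. G z \<noteq> 0} \<subseteq> {z \<in> S. F z \<noteq> 0}"
          using im \<rho> by (fastforce simp: G_def)
      qed (intro holomorphic_intros)
      thus "G holomorphic_on {z\<in>ball 0 1. G z \<noteq> 0}" by (simp add: G_def o_def)
    qed
    hence "(G \<circ> (\<lambda>z. (z - w) / of_real \<rho>)) holomorphic_on ball w \<rho>"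
      using \<rho> by (intro holomorphic_on_compose_gen[of _ _ G "ball 0 1"])
        (auto intro!: holomorphic_intros simp: norm_divide dist_norm norm_minus_commute)
    moreover have "(G \<circ> (\<lambda>z. (z - w) / of_real \<rho>)) = F" using \<rho> by (auto simp: G_def)
    ultimately have "F holomorphic_on ball w \<rho>" by simp
    thus ?thesis using \<rho> by (simp add: holomorphic_on_imp_differentiable_at)
  qed
  thus ?thesis using field_differentiable_at_within holomorphic_on_def by blast
qed

lemma zero_free_punctured_ball:
  assumes S: "open S" "connected S" and q: "q holomorphic_on S" and nz: "w \<in> S" "q w \<noteq> 0" and z: "z \<in> S"
  obtains e where "e > 0" "ball z e \<subseteq> S" "\<And>y. y \<in> ball z e - {z} ==> q y \<noteq> 0"
proof (cases "q z = 0")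
  case True
  have "\<not> q constant_on S" using True nz z unfolding constant_on_def by metis
  then obtain e where "e > 0" "ball z e \<subseteq> S" "\<And>y. y \<in> ball z e - {z} ==> q y \<noteq> 0"
    using isolated_zeros[OF q S z True nz] by metis
  thus ?thesis by (rule that)
next
  case False
  have "open (S \<inter> q -` (-{0}))"
    using continuous_open_preimage[OF holomorphic_on_imp_continuous_on[OF q] S(1)] by auto
  moreover have "z \<in> S \<inter> q -` (-{0})" using False z by auto
  ultimately obtain e where "e > 0" "ball z e \<subseteq> S \<inter> q -` (-{0})" using openE by blast
  thus ?thesis using that[of e] by blast
qed

lemma holomorphic_across_zero_set:
  assumes P: "continuous_on S P" "P holomorphic_on {z\<in>S. q z \<noteq> 0}" and S: "open S" "connected S"
    and q: "q holomorphic_on S" and nz: "w \<in> S" "q w \<noteq> 0"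
  shows "P holomorphic_on S"
proof -
  have "P field_differentiable at z" if z: "z \<in> S" for z
  proof -
    obtain e where e: "e > 0" "ball z e \<subseteq> S" "\<And>y. y \<in> ball z e - {z} ==> q y \<noteq> 0"
      using zero_free_punctured_ball[OF S q nz z] by blast
    have "P holomorphic_on ball z e"
      by (rule no_isolated_singularity[of _ _ "{z}"])
         (use e in \<open>auto intro: continuous_on_subset[OF P(1)] holomorphic_on_subset[OF P(2)]\<close>)
    thus ?thesis using e by (simp add: holomorphic_on_imp_differentiable_at)
  qed
  thus ?thesis using field_differentiable_at_within holomorphic_on_def by blast
qed

section \<open>Zeros of a holomorphic function of one variable\<close>

text \<open>The quotient of the two functions is holomorphic and zero-free near \<open>b\<close>, being continuous with a continuous
  logarithm off the isolated zeros.\<close>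
lemma zorder_times_exp_continuous:
  assumes k1: "k1 holomorphic_on D" and k2: "k2 holomorphic_on D" and D: "open D" "connected D"
    and \<psi>: "continuous_on D \<psi>" and eq: "\<And>s. s \<in> D ==> k1 s = exp (\<psi> s) * k2 s"
    and b: "b \<in> D" and nz: "\<exists>s\<in>D. k2 s \<noteq> 0"
  shows "zorder k1 b = zorder k2 b"
proof -
  define n where "n = zorder k2 b"
  define g where "g = zor_poly k2 b"
  have ex: "(if k2 b = 0 then n > 0 else n = 0) \<and> (\<exists>r. r>0 \<and> cball b r \<subseteq> D \<and> g holomorphic_on cball b r
    \<and> (\<forall>w\<in>cball b r. k2 w  = g w * (w-b) ^ nat n  \<and> g w \<noteq>0))"
    using zorder_exist_zero[OF k2 D b nz] unfolding n_def g_def .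
  then have n: "n \<ge> 0" by (auto split: if_splits)
  obtain r where r: "r > 0" "cball b r \<subseteq> D" "g holomorphic_on cball b r"
    and g: "\<And>w. w \<in> cball b r ==> k2 w = g w * (w - b) ^ nat n \<and> g w \<noteq> 0"
    using ex by blast
  define g1 where "g1 = (\<lambda>s. exp (\<psi> s) * g s)"
  have bD: "ball b r \<subseteq> D" using r(2) ball_subset_cball by blast
  have "g1 holomorphic_on ball b r"
  proof (rule no_isolated_singularity[of _ _ "{b}"])
    show "continuous_on (ball b r) g1" unfolding g1_def
      using r by (intro continuous_intros continuous_on_subset[OF \<psi>] continuous_on_subset[OF holomorphic_on_imp_continuous_on[OF r(3)]]) (auto)
    have "(\<lambda>s. k1 s / (s - b) ^ nat n) holomorphic_on ball b r - {b}"
      using bD by (intro holomorphic_intros holomorphic_on_subset[OF k1]) auto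
    thus "g1 holomorphic_on ball b r - {b}"
    proof (rule holomorphic_transform)
      fix s assume s: "s \<in> ball b r - {b}"
      hence "s \<in> cball b r" "s \<in> D" using r(2) by auto
      thus "k1 s / (s - b) ^ nat n = g1 s" using eq[of s] g[of s] s by (simp add: g1_def)
    qed
  qed auto
  hence "zorder k1 b = n"
  proof (rule zorder_eqI[rotated 2])
    show "g1 b \<noteq> 0" using g[of b] r by (auto simp: g1_def)
    fix w assume w: "w \<in> ball b r" "w \<noteq> b"
    thus "k1 w = g1 w * (w - b) powi n"
      using eq[of w] g[of w] bD n by (auto simp: g1_def power_int_def)
  qed (use r in auto)
  thus ?thesis by (simp add: n_def)
qed

lemma finite_zeros_in_compact:
  assumes k: "k holomorphic_on D" "open D" "connected D" and K: "compact K" "K \<subseteq> D" and nz: "\<exists>s\<in>D. k s \<noteq> 0"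
  shows "finite {s\<in>K. k s = 0}"
proof (rule ccontr)
  assume inf: "infinite {s\<in>K. k s = 0}"
  then obtain x where x: "x \<in> K" "x islimpt {s\<in>K. k s = 0}"
    using K(1) by (metis (no_types, lifting) Heine_Borel_imp_Bolzano_Weierstrass mem_Collect_eq subsetI)
  obtain s where s: "s \<in> D" "k s \<noteq> 0" using nz by blast
  have "k s = 0"
    by (rule analytic_continuation[OF k, of "{s\<in>K. k s = 0}" x]) (use x K s in auto)
  with s show False by simp
qed

lemma cball_enlarge:
  fixes s0 :: complex
  assumes "open D" and sub: "cball s0 r \<subseteq> D" and r: "r > 0"
  obtains e where "e > 0" "cball s0 (r + e) \<subseteq> D"
proof -
  obtain e where e: "e > 0" "(\<Union>x\<in>cball s0 r. cball x e) \<subseteq> D"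
    using compact_subset_open_imp_cball_epsilon_subset[of "cball s0 r" D] assms by auto
  have sub2: "cball s0 (r + e) \<subseteq> D"
  proof
    fix x assume x: "x \<in> cball s0 (r + e)"
    show "x \<in> D"
    proof (cases "x \<in> cball s0 r")
      case True thus ?thesis using sub by blast
    next
      case False
      define d where "d = dist s0 x"
      have d: "d > r" "d \<le> r + e" using x False by (auto simp: d_def)
      define y where "y = s0 + of_real (r / d) * (x - s0)"
      have nd: "norm (x - s0) = d" by (simp add: d_def dist_norm norm_minus_commute)
      have "dist s0 y = r / d * norm (x - s0)" using d r by (simp add: y_def dist_norm norm_mult norm_divide)
      hence "dist s0 y = r" unfolding nd using d r by simp
      moreover have "y - x = of_real (r/d - 1) * (x - s0)" by (simp add: y_def algebra_simps)
      hence "dist y x = \<bar>r / d - 1\<bar> * d" by (simp only: dist_norm norm_mult norm_of_real nd)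
      hence "dist y x = (1 - r / d) * d" using d r by (simp add: abs_if)
      hence "dist y x = d - r" using d r by (simp add: algebra_simps)
      hence "dist y x \<le> e" using d by simp
      ultimately show ?thesis using e by fastforce
    qed
  qed
  show ?thesis using that e(1) sub2 by blast
qed

text \<open>The generalised argument principle; it expresses sums over zeros by values on the circle.\<close>
lemma zero_sum_contour:
  fixes k Q :: "complex \<Rightarrow> complex"
  assumes k: "k holomorphic_on D" "open D" "connected D" and sub: "cball s0 r \<subseteq> D" and r: "r > 0"
    and Q: "Q holomorphic_on D" and nz: "\<And>s. s \<in> sphere s0 r ==> k s \<noteq> 0"
  shows "contour_integral (circlepath s0 r) (\<lambda>s. deriv k s * Q s / k s) =
           2 * pi * \<i> * (\<Sum>b\<in>{b\<in>ball s0 r. k b = 0}. Q b * of_int (zorder k b))"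
    and "finite {b\<in>ball s0 r. k b = 0}"
proof -
  obtain e where e: "e > 0" and sub2: "cball s0 (r + e) \<subseteq> D" using cball_enlarge[OF k(2) sub r] by blast
  define S where "S = ball s0 (r + e)"
  have S: "open S" "connected S" "S \<subseteq> D" using sub2 by (auto simp: S_def)
  have s0r: "s0 + of_real r \<in> sphere s0 r" using r by (auto simp: dist_norm)
  have nz': "\<exists>s\<in>D. k s \<noteq> 0" using nz[OF s0r] s0r sub by (intro bexI[of _ "s0 + of_real r"]) auto
  have "finite {s\<in>cball s0 (r+e). k s = 0}"
    by (rule finite_zeros_in_compact[OF k _ sub2 nz']) auto
  hence finS: "finite {s\<in>S. k s = 0}" by (rule rev_finite_subset) (auto simp: S_def)
  show fin: "finite {b\<in>ball s0 r. k b = 0}"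
    by (rule finite_subset[OF _ finS]) (use e in \<open>auto simp: S_def\<close>)
  have "contour_integral (circlepath s0 r) (\<lambda>s. deriv k s * Q s / k s) =
     2 * pi * \<i> * (\<Sum>p\<in>{w\<in>S. k w = 0 \<or> w \<in> {}}. winding_number (circlepath s0 r) p * Q p * of_int (zorder k p))"
  proof (rule argument_principle)
    show "k holomorphic_on S - {}" "Q holomorphic_on S"
      using k Q S holomorphic_on_subset by auto
    show "path_image (circlepath s0 r) \<subseteq> S - {w \<in> S. k w = 0 \<or> w \<in> {}}"
      using nz r e by (auto simp: path_image_circlepath S_def dist_norm)
    show "\<forall>z. z \<notin> S \<longrightarrow> winding_number (circlepath s0 r) z = 0"
    proof (intro allI impI)
      fix z assume z: "z \<notin> S"
      show "winding_number (circlepath s0 r) z = 0"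
        by (rule winding_number_zero_outside[of _ "cball s0 r"]) (use z r e in \<open>auto simp: S_def path_image_circlepath\<close>)
    qed
  qed (use S finS in auto)
  also have "(\<Sum>p\<in>{w\<in>S. k w = 0 \<or> w \<in> {}}. winding_number (circlepath s0 r) p * Q p * of_int (zorder k p))
     = (\<Sum>b\<in>{b\<in>ball s0 r. k b = 0}. Q b * of_int (zorder k b))"
  proof (rule sum.mono_neutral_cong_right)
    show "finite {w\<in>S. k w = 0 \<or> w \<in> {}}" using finS by simp
    show "{b \<in> ball s0 r. k b = 0} \<subseteq> {w \<in> S. k w = 0 \<or> w \<in> {}}" using e by (auto simp: S_def)
    show "\<forall>i\<in>{w \<in> S. k w = 0 \<or> w \<in> {}} - {b \<in> ball s0 r. k b = 0}. winding_number (circlepath s0 r) i * Q i * of_int (zorder k i) = 0"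
    proof
      fix p assume p: "p \<in> {w \<in> S. k w = 0 \<or> w \<in> {}} - {b \<in> ball s0 r. k b = 0}"
      have "p \<notin> cball s0 r" using p nz[of p] by (auto simp: less_le)
      hence "winding_number (circlepath s0 r) p = 0"
        by (intro winding_number_zero_outside[of _ "cball s0 r"]) (use r in \<open>auto simp: path_image_circlepath\<close>)
      thus "winding_number (circlepath s0 r) p * Q p * of_int (zorder k p) = 0" by simp
    qed
    fix p assume "p \<in> {b \<in> ball s0 r. k b = 0}"
    thus "winding_number (circlepath s0 r) p * Q p * of_int (zorder k p) = Q p * of_int (zorder k p)"
      by (auto simp: winding_number_circlepath dist_norm norm_minus_commute)
  qed
  finally show "contour_integral (circlepath s0 r) (\<lambda>s. deriv k s * Q s / k s) =
           2 * pi * \<i> * (\<Sum>b\<in>{b\<in>ball s0 r. k b = 0}. Q b * of_int (zorder k b))" .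
qed

definition zero_poly :: "(complex \<Rightarrow> complex) \<Rightarrow> complex set \<Rightarrow> complex poly" where
  "zero_poly k B = (\<Prod>b\<in>B. [:- b, 1:] ^ nat (zorder k b))"

lemma zero_poly_divides:
  assumes k: "k holomorphic_on D" "open D" "connected D" and B: "finite B" "B \<subseteq> D" and nz: "\<exists>s\<in>D. k s \<noteq> 0"
  obtains \<kappa> where "\<kappa> holomorphic_on D" "\<And>s. s \<in> D ==> k s = poly (zero_poly k B) s * \<kappa> s" "\<And>b. b \<in> B ==> \<kappa> b \<noteq> 0"
proof -
  define n where "n = (\<lambda>b. nat (zorder k b))"
  define W where "W = (\<lambda>s. poly (zero_poly k B) s)"
  have W: "W s = (\<Prod>b\<in>B. (s - b) ^ n b)" for s
    by (simp add: W_def zero_poly_def poly_prod n_def)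
  define g where "g = zor_poly k"
  define \<kappa> where "\<kappa> = (\<lambda>s. if s \<in> B then g s s / (\<Prod>b\<in>B-{s}. (s - b) ^ n b) else k s / W s)"
  have ex: "\<exists>r>0. cball b r \<subseteq> D \<and> g b holomorphic_on cball b r \<and>
     (\<forall>w\<in>cball b r. k w = g b w * (w - b) ^ n b \<and> g b w \<noteq> 0)" if "b \<in> D" for b
    using zorder_exist_zero[OF k that nz] unfolding n_def g_def by auto
  have Wnz: "W s \<noteq> 0" if "s \<notin> B" for s
    using that B by (auto simp: W)
  have eqW: "W s = (s - b) ^ n b * (\<Prod>b\<in>B-{b}. (s - b) ^ n b)" if "b \<in> B" for s b
    unfolding W using B that by (simp add: prod.remove)
  have fd: "\<kappa> field_differentiable at s" if s: "s \<in> D" for s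
  proof (cases "s \<in> B")
    case False
    have "open (D - B)" using k B by (intro open_Diff finite_imp_closed) auto
    moreover have "(\<lambda>s. k s / W s) holomorphic_on D - B"
      using Wnz unfolding W_def by (intro holomorphic_intros holomorphic_on_subset[OF k(1)]) auto
    hence "\<kappa> holomorphic_on D - B" by (rule holomorphic_transform) (auto simp: \<kappa>_def)
    ultimately show ?thesis using s False by (auto simp: holomorphic_on_imp_differentiable_at)
  next
    case True
    obtain r where r: "r > 0" "cball s r \<subseteq> D" "g s holomorphic_on cball s r"
      "\<And>w. w\<in>cball s r ==> k w = g s w * (w - s) ^ n s \<and> g s w \<noteq> 0"
      using ex[OF s] by blast
    have "open (ball s r - (B - {s}))" using B by (intro open_Diff finite_imp_closed) auto
    moreover have s': "s \<in> ball s r - (B - {s})" using r by auto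
    ultimately obtain e where e: "e > 0" "ball s e \<subseteq> ball s r - (B - {s})" using openE by blast
    have "(\<lambda>w. g s w / (\<Prod>b\<in>B-{s}. (w - b) ^ n b)) holomorphic_on ball s e"
    proof (intro holomorphic_intros)
      show "g s holomorphic_on ball s e" using r(3) e holomorphic_on_subset[of _ "cball s r"] by fastforce
      fix w assume "w \<in> ball s e"
      thus "(\<Prod>b\<in>B-{s}. (w - b) ^ n b) \<noteq> 0" using e B by auto
    qed
    moreover have "\<kappa> w = g s w / (\<Prod>b\<in>B-{s}. (w - b) ^ n b)" if w: "w \<in> ball s e" for w
    proof (cases "w = s")
      case False
      hence "w \<notin> B" using w e by auto
      hence "\<kappa> w = k w / W w" by (simp add: \<kappa>_def)
      thus ?thesis using eqW[OF True, of w] r(4)[of w] w e False by auto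
    qed (use True in \<open>auto simp: \<kappa>_def\<close>)
    ultimately have "\<kappa> holomorphic_on ball s e" by (metis (no_types, lifting) holomorphic_transform)
    thus ?thesis using e by (simp add: holomorphic_on_imp_differentiable_at)
  qed
  show ?thesis
  proof (rule that[of \<kappa>])
    show "\<kappa> holomorphic_on D" using fd field_differentiable_at_within holomorphic_on_def by blast
    fix b assume b: "b \<in> B"
    then obtain r where r0: "r > 0" "\<And>w. w\<in>cball b r ==> g b w \<noteq> 0"
      using ex[of b] B by blast
    have "g b b \<noteq> 0" using r0(1) by (intro r0(2)) simp
    thus "\<kappa> b \<noteq> 0" using b B by (auto simp: \<kappa>_def)
  next
    fix s assume s: "s \<in> D"
    show "k s = poly (zero_poly k B) s * \<kappa> s"
    proof (cases "s \<in> B")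
      case False thus ?thesis using Wnz[of s] by (simp add: \<kappa>_def W_def)
    next
      case True
      obtain r where r0: "r > 0" "\<And>w. w\<in>cball s r ==> k w = g s w * (w - s) ^ n s"
        using ex[OF s] by blast
      have r: "k s = g s s * (s - s) ^ n s" using r0(1) by (intro r0(2)) simp
      have "(\<Prod>b\<in>B-{s}. (s - b) ^ n b) \<noteq> 0" using B by auto
      thus ?thesis using r eqW[OF True, of s] True unfolding \<kappa>_def W_def by simp
    qed
  qed
qed

lemma uniform_limit_deriv_circle:
  assumes f: "\<And>n. f n holomorphic_on ball s0 r1" and lim: "uniform_limit (ball s0 r1) f g sequentially"
    and r: "0 < r" "r < r1"
  shows "uniform_limit (sphere s0 r) (\<lambda>n. deriv (f n)) (deriv g) sequentially" "g holomorphic_on ball s0 r1"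
proof -
  show g: "g holomorphic_on ball s0 r1"
  proof -
    have "g field_differentiable at z" if z: "z \<in> ball s0 r1" for z
    proof -
      obtain e where e: "e > 0" "cball z e \<subseteq> ball s0 r1" using z open_contains_cball_eq[OF open_ball] by blast
      have ev: "\<forall>\<^sub>F n in sequentially. continuous_on (cball z e) (f n) \<and> f n holomorphic_on ball z e"
      proof (intro always_eventually allI conjI)
        fix n
        have "f n holomorphic_on cball z e" by (rule holomorphic_on_subset[OF f e(2)])
        thus "continuous_on (cball z e) (f n)" "f n holomorphic_on ball z e"
          using holomorphic_on_imp_continuous_on holomorphic_on_subset[OF _ ball_subset_cball] by blast+
      qed
      have "g holomorphic_on ball z e"
        using holomorphic_uniform_limit[OF ev uniform_limit_on_subset[OF lim e(2)]] by auto
      thus ?thesis using e by (simp add: holomorphic_on_imp_differentiable_at)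
    qed
    thus ?thesis using field_differentiable_at_within holomorphic_on_def by blast
  qed
  define e where "e = (r1 - r) / 2"
  have e: "e > 0" using r by (simp add: e_def)
  show "uniform_limit (sphere s0 r) (\<lambda>n. deriv (f n)) (deriv g) sequentially"
  proof (rule uniform_limitI)
    fix \<epsilon> :: real assume \<epsilon>: "\<epsilon> > 0"
    have "\<forall>\<^sub>F n in sequentially. \<forall>x\<in>ball s0 r1. dist (f n x) (g x) < \<epsilon> * e / 2"
      using uniform_limitD[OF lim, of "\<epsilon> * e / 2"] \<epsilon> e by simp
    thus "\<forall>\<^sub>F n in sequentially. \<forall>x\<in>sphere s0 r. dist (deriv (f n) x) (deriv g x) < \<epsilon>"
    proof eventually_elim
      case (elim n)
      show ?case
      proof
        fix x assume x: "x \<in> sphere s0 r"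
        have sub: "cball x e \<subseteq> ball s0 r1"
        proof
          fix y assume "y \<in> cball x e"
          hence "dist s0 y \<le> r + e" using x dist_triangle[of s0 y x] by simp
          hence "dist s0 y < r1" using r by (simp add: e_def field_simps)
          thus "y \<in> ball s0 r1" by simp
        qed
        have xin: "x \<in> ball s0 r1" using x r by simp
        have "norm ((deriv ^^ 1) (\<lambda>w. f n w - g w) x) \<le> fact 1 * (\<epsilon> * e / 2) / e ^ 1"
        proof (rule Cauchy_inequality)
          show "(\<lambda>w. f n w - g w) holomorphic_on ball x e"
            using sub ball_subset_cball by (intro holomorphic_intros holomorphic_on_subset[OF f] holomorphic_on_subset[OF g]) blast+
          show "continuous_on (cball x e) (\<lambda>w. f n w - g w)"
            using sub by (intro continuous_intros holomorphic_on_imp_continuous_on holomorphic_on_subset[OF f] holomorphic_on_subset[OF g])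
          fix y assume "norm (x - y) = e"
          hence "y \<in> ball s0 r1" using sub by (auto simp: dist_norm)
          thus "norm (f n y - g y) \<le> \<epsilon> * e / 2" using elim by (fastforce simp: dist_norm)
        qed (use e in auto)
        moreover have "deriv (\<lambda>w. f n w - g w) x = deriv (f n) x - deriv g x"
          using holomorphic_on_imp_differentiable_at[OF f _ xin] holomorphic_on_imp_differentiable_at[OF g _ xin]
          by (intro deriv_diff) auto
        ultimately show "dist (deriv (f n) x) (deriv g x) < \<epsilon>" using \<epsilon> e by (simp add: dist_norm)
      qed
    qed
  qed
qed

text \<open>Evaluation at sufficiently many points determines the coefficients by linear algebra. Hence a class of functions
  that is closed under linear combinations contains the coefficients as soon as it contains the values. It
  is used for continuous and for holomorphic functions.\<close>
lemma coeff_family: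
  fixes p :: "'a \<Rightarrow> complex poly"
  assumes add: "\<And>u v. R u ==> R v ==> R (\<lambda>z. u z + v z)" and cm: "\<And>u c. R u ==> R (\<lambda>z. c * u z)"
    and zero: "R (\<lambda>z. 0)"
    and deg: "\<And>z. degree (p z) \<le> N" and T: "infinite T" "\<And>s. s \<in> T ==> R (\<lambda>z. poly (p z) s)"
  shows "R (\<lambda>z. coeff (p z) i)"
  using deg T
proof (induction N arbitrary: p i T)
  case 0
  obtain s where s: "s \<in> T" using 0 infinite_imp_nonempty by blast
  have "coeff (p z) i = (if i = 0 then poly (p z) s else 0)" for z
  proof -
    obtain c where "p z = [:c:]" using 0(1)[of z] degree_eq_zeroE by blast
    thus ?thesis by (cases i) auto
  qed
  thus ?case using 0(3)[OF s] zero by (cases "i = 0") auto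
next
  case (Suc N)
  obtain c where c: "c \<in> T" using Suc infinite_imp_nonempty by blast
  define q where "q = (\<lambda>z. synthetic_div (p z) c)"
  have pq: "p z + smult c (q z) = pCons (poly (p z) c) (q z)" for z
    unfolding q_def by (rule synthetic_div_correct)
  have "R (\<lambda>z. coeff (q z) j)" for j
  proof (rule Suc.IH)
    show "degree (q z) \<le> N" for z using Suc(2)[of z] by (simp add: q_def degree_synthetic_div)
    show "infinite (T - {c})" using Suc by simp
    fix s assume s: "s \<in> T - {c}"
    have "poly (q z) s = 1 / (s - c) * (poly (p z) s + (-1) * poly (p z) c)" for z
    proof -
      have "poly (p z) s + c * poly (q z) s = poly (p z) c + s * poly (q z) s"
        using arg_cong[OF pq[of z], of "\<lambda>p. poly p s"] by simp
      hence "(s - c) * poly (q z) s = poly (p z) s - poly (p z) c" by (simp add: algebra_simps)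
      thus ?thesis using s by (simp add: field_simps)
    qed
    moreover have "R (\<lambda>z. 1 / (s - c) * (poly (p z) s + (-1) * poly (p z) c))"
      using s c by (intro cm add Suc(4)) auto
    ultimately show "R (\<lambda>z. poly (q z) s)" by simp
  qed
  hence "R (\<lambda>z. (if i = 0 then poly (p z) c else coeff (q z) (i - 1)) + (-c) * coeff (q z) i)"
    using Suc(4)[OF c] by (cases "i = 0") (simp_all only: if_True if_False simp_thms, (intro add cm; blast)+)
  moreover have "coeff (p z) i = (if i = 0 then poly (p z) c else coeff (q z) (i - 1)) + (-c) * coeff (q z) i" for z
    using arg_cong[OF pq[of z], of "\<lambda>p. coeff p i"] by (cases i) (auto simp: algebra_simps)
  ultimately show ?case by presburger
qed

text \<open>Off the zeros of \<open>h\<close> the root is locally a branch of a holomorphic logarithm; the zeros are isolated.\<close>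
lemma continuous_root_holomorphic:
  assumes h: "h holomorphic_on S" and S: "open S" "connected S" and \<rho>: "continuous_on S \<rho>"
    and eq: "\<And>z. z \<in> S ==> h z = \<rho> z ^ n" and n: "n > 0"
  shows "\<rho> holomorphic_on S"
proof (cases "\<exists>z\<in>S. h z \<noteq> 0")
  case False
  hence "\<rho> z = 0" if "z \<in> S" for z using eq[OF that] that n by auto
  thus ?thesis by (metis holomorphic_on_const holomorphic_transform)
next
  case True
  then obtain w where w: "w \<in> S" "h w \<noteq> 0" by blast
  have off: "\<rho> field_differentiable at z" if z: "z \<in> S" "h z \<noteq> 0" for z
  proof -
    have "open (S \<inter> h -` (-{0}))"
      using continuous_open_preimage[OF holomorphic_on_imp_continuous_on[OF h] S(1)] by auto
    moreover have "z \<in> S \<inter> h -` (-{0})" using z by auto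
    ultimately obtain e where e: "e > 0" "ball z e \<subseteq> S \<inter> h -` (-{0})" using openE by blast
    have \<rho>nz: "\<rho> x \<noteq> 0" if "x \<in> ball z e" for x
    proof -
      have "x \<in> S" "h x \<noteq> 0" using e that by blast+
      thus ?thesis using eq[of x] n by auto
    qed
    obtain L where L: "continuous_on (ball z e) L" "\<And>x. x \<in> ball z e ==> \<rho> x = exp (L x)"
      using continuous_logarithm_on_ball[of z e \<rho>] continuous_on_subset[OF \<rho>] e \<rho>nz by blast
    have hh: "h x = exp (of_nat n * L x)" if "x \<in> ball z e" for x
      using eq[of x] L(2)[OF that] e that by (auto simp: exp_of_nat_mult)
    have he: "h holomorphic_on ball z e" using h e holomorphic_on_subset by blast
    obtain G where G: "G holomorphic_on ball z e" "\<And>x. x \<in> ball z e ==> h x = exp (G x)"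
      using contractible_imp_holomorphic_log[OF he convex_imp_contractible[OF convex_ball]] e by blast
    define m where "m = (\<lambda>x. (of_nat n * L x - G x) / (2 * of_real pi * \<i>))"
    have "m constant_on ball z e"
    proof (rule continuous_discrete_range_constant)
      show "continuous_on (ball z e) m" unfolding m_def
        by (intro continuous_intros L(1) holomorphic_on_imp_continuous_on[OF G(1)]) auto
      fix x assume x: "x \<in> ball z e"
      have int: "\<exists>j::int. m y = of_int j" if "y \<in> ball z e" for y
      proof -
        have "exp (of_nat n * L y) = exp (G y)" using hh[OF that] G(2)[OF that] by simp
        then obtain j::int where "of_nat n * L y = G y + of_int (2 * j) * (of_real pi * \<i>)" unfolding exp_eq by auto
        thus ?thesis by (auto simp: m_def intro!: exI[of _ j])
      qed
      show "\<exists>e'>0. \<forall>y. y \<in> ball z e \<and> m y \<noteq> m x \<longrightarrow> e' \<le> norm (m y - m x)"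
      proof (intro exI[of _ 1] conjI allI impI)
        fix y assume y: "y \<in> ball z e \<and> m y \<noteq> m x"
        obtain i j where ij: "m x = of_int i" "m y = of_int j" using int x y by metis
        hence "norm (m y - m x) = \<bar>of_int (j - i)\<bar>" by (metis norm_of_int of_int_diff)
        moreover have "\<bar>j - i\<bar> \<ge> 1" using ij y by auto
        ultimately show "1 \<le> norm (m y - m x)" by linarith
      qed simp
    qed auto
    then obtain c where c: "\<And>x. x \<in> ball z e ==> m x = c" by (auto simp: constant_on_def)
    have "L x = (G x + 2 * of_real pi * \<i> * c) / of_nat n" if "x \<in> ball z e" for x
      using c[OF that] n by (auto simp: m_def field_simps)
    hence "\<rho> x = exp ((G x + 2 * of_real pi * \<i> * c) / of_nat n)" if "x \<in> ball z e" for x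
      using L(2) that by auto
    moreover have "(\<lambda>x. exp ((G x + 2 * of_real pi * \<i> * c) / of_nat n)) holomorphic_on ball z e"
      using n by (intro holomorphic_intros G) auto
    ultimately have "\<rho> holomorphic_on ball z e" by (metis (no_types, lifting) holomorphic_transform)
    thus ?thesis using e by (simp add: holomorphic_on_imp_differentiable_at)
  qed
  have "\<rho> field_differentiable at z" if z: "z \<in> S" for z
  proof (cases "h z = 0")
    case False thus ?thesis using off z by blast
  next
    case True
    obtain e where e: "e > 0" "ball z e \<subseteq> S" "\<And>y. y \<in> ball z e - {z} ==> h y \<noteq> 0"
      using isolated_zeros[OF h S z True w] by metis
    have "\<rho> holomorphic_on ball z e"
    proof (rule no_isolated_singularity[of _ _ "{z}"])
      show "\<rho> holomorphic_on ball z e - {z}"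
        unfolding holomorphic_on_def
      proof
        fix x assume "x \<in> ball z e - {z}"
        hence "\<rho> field_differentiable at x" using e by (intro off) auto
        thus "\<rho> field_differentiable at x within ball z e - {z}" by (rule field_differentiable_at_within)
      qed
    qed (use e continuous_on_subset[OF \<rho>] in auto)
    thus ?thesis using e by (simp add: holomorphic_on_imp_differentiable_at)
  qed
  thus ?thesis using field_differentiable_at_within holomorphic_on_def by blast
qed

text \<open>Hurwitz's theorem in quantitative form: the contour integrals converge.\<close>
lemma zero_sum_tendsto:
  fixes k :: "nat \<Rightarrow> complex \<Rightarrow> complex"
  assumes k: "\<And>n. k n holomorphic_on ball s0 r1" and lim: "uniform_limit (ball s0 r1) k k' sequentially"
    and r: "0 < r" "r < r1" and Q: "Q holomorphic_on ball s0 r1"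
    and nz: "\<And>n s. s \<in> sphere s0 r ==> k n s \<noteq> 0" and nz': "\<And>s. s \<in> sphere s0 r ==> k' s \<noteq> 0"
  shows "(\<lambda>n. \<Sum>b\<in>{b\<in>ball s0 r. k n b = 0}. Q b * of_int (zorder (k n) b)) \<longlonglongrightarrow>
           (\<Sum>b\<in>{b\<in>ball s0 r. k' b = 0}. Q b * of_int (zorder k' b))"
proof -
  note der = uniform_limit_deriv_circle[OF k lim r]
  have sub: "cball s0 r \<subseteq> ball s0 r1" using r by auto
  have sp: "sphere s0 r \<subseteq> ball s0 r1" using r by auto
  have cont: "continuous_on (sphere s0 r) k'" "continuous_on (sphere s0 r) (deriv k')" "continuous_on (sphere s0 r) Q"
    using holomorphic_on_imp_continuous_on[OF der(2)] holomorphic_on_imp_continuous_on[OF holomorphic_deriv[OF der(2) open_ball]]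
      holomorphic_on_imp_continuous_on[OF Q] sp continuous_on_subset by blast+
  have bdd: "bounded (g ` sphere s0 r)" if "continuous_on (sphere s0 r) g" for g :: "complex \<Rightarrow> complex"
    using compact_continuous_image[OF that compact_sphere] compact_imp_bounded by blast
  obtain m where m: "m > 0" "\<And>s. s \<in> sphere s0 r ==> m \<le> norm (k' s)"
  proof -
    have "sphere s0 r \<noteq> {}" using r by auto
    then obtain y where y: "y \<in> sphere s0 r" "\<And>s. s \<in> sphere s0 r ==> norm (k' y) \<le> norm (k' s)"
      using continuous_attains_inf[OF compact_sphere _ continuous_on_norm[OF cont(1)]] by blast
    show ?thesis by (rule that[of "norm (k' y)"]) (use y nz' in auto)
  qed
  have ul: "uniform_limit (sphere s0 r) (\<lambda>n s. deriv (k n) s * Q s / k n s) (\<lambda>s. deriv k' s * Q s / k' s) sequentially"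
  proof (rule uniform_lim_divide)
    show "uniform_limit (sphere s0 r) (\<lambda>n s. deriv (k n) s * Q s) (\<lambda>s. deriv k' s * Q s) sequentially"
      by (rule uniform_lim_mult[OF der(1) uniform_limit_const bdd[OF cont(2)] bdd[OF cont(3)]])
    show "uniform_limit (sphere s0 r) k k' sequentially" by (rule uniform_limit_on_subset[OF lim sp])
    show "bounded ((\<lambda>s. deriv k' s * Q s) ` sphere s0 r)" by (intro bdd continuous_intros cont)
  qed (use m in auto)
  have "(\<lambda>n. contour_integral (circlepath s0 r) (\<lambda>s. deriv (k n) s * Q s / k n s)) \<longlonglongrightarrow>
        contour_integral (circlepath s0 r) (\<lambda>s. deriv k' s * Q s / k' s)"
  proof (rule contour_integral_uniform_limit_circlepath[OF _ ul])
    show "\<forall>\<^sub>F n in sequentially. (\<lambda>s. deriv (k n) s * Q s / k n s) contour_integrable_on circlepath s0 r"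
    proof (intro always_eventually allI contour_integrable_continuous_circlepath)
      fix n
      have "continuous_on (sphere s0 r) (k n)" "continuous_on (sphere s0 r) (deriv (k n))"
        using holomorphic_on_imp_continuous_on[OF k] holomorphic_on_imp_continuous_on[OF holomorphic_deriv[OF k open_ball]]
         sp continuous_on_subset by blast+
      thus "continuous_on (path_image (circlepath s0 r)) (\<lambda>s. deriv (k n) s * Q s / k n s)"
        using r nz by (auto simp: path_image_circlepath intro!: continuous_intros cont)
    qed
  qed (use r in auto)
  hence "(\<lambda>n. 2 * pi * \<i> * (\<Sum>b\<in>{b\<in>ball s0 r. k n b = 0}. Q b * of_int (zorder (k n) b))) \<longlonglongrightarrow>
         2 * pi * \<i> * (\<Sum>b\<in>{b\<in>ball s0 r. k' b = 0}. Q b * of_int (zorder k' b))"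
    using zero_sum_contour(1)[OF k _ _ sub r(1) Q nz] zero_sum_contour(1)[OF der(2) _ _ sub r(1) Q nz'] by simp
  thus ?thesis by (subst (asm) tendsto_mult_left_iff) auto
qed

section \<open>Zeros along a family of lines: continuity in the parameter\<close>

text \<open>The situation on a family of parallel lines: \<open>z\<close> is the parameter of the line and \<open>s\<close> the coordinate on
  it. The parameter space is a metric space because it is sometimes the full space and sometimes a disc in one
  other coordinate. Nothing is required of \<open>V\<close> in \<open>z\<close>; the uniform Hoelder condition in \<open>s\<close> replaces it, by
  compactness.\<close>
locale line_family =
  fixes X :: "'a::metric_space set" and D :: "complex set" and f V :: "'a \<Rightarrow> complex \<Rightarrow> complex" and C \<alpha> M :: real
  assumes X: "open X" and D: "open D" "connected D" "bounded D"
    and cont: "continuous_on (X \<times> D) (\<lambda>(z, s). f z s)"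
    and hol: "\<And>z. z \<in> X ==> (\<lambda>s. exp (- V z s) * f z s) holomorphic_on D"
    and bound: "\<And>z s. z \<in> X ==> s \<in> D ==> norm (V z s) \<le> M"
    and hoelder: "\<And>z s t. z \<in> X ==> s \<in> D ==> t \<in> D ==> norm (V z s - V z t) \<le> C * dist s t powr \<alpha>"
    and \<alpha>: "\<alpha> > 0"
begin

definition k :: "'a \<Rightarrow> complex \<Rightarrow> complex" where "k z s = exp (- V z s) * f z s"
definition E :: "complex \<Rightarrow> real \<Rightarrow> 'a set" where "E s0 r = {z\<in>X. \<forall>s\<in>sphere s0 r. f z s \<noteq> 0}"
definition Z :: "complex \<Rightarrow> real \<Rightarrow> 'a \<Rightarrow> complex set" where "Z s0 r z = {b\<in>ball s0 r. k z b = 0}"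
definition P :: "(complex \<Rightarrow> complex) \<Rightarrow> complex \<Rightarrow> real \<Rightarrow> 'a \<Rightarrow> complex" where
  "P Q s0 r z = (\<Sum>b\<in>Z s0 r z. Q b * of_int (zorder (k z) b))"
definition cnt :: "complex \<Rightarrow> real \<Rightarrow> 'a \<Rightarrow> nat" where
  "cnt s0 r z = (\<Sum>b\<in>Z s0 r z. nat (zorder (k z) b))"
definition W :: "complex \<Rightarrow> real \<Rightarrow> 'a \<Rightarrow> complex poly" where
  "W s0 r z = zero_poly (k z) (Z s0 r z)"

lemma k_eq_0 [simp]: "k z s = 0 \<longleftrightarrow> f z s = 0" by (simp add: k_def)

lemma f_eq: "f z s = exp (V z s) * k z s" by (simp add: k_def exp_minus)

lemma hol_k: "z \<in> X ==> k z holomorphic_on D"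
proof -
  assume "z \<in> X"
  moreover have "k z = (\<lambda>s. exp (- V z s) * f z s)" by (rule ext) (simp add: k_def)
  ultimately show ?thesis using hol by metis
qed

lemma equicont: assumes "e > 0" shows "\<exists>d>0. \<forall>z\<in>X. \<forall>s\<in>D. \<forall>t\<in>D. dist s t < d \<longrightarrow> norm (V z s - V z t) < e"
proof (intro exI conjI ballI impI)
  define d where "d = (e / (\<bar>C\<bar> + 1)) powr (1 / \<alpha>)"
  show "d > 0" using assms by (simp add: d_def)
  fix z s t assume *: "z \<in> X" "s \<in> D" "t \<in> D" "dist s t < d"
  have "dist s t powr \<alpha> \<le> d powr \<alpha>" using * \<alpha> by (intro powr_mono2) auto
  also have "d powr \<alpha> = e / (\<bar>C\<bar> + 1)" using \<alpha> assms by (simp add: d_def powr_powr)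
  finally have le: "dist s t powr \<alpha> \<le> e / (\<bar>C\<bar> + 1)" .
  have "norm (V z s - V z t) \<le> C * dist s t powr \<alpha>" by (rule hoelder) fact+
  also have "\<dots> \<le> \<bar>C\<bar> * dist s t powr \<alpha>" by (intro mult_right_mono) auto
  also have "\<dots> \<le> \<bar>C\<bar> * (e / (\<bar>C\<bar> + 1))" using le by (intro mult_left_mono) auto
  also have "\<dots> < e" using assms by (simp add: field_simps)
  finally show "norm (V z s - V z t) < e" .
qed

lemma cont_z: "s \<in> D ==> continuous_on X (\<lambda>z. f z s)"
proof -
  assume "s \<in> D"
  hence "continuous_on X (\<lambda>z. (\<lambda>(z, s). f z s) (z, s))"
    by (intro continuous_on_compose2[OF cont]) (auto intro!: continuous_intros)
  thus ?thesis by simp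
qed

lemma cont_s: "z \<in> X ==> continuous_on D (f z)"
proof -
  assume "z \<in> X"
  hence "continuous_on D (\<lambda>s. (\<lambda>(z, s). f z s) (z, s))"
    by (intro continuous_on_compose2[OF cont]) (auto intro!: continuous_intros)
  thus ?thesis by simp
qed

lemma cont_V: assumes z: "z \<in> X" shows "continuous_on D (V z)"
  unfolding continuous_on_iff
proof (intro ballI allI impI)
  fix s e assume "s \<in> D" "(0::real) < e"
  thus "\<exists>d>0. \<forall>x'\<in>D. dist x' s < d \<longrightarrow> dist (V z x') (V z s) < e"
    using equicont[of e] z unfolding dist_norm by metis
qed

lemma nonzero_nhd:
  assumes K: "compact K" "K \<subseteq> D" and z0: "z0 \<in> X" and nz: "\<And>s. s \<in> K ==> f z0 s \<noteq> 0"
  obtains e where "e > 0" "ball z0 e \<subseteq> X" "\<And>z s. z \<in> ball z0 e ==> s \<in> K ==> f z s \<noteq> 0"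
proof (cases "K = {}")
  case True
  thus ?thesis using that X z0 openE by blast
next
  case False
  have cK: "continuous_on (X \<times> K) (\<lambda>(z, s). f z s)" using K by (intro continuous_on_subset[OF cont]) auto
  obtain y where y: "y \<in> K" "\<And>s. s \<in> K ==> norm (f z0 y) \<le> norm (f z0 s)"
    using continuous_attains_inf[OF K(1) False, of "\<lambda>s. norm (f z0 s)"] continuous_on_subset[OF cont_s[OF z0] K(2)]
    by (auto intro: continuous_intros)
  have m: "norm (f z0 y) > 0" using nz y by simp
  obtain X0 where X0: "z0 \<in> X0" "open X0" "\<forall>x\<in>X0 \<inter> X. \<forall>t\<in>K. dist ((\<lambda>(z, s). f z s) (x, t)) ((\<lambda>(z, s). f z s) (z0, t)) \<le> norm (f z0 y) / 2"
    using continuous_on_prod_compactE[OF cK K(1) z0 half_gt_zero[OF m]] by blast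
  obtain e where e: "e > 0" "ball z0 e \<subseteq> X0 \<inter> X" using openE[of "X0 \<inter> X" z0] X0 X z0 by blast
  show ?thesis
  proof (rule that[OF e(1)])
    show "ball z0 e \<subseteq> X" using e by blast
    fix z s assume zs: "z \<in> ball z0 e" "s \<in> K"
    have "z \<in> X0 \<inter> X" using e zs by blast
    hence "dist (f z s) (f z0 s) \<le> norm (f z0 y) / 2" using X0(3) zs(2) by fastforce
    moreover have "norm (f z0 y) \<le> norm (f z0 s)" using y zs by blast
    moreover have "dist (f z s) (f z0 s) = norm (f z0 s)" if "f z s = 0" using that by simp
    ultimately show "f z s \<noteq> 0" using m by linarith
  qed
qed

lemma E_nhd:
  assumes "z0 \<in> E s0 r" "cball s0 r \<subseteq> D"
  obtains e where "e > 0" "ball z0 e \<subseteq> E s0 r"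
proof -
  have "sphere s0 r \<subseteq> D" using assms(2) by auto
  then obtain e where "e > 0" "ball z0 e \<subseteq> X" "\<And>z s. z \<in> ball z0 e ==> s \<in> sphere s0 r ==> f z s \<noteq> 0"
    using nonzero_nhd[of "sphere s0 r" z0] assms(1) by (auto simp: E_def)
  hence "ball z0 e \<subseteq> E s0 r" unfolding E_def by blast
  with \<open>e > 0\<close> show ?thesis using that by blast
qed

lemma open_E: assumes sub: "cball s0 r \<subseteq> D" shows "open (E s0 r)"
  unfolding open_contains_ball using E_nhd[OF _ sub] by blast

lemma E_subset: "E s0 r \<subseteq> X" by (auto simp: E_def)

text \<open>Arzela--Ascoli for the equicontinuous functions \<open>V\<close>. It is the substitute for continuity of \<open>V\<close> in the
  parameter: every sequence of parameters has a subsequence along which the functions \<open>k\<close> converge.\<close>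
lemma subseq_limit:
  assumes x: "\<And>n. x n \<in> X" "x \<longlonglongrightarrow> a" and a: "a \<in> X" and K: "compact K" "K \<subseteq> D"
  obtains V' \<rho> where "strict_mono (\<rho> :: nat \<Rightarrow> nat)" "continuous_on K V'"
    "uniform_limit K (\<lambda>n. V (x (\<rho> n))) V' sequentially"
    "uniform_limit K (\<lambda>n. k (x (\<rho> n))) (\<lambda>s. exp (- V' s) * f a s) sequentially"
proof -
  obtain V' \<rho> where V': "continuous_on K V'" "strict_mono (\<rho> :: nat \<Rightarrow> nat)"
    and lim: "\<And>e. 0 < e ==> \<exists>N. \<forall>n x'. n \<ge> N \<and> x' \<in> K \<longrightarrow> norm (V (x (\<rho> n)) x' - V' x') < e"
  proof (rule Arzela_Ascoli[of K "\<lambda>n. V (x n)" M])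
    show "\<exists>d>0. \<forall>n y. y \<in> K \<and> cmod (s - y) < d \<longrightarrow> cmod (V (x n) s - V (x n) y) < e" if "s \<in> K" "0 < e" for s e
      using equicont[OF that(2)] that(1) K(2) x(1) unfolding dist_norm by (metis subsetD)
    show "compact K" by (rule K(1))
    show "cmod (V (x n) s) \<le> M" if "s \<in> K" for n s using bound[OF x(1)] K(2) that by blast
  qed (rule that)
  have ulV: "uniform_limit K (\<lambda>n. V (x (\<rho> n))) V' sequentially"
    unfolding uniform_limit_iff eventually_sequentially dist_norm using lim by metis
  have "uniform_limit K (\<lambda>n s. exp (- V (x (\<rho> n)) s)) (\<lambda>s. exp (- V' s)) sequentially"
  proof (rule uniform_limit_compose_uniformly_continuous_on[OF ulV, of "cball 0 M"])
    show "uniformly_continuous_on (cball 0 M) (\<lambda>w::complex. exp (- w))"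
      by (intro compact_uniformly_continuous continuous_intros) auto
  qed (use bound x(1) K(2) in \<open>auto intro!: always_eventually\<close>)
  moreover have "uniform_limit K (\<lambda>n. f (x (\<rho> n))) (f a) sequentially"
  proof (rule uniform_limitI)
    fix e :: real assume e: "e > 0"
    have cK: "continuous_on (X \<times> K) (\<lambda>(z, s). f z s)" using K by (intro continuous_on_subset[OF cont]) auto
    obtain X0 where X0: "a \<in> X0" "open X0" "\<forall>x\<in>X0 \<inter> X. \<forall>t\<in>K. dist ((\<lambda>(z, s). f z s) (x, t)) ((\<lambda>(z, s). f z s) (a, t)) \<le> e / 2"
      using continuous_on_prod_compactE[OF cK K(1) a half_gt_zero[OF e]] by blast
    have "(\<lambda>n. x (\<rho> n)) \<longlonglongrightarrow> a" using LIMSEQ_subseq_LIMSEQ[OF x(2) V'(2)] by (simp add: o_def)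
    hence "\<forall>\<^sub>F n in sequentially. x (\<rho> n) \<in> X0" using X0 topological_tendstoD by blast
    thus "\<forall>\<^sub>F n in sequentially. \<forall>s\<in>K. dist (f (x (\<rho> n)) s) (f a s) < e"
    proof eventually_elim
      case (elim n)
      show ?case
      proof
        fix s assume "s \<in> K"
        moreover have "x (\<rho> n) \<in> X0 \<inter> X" using elim x(1) by blast
        ultimately have "dist (f (x (\<rho> n)) s) (f a s) \<le> e / 2" using X0(3) by fastforce
        thus "dist (f (x (\<rho> n)) s) (f a s) < e" using e by simp
      qed
    qed
  qed
  moreover have "bounded ((\<lambda>s. exp (- V' s)) ` K)" "bounded (f a ` K)"
    by (intro compact_imp_bounded compact_continuous_image continuous_intros V' continuous_on_subset[OF cont_s[OF a]] K)+
  ultimately have "uniform_limit K (\<lambda>n s. exp (- V (x (\<rho> n)) s) * f (x (\<rho> n)) s) (\<lambda>s. exp (- V' s) * f a s) sequentially"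
    by (intro uniform_lim_mult)
  thus ?thesis using that[OF V'(2,1) ulV] by (simp add: k_def[abs_def])
qed

text \<open>The limit of the functions \<open>k\<close> need not be \<open>k a\<close>, but it differs from it by the exponential of a
  continuous function, so it has the same zeros with the same orders.\<close>
lemma P_subseq:
  assumes x: "\<And>n. x n \<in> E s0 r" "x \<longlonglongrightarrow> a" and a: "a \<in> E s0 r" and D0: "cball s0 r \<subseteq> D" "r > 0" and Q: "Q holomorphic_on D"
  obtains \<rho> where "strict_mono (\<rho> :: nat \<Rightarrow> nat)" "(\<lambda>n. P Q s0 r (x (\<rho> n))) \<longlonglongrightarrow> P Q s0 r a"
proof -
  obtain e where e: "e > 0" "cball s0 (r + e) \<subseteq> D" using cball_enlarge[OF D(1) D0] by blast
  define r1 where "r1 = r + e"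
  have r1: "r < r1" "cball s0 r1 \<subseteq> D" "ball s0 r1 \<subseteq> D" using e ball_subset_cball by (auto simp: r1_def)
  have xX: "x n \<in> X" for n using x(1) E_subset by blast
  have aX: "a \<in> X" using a E_subset by blast
  obtain V' \<rho> where \<rho>: "strict_mono (\<rho> :: nat \<Rightarrow> nat)" "continuous_on (cball s0 r1) V'"
    and ul: "uniform_limit (cball s0 r1) (\<lambda>n. k (x (\<rho> n))) (\<lambda>s. exp (- V' s) * f a s) sequentially"
    using subseq_limit[OF xX x(2) aX compact_cball r1(2)] by metis
  define k' where "k' = (\<lambda>s. exp (- V' s) * f a s)"
  have ul': "uniform_limit (ball s0 r1) (\<lambda>n. k (x (\<rho> n))) k' sequentially"
    unfolding k'_def by (rule uniform_limit_on_subset[OF ul ball_subset_cball])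
  have hk: "k (x (\<rho> n)) holomorphic_on ball s0 r1" for n using hol_k[OF xX] r1(3) holomorphic_on_subset by blast
  have hk': "k' holomorphic_on ball s0 r1" by (rule uniform_limit_deriv_circle(2)[OF hk ul' D0(2) r1(1)])
  have ka: "k a holomorphic_on ball s0 r1" using hol_k[OF aX] r1(3) holomorphic_on_subset by blast
  have "(\<lambda>n. \<Sum>b\<in>{b\<in>ball s0 r. k (x (\<rho> n)) b = 0}. Q b * of_int (zorder (k (x (\<rho> n))) b)) \<longlonglongrightarrow>
           (\<Sum>b\<in>{b\<in>ball s0 r. k' b = 0}. Q b * of_int (zorder k' b))"
    by (rule zero_sum_tendsto[OF hk ul' D0(2) r1(1)])
       (use Q r1 x(1) a in \<open>auto simp: k'_def E_def intro: holomorphic_on_subset\<close>)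
  also have "(\<Sum>b\<in>{b\<in>ball s0 r. k' b = 0}. Q b * of_int (zorder k' b)) = P Q s0 r a"
    unfolding P_def Z_def
  proof (rule sum.cong)
    fix b assume b: "b \<in> {b \<in> ball s0 r. k a b = 0}"
    have s0r: "s0 + of_real r \<in> sphere s0 r" using D0 by (auto simp: dist_norm)
    have "zorder k' b = zorder (k a) b"
    proof (rule zorder_times_exp_continuous[OF hk' ka open_ball connected_ball, of "\<lambda>s. V a s - V' s"])
      show "continuous_on (ball s0 r1) (\<lambda>s. V a s - V' s)"
        by (intro continuous_intros continuous_on_subset[OF cont_V[OF aX] r1(3)] continuous_on_subset[OF \<rho>(2) ball_subset_cball])
      show "\<exists>s\<in>ball s0 r1. k a s \<noteq> 0"
        using a s0r r1(1) by (intro bexI[of _ "s0 + of_real r"]) (auto simp: E_def)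
    qed (use b r1 in \<open>auto simp: k'_def k_def exp_diff exp_minus field_simps\<close>)
    thus "Q b * of_int (zorder k' b) = Q b * of_int (zorder (k a) b)" by simp
  qed (auto simp: k'_def)
  finally show ?thesis using that[OF \<rho>(1)] by (simp add: P_def Z_def)
qed

text \<open>Every sequence has a subsequence with the right limit, and the limit does not depend on the subsequence.\<close>
lemma P_continuous:
  assumes D0: "cball s0 r \<subseteq> D" "r > 0" and Q: "Q holomorphic_on D"
  shows "continuous_on (E s0 r) (P Q s0 r)"
  unfolding continuous_on_sequentially
proof (intro allI ballI impI, elim conjE)
  fix x a assume a: "a \<in> E s0 r" and x: "\<forall>n. x n \<in> E s0 r" "x \<longlonglongrightarrow> a"
  show "(P Q s0 r \<circ> x) \<longlonglongrightarrow> P Q s0 r a"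
  proof (rule ccontr)
    assume "\<not> (P Q s0 r \<circ> x) \<longlonglongrightarrow> P Q s0 r a"
    then obtain e where e: "e > 0" "\<forall>N. \<exists>n\<ge>N. dist (P Q s0 r (x n)) (P Q s0 r a) \<ge> e"
      unfolding lim_sequentially by (auto simp: not_less)
    hence "infinite {n. dist (P Q s0 r (x n)) (P Q s0 r a) \<ge> e}"
      unfolding infinite_nat_iff_unbounded_le by blast
    then obtain q :: "nat \<Rightarrow> nat" where q: "strict_mono q" "\<And>n. dist (P Q s0 r (x (q n))) (P Q s0 r a) \<ge> e"
      using infinite_enumerate by (metis (mono_tags, lifting) mem_Collect_eq)
    have "(\<lambda>n. x (q n)) \<longlonglongrightarrow> a" using LIMSEQ_subseq_LIMSEQ[OF x(2) q(1)] by (simp add: o_def)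
    then obtain \<rho> where "strict_mono (\<rho> :: nat \<Rightarrow> nat)" "(\<lambda>n. P Q s0 r (x (q (\<rho> n)))) \<longlonglongrightarrow> P Q s0 r a"
      using P_subseq[of "\<lambda>n. x (q n)", OF _ _ a D0 Q] x(1) by blast
    from metric_LIMSEQ_D[OF this(2) e(1)] q(2) show False by (meson le_refl not_less)
  qed
qed

lemma finite_Z: assumes "z \<in> E s0 r" "cball s0 r \<subseteq> D" "r > 0" shows "finite (Z s0 r z)"
proof -
  have "z \<in> X" using assms E_subset by blast
  show ?thesis unfolding Z_def
    by (rule zero_sum_contour(2)[OF hol_k[OF \<open>z \<in> X\<close>] D(1,2) assms(2,3), of "\<lambda>_. 1"]) (use assms in \<open>auto simp: E_def\<close>)
qed

lemma k_not_0: assumes "z \<in> E s0 r" "cball s0 r \<subseteq> D" "r > 0" shows "\<exists>s\<in>D. k z s \<noteq> 0"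
proof -
  have "s0 + of_real r \<in> sphere s0 r" using assms by (auto simp: dist_norm)
  thus ?thesis using assms by (intro bexI[of _ "s0 + of_real r"]) (auto simp: E_def)
qed

lemma zorder_pos: assumes "z \<in> E s0 r" "cball s0 r \<subseteq> D" "r > 0" "b \<in> Z s0 r z" shows "zorder (k z) b > 0"
proof -
  have "z \<in> X" using assms E_subset by blast
  have "b \<in> D" using assms by (auto simp: Z_def)
  have "if k z b = 0 then zorder (k z) b > 0 else zorder (k z) b = 0"
    using zorder_exist_zero[OF hol_k[OF \<open>z \<in> X\<close>] D(1,2) \<open>b \<in> D\<close> k_not_0[OF assms(1-3)]] by (rule conjunct1)
  moreover have "k z b = 0" using assms(4) unfolding Z_def by blast
  ultimately show ?thesis by (simp only: if_True)
qed

text \<open>The constant power sum counts zeros; being continuous it is locally constant.\<close>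
lemma P_const: assumes "z \<in> E s0 r" "cball s0 r \<subseteq> D" "r > 0" shows "P (\<lambda>_. c) s0 r z = c * of_nat (cnt s0 r z)"
proof -
  have "of_int (zorder (k z) b) = (of_nat (nat (zorder (k z) b)) :: complex)" if "b \<in> Z s0 r z" for b
    using zorder_pos[OF assms that] by simp
  thus ?thesis by (simp add: P_def cnt_def sum_distrib_left)
qed

lemma cnt_locally_const:
  assumes z0: "z0 \<in> E s0 r" and D0: "cball s0 r \<subseteq> D" "r > 0"
  obtains e where "e > 0" "ball z0 e \<subseteq> E s0 r" "\<And>z. z \<in> ball z0 e ==> cnt s0 r z = cnt s0 r z0"
proof -
  have "continuous_on (E s0 r) (P (\<lambda>_. 1) s0 r)" by (rule P_continuous[OF D0]) auto
  then obtain d where d: "d > 0" "\<And>z. z \<in> E s0 r ==> dist z z0 < d ==> dist (P (\<lambda>_. 1) s0 r z) (P (\<lambda>_. 1) s0 r z0) < 1"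
    using z0 unfolding continuous_on_iff by (metis zero_less_one)
  obtain e where e: "e > 0" "ball z0 e \<subseteq> E s0 r" using E_nhd[OF z0 D0(1)] .
  show ?thesis
  proof (rule that[of "min d e"])
    fix z assume z: "z \<in> ball z0 (min d e)"
    hence zE: "z \<in> E s0 r" using e by auto
    have "dist (of_nat (cnt s0 r z) :: complex) (of_nat (cnt s0 r z0)) < 1"
      using d(2)[OF zE] z by (simp add: P_const[OF zE D0] P_const[OF z0 D0] dist_commute)
    thus "cnt s0 r z = cnt s0 r z0"
      unfolding dist_of_nat by linarith
  qed (use d e in auto)
qed

lemma degree_W: assumes "z \<in> E s0 r" "cball s0 r \<subseteq> D" "r > 0" shows "degree (W s0 r z) = cnt s0 r z"
proof -
  have "degree (\<Prod>b\<in>Z s0 r z. [:- b, 1:] ^ nat (zorder (k z) b)) = (\<Sum>b\<in>Z s0 r z. degree ([:- b, 1:] ^ nat (zorder (k z) b)))"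
    by (rule degree_prod_eq_sum_degree) auto
  thus ?thesis by (simp add: W_def zero_poly_def cnt_def degree_power_eq)
qed

lemma poly_W: "poly (W s0 r z) s = (\<Prod>b\<in>Z s0 r z. (s - b) ^ nat (zorder (k z) b))"
  by (simp add: W_def zero_poly_def poly_prod)

text \<open>Outside the disc all factors \<open>1 - (b - s0) / (s - s0)\<close> lie in the domain of the principal logarithm. Hence the value
  of the polynomial is a sum over the zeros in disguise, and inherits the regularity of such sums.\<close>
lemma poly_W_outside:
  assumes z: "z \<in> E s0 r" and D0: "cball s0 r \<subseteq> D" "r > 0" and s: "norm (s - s0) > r"
  shows "poly (W s0 r z) s = (s - s0) ^ cnt s0 r z * exp (P (\<lambda>b. Ln (1 - (b - s0) / (s - s0))) s0 r z)"
proof -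
  have nz: "s \<noteq> s0" using s D0 by auto
  have fac: "(s - b) ^ nat (zorder (k z) b) = (s - s0) ^ nat (zorder (k z) b) * exp (Ln (1 - (b - s0) / (s - s0)) * of_int (zorder (k z) b))"
    if b: "b \<in> Z s0 r z" for b
  proof -
    have "b \<noteq> s" using b s by (auto simp: Z_def dist_norm norm_minus_commute)
    hence ne: "1 - (b - s0) / (s - s0) \<noteq> 0" using nz by (simp add: field_simps)
    have "exp (Ln (1 - (b - s0) / (s - s0)) * of_int (zorder (k z) b)) = exp (of_nat (nat (zorder (k z) b)) * Ln (1 - (b - s0) / (s - s0)))"
      using zorder_pos[OF z D0 b] by (simp add: mult.commute)
    also have "\<dots> = (1 - (b - s0) / (s - s0)) ^ nat (zorder (k z) b)" using ne by (simp add: exp_of_nat_mult)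
    also have "(s - s0) ^ nat (zorder (k z) b) * \<dots> = (s - b) ^ nat (zorder (k z) b)"
      using nz by (simp add: power_mult_distrib[symmetric] field_simps)
    finally show ?thesis by simp
  qed
  show ?thesis
    unfolding poly_W P_def exp_sum[OF finite_Z[OF z D0]] cnt_def power_sum
    by (subst prod.distrib[symmetric], rule prod.cong) (use fac in auto)
qed

lemma D_bound: fixes r :: real and s0 :: complex obtains L where "L > r" "\<And>b. b \<in> D ==> norm (b - s0) < L"
proof -
  obtain L where "\<And>b. b \<in> D ==> norm b \<le> L" using D(3) bounded_iff by blast
  hence "norm (b - s0) < max (r + 1) (L + norm s0 + 1)" if "b \<in> D" for b
    using norm_triangle_ineq4[of b s0] that by (smt (verit))
  thus ?thesis by (intro that[of "max (r + 1) (L + norm s0 + 1)"]) auto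
qed

text \<open>The values at points far away are regular by the preceding formula; interpolation gives the coefficients.
  The abstract predicate \<open>R\<close> stands for continuity or for holomorphy.\<close>
lemma coeff_W_regular:
  assumes Uset: "A \<subseteq> E s0 r" and D0: "cball s0 r \<subseteq> D" "r > 0" and c: "\<And>z. z \<in> A ==> cnt s0 r z = N"
    and cong: "\<And>u v. R u ==> (\<And>z. z \<in> A ==> u z = v z) ==> R v"
    and ex: "\<And>u. R u ==> R (\<lambda>z. exp (u z))"
    and add: "\<And>u v. R u ==> R v ==> R (\<lambda>z. u z + v z)" and cm: "\<And>u c. R u ==> R (\<lambda>z. c * u z)"
    and zero: "R (\<lambda>z. 0)"
    and P: "\<And>Q. Q holomorphic_on D ==> R (P Q s0 r)"
  shows "R (\<lambda>z. coeff (W s0 r z) i)"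
proof -
  define p where "p = (\<lambda>z. if z \<in> A then W s0 r z else 0)"
  obtain L where L: "L > r" "\<And>b. b \<in> D ==> norm (b - s0) < L" using D_bound by blast
  have "R (\<lambda>z. coeff (p z) i)"
  proof (rule coeff_family[where R = R and N = N and T = "{s. norm (s - s0) > L}", OF add cm zero])
    show "degree (p z) \<le> N" for z using degree_W[OF _ D0] c Uset by (auto simp: p_def)
    have "(\<lambda>n. s0 + of_real (L + real (Suc n))) ` UNIV \<subseteq> {s. norm (s - s0) > L}"
      using L D0 by (auto simp del: of_real_add of_nat_Suc simp: norm_of_real)
    moreover have "inj (\<lambda>n. s0 + complex_of_real (L + real (Suc n)))" by (auto simp: inj_def simp del: of_real_add)
    hence "infinite (range (\<lambda>n. s0 + complex_of_real (L + real (Suc n))))" by (rule range_inj_infinite)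
    ultimately show "infinite {s. norm (s - s0) > L}" using infinite_super by blast
    fix s assume s: "s \<in> {s. norm (s - s0) > L}"
    have hQ: "(\<lambda>b. Ln (1 - (b - s0) / (s - s0))) holomorphic_on D"
    proof (intro holomorphic_intros)
      show "s - s0 \<noteq> 0" using s L D0 by auto
      fix b assume b: "b \<in> D"
      have "norm ((b - s0) / (s - s0)) < 1" using L(2)[OF b] s by (simp add: norm_divide divide_less_eq_1)
      hence "Re ((b - s0) / (s - s0)) < 1" using complex_Re_le_cmod[of "(b - s0) / (s - s0)"] by linarith
      thus "1 - (b - s0) / (s - s0) \<notin> \<real>\<^sub>\<le>\<^sub>0" by (auto simp: complex_nonpos_Reals_iff)
    qed
    have "R (\<lambda>z. (s - s0) ^ N * exp (P (\<lambda>b. Ln (1 - (b - s0) / (s - s0))) s0 r z))"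
      by (rule cm, rule ex, rule P[OF hQ])
    thus "R (\<lambda>z. poly (p z) s)"
      by (rule cong) (use poly_W_outside[OF _ D0, of _ s] Uset c s L in \<open>auto simp: p_def\<close>)
  qed
  thus ?thesis by (rule cong) (simp add: p_def)
qed

lemma coeff_W_continuous:
  assumes z0: "z0 \<in> E s0 r" and D0: "cball s0 r \<subseteq> D" "r > 0"
  obtains e where "e > 0" "ball z0 e \<subseteq> E s0 r" "\<And>z. z \<in> ball z0 e ==> degree (W s0 r z) = cnt s0 r z0"
    "\<And>i. continuous_on (ball z0 e) (\<lambda>z. coeff (W s0 r z) i)"
proof -
  obtain e where e: "e > 0" "ball z0 e \<subseteq> E s0 r" "\<And>z. z \<in> ball z0 e ==> cnt s0 r z = cnt s0 r z0"
    using cnt_locally_const[OF assms] by blast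
  have "continuous_on (ball z0 e) (\<lambda>z. coeff (W s0 r z) i)" for i
  proof (rule coeff_W_regular[where R = "continuous_on (ball z0 e)", OF e(2) D0 e(3)])
    show "continuous_on (ball z0 e) (P Q s0 r)" if "Q holomorphic_on D" for Q
      using P_continuous[OF D0 that] e(2) continuous_on_subset by blast
    show "continuous_on (ball z0 e) v" if "continuous_on (ball z0 e) u" "\<And>z. z \<in> ball z0 e ==> u z = v z" for u v
      using continuous_on_eq[OF that] .
  qed (auto intro: continuous_intros)
  moreover have "degree (W s0 r z) = cnt s0 r z0" if "z \<in> ball z0 e" for z
  proof -
    have "z \<in> E s0 r" using that e(2) by blast
    thus ?thesis using degree_W[OF _ D0] e(3)[OF that] by simp
  qed
  ultimately show ?thesis by - (rule that[OF e(1,2)])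
qed

lemma W_continuous:
  assumes z0: "z0 \<in> E s0 r" and D0: "cball s0 r \<subseteq> D" "r > 0"
  obtains e where "e > 0" "ball z0 e \<subseteq> E s0 r" "continuous_on (ball z0 e \<times> UNIV) (\<lambda>(z, s). poly (W s0 r z) s)"
proof -
  obtain e where e: "e > 0" "ball z0 e \<subseteq> E s0 r" "\<And>z. z \<in> ball z0 e ==> degree (W s0 r z) = cnt s0 r z0"
    "\<And>i. continuous_on (ball z0 e) (\<lambda>z. coeff (W s0 r z) i)" using coeff_W_continuous[OF assms] by blast
  have "continuous_on (ball z0 e \<times> UNIV) (\<lambda>x. \<Sum>i\<le>cnt s0 r z0. coeff (W s0 r (fst x)) i * snd x ^ i)"
    by (intro continuous_intros continuous_on_compose2[OF e(4)]) auto
  moreover have "(\<Sum>i\<le>cnt s0 r z0. coeff (W s0 r z) i * s ^ i) = poly (W s0 r z) s" if "z \<in> ball z0 e" for z s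
    using e(3)[OF that] by (simp add: poly_altdef)
  ultimately have "continuous_on (ball z0 e \<times> UNIV) (\<lambda>(z, s). poly (W s0 r z) s)"
    by (auto simp: case_prod_unfold elim!: continuous_on_eq)
  thus ?thesis using that e by blast
qed

lemma kap_ex:
  assumes z: "z \<in> E s0 r" and D0: "cball s0 r \<subseteq> D" "r > 0"
  shows "\<exists>\<kappa>. \<kappa> holomorphic_on D \<and> (\<forall>s\<in>D. k z s = poly (W s0 r z) s * \<kappa> s) \<and> (\<forall>s\<in>cball s0 r. \<kappa> s \<noteq> 0)"
proof -
  have zX: "z \<in> X" using z E_subset by blast
  have ZD: "Z s0 r z \<subseteq> D" using D0 by (auto simp: Z_def)
  obtain \<kappa> where \<kappa>: "\<kappa> holomorphic_on D" "\<And>s. s \<in> D ==> k z s = poly (W s0 r z) s * \<kappa> s"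
    "\<And>b. b \<in> Z s0 r z ==> \<kappa> b \<noteq> 0"
    using zero_poly_divides[OF hol_k[OF zX] D(1,2) finite_Z[OF z D0] ZD k_not_0[OF z D0]] unfolding W_def by metis
  have "\<kappa> s \<noteq> 0" if s: "s \<in> cball s0 r" for s
  proof (cases "s \<in> Z s0 r z")
    case False
    have "k z s \<noteq> 0"
    proof (cases "s \<in> sphere s0 r")
      case True thus ?thesis using z by (simp add: E_def)
    next
      case False
      hence "s \<in> ball s0 r" using s by (simp add: less_le)
      thus ?thesis using \<open>s \<notin> Z s0 r z\<close> by (simp add: Z_def)
    qed
    thus ?thesis using \<kappa>(2)[of s] s D0 by auto
  qed (use \<kappa>(3) in blast)
  thus ?thesis using \<kappa>(1,2) by blast
qed

definition kap :: "complex \<Rightarrow> real \<Rightarrow> 'a \<Rightarrow> complex \<Rightarrow> complex" where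
  "kap s0 r z = (SOME \<kappa>. \<kappa> holomorphic_on D \<and> (\<forall>s\<in>D. k z s = poly (W s0 r z) s * \<kappa> s) \<and> (\<forall>s\<in>cball s0 r. \<kappa> s \<noteq> 0))"

definition F :: "complex \<Rightarrow> real \<Rightarrow> 'a \<Rightarrow> complex \<Rightarrow> complex" where
  "F s0 r z s = exp (V z s) * kap s0 r z s"

lemma kap:
  assumes z: "z \<in> E s0 r" and D0: "cball s0 r \<subseteq> D" "r > 0"
  shows "kap s0 r z holomorphic_on D" "\<And>s. s \<in> D ==> k z s = poly (W s0 r z) s * kap s0 r z s"
    "\<And>s. s \<in> cball s0 r ==> kap s0 r z s \<noteq> 0"
  using someI_ex[OF kap_ex[OF assms]] unfolding kap_def[symmetric] by blast+

lemma F_props: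
  assumes z: "z \<in> E s0 r" and D0: "cball s0 r \<subseteq> D" "r > 0"
  shows "\<And>s. s \<in> D ==> f z s = poly (W s0 r z) s * F s0 r z s"
    "\<And>s. s \<in> cball s0 r ==> F s0 r z s \<noteq> 0" "continuous_on D (F s0 r z)"
proof -
  show "f z s = poly (W s0 r z) s * F s0 r z s" if "s \<in> D" for s
    using kap(2)[OF assms that] by (simp add: f_eq F_def)
  show "F s0 r z s \<noteq> 0" if "s \<in> cball s0 r" for s
    using kap(3)[OF assms that] by (simp add: F_def)
  have "z \<in> X" using z E_subset by blast
  thus "continuous_on D (F s0 r z)" unfolding F_def[abs_def]
    by (intro continuous_intros cont_V holomorphic_on_imp_continuous_on[OF kap(1)[OF assms]])
qed

text \<open>Inside the disc, \<open>F\<close> is recovered from its values near the boundary circle by the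
  maximum principle, where the polynomial does not vanish and \<open>F\<close> is a quotient of continuous functions.\<close>
lemma F_continuous:
  assumes D0: "cball s0 r \<subseteq> D" "r > 0"
  shows "continuous_on (E s0 r \<times> ball s0 r) (\<lambda>(z, s). F s0 r z s)"
  unfolding continuous_on_iff
proof (intro ballI allI impI)
  fix zs :: "'a \<times> complex" and e :: real
  assume "zs \<in> E s0 r \<times> ball s0 r" and e: "e > 0"
  then obtain z1 s1 where zs: "zs = (z1, s1)" "z1 \<in> E s0 r" "s1 \<in> ball s0 r" by auto
  have z1X: "z1 \<in> X" using zs E_subset by blast
  have s1D: "s1 \<in> D" using zs(3) D0 by auto
  define A where "A = F s0 r z1 s1"
  define e1 where "e1 = e / 5"
  define e2 where "e2 = e1 / (norm A + 3 * e1 + 1)"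
  have e1: "e1 > 0" using e by (simp add: e1_def)
  have pos: "norm A + 3 * e1 + 1 > 0" using e1 by (simp add: add_nonneg_pos)
  have e2: "e2 > 0" using e1 pos by (simp add: e2_def)
  have e2mult: "x * e2 \<le> e1" if "x \<le> norm A + 3 * e1" for x
  proof -
    have "x * e2 \<le> (norm A + 3 * e1 + 1) * e2" using that e2 by (intro mult_right_mono) auto
    thus ?thesis using pos by (simp add: e2_def)
  qed
  have "((\<lambda>w::complex. exp w) \<longlongrightarrow> exp 0) (at 0)" by (intro tendsto_intros)
  then obtain \<tau> where \<tau>: "\<tau> > 0" "\<And>w::complex. norm w < \<tau> ==> norm (exp w - 1) < e2"
    using e2 unfolding LIM_eq by (metis diff_zero exp_zero norm_zero diff_self)
  obtain d1 where d1: "d1 > 0" "\<And>z s t. z \<in> X ==> s \<in> D ==> t \<in> D ==> dist s t < d1 ==> norm (V z s - V z t) < \<tau>"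
    using equicont[OF \<tau>(1)] by blast
  obtain d2 where d2: "d2 > 0" "\<And>s. s \<in> D ==> dist s s1 < d2 ==> norm (F s0 r z1 s - A) < e1"
    using F_props(3)[OF zs(2) D0] s1D e1 unfolding continuous_on_iff dist_norm A_def by metis
  obtain d3 where d3: "d3 > 0" "\<And>s. s \<in> ball s1 d3 - {s1} ==> s \<in> D \<and> f z1 s \<noteq> 0"
  proof (cases "k z1 s1 = 0")
    case True
    obtain w where w: "w \<in> D" "k z1 w \<noteq> 0" using k_not_0[OF zs(2) D0] by blast
    obtain d where d: "d > 0" "ball s1 d \<subseteq> D" "\<And>y. y \<in> ball s1 d - {s1} ==> k z1 y \<noteq> 0"
      using isolated_zeros[OF hol_k[OF z1X] D(1,2) s1D True w] by blast
    have "s \<in> D \<and> f z1 s \<noteq> 0" if "s \<in> ball s1 d - {s1}" for s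
      using d(2) d(3)[OF that] that k_eq_0[of z1 s] by blast
    thus ?thesis using that[of d] d(1) by blast
  next
    case False
    have "open (D \<inter> k z1 -` (-{0}))"
      using continuous_open_preimage[OF holomorphic_on_imp_continuous_on[OF hol_k[OF z1X]] D(1)] by auto
    moreover have "s1 \<in> D \<inter> k z1 -` (-{0})" using False s1D by auto
    ultimately obtain d where d: "d > 0" "ball s1 d \<subseteq> D \<inter> k z1 -` (-{0})" using openE by blast
    have "s \<in> D \<and> f z1 s \<noteq> 0" if "s \<in> ball s1 d" for s
      using d(2) that k_eq_0[of z1 s] by blast
    thus ?thesis using that[of d] d(1) by blast
  qed
  obtain d4 where d4: "d4 > 0" "ball s1 d4 \<subseteq> ball s0 r" using zs(3) openE[OF open_ball] by blast
  define \<eta> where "\<eta> = min (min d1 d2) (min d3 d4) / 2"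
  have \<eta>: "\<eta> > 0" "\<eta> < d1" "\<eta> < d2" "\<eta> < d3" "\<eta> < d4" using d1(1) d2(1) d3(1) d4(1) by (auto simp: \<eta>_def)
  have cb: "cball s1 \<eta> \<subseteq> ball s0 r" using d4(2) \<eta>(5) by (auto simp: subset_eq)
  have cbD: "cball s1 \<eta> \<subseteq> D" using cb D0 by fastforce
  have spD: "sphere s1 \<eta> \<subseteq> D" using cbD by auto
  have nzs: "f z1 s \<noteq> 0" if "s \<in> sphere s1 \<eta>" for s
    using that d3(2)[of s] \<eta> by auto
  obtain r1 where r1: "r1 > 0" "ball z1 r1 \<subseteq> X" "\<And>z s. z \<in> ball z1 r1 ==> s \<in> sphere s1 \<eta> ==> f z s \<noteq> 0"
    using nonzero_nhd[OF compact_sphere spD z1X nzs] by blast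
  obtain r2 where r2: "r2 > 0" "ball z1 r2 \<subseteq> E s0 r" "continuous_on (ball z1 r2 \<times> UNIV) (\<lambda>(z, s). poly (W s0 r z) s)"
    using W_continuous[OF zs(2) D0] by blast
  define r3 where "r3 = min r1 r2"
  have r3: "r3 > 0" "ball z1 r3 \<subseteq> E s0 r" using r1 r2 by (auto simp: r3_def)
  have FE: "F s0 r z s = f z s / poly (W s0 r z) s \<and> poly (W s0 r z) s \<noteq> 0" if "z \<in> ball z1 r3" "s \<in> sphere s1 \<eta>" for z s
  proof -
    have "f z s \<noteq> 0" using r1(3) that by (auto simp: r3_def)
    moreover have "f z s = poly (W s0 r z) s * F s0 r z s"
      by (rule F_props(1)[OF _ D0]) (use that r3 spD in auto)
    ultimately show ?thesis by auto
  qed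
  have contF: "continuous_on (ball z1 r3 \<times> sphere s1 \<eta>) (\<lambda>(z, s). F s0 r z s)"
  proof (rule continuous_on_eq)
    have 1: "continuous_on (ball z1 r3 \<times> sphere s1 \<eta>) (\<lambda>(z, s). f z s)"
      by (rule continuous_on_subset[OF cont]) (use r3 E_subset spD in blast)
    have 2: "continuous_on (ball z1 r3 \<times> sphere s1 \<eta>) (\<lambda>(z, s). poly (W s0 r z) s)"
      by (rule continuous_on_subset[OF r2(3)]) (auto simp: r3_def)
    show "continuous_on (ball z1 r3 \<times> sphere s1 \<eta>) (\<lambda>x. (\<lambda>(z, s). f z s) x / (\<lambda>(z, s). poly (W s0 r z) s) x)"
      by (intro continuous_on_divide 1 2) (use FE in auto)
  qed (use FE in auto)
  have z1in: "z1 \<in> ball z1 r3" using r3 by simp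
  obtain X0 where X0: "z1 \<in> X0" "open X0"
     "\<forall>x\<in>X0 \<inter> ball z1 r3. \<forall>t\<in>sphere s1 \<eta>. dist ((\<lambda>(z, s). F s0 r z s) (x, t)) ((\<lambda>(z, s). F s0 r z s) (z1, t)) \<le> e1"
    using continuous_on_prod_compactE[OF contF compact_sphere z1in e1] by blast
  have "open (X0 \<inter> ball z1 r3)" "z1 \<in> X0 \<inter> ball z1 r3" using X0 r3 by auto
  then obtain d5 where d5: "d5 > 0" "ball z1 d5 \<subseteq> X0 \<inter> ball z1 r3" using openE by blast
  have main: "norm (F s0 r z s - A) \<le> 4 * e1" if z: "z \<in> ball z1 d5" and s: "s \<in> cball s1 \<eta>" for z s
  proof -
    have zE: "z \<in> E s0 r" using z d5 r3 by blast
    have zX: "z \<in> X" using zE E_subset by blast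
    define G where "G = (\<lambda>s. kap s0 r z s * exp (V z s1))"
    have Gh: "G holomorphic_on D" unfolding G_def by (intro holomorphic_intros kap(1)[OF zE D0])
    have dV: "norm (exp (V z t - V z s1) - 1) < e2" "norm (exp (V z s1 - V z t) - 1) < e2" if t: "t \<in> cball s1 \<eta>" for t
    proof -
      have "norm (V z t - V z s1) < \<tau>"
        using t \<eta> cbD by (intro d1(2) zX s1D) (auto simp: dist_commute)
      thus "norm (exp (V z t - V z s1) - 1) < e2" "norm (exp (V z s1 - V z t) - 1) < e2"
        using \<tau>(2) by (auto simp: norm_minus_commute)
    qed
    have circ: "norm (G t - A) \<le> 3 * e1" if t: "t \<in> sphere s1 \<eta>" for t
    proof -
      have "norm (F s0 r z1 t - A) < e1" using t \<eta> spD by (intro d2(2)) (auto simp: dist_commute)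
      moreover have "norm (F s0 r z t - F s0 r z1 t) \<le> e1"
      proof -
        have "z \<in> X0 \<inter> ball z1 r3" using z d5 by blast
        thus ?thesis using X0(3) t by (fastforce simp: dist_norm)
      qed
      ultimately have FA: "norm (F s0 r z t - A) \<le> 2 * e1"
        using norm_triangle_ineq[of "F s0 r z t - F s0 r z1 t" "F s0 r z1 t - A"] by simp
      hence "norm (F s0 r z t) \<le> norm A + 2 * e1" using norm_triangle_sub[of "F s0 r z t" A] by linarith
      moreover have "G t - F s0 r z t = F s0 r z t * (exp (V z s1 - V z t) - 1)"
        by (simp add: G_def F_def algebra_simps exp_diff)
      hence "norm (G t - F s0 r z t) \<le> norm (F s0 r z t) * e2"
        using dV(2)[of t] t by (simp add: norm_mult mult_left_mono)
      ultimately have "norm (G t - F s0 r z t) \<le> e1" using e2mult[of "norm (F s0 r z t)"] e1 by linarith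
      thus ?thesis using FA norm_triangle_ineq[of "G t - F s0 r z t" "F s0 r z t - A"] by simp
    qed
    have GA: "norm (G s - A) \<le> 3 * e1"
    proof (rule maximum_modulus_frontier[of "\<lambda>s. G s - A" "cball s1 \<eta>"])
      show "(\<lambda>s. G s - A) holomorphic_on interior (cball s1 \<eta>)"
        using cbD ball_subset_cball[of s1 \<eta>] by (intro holomorphic_intros holomorphic_on_subset[OF Gh]) auto
      show "continuous_on (closure (cball s1 \<eta>)) (\<lambda>s. G s - A)"
        using cbD by (intro continuous_intros holomorphic_on_imp_continuous_on holomorphic_on_subset[OF Gh]) auto
      fix t assume "t \<in> frontier (cball s1 \<eta>)"
      thus "norm (G t - A) \<le> 3 * e1" using circ[of t] by simp
    qed (use s in auto)
    hence "norm (G s) \<le> norm A + 3 * e1" using norm_triangle_sub[of "G s" A] by linarith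
    moreover have "F s0 r z s - G s = G s * (exp (V z s - V z s1) - 1)"
      by (simp add: G_def F_def algebra_simps exp_diff)
    hence "norm (F s0 r z s - G s) \<le> norm (G s) * e2"
      using dV(1)[OF s] by (simp add: norm_mult mult_left_mono)
    ultimately have "norm (F s0 r z s - G s) \<le> e1" using e2mult[of "norm (G s)"] by linarith
    thus ?thesis using GA norm_triangle_ineq[of "F s0 r z s - G s" "G s - A"] by simp
  qed
  show "\<exists>d>0. \<forall>x'\<in>E s0 r \<times> ball s0 r. dist x' zs < d \<longrightarrow> dist (case x' of (z, s) \<Rightarrow> F s0 r z s) (case zs of (z, s) \<Rightarrow> F s0 r z s) < e"
  proof (intro exI[of _ "min d5 \<eta>"] conjI ballI impI)
    fix x' assume x': "x' \<in> E s0 r \<times> ball s0 r" "dist x' zs < min d5 \<eta>"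
    obtain z s where [simp]: "x' = (z, s)" by (cases x')
    have "dist z z1 \<le> dist x' zs" "dist s s1 \<le> dist x' zs"
      using dist_fst_le[of x' zs] dist_snd_le[of x' zs] by (auto simp: zs)
    hence "norm (F s0 r z s - A) \<le> 4 * e1" using x'(2) by (intro main) (auto simp: dist_commute)
    thus "dist (case x' of (z, s) \<Rightarrow> F s0 r z s) (case zs of (z, s) \<Rightarrow> F s0 r z s) < e"
      using e by (simp add: zs A_def dist_norm e1_def)
  qed (use d5 \<eta> in auto)
qed

text \<open>Near a parameter the zeros in a disc are distributed over small discs around the original zeros.\<close>
lemma P_split:
  assumes z1: "z1 \<in> E s0 r" and D0: "cball s0 r \<subseteq> D" "r > 0"
  obtains \<rho> e where "\<rho> > 0" "e > 0" "\<And>b. b \<in> Z s0 r z1 ==> cball b \<rho> \<subseteq> D" "\<And>b. b \<in> Z s0 r z1 ==> z1 \<in> E b \<rho>"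
    "\<And>b. b \<in> Z s0 r z1 ==> Z b \<rho> z1 = {b}"
    "\<And>z Q. z \<in> ball z1 e ==> P Q s0 r z = (\<Sum>b\<in>Z s0 r z1. P Q b \<rho> z)"
proof -
  define B where "B = Z s0 r z1"
  have fin: "finite B" unfolding B_def by (rule finite_Z[OF assms])
  have Bsub: "B \<subseteq> ball s0 r" by (auto simp: B_def Z_def)
  have z1X: "z1 \<in> X" using z1 E_subset by blast
  have "\<forall>b\<in>B. \<exists>\<rho>>0. ball b \<rho> \<subseteq> ball s0 r - (B - {b})"
  proof
    fix b assume "b \<in> B"
    hence "b \<in> ball s0 r - (B - {b})" using Bsub by blast
    moreover have "open (ball s0 r - (B - {b}))" using fin by (intro open_Diff finite_imp_closed) auto
    ultimately show "\<exists>\<rho>>0. ball b \<rho> \<subseteq> ball s0 r - (B - {b})" using openE by blast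
  qed
  then obtain \<rho>0 where \<rho>0: "\<And>b. b \<in> B ==> \<rho>0 b > 0" "\<And>b. b \<in> B ==> ball b (\<rho>0 b) \<subseteq> ball s0 r - (B - {b})" by metis
  define \<rho> where "\<rho> = Min (insert 1 (\<rho>0 ` B)) / 3"
  have \<rho>: "\<rho> > 0" using fin \<rho>0(1) by (auto simp: \<rho>_def)
  have \<rho>le: "3 * \<rho> \<le> \<rho>0 b" if "b \<in> B" for b using fin that by (auto simp: \<rho>_def)
  have cb: "cball b \<rho> \<subseteq> ball s0 r - (B - {b})" if "b \<in> B" for b
  proof -
    have "cball b \<rho> \<subseteq> ball b (\<rho>0 b)" using \<rho>le[OF that] \<rho> by auto
    thus ?thesis using \<rho>0(2)[OF that] by blast
  qed
  have sep: "dist b b' \<ge> 3 * \<rho>" if "b \<in> B" "b' \<in> B" "b \<noteq> b'" for b b'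
  proof (rule ccontr)
    assume "\<not> 3 * \<rho> \<le> dist b b'"
    hence "b' \<in> ball b (\<rho>0 b)" using \<rho>le[OF that(1)] by simp
    thus False using \<rho>0(2)[OF that(1)] that by blast
  qed
  have disj: "ball b \<rho> \<inter> ball b' \<rho> = {}" if "b \<in> B" "b' \<in> B" "b \<noteq> b'" for b b'
  proof (rule ccontr)
    assume "ball b \<rho> \<inter> ball b' \<rho> \<noteq> {}"
    then obtain x where "dist b x < \<rho>" "dist b' x < \<rho>" by auto
    hence "dist b b' < 2 * \<rho>" using dist_triangle2[of b b' x] by simp
    thus False using sep[OF that] \<rho> by simp
  qed
  define K where "K = cball s0 r - (\<Union>b\<in>B. ball b \<rho>)"
  have K: "compact K" "K \<subseteq> D" unfolding K_def using D0 by (auto intro!: compact_diff open_UN)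
  have nzK: "f z1 s \<noteq> 0" if s: "s \<in> K" for s
  proof
    assume 0: "f z1 s = 0"
    hence "s \<notin> sphere s0 r" using z1 by (auto simp: E_def)
    hence "s \<in> B" using s 0 by (auto simp: K_def B_def Z_def less_le)
    thus False using s \<rho> by (auto simp: K_def)
  qed
  obtain e where e: "e > 0" "ball z1 e \<subseteq> X" "\<And>z s. z \<in> ball z1 e ==> s \<in> K ==> f z s \<noteq> 0"
    using nonzero_nhd[OF K z1X nzK] by blast
  have Zeq: "Z s0 r z = (\<Union>b\<in>B. Z b \<rho> z)" if z: "z \<in> ball z1 e" for z
  proof
    show "Z s0 r z \<subseteq> (\<Union>b\<in>B. Z b \<rho> z)"
    proof
      fix s assume s: "s \<in> Z s0 r z"
      hence "s \<notin> K" using e(3)[OF z] by (auto simp: Z_def)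
      thus "s \<in> (\<Union>b\<in>B. Z b \<rho> z)" using s by (auto simp: K_def Z_def)
    qed
    show "(\<Union>b\<in>B. Z b \<rho> z) \<subseteq> Z s0 r z"
      using cb ball_subset_cball by (fastforce simp: Z_def)
  qed
  obtain e' where e': "e' > 0" "ball z1 e' \<subseteq> E s0 r" using E_nhd[OF z1 D0(1)] .
  show ?thesis
  proof (rule that[of \<rho> "min e e'"])
    show "\<rho> > 0" "min e e' > 0" using \<rho> e e' by auto
    fix b assume b: "b \<in> Z s0 r z1"
    hence bB: "b \<in> B" by (simp add: B_def)
    show "cball b \<rho> \<subseteq> D" using cb[OF bB] D0 by fastforce
    have zero: "s = b" if "s \<in> cball b \<rho>" "f z1 s = 0" for s
    proof -
      have "s \<in> ball s0 r - (B - {b})" using cb[OF bB] that by blast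
      thus ?thesis using that by (auto simp: B_def Z_def)
    qed
    show "z1 \<in> E b \<rho>" using zero z1X \<rho> by (fastforce simp: E_def)
    show "Z b \<rho> z1 = {b}" using zero b \<rho> by (auto simp: Z_def)
  next
    fix z Q assume z: "z \<in> ball z1 (min e e')"
    hence ze: "z \<in> ball z1 e" and zE: "z \<in> E s0 r" using e' by auto
    have finZ: "finite (Z s0 r z)" by (rule finite_Z[OF zE D0])
    have "P Q s0 r z = (\<Sum>b\<in>(\<Union>b\<in>B. Z b \<rho> z). Q b * of_int (zorder (k z) b))"
      by (simp add: P_def Zeq[OF ze])
    also have "\<dots> = (\<Sum>b\<in>B. P Q b \<rho> z)"
      unfolding P_def
    proof (rule sum.UNION_disjoint[OF fin])
      show "\<forall>i\<in>B. finite (Z i \<rho> z)" using finZ Zeq[OF ze] by (metis UN_upper finite_subset)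
      show "\<forall>i\<in>B. \<forall>j\<in>B. i \<noteq> j \<longrightarrow> Z i \<rho> z \<inter> Z j \<rho> z = {}" using disj by (fastforce simp: Z_def)
    qed
    finally show "P Q s0 r z = (\<Sum>b\<in>Z s0 r z1. P Q b \<rho> z)" by (simp add: B_def)
  qed
qed

end

section \<open>Zeros along a family of lines: holomorphy in the parameter\<close>

text \<open>Now the parameter is a complex coordinate, and \<open>U s\<close> is the logarithm that belongs to the line in this
  second direction.\<close>
locale cross_line_family = line_family X D f V C \<alpha> M
  for X :: "complex set" and D f V C \<alpha> M +
  fixes U :: "complex \<Rightarrow> complex \<Rightarrow> complex"
  assumes contU: "\<And>s. s \<in> D ==> continuous_on X (U s)"
    and holU: "\<And>s. s \<in> D ==> (\<lambda>z. exp (- U s z) * f z s) holomorphic_on X"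
begin

text \<open>If all zeros coincide, evaluate at the fixed value \<open>s1\<close> of the zero at \<open>z0\<close>. The holomorphic function
  \<open>exp (- U s1) * f\<close> is, up to a zero-free continuous factor, the \<open>n\<close>-th power of \<open>s1 - c\<close>. So a
  continuous \<open>n\<close>-th root exists and is holomorphic. The continuous factor has a value but perhaps no
  derivative at \<open>z0\<close>; this is enough because the root vanishes there.\<close>
lemma single_zero_differentiable:
  assumes D0: "cball s0 r \<subseteq> D" "r > 0" and e: "e > 0" "ball z0 e \<subseteq> E s0 r" and n: "n > 0"
    and c: "continuous_on (ball z0 e) c" "\<And>z. z \<in> ball z0 e ==> W s0 r z = [:- c z, 1:] ^ n"
    and cz0: "c z0 \<in> ball s0 r"
  shows "c field_differentiable at z0"
proof -
  define s1 where "s1 = c z0"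
  have s1: "s1 \<in> ball s0 r" "s1 \<in> D" using cz0 D0 by (auto simp: s1_def)
  have BX: "ball z0 e \<subseteq> X" using e E_subset by blast
  define h where "h = (\<lambda>z. exp (- U s1 z) * f z s1)"
  have h: "h holomorphic_on ball z0 e" unfolding h_def using holU[OF s1(2)] BX holomorphic_on_subset by blast
  have "continuous_on (ball z0 e) (\<lambda>z. (\<lambda>(z, s). F s0 r z s) (z, s1))"
    by (rule continuous_on_compose2[OF F_continuous[OF D0]]) (use s1 e in \<open>auto intro!: continuous_intros\<close>)
  hence cF: "continuous_on (ball z0 e) (\<lambda>z. exp (- U s1 z) * F s0 r z s1)"
    by (intro continuous_intros continuous_on_subset[OF contU[OF s1(2)] BX]) auto
  have F0: "exp (- U s1 z) * F s0 r z s1 \<noteq> 0" if "z \<in> ball z0 e" for z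
    using F_props(2)[OF _ D0, of z s1] that e s1 by auto
  obtain L where L: "continuous_on (ball z0 e) L" "\<And>z. z \<in> ball z0 e ==> exp (- U s1 z) * F s0 r z s1 = exp (L z)"
    using continuous_logarithm_on_ball[OF cF F0] by blast
  define \<rho> where "\<rho> = (\<lambda>z. (s1 - c z) * exp (L z / of_nat n))"
  have "\<rho> holomorphic_on ball z0 e"
  proof (rule continuous_root_holomorphic[OF h open_ball connected_ball _ _ n])
    show "continuous_on (ball z0 e) \<rho>" unfolding \<rho>_def using n by (intro continuous_intros c L) auto
    fix z assume z: "z \<in> ball z0 e"
    have "exp (L z / of_nat n) ^ n = exp (L z)" using n by (simp add: exp_of_nat_mult[symmetric])
    moreover have "f z s1 = (s1 - c z) ^ n * F s0 r z s1"
      using F_props(1)[OF _ D0 s1(2), of z] z e c(2)[OF z] by (auto simp: poly_power)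
    ultimately show "h z = \<rho> z ^ n" using L(2)[OF z] unfolding h_def \<rho>_def power_mult_distrib
      by (simp add: mult.left_commute[of "exp (- U s1 z)"])
  qed
  hence "\<rho> field_differentiable at z0" using e by (simp add: holomorphic_on_imp_differentiable_at)
  then obtain \<rho>' where \<rho>': "((\<lambda>z. (\<rho> z - \<rho> z0) / (z - z0)) \<longlongrightarrow> \<rho>') (at z0)"
    by (auto simp: field_differentiable_def has_field_derivative_iff)
  have \<rho>0: "\<rho> z0 = 0" by (simp add: \<rho>_def s1_def)
  have cL: "((\<lambda>z. exp (- L z / of_nat n)) \<longlongrightarrow> exp (- L z0 / of_nat n)) (at z0)"
  proof -
    have "continuous_on (ball z0 e) (\<lambda>z. exp (- L z / of_nat n))" using n by (intro continuous_intros L) auto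
    thus ?thesis using e by (simp add: continuous_on_eq_continuous_at isCont_def)
  qed
  have "((\<lambda>z. - ((\<rho> z - \<rho> z0) / (z - z0)) * exp (- L z / of_nat n)) \<longlongrightarrow> - \<rho>' * exp (- L z0 / of_nat n)) (at z0)"
    by (intro tendsto_intros \<rho>' cL)
  moreover have "- ((\<rho> z - \<rho> z0) / (z - z0)) * exp (- L z / of_nat n) = (c z - c z0) / (z - z0)" for z
  proof -
    have "exp (L z / of_nat n) * exp (- L z / of_nat n) = 1" by (simp add: exp_add[symmetric])
    hence eq: "\<rho> z * exp (- L z / of_nat n) = s1 - c z" unfolding \<rho>_def by (simp only: mult.assoc mult_1_right)
    have "- ((\<rho> z - \<rho> z0) / (z - z0)) * exp (- L z / of_nat n) = - ((\<rho> z * exp (- L z / of_nat n)) / (z - z0))"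
      unfolding \<rho>0 by simp
    also have "\<dots> = (c z - c z0) / (z - z0)" unfolding eq s1_def minus_divide_left by simp
    finally show ?thesis .
  qed
  ultimately show ?thesis by (auto simp: field_differentiable_def has_field_derivative_iff)
qed

lemma P_eq_single:
  assumes "Z s0 r z = {b}" "z \<in> E s0 r" "cball s0 r \<subseteq> D" "r > 0"
  shows "P Q s0 r z = Q b * of_nat (cnt s0 r z)" "W s0 r z = [:- b, 1:] ^ cnt s0 r z"
proof -
  have "zorder (k z) b > 0" using zorder_pos[OF assms(2-4)] assms(1) by simp
  thus "P Q s0 r z = Q b * of_nat (cnt s0 r z)" using assms by (simp add: P_def cnt_def)
  show "W s0 r z = [:- b, 1:] ^ cnt s0 r z" using assms by (simp add: W_def zero_poly_def cnt_def)
qed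

text \<open>Induction on the number of zeros. Where they do not all coincide, they are distributed over smaller discs. Suppose
  that they coincide at \<open>z0\<close> but not nearby. The difference of the two sides of the equation that holds for a single zero
  is then continuous, holomorphic where it does not vanish, and not identically zero. By Rado's theorem
  its zeros are isolated, and continuity removes them.\<close>
theorem P_differentiable:
  assumes "cball s0 r \<subseteq> D" "r > 0" "z0 \<in> E s0 r" "Q holomorphic_on D"
  shows "P Q s0 r field_differentiable at z0"
  using assms
proof (induction "cnt s0 r z0" arbitrary: s0 r z0 Q rule: less_induct)
  case less
  note D0 = less.prems(1,2) and z0 = less.prems(3)
  define n where "n = cnt s0 r z0"
  obtain e where e: "e > 0" "ball z0 e \<subseteq> E s0 r" "\<And>z. z \<in> ball z0 e ==> cnt s0 r z = n"
    using cnt_locally_const[OF z0 D0] unfolding n_def by blast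
  define B where "B = ball z0 e"
  have BE: "B \<subseteq> E s0 r" and oB: "open B" and cB: "connected B" and z0B: "z0 \<in> B" using e by (auto simp: B_def)
  have cntB: "cnt s0 r z = n" if "z \<in> B" for z using e(3) that by (simp add: B_def)
  have cnt_ge: "card (Z s0 r z) \<le> cnt s0 r z" if "z \<in> B" for z
  proof -
    have zE: "z \<in> E s0 r" using that BE by blast
    have "nat (zorder (k z) b) \<ge> 1" if "b \<in> Z s0 r z" for b using zorder_pos[OF zE D0 that] by simp
    hence "(\<Sum>b\<in>Z s0 r z. 1) \<le> cnt s0 r z" unfolding cnt_def by (intro sum_mono) auto
    thus ?thesis by simp
  qed
  have Pcont: "continuous_on B (P Q s0 r)" if "Q holomorphic_on D" for Q
    using P_continuous[OF D0 that] BE continuous_on_subset by blast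
  show ?case
  proof (cases "n = 0")
    case True
    have "P Q s0 r z = 0" if "z \<in> B" for z
    proof -
      have "card (Z s0 r z) = 0" using cnt_ge[OF that] cntB[OF that] True by simp
      moreover have "finite (Z s0 r z)" using finite_Z[OF _ D0] that BE by blast
      ultimately have "Z s0 r z = {}" by simp
      thus ?thesis unfolding P_def by simp
    qed
    hence "P Q s0 r holomorphic_on B" by (intro holomorphic_transform[OF holomorphic_on_const[of 0 B]]) simp
    thus ?thesis using oB z0B by (simp add: holomorphic_on_imp_differentiable_at)
  next
    case False
    hence n: "n > 0" by simp
    \<comment> \<open>Points with several zeros reduce to discs with fewer zeros.\<close>
    have several: "P Q s0 r field_differentiable at z1" if z1: "z1 \<in> B" and card: "card (Z s0 r z1) \<noteq> 1" and Q: "Q holomorphic_on D" for z1 Q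
    proof -
      have z1E: "z1 \<in> E s0 r" using z1 BE by blast
      obtain \<rho> e1 where \<rho>: "\<rho> > 0" "e1 > 0" "\<And>b. b \<in> Z s0 r z1 ==> cball b \<rho> \<subseteq> D" "\<And>b. b \<in> Z s0 r z1 ==> z1 \<in> E b \<rho>"
        "\<And>b. b \<in> Z s0 r z1 ==> Z b \<rho> z1 = {b}"
        "\<And>z Q. z \<in> ball z1 e1 ==> P Q s0 r z = (\<Sum>b\<in>Z s0 r z1. P Q b \<rho> z)"
        using P_split[OF z1E D0] by blast
      have fin: "finite (Z s0 r z1)" by (rule finite_Z[OF z1E D0])
      have "P Q b \<rho> field_differentiable at z1" if b: "b \<in> Z s0 r z1" for b
      proof (rule less.hyps)
        have "Z s0 r z1 \<noteq> {b}" using card by auto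
        then obtain b' where b': "b' \<in> Z s0 r z1" "b' \<noteq> b" using b by blast
        have "cnt b \<rho> z1 = nat (zorder (k z1) b)" unfolding cnt_def \<rho>(5)[OF b] by simp
        also have "\<dots> < nat (zorder (k z1) b) + nat (zorder (k z1) b')"
          using zorder_pos[OF z1E D0 b'(1)] by simp
        also have "\<dots> = (\<Sum>x\<in>{b, b'}. nat (zorder (k z1) x))" using b' by simp
        also have "\<dots> \<le> cnt s0 r z1" unfolding cnt_def using fin b b' by (intro sum_mono2) auto
        also have "\<dots> = cnt s0 r z0" using cntB[OF z1] by (simp add: n_def)
        finally show "cnt b \<rho> z1 < cnt s0 r z0" .
      qed (use \<rho> b Q in auto)
      hence "(\<lambda>z. \<Sum>b\<in>Z s0 r z1. P Q b \<rho> z) field_differentiable at z1"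
        by (intro field_differentiable_sum) auto
      thus ?thesis
      proof (rule field_differentiable_transform_within[of e1 z1 UNIV "\<lambda>z. \<Sum>b\<in>Z s0 r z1. P Q b \<rho> z", rotated 3])
        fix z assume "dist z z1 < e1"
        hence "z \<in> ball z1 e1" by (simp add: dist_commute)
        thus "(\<Sum>b\<in>Z s0 r z1. P Q b \<rho> z) = P Q s0 r z" by (rule \<rho>(6)[symmetric])
      qed (use \<rho>(2) in auto)
    qed
    define c where "c = (\<lambda>z. P (\<lambda>s. s) s0 r z / of_nat n)"
    have ccont: "continuous_on B c" unfolding c_def using n by (intro continuous_intros Pcont) auto
    show ?thesis
    proof (cases "\<forall>z\<in>B. card (Z s0 r z) = 1")
      case True
      have single: "Z s0 r z = {c z} \<and> W s0 r z = [:- c z, 1:] ^ n \<and> (\<forall>Q. P Q s0 r z = Q (c z) * of_nat n)" if z: "z \<in> B" for z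
      proof -
        obtain b where b: "Z s0 r z = {b}" using True z card_1_singletonE by blast
        note PW = P_eq_single[OF b _ D0]
        have zE: "z \<in> E s0 r" using z BE by blast
        have "c z = b" using PW(1)[OF zE, of "\<lambda>s. s"] cntB[OF z] n by (simp add: c_def)
        thus ?thesis using PW[OF zE] b cntB[OF z] by simp
      qed
      have cz0: "c z0 \<in> ball s0 r" using single[OF z0B] by (auto simp: Z_def)
      have "c field_differentiable at z0"
      proof (rule single_zero_differentiable[of s0 r e z0 n c])
        show "continuous_on (ball z0 e) c" using ccont by (simp add: B_def)
        show "W s0 r z = [:- c z, 1:] ^ n" if "z \<in> ball z0 e" for z using single that by (simp add: B_def)
      qed (use D0 e(1,2) n cz0 in auto)
      moreover have "Q field_differentiable at (c z0)"
        by (rule holomorphic_on_imp_differentiable_at[OF less.prems(4) D(1)]) (use cz0 D0 in auto)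
      ultimately have "(\<lambda>z. Q (c z) * of_nat n) field_differentiable at z0"
        using field_differentiable_mult[OF field_differentiable_compose[of c z0 Q] field_differentiable_const[of "of_nat n"]]
        by (simp add: o_def)
      thus ?thesis
      proof (rule field_differentiable_transform_within[of e z0 UNIV "\<lambda>z. Q (c z) * of_nat n", rotated 3])
        fix z assume "dist z z0 < e"
        hence "z \<in> B" by (simp add: B_def dist_commute)
        thus "Q (c z) * of_nat n = P Q s0 r z" using single by metis
      qed (use e in auto)
    next
      case False
      then obtain z2 where z2: "z2 \<in> B" "card (Z s0 r z2) \<noteq> 1" by blast
      have z2E: "z2 \<in> E s0 r" using z2 BE by blast
      have "\<not> Z s0 r z2 \<subseteq> {c z2}"
      proof
        assume "Z s0 r z2 \<subseteq> {c z2}"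
        hence "Z s0 r z2 = {}" using z2(2) by (auto simp: subset_singleton_iff)
        hence "cnt s0 r z2 = 0" by (simp add: cnt_def)
        thus False using cntB[OF z2(1)] n by simp
      qed
      then obtain b where b: "b \<in> Z s0 r z2" "b \<noteq> c z2" by blast
      \<comment> \<open>q vanishes wherever all zeros coincide, but not at z2.\<close>
      define q where "q = (\<lambda>z. poly (W s0 r z) b - (b - c z) ^ n)"
      have qz2: "q z2 \<noteq> 0"
      proof -
        have "zorder (k z2) b > 0" by (rule zorder_pos[OF z2E D0 b(1)])
        hence "poly (W s0 r z2) b = 0" unfolding poly_W using finite_Z[OF z2E D0] b(1) by (auto simp: prod_zero_iff)
        thus ?thesis using b(2) n by (simp add: q_def)
      qed
      have q0: "q z = 0" if z: "z \<in> B" and card: "card (Z s0 r z) = 1" for z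
      proof -
        obtain b' where b': "Z s0 r z = {b'}" using card card_1_singletonE by blast
        have zE: "z \<in> E s0 r" using z BE by blast
        have "c z = b'" using P_eq_single(1)[OF b' zE D0, of "\<lambda>s. s"] cntB[OF z] n by (simp add: c_def)
        thus ?thesis using P_eq_single(2)[OF b' zE D0] cntB[OF z] by (simp add: q_def poly_power)
      qed
      have polyW: "poly (W s0 r z) b = (\<Sum>i\<le>n. coeff (W s0 r z) i * b ^ i)" if "z \<in> B" for z
      proof -
        have "z \<in> E s0 r" using BE that by blast
        hence "degree (W s0 r z) = n" using degree_W[OF _ D0] cntB[OF that] by simp
        thus ?thesis by (simp add: poly_altdef)
      qed
      have qcont: "continuous_on B q"
      proof -
        have "continuous_on B (\<lambda>z. coeff (W s0 r z) i)" for i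
        proof (rule coeff_W_regular[where R = "continuous_on B", OF BE D0 cntB])
          show "continuous_on B v" if "continuous_on B u" "\<And>z. z \<in> B ==> u z = v z" for u v
            using continuous_on_eq[OF that] .
        qed (auto intro: continuous_intros Pcont)
        hence "continuous_on B (\<lambda>z. (\<Sum>i\<le>n. coeff (W s0 r z) i * b ^ i) - (b - c z) ^ n)"
          by (intro continuous_intros ccont)
        thus ?thesis by (rule continuous_on_eq) (simp add: q_def polyW)
      qed
      define A where "A = {z\<in>B. q z \<noteq> 0}"
      have PA: "P Q s0 r holomorphic_on A" if "Q holomorphic_on D" for Q
        unfolding holomorphic_on_def
      proof
        fix z assume "z \<in> A"
        hence "P Q s0 r field_differentiable at z" using several[OF _ _ that, of z] q0 by (auto simp: A_def)
        thus "P Q s0 r field_differentiable at z within A" by (rule field_differentiable_at_within)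
      qed
      have AE: "A \<subseteq> E s0 r" using BE by (auto simp: A_def)
      have cntA: "cnt s0 r z = n" if "z \<in> A" for z using cntB that by (simp add: A_def)
      have qA: "q holomorphic_on A"
      proof -
        have "(\<lambda>z. coeff (W s0 r z) i) holomorphic_on A" for i
        proof (rule coeff_W_regular[where R = "\<lambda>u. u holomorphic_on A", OF AE D0 cntA])
          show "v holomorphic_on A" if "u holomorphic_on A" "\<And>z. z \<in> A ==> u z = v z" for u v
            using holomorphic_transform[OF that] .
        qed (auto intro!: holomorphic_intros PA)
        hence "(\<lambda>z. (\<Sum>i\<le>n. coeff (W s0 r z) i * b ^ i) - (b - c z) ^ n) holomorphic_on A"
          unfolding c_def using n by (intro holomorphic_intros PA) auto
        thus ?thesis by (rule holomorphic_transform) (simp add: q_def polyW A_def)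
      qed
      have qB: "q holomorphic_on B" by (rule Rado[OF qcont oB qA[unfolded A_def]])
      have "P Q s0 r holomorphic_on B"
        by (rule holomorphic_across_zero_set[OF Pcont _ oB cB qB z2(1) qz2])
           (use less.prems(4) PA[unfolded A_def] in auto)
      thus ?thesis using oB z0B by (simp add: holomorphic_on_imp_differentiable_at)
    qed
  qed
qed

lemma W_holomorphic:
  assumes z0: "z0 \<in> E s0 r" and D0: "cball s0 r \<subseteq> D" "r > 0"
  obtains e where "e > 0" "ball z0 e \<subseteq> E s0 r" "\<And>s. (\<lambda>z. poly (W s0 r z) s) holomorphic_on ball z0 e"
proof -
  obtain e where e: "e > 0" "ball z0 e \<subseteq> E s0 r" "\<And>z. z \<in> ball z0 e ==> cnt s0 r z = cnt s0 r z0"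
    using cnt_locally_const[OF z0 D0] by blast
  have "(\<lambda>z. coeff (W s0 r z) i) holomorphic_on ball z0 e" for i
  proof (rule coeff_W_regular[where R = "\<lambda>u. u holomorphic_on ball z0 e", OF e(2) D0 e(3)])
    show "v holomorphic_on ball z0 e" if "u holomorphic_on ball z0 e" "\<And>z. z \<in> ball z0 e ==> u z = v z" for u v
      using holomorphic_transform[OF that] .
    show "P Q s0 r holomorphic_on ball z0 e" if "Q holomorphic_on D" for Q
      unfolding holomorphic_on_def
    proof
      fix z assume "z \<in> ball z0 e"
      hence "P Q s0 r field_differentiable at z" using P_differentiable[OF D0 _ that] e(2) by blast
      thus "P Q s0 r field_differentiable at z within ball z0 e" by (rule field_differentiable_at_within)
    qed
  qed (auto intro!: holomorphic_intros)
  hence *: "(\<lambda>z. \<Sum>i\<le>cnt s0 r z0. coeff (W s0 r z) i * s ^ i) holomorphic_on ball z0 e" for s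
    by (intro holomorphic_intros)
  have "(\<lambda>z. poly (W s0 r z) s) holomorphic_on ball z0 e" for s
  proof (rule holomorphic_transform[OF *[of s]])
    fix z assume z: "z \<in> ball z0 e"
    have "z \<in> E s0 r" using e(2) z by blast
    hence "degree (W s0 r z) = cnt s0 r z0" using degree_W[OF _ D0] e(3)[OF z] by simp
    thus "(\<Sum>i\<le>cnt s0 r z0. coeff (W s0 r z) i * s ^ i) = poly (W s0 r z) s" by (simp add: poly_altdef)
  qed
  thus ?thesis using that e(1,2) by blast
qed

end

section \<open>Smooth test functions and convolution in the plane\<close>

lemma Ck_funI:
  assumes "\<And>z. (\<phi> has_derivative (\<lambda>v. D v z)) (at z)" "\<And>v. Ck_fun k (D v)"
  shows "Ck_fun (Suc k) \<phi>"
proof -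
  have "frechet_derivative \<phi> (at z) = (\<lambda>v. D v z)" for z
    using frechet_derivative_at[OF assms(1)] by simp
  hence "(\<lambda>z. frechet_derivative \<phi> (at z) v) = D v" for v by (simp add: fun_eq_iff)
  thus ?thesis using assms unfolding Ck_fun.simps differentiable_def by metis
qed

lemma Ck_fun_has_derivative:
  "Ck_fun (Suc k) \<phi> ==> (\<phi> has_derivative frechet_derivative \<phi> (at z)) (at z)"
  by (simp add: frechet_derivative_works)

lemma Ck_fun_continuous: "Ck_fun k \<phi> ==> continuous_on UNIV \<phi>"
proof (cases k)
  case (Suc j)
  assume "Ck_fun k \<phi>"
  hence "\<phi> differentiable at z" for z using Suc by simp
  thus ?thesis by (meson continuous_at_imp_continuous_on differentiable_imp_continuous_within)
qed simp

lemma Ck_fun_mono: "Ck_fun (Suc k) \<phi> ==> Ck_fun k \<phi>"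
proof (induction k arbitrary: \<phi>)
  case 0
  thus ?case using Ck_fun_continuous[of "Suc 0"] by simp
next
  case (Suc k)
  have "Ck_fun (Suc k) (\<lambda>z. frechet_derivative \<phi> (at z) v)" for v using Suc.prems by simp
  thus ?case using Suc by simp
qed

lemma Ck_fun_const: "Ck_fun k (\<lambda>z. c)"
  by (induction k arbitrary: c) (simp, rule Ck_funI[where D = "\<lambda>v z. 0"], auto intro!: derivative_eq_intros)

lemma Ck_fun_linear: assumes "bounded_linear L" shows "Ck_fun k L"
proof (cases k)
  case 0 thus ?thesis using assms by (simp add: linear_continuous_on)
next
  case (Suc j)
  have "Ck_fun (Suc j) L"
    by (rule Ck_funI[where D = "\<lambda>v z. L v"]) (use assms in \<open>auto intro: bounded_linear_imp_has_derivative Ck_fun_const\<close>)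
  thus ?thesis using Suc by simp
qed

lemma Ck_fun_add: "Ck_fun k \<phi> ==> Ck_fun k \<psi> ==> Ck_fun k (\<lambda>z. \<phi> z + \<psi> z)"
proof (induction k arbitrary: \<phi> \<psi>)
  case 0 thus ?case by (auto intro: continuous_intros)
next
  case (Suc k)
  show ?case
    by (rule Ck_funI[where D = "\<lambda>v z. frechet_derivative \<phi> (at z) v + frechet_derivative \<psi> (at z) v"])
       (use Suc Ck_fun_has_derivative in \<open>auto intro!: has_derivative_add\<close>)
qed

lemma Ck_fun_mult: "Ck_fun k \<phi> ==> Ck_fun k \<psi> ==> Ck_fun k (\<lambda>z. \<phi> z * \<psi> z)"
proof (induction k arbitrary: \<phi> \<psi>)
  case 0 thus ?case by (auto intro: continuous_intros)
next
  case (Suc k)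
  show ?case
  proof (rule Ck_funI[where D = "\<lambda>v z. \<phi> z * frechet_derivative \<psi> (at z) v + frechet_derivative \<phi> (at z) v * \<psi> z"])
    show "((\<lambda>z. \<phi> z * \<psi> z) has_derivative (\<lambda>v. \<phi> z * frechet_derivative \<psi> (at z) v + frechet_derivative \<phi> (at z) v * \<psi> z)) (at z)" for z
      by (intro has_derivative_mult Ck_fun_has_derivative[OF Suc.prems(1)] Ck_fun_has_derivative[OF Suc.prems(2)])
    show "Ck_fun k (\<lambda>z. \<phi> z * frechet_derivative \<psi> (at z) v + frechet_derivative \<phi> (at z) v * \<psi> z)" for v
      using Suc by (intro Ck_fun_add Suc.IH) (auto intro: Ck_fun_mono)
  qed
qed

lemma Ck_fun_uminus: "Ck_fun k \<phi> ==> Ck_fun k (\<lambda>z. - \<phi> z)"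
  using Ck_fun_mult[OF Ck_fun_const[of k "-1"], of \<phi>] by simp

lemma Ck_fun_inverse: "Ck_fun k \<phi> ==> (\<And>z. \<phi> z \<noteq> 0) ==> Ck_fun k (\<lambda>z. inverse (\<phi> z))"
proof (induction k arbitrary: \<phi>)
  case 0 thus ?case by (auto intro: continuous_intros)
next
  case (Suc k)
  show ?case
  proof (rule Ck_funI[where D = "\<lambda>v z. - (inverse (\<phi> z) * frechet_derivative \<phi> (at z) v * inverse (\<phi> z))"])
    show "((\<lambda>z. inverse (\<phi> z)) has_derivative (\<lambda>v. - (inverse (\<phi> z) * frechet_derivative \<phi> (at z) v * inverse (\<phi> z)))) (at z)" for z
      using Deriv.has_derivative_inverse[OF Suc.prems(2) Ck_fun_has_derivative[OF Suc.prems(1)]] .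
    show "Ck_fun k (\<lambda>z. - (inverse (\<phi> z) * frechet_derivative \<phi> (at z) v * inverse (\<phi> z)))" for v
      using Suc by (intro Ck_fun_uminus Ck_fun_mult Suc.IH) (auto intro: Ck_fun_mono)
  qed
qed

lemma Ck_fun_exp: "Ck_fun k \<phi> ==> Ck_fun k (\<lambda>z. exp (\<phi> z))"
proof (induction k arbitrary: \<phi>)
  case 0 thus ?case by (auto intro: continuous_intros)
next
  case (Suc k)
  show ?case
  proof (rule Ck_funI[where D = "\<lambda>v z. frechet_derivative \<phi> (at z) v * exp (\<phi> z)"])
    show "((\<lambda>z. exp (\<phi> z)) has_derivative (\<lambda>v. frechet_derivative \<phi> (at z) v * exp (\<phi> z))) (at z)" for z
      using has_derivative_compose[OF Ck_fun_has_derivative[OF Suc.prems], of exp "\<lambda>h. exp (\<phi> z) * h" z]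
        DERIV_exp[of "\<phi> z"] by (simp add: has_field_derivative_def mult.commute[of _ "exp (\<phi> z)"])
    show "Ck_fun k (\<lambda>z. frechet_derivative \<phi> (at z) v * exp (\<phi> z))" for v
      using Suc by (intro Ck_fun_mult Suc.IH) (auto intro: Ck_fun_mono)
  qed
qed

text \<open>The factors \<open>inverse x ^ m\<close> make the class closed under differentiation.\<close>
definition flat :: "nat \<Rightarrow> real \<Rightarrow> real" where
  "flat m x = (if x > 0 then exp (- inverse x) * inverse x ^ m else 0)"

lemma flat_bound: "\<bar>flat m x\<bar> \<le> fact (m + 2) * x\<^sup>2"
proof (cases "x > 0")
  case True
  define y where "y = inverse x"
  have y: "y > 0" using True by (simp add: y_def)
  have "y ^ (m + 2) / fact (m + 2) \<le> exp y"
  proof -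
    have s: "(\<lambda>n. y ^ n /\<^sub>R fact n) sums exp y" by (rule exp_converges)
    have "(\<Sum>n\<in>{m+2}. y ^ n /\<^sub>R fact n) \<le> (\<Sum>n. y ^ n /\<^sub>R fact n)"
      by (rule sum_le_suminf) (use s y in \<open>auto simp: sums_iff\<close>)
    thus ?thesis using s by (simp add: sums_iff divide_inverse mult.commute)
  qed
  hence "y ^ (m + 2) \<le> exp y * fact (m + 2)" by (simp only: pos_divide_le_eq[OF fact_gt_zero])
  hence "exp (-y) * y ^ (m + 2) \<le> exp (-y) * (exp y * fact (m + 2))" by (intro mult_left_mono) auto
  also have "\<dots> = fact (m + 2)" by (simp only: mult.assoc[symmetric] exp_add[symmetric]) simp
  finally have "exp (-y) * y ^ (m + 2) \<le> fact (m + 2)" .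
  moreover have "flat m x = exp (-y) * y ^ (m + 2) * x\<^sup>2"
    using True by (simp add: flat_def y_def power_add power2_eq_square field_simps)
  ultimately show ?thesis using y True by (simp add: abs_mult mult_right_mono)
qed (simp add: flat_def)

lemma flat_deriv: "(flat m has_real_derivative (flat (m + 2) x - real m * flat (m + 1) x)) (at x)"
proof -
  consider "x > 0" | "x < 0" | "x = 0" by linarith
  thus ?thesis
  proof cases
    case 1
    have "((\<lambda>x. exp (- inverse x) * inverse x ^ m) has_real_derivative
       exp (- inverse x) * (inverse x * inverse x) * inverse x ^ m + exp (- inverse x) * (real m * (inverse x ^ (m - 1) * - (inverse x * inverse x)))) (at x)"
      using 1 by (auto intro!: derivative_eq_intros simp: power2_eq_square)
    also have "exp (- inverse x) * (inverse x * inverse x) * inverse x ^ m + exp (- inverse x) * (real m * (inverse x ^ (m - 1) * - (inverse x * inverse x)))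
      = flat (m + 2) x - real m * flat (m + 1) x"
      using 1 by (cases m) (auto simp: flat_def algebra_simps)
    finally show ?thesis
      by (rule has_field_derivative_transform_within_open[of _ _ _ "{0<..}"]) (use 1 in \<open>auto simp: flat_def\<close>)
  next
    case 2
    have "((\<lambda>x. 0) has_real_derivative (flat (m + 2) x - real m * flat (m + 1) x)) (at x)"
      using 2 by (auto simp: flat_def)
    thus ?thesis
      by (rule has_field_derivative_transform_within_open[of _ _ _ "{..<0}"]) (use 2 in \<open>auto simp: flat_def\<close>)
  next
    case 3
    have "((\<lambda>y. (flat m y - flat m 0) / (y - 0)) \<longlongrightarrow> 0) (at 0)"
    proof (rule Lim_null_comparison)
      show "\<forall>\<^sub>F y in at 0. norm ((flat m y - flat m 0) / (y - 0)) \<le> fact (m + 2) * \<bar>y\<bar>"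
        unfolding eventually_at
      proof (intro exI[of _ 1] conjI ballI impI)
        fix y :: real assume "y \<noteq> 0 \<and> dist y 0 < 1"
        hence y: "\<bar>y\<bar> > 0" by simp
        have "norm ((flat m y - flat m 0) / (y - 0)) = \<bar>flat m y\<bar> / \<bar>y\<bar>" by (simp add: flat_def)
        also have "\<dots> \<le> (fact (m + 2) * y\<^sup>2) / \<bar>y\<bar>" using flat_bound[of m y] y by (intro divide_right_mono) auto
        also have "\<dots> = fact (m + 2) * \<bar>y\<bar>" using y by (simp add: power2_eq_square field_simps abs_if)
        finally show "norm ((flat m y - flat m 0) / (y - 0)) \<le> fact (m + 2) * \<bar>y\<bar>" .
      qed simp
      show "((\<lambda>y. fact (m + 2) * \<bar>y\<bar>) \<longlongrightarrow> 0) (at (0::real))" by (auto intro!: tendsto_eq_intros)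
    qed
    thus ?thesis using 3 by (simp add: has_field_derivative_iff flat_def)
  qed
qed

definition bump :: "real \<Rightarrow> complex \<Rightarrow> complex" where
  "bump d z = of_real (flat 0 (d\<^sup>2 - (norm z)\<^sup>2))"

lemma Ck_fun_flat: "Ck_fun k (\<lambda>z. of_real (flat m (d\<^sup>2 - (norm z)\<^sup>2)))"
proof (induction k arbitrary: m)
  have der: "((\<lambda>z::complex. complex_of_real (flat m (d\<^sup>2 - (norm z)\<^sup>2))) has_derivative
     (\<lambda>v. of_real ((flat (m + 2) (d\<^sup>2 - (norm z)\<^sup>2) - real m * flat (m + 1) (d\<^sup>2 - (norm z)\<^sup>2)) * (- 2 * (z \<bullet> v))))) (at z)" for z m
  proof -
    have 1: "((\<lambda>z::complex. d\<^sup>2 - (norm z)\<^sup>2) has_derivative (\<lambda>v. - 2 * (z \<bullet> v))) (at z)"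
      unfolding power2_norm_eq_inner
      by (auto intro!: derivative_eq_intros simp: inner_commute)
    have 2: "(flat m has_derivative (\<lambda>h. (flat (m + 2) (d\<^sup>2 - (norm z)\<^sup>2) - real m * flat (m + 1) (d\<^sup>2 - (norm z)\<^sup>2)) * h)) (at (d\<^sup>2 - (norm z)\<^sup>2))"
      using flat_deriv[of m "d\<^sup>2 - (norm z)\<^sup>2"] by (simp add: has_field_derivative_def)
    from has_derivative_compose[OF 1 2] show ?thesis by (rule has_derivative_of_real)
  qed
  {
    case 0
    show ?case unfolding Ck_fun.simps
      by (intro continuous_at_imp_continuous_on ballI has_derivative_continuous[OF der])
  next
    case (Suc k)
    show ?case
    proof (rule Ck_funI[OF der])
      fix v :: complex
      have "bounded_linear (\<lambda>z::complex. complex_of_real (z \<bullet> v))"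
        by (intro bounded_linear_compose[OF bounded_linear_of_real] bounded_linear_inner_left)
      hence L: "Ck_fun k (\<lambda>z::complex. complex_of_real (z \<bullet> v))" by (rule Ck_fun_linear)
      have "Ck_fun k (\<lambda>z. (of_real (flat (m + 2) (d\<^sup>2 - (norm z)\<^sup>2)) + (- of_nat m) * of_real (flat (m + 1) (d\<^sup>2 - (norm z)\<^sup>2))) * ((-2) * of_real (z \<bullet> v)))"
        by (intro Ck_fun_mult Ck_fun_add Suc.IH Ck_fun_const L)
      thus "Ck_fun k (\<lambda>z. of_real ((flat (m + 2) (d\<^sup>2 - (norm z)\<^sup>2) - real m * flat (m + 1) (d\<^sup>2 - (norm z)\<^sup>2)) * (- 2 * (z \<bullet> v))))"
        by (simp add: algebra_simps)
    qed
  }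
qed

lemma Ck_fun_bump: "Ck_fun k (bump d)"
  using Ck_fun_flat[of k 0 d] unfolding bump_def[abs_def] .

lemma Ck_fun_translate: "Ck_fun k \<phi> ==> Ck_fun k (\<lambda>w. \<phi> (z - w))"
proof (induction k arbitrary: \<phi>)
  case 0
  have "continuous_on UNIV (\<lambda>w. \<phi> (z - w))"
    by (rule continuous_on_compose2[of UNIV \<phi>]) (use 0 in \<open>auto intro!: continuous_intros\<close>)
  thus ?case by simp
next
  case (Suc k)
  show ?case
  proof (rule Ck_funI[where D = "\<lambda>v w. - frechet_derivative \<phi> (at (z - w)) v"])
    fix w
    have 1: "((\<lambda>w. z - w) has_derivative (\<lambda>v. - v)) (at w)" by (auto intro!: derivative_eq_intros)
    have 2: "(\<phi> has_derivative frechet_derivative \<phi> (at (z - w))) (at (z - w))"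
      by (rule Ck_fun_has_derivative[OF Suc.prems])
    have "linear (frechet_derivative \<phi> (at (z - w)))" using 2 has_derivative_linear by blast
    hence "(\<lambda>v. frechet_derivative \<phi> (at (z - w)) (- v)) = (\<lambda>v. - frechet_derivative \<phi> (at (z - w)) v)"
      by (simp add: linear_neg)
    with has_derivative_compose[OF 1 2]
    show "((\<lambda>w. \<phi> (z - w)) has_derivative (\<lambda>v. - frechet_derivative \<phi> (at (z - w)) v)) (at w)" by simp
  next
    fix v
    have "Ck_fun k (\<lambda>z. frechet_derivative \<phi> (at z) v)" using Suc.prems by simp
    from Ck_fun_uminus[OF Suc.IH[OF this]] show "Ck_fun k (\<lambda>w. - frechet_derivative \<phi> (at (z - w)) v)" .
  qed
qed

lemma dbar_translate: assumes "Ck_fun 1 \<phi>" shows "dbar (\<lambda>w. \<phi> (z - w)) w = - dbar \<phi> (z - w)"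
proof -
  have 1: "((\<lambda>w. z - w) has_derivative (\<lambda>v. - v)) (at w)" by (auto intro!: derivative_eq_intros)
  have 2: "(\<phi> has_derivative frechet_derivative \<phi> (at (z - w))) (at (z - w))"
    by (rule Ck_fun_has_derivative[of 0]) (use assms in simp)
  have lin: "linear (frechet_derivative \<phi> (at (z - w)))" using 2 has_derivative_linear by blast
  have "frechet_derivative (\<lambda>w. \<phi> (z - w)) (at w) = (\<lambda>v. - frechet_derivative \<phi> (at (z - w)) v)"
    using frechet_derivative_at[OF has_derivative_compose[OF 1 2]] lin by (simp add: linear_neg)
  thus ?thesis by (simp add: dbar_def field_simps)
qed

lemma integrable_conv:
  fixes b \<kappa> :: "complex \<Rightarrow> complex"
  assumes b: "integrable lborel b" and supp: "\<And>w. w \<notin> cball 0 R ==> b w = 0" and \<kappa>: "continuous_on UNIV \<kappa>"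
  shows "integrable lborel (\<lambda>w. b w * \<kappa> (z - w))"
proof -
  have cK: "continuous_on UNIV (\<lambda>w. \<kappa> (z - w))"
    by (rule continuous_on_compose2[OF \<kappa>]) (auto intro!: continuous_intros)
  have "compact ((\<lambda>w. \<kappa> (z - w)) ` cball 0 R)"
    by (intro compact_continuous_image continuous_on_subset[OF cK]) auto
  then obtain B where B: "\<And>w. w \<in> cball 0 R ==> norm (\<kappa> (z - w)) \<le> B"
    by (meson compact_imp_bounded bounded_iff imageI)
  have meas: "(\<lambda>w. \<kappa> (z - w)) \<in> borel_measurable lborel"
    using borel_measurable_continuous_onI[OF cK] by simp
  show ?thesis
  proof (rule Bochner_Integration.integrable_bound[of _ "\<lambda>w. B * norm (b w)"])
    show "integrable lborel (\<lambda>w. B * norm (b w))" using b by simp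
    show "AE w in lborel. norm (b w * \<kappa> (z - w)) \<le> norm (B * norm (b w))"
    proof (rule AE_I2)
      fix w
      show "norm (b w * \<kappa> (z - w)) \<le> norm (B * norm (b w))"
      proof (cases "w \<in> cball 0 R")
        case True
        hence "norm (\<kappa> (z - w)) \<le> B" by (rule B)
        moreover have "B \<ge> 0" using \<open>norm (\<kappa> (z - w)) \<le> B\<close> norm_ge_zero order_trans by blast
        ultimately show ?thesis by (simp add: norm_mult mult.commute[of B] mult_left_mono)
      qed (use supp in simp)
    qed
  qed (use b meas in auto)
qed

definition conv :: "(complex \<Rightarrow> complex) \<Rightarrow> (complex \<Rightarrow> complex) \<Rightarrow> complex \<Rightarrow> complex" where
  "conv b \<kappa> z = (LINT w|lborel. b w * \<kappa> (z - w))"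

text \<open>Only the kernel is differentiated, so the integrable factor needs no regularity.\<close>
lemma conv_has_derivative:
  assumes b: "integrable lborel b" and supp: "\<And>w. w \<notin> cball 0 R ==> b w = 0" and \<kappa>: "Ck_fun 1 \<kappa>"
  shows "(conv b \<kappa> has_derivative (\<lambda>v. conv b (\<lambda>z. frechet_derivative \<kappa> (at z) v) z)) (at z)"
proof -
  define D where "D = (\<lambda>y. frechet_derivative \<kappa> (at y))"
  have hd: "(\<kappa> has_derivative D y) (at y)" for y
    unfolding D_def by (rule Ck_fun_has_derivative[of 0]) (use \<kappa> in simp)
  have bl: "bounded_linear (D y)" for y using hd has_derivative_bounded_linear by blast
  have cD: "continuous_on UNIV (\<lambda>y. D y v)" for v using \<kappa> by (simp add: D_def)
  have Dexp: "D y v = of_real (Re v) * D y 1 + of_real (Im v) * D y \<i>" for y v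
  proof -
    have "D y v = D y (Re v *\<^sub>R 1 + Im v *\<^sub>R \<i>)" by (rule arg_cong[of _ _ "D y"]) (simp add: complex_eq_iff)
    also have "\<dots> = of_real (Re v) * D y 1 + of_real (Im v) * D y \<i>"
    proof -
      note lin = bounded_linear.linear[OF bl]
      show ?thesis unfolding linear_add[OF lin] linear_scale[OF lin] by (simp only: scaleR_conv_of_real)
    qed
    finally show ?thesis .
  qed
  have c\<kappa>: "continuous_on UNIV \<kappa>" using Ck_fun_continuous[OF \<kappa>] .
  have int: "integrable lborel (\<lambda>w. b w * \<kappa> (z - w))" for z by (rule integrable_conv[OF b supp c\<kappa>])
  have intD: "integrable lborel (\<lambda>w. b w * D (z - w) v)" for z v by (rule integrable_conv[OF b supp cD])
  define I where "I = (LINT w|lborel. norm (b w))"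
  have I0: "I \<ge> 0" by (simp add: I_def)
  have "(conv b \<kappa> has_derivative (\<lambda>v. conv b (\<lambda>z. D z v) z)) (at z)"
    unfolding has_derivative_at_alt
  proof (intro conjI allI impI)
    have eq: "conv b (\<lambda>z. D z v) z = of_real (Re v) * conv b (\<lambda>z. D z 1) z + of_real (Im v) * conv b (\<lambda>z. D z \<i>) z" for v
    proof -
      have "conv b (\<lambda>z. D z v) z = (LINT w|lborel. of_real (Re v) * (b w * D (z - w) 1) + of_real (Im v) * (b w * D (z - w) \<i>))"
        unfolding conv_def by (rule Bochner_Integration.integral_cong) (auto simp: Dexp[of _ v] algebra_simps)
      also have "\<dots> = of_real (Re v) * conv b (\<lambda>z. D z 1) z + of_real (Im v) * conv b (\<lambda>z. D z \<i>) z"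
        unfolding conv_def using intD by (subst Bochner_Integration.integral_add) auto
      finally show ?thesis .
    qed
    have "bounded_linear (\<lambda>v. of_real (Re v) * c1 + of_real (Im v) * c2)" for c1 c2 :: complex
      by (intro bounded_linear_add bounded_linear_compose[OF bounded_linear_mult_left]
           bounded_linear_compose[OF bounded_linear_of_real] bounded_linear_Re bounded_linear_Im)
    moreover have "(\<lambda>v. conv b (\<lambda>z. D z v) z) =
        (\<lambda>v. of_real (Re v) * conv b (\<lambda>z. D z 1) z + of_real (Im v) * conv b (\<lambda>z. D z \<i>) z)"
      by (rule ext) (rule eq)
    ultimately show "bounded_linear (\<lambda>v. conv b (\<lambda>z. D z v) z)" by metis
    fix e :: real assume e: "e > 0"
    define e1 where "e1 = e / (2 * (I + 1))"
    have e1: "e1 > 0" using e I0 by (simp add: e1_def)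
    define K where "K = cball (0::complex) (norm z + R + 1)"
    have uc: "uniformly_continuous_on K (\<lambda>y. D y v)" for v
      by (intro compact_uniformly_continuous continuous_on_subset[OF cD]) (auto simp: K_def)
    obtain d1 where d1: "d1 > 0" "\<And>x y. x \<in> K ==> y \<in> K ==> dist x y < d1 ==> dist (D x 1) (D y 1) < e1"
      using uc[of 1] e1 unfolding uniformly_continuous_on_def by blast
    obtain d2 where d2: "d2 > 0" "\<And>x y. x \<in> K ==> y \<in> K ==> dist x y < d2 ==> dist (D x \<i>) (D y \<i>) < e1"
      using uc[of \<i>] e1 unfolding uniformly_continuous_on_def by blast
    define d where "d = min (min d1 d2) 1"
    have d: "d > 0" "d \<le> d1" "d \<le> d2" "d \<le> 1" using d1 d2 by (auto simp: d_def)
    have lin: "norm (\<kappa> (y + h) - \<kappa> y - D y h) \<le> norm h * (2 * e1)" if y: "norm y \<le> norm z + R" and h: "norm h < d" for y h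
    proof -
      have "norm (\<kappa> (y + h) - \<kappa> y - D y ((y + h) - y)) \<le> norm ((y + h) - y) * (2 * e1)"
      proof (rule differentiable_bound_linearization[of y "y + h" "ball y d" \<kappa> D y "2 * e1"])
        show "y + t *\<^sub>R (y + h - y) \<in> ball y d" if "t \<in> {0..1}" for t
        proof -
          have "norm (t *\<^sub>R h) \<le> 1 * norm h" unfolding norm_scaleR using that by (intro mult_right_mono) auto
          thus ?thesis using h by (simp add: dist_norm)
        qed
        show "y \<in> ball y d" using d by simp
        show "(\<kappa> has_derivative D x) (at x within ball y d)" if "x \<in> ball y d" for x
          using hd has_derivative_at_withinI by blast
        show "onorm (D x - D y) \<le> 2 * e1" if x: "x \<in> ball y d" for x
          unfolding fun_diff_def
        proof (rule onorm_bound)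
          fix v
          have "norm x \<le> norm y + norm (x - y)" by (metis add.commute norm_triangle_sub)
          hence xK: "x \<in> K" "y \<in> K" using x y d by (auto simp: K_def dist_norm norm_minus_commute)
          have "dist x y < d" using x by (simp add: dist_commute)
          hence n1: "norm (D x 1 - D y 1) < e1" "norm (D x \<i> - D y \<i>) < e1"
            using d1(2)[OF xK] d2(2)[OF xK] d unfolding dist_norm by linarith+
          have "D x v - D y v = of_real (Re v) * (D x 1 - D y 1) + of_real (Im v) * (D x \<i> - D y \<i>)"
            by (simp add: Dexp[of _ v] algebra_simps)
          also have "norm \<dots> \<le> \<bar>Re v\<bar> * norm (D x 1 - D y 1) + \<bar>Im v\<bar> * norm (D x \<i> - D y \<i>)"
            using norm_triangle_ineq[of "of_real (Re v) * (D x 1 - D y 1)" "of_real (Im v) * (D x \<i> - D y \<i>)"]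
            by (simp add: norm_mult)
          also have "\<dots> \<le> norm v * e1 + norm v * e1"
            using n1 abs_Re_le_cmod[of v] abs_Im_le_cmod[of v] by (intro add_mono mult_mono) auto
          finally show "norm (D x v - D y v) \<le> 2 * e1 * norm v" by (simp add: algebra_simps)
        qed (use e1 in auto)
      qed
      thus ?thesis by simp
    qed
    show "\<exists>d>0. \<forall>y. norm (y - z) < d \<longrightarrow> norm (conv b \<kappa> y - conv b \<kappa> z - conv b (\<lambda>z'. D z' (y - z)) z) \<le> e * norm (y - z)"
    proof (intro exI[of _ d] conjI allI impI)
      fix y assume y: "norm (y - z) < d"
      define h where "h = y - z"
      have "conv b \<kappa> y - conv b \<kappa> z - conv b (\<lambda>z'. D z' h) z = (LINT w|lborel. b w * \<kappa> (y - w) - b w * \<kappa> (z - w) - b w * D (z - w) h)"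
        unfolding conv_def using int intD by simp
      also have "norm \<dots> \<le> (LINT w|lborel. norm (b w) * (norm h * (2 * e1)))"
      proof (rule Bochner_Integration.integral_norm_bound_integral)
        show "integrable lborel (\<lambda>w. norm (b w) * (norm h * (2 * e1)))" using b by simp
        fix w :: complex
        show "norm (b w * \<kappa> (y - w) - b w * \<kappa> (z - w) - b w * D (z - w) h) \<le> norm (b w) * (norm h * (2 * e1))"
        proof (cases "w \<in> cball 0 R")
          case True
          have "norm (z - w) \<le> norm z + R" using norm_triangle_ineq4[of z w] True by simp
          from lin[OF this, of h] y have "norm (\<kappa> ((z - w) + h) - \<kappa> (z - w) - D (z - w) h) \<le> norm h * (2 * e1)"
            by (simp add: h_def)
          moreover have "b w * \<kappa> (y - w) - b w * \<kappa> (z - w) - b w * D (z - w) h = b w * (\<kappa> ((z - w) + h) - \<kappa> (z - w) - D (z - w) h)"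
            by (simp add: h_def algebra_simps)
          ultimately show ?thesis by (simp add: norm_mult mult_left_mono)
        qed (use supp e1 in simp)
      qed (use int intD in auto)
      also have "\<dots> = I * (norm h * (2 * e1))" by (simp add: I_def)
      also have "\<dots> = (I * (2 * e1)) * norm h" by simp
      also have "\<dots> \<le> e * norm h"
        using e I0 by (intro mult_right_mono) (auto simp: e1_def field_simps)
      finally show "norm (conv b \<kappa> y - conv b \<kappa> z - conv b (\<lambda>z'. D z' (y - z)) z) \<le> e * norm (y - z)" by (simp add: h_def)
    qed (use d in auto)
  qed
  thus ?thesis unfolding D_def .
qed

lemma Ck_fun_conv:
  assumes b: "integrable lborel b" and supp: "\<And>w. w \<notin> cball 0 R ==> b w = 0" and \<kappa>: "Ck_fun (Suc k) \<kappa>"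
  shows "Ck_fun k (conv b \<kappa>)"
  using \<kappa>
proof (induction k arbitrary: \<kappa>)
  case 0
  thus ?case using has_derivative_continuous[OF conv_has_derivative[OF b supp]]
    by (auto intro: continuous_at_imp_continuous_on)
next
  case (Suc k)
  have "Ck_fun (Suc k) (\<lambda>z. frechet_derivative \<kappa> (at z) v)" for v using Suc.prems by simp
  hence "continuous_on UNIV (\<lambda>z. frechet_derivative \<kappa> (at z) v)" for v by (rule Ck_fun_continuous)
  hence 1: "Ck_fun 1 \<kappa>" using Suc.prems by simp
  show ?case
    by (rule Ck_funI[OF conv_has_derivative[OF b supp 1]]) (use Suc in auto)
qed

lemma dbar_conv:
  assumes b: "integrable lborel b" and supp: "\<And>w. w \<notin> cball 0 R ==> b w = 0" and \<kappa>: "Ck_fun 1 \<kappa>"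
  shows "dbar (conv b \<kappa>) z = conv b (dbar \<kappa>) z"
proof -
  have fd: "frechet_derivative (conv b \<kappa>) (at z) = (\<lambda>v. conv b (\<lambda>z. frechet_derivative \<kappa> (at z) v) z)"
    using frechet_derivative_at[OF conv_has_derivative[OF assms]] by simp
  have cD: "continuous_on UNIV (\<lambda>y. frechet_derivative \<kappa> (at y) v)" for v using \<kappa> by simp
  have intD: "integrable lborel (\<lambda>w. b w * frechet_derivative \<kappa> (at (z - w)) v)" for z v by (rule integrable_conv[OF b supp cD])
  have "conv b (dbar \<kappa>) z = (LINT w|lborel. (b w * frechet_derivative \<kappa> (at (z - w)) 1 + \<i> * (b w * frechet_derivative \<kappa> (at (z - w)) \<i>)) / 2)"
    unfolding conv_def dbar_def by (rule Bochner_Integration.integral_cong) (auto simp: algebra_simps)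
  also have "\<dots> = dbar (conv b \<kappa>) z"
    unfolding dbar_def fd conv_def using intD by simp
  finally show ?thesis by simp
qed

section \<open>Integral estimates for the Cauchy kernel\<close>

lemma emeasure_cball_complex: "r \<ge> 0 ==> emeasure lborel (cball (c::complex) r) = ennreal (unit_ball_vol 2 * r\<^sup>2)"
  by (subst emeasure_cball) auto

text \<open>A function that is bounded on discs by constants whose sum against the areas converges is integrable. With dyadic discs
  this settles the integrability of radial powers, both at the origin and at infinity.\<close>
lemma nn_integral_dyadic:
  fixes h :: "complex \<Rightarrow> ennreal"
  assumes cover: "\<And>z. h z \<noteq> 0 ==> \<exists>n::nat. norm z \<le> \<rho> n \<and> h z \<le> ennreal (u n)"
    and \<rho>: "\<And>n. \<rho> n \<ge> 0" and u: "\<And>n. u n \<ge> 0" and sum: "summable (\<lambda>n. u n * (\<rho> n)\<^sup>2)"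
  shows "(\<integral>\<^sup>+ z. h z \<partial>lborel) < \<infinity>"
proof -
  have "(\<integral>\<^sup>+ z. h z \<partial>lborel) \<le> (\<integral>\<^sup>+ z. (\<Sum>n. ennreal (u n) * indicator (cball (0::complex) (\<rho> n)) z) \<partial>lborel)"
  proof (rule nn_integral_mono)
    fix z :: complex
    show "h z \<le> (\<Sum>n. ennreal (u n) * indicator (cball 0 (\<rho> n)) z)"
    proof (cases "h z = 0")
      case False
      then obtain n where n: "norm z \<le> \<rho> n" "h z \<le> ennreal (u n)" using cover by blast
      have "h z \<le> ennreal (u n) * indicator (cball 0 (\<rho> n)) z" using n by simp
      also have "\<dots> = (\<Sum>m\<in>{n}. ennreal (u m) * indicator (cball 0 (\<rho> m)) z)"
        by (simp only: sum.insert finite.emptyI empty_iff sum.empty add_0_right not_False_eq_True)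
      also have "\<dots> \<le> (\<Sum>m. ennreal (u m) * indicator (cball 0 (\<rho> m)) z)"
        by (rule sum_le_suminf) auto
      finally show ?thesis .
    qed simp
  qed
  also have "\<dots> = (\<Sum>n. \<integral>\<^sup>+ z. ennreal (u n) * indicator (cball (0::complex) (\<rho> n)) z \<partial>lborel)"
    by (rule nn_integral_suminf) (intro borel_measurable_times_ennreal borel_measurable_const borel_measurable_indicator, simp)
  also have "\<dots> = (\<Sum>n. ennreal (unit_ball_vol 2 * (u n * (\<rho> n)\<^sup>2)))"
  proof (rule suminf_cong)
    fix n
    have "(\<integral>\<^sup>+ z. ennreal (u n) * indicator (cball (0::complex) (\<rho> n)) z \<partial>lborel) = ennreal (u n) * emeasure lborel (cball (0::complex) (\<rho> n))"
      by (rule nn_integral_cmult_indicator) simp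
    also have "\<dots> = ennreal (unit_ball_vol 2 * (u n * (\<rho> n)\<^sup>2))"
      using \<rho>[of n] u[of n] by (subst emeasure_cball_complex) (auto simp: ennreal_mult[symmetric] algebra_simps)
    finally show "(\<integral>\<^sup>+ z. ennreal (u n) * indicator (cball (0::complex) (\<rho> n)) z \<partial>lborel) = ennreal (unit_ball_vol 2 * (u n * (\<rho> n)\<^sup>2))" .
  qed
  also have "\<dots> = ennreal (\<Sum>n. unit_ball_vol 2 * (u n * (\<rho> n)\<^sup>2))"
    using sum u by (intro suminf_ennreal2) (auto intro!: mult_nonneg_nonneg summable_mult)
  also have "\<dots> < \<infinity>" by simp
  finally show ?thesis .
qed

text \<open>A radial function with the singularity \<open>- t\<close> of the Cauchy kernel at the origin and the decay \<open>- 2 * t\<close> of the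
  difference of two Cauchy kernels at infinity.\<close>
definition radk :: "real \<Rightarrow> complex \<Rightarrow> real" where
  "radk t v = (norm v * max (1/2) (norm v)) powr (- t)"

lemma radk_measurable [measurable]: "radk t \<in> borel_measurable borel"
  unfolding radk_def[abs_def] by measurable

lemma dyadic_in: assumes "0 < (x::real)" "x \<le> 1" obtains n :: nat where "x \<le> (1/2) ^ n" "(1/2) ^ Suc n < x"
proof -
  define P where "P = (\<lambda>n. (1/2::real) ^ n < x)"
  obtain N where "P N" using real_arch_pow_inv[of x "1/2"] assms by (auto simp: P_def)
  define m where "m = (LEAST n. P n)"
  have m: "P m" unfolding m_def by (rule LeastI[of P N]) fact
  have "m \<noteq> 0" using m assms by (auto simp: P_def intro: ccontr)
  then obtain n where n: "m = Suc n" by (cases m) auto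
  have "\<not> P n" unfolding m_def using n not_less_Least[of n P] by (simp add: m_def)
  thus ?thesis using m that[of n] by (auto simp: P_def n)
qed

lemma dyadic_out: assumes "1 < (x::real)" obtains n :: nat where "x \<le> 2 ^ Suc n" "2 ^ n < x"
proof -
  define P where "P = (\<lambda>n. x \<le> (2::real) ^ n)"
  obtain N where "P N" using real_arch_pow[of 2 x] by (auto simp: P_def intro: less_imp_le)
  define m where "m = (LEAST n. P n)"
  have m: "P m" unfolding m_def by (rule LeastI[of P N]) fact
  have "m \<noteq> 0" using m assms by (auto simp: P_def intro: ccontr)
  then obtain n where n: "m = Suc n" by (cases m) auto
  have "\<not> P n" using n not_less_Least[of n P] by (simp add: m_def)
  thus ?thesis using m that[of n] by (auto simp: P_def n)
qed

lemma radk_integral_finite: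
  assumes t: "1 < t" "t < 2"
  shows "(\<integral>\<^sup>+ v. ennreal (radk t v) \<partial>lborel) < \<infinity>"
proof -
  have "(\<integral>\<^sup>+ v. ennreal (radk t v) * indicator (cball 0 1) v \<partial>lborel) < \<infinity>"
  proof (rule nn_integral_dyadic[where \<rho> = "\<lambda>n. (1/2) ^ n" and u = "\<lambda>n. 4 powr t * (2 powr t) ^ n"])
    fix z :: complex assume nz: "ennreal (radk t z) * indicator (cball 0 1) z \<noteq> 0"
    hence z: "0 < norm z" "norm z \<le> 1" by (auto simp: radk_def indicator_def split: if_splits)
    obtain n where n: "norm z \<le> (1/2) ^ n" "(1/2) ^ Suc n < norm z" using dyadic_in[OF z] .
    have "radk t z \<le> ((1/2) ^ Suc n * (1/2)) powr (- t)"
      unfolding radk_def using n z t by (intro powr_mono2' mult_mono mult_pos_pos) auto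
    also have "\<dots> = 4 powr t * (2 powr t) ^ n"
      by (simp add: powr_mult powr_minus powr_divide powr_realpow[symmetric] powr_powr field_simps powr_power)
    finally show "\<exists>n. norm z \<le> (1/2) ^ n \<and> ennreal (radk t z) * indicator (cball 0 1) z \<le> ennreal (4 powr t * (2 powr t) ^ n)"
      using n z by (intro exI[of _ n]) (auto simp: ennreal_leI)
  next
    have "norm (2 powr t / 4) < 1"
    proof -
      have "2 powr t < 2 powr (2::real)" using t by (intro powr_less_mono) auto
      thus ?thesis by simp
    qed
    hence "summable (\<lambda>n. 4 powr t * (2 powr t / 4) ^ n)" by (intro summable_mult summable_geometric)
    moreover have "4 powr t * (2 powr t) ^ n * ((1/2) ^ n)\<^sup>2 = 4 powr t * (2 powr t / 4) ^ n" for n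
    proof -
      have "((1/2::real) ^ n)\<^sup>2 = (1/4) ^ n" by (simp add: power2_eq_square power_mult_distrib[symmetric])
      thus ?thesis by (simp add: power_divide)
    qed
    ultimately show "summable (\<lambda>n. 4 powr t * (2 powr t) ^ n * ((1/2) ^ n)\<^sup>2)" by (simp only:)
  qed auto
  moreover have "(\<integral>\<^sup>+ v. ennreal (radk t v) * indicator (- cball 0 1) v \<partial>lborel) < \<infinity>"
  proof (rule nn_integral_dyadic[where \<rho> = "\<lambda>n. 2 ^ Suc n" and u = "\<lambda>n. (4 powr (-t)) ^ n"])
    fix z :: complex assume nz: "ennreal (radk t z) * indicator (- cball 0 1) z \<noteq> 0"
    hence "z \<notin> cball 0 1" by (cases "z \<in> cball 0 1") simp_all
    hence z: "1 < norm z" by simp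
    obtain n where n: "norm z \<le> 2 ^ Suc n" "2 ^ n < norm z" using dyadic_out[OF z] .
    have "radk t z \<le> (2 ^ n * 2 ^ n) powr (- t)"
      unfolding radk_def using n z t by (intro powr_mono2' mult_mono mult_pos_pos) auto
    also have "2 ^ n * 2 ^ n = (4::real) ^ n" by (simp add: power_mult_distrib[symmetric])
    also have "((4::real) ^ n) powr (- t) = (4 powr (-t)) ^ n"
      by (simp add: powr_realpow[symmetric] powr_powr powr_power mult.commute)
    finally show "\<exists>n. norm z \<le> 2 ^ Suc n \<and> ennreal (radk t z) * indicator (- cball 0 1) z \<le> ennreal ((4 powr (-t)) ^ n)"
      using n z by (intro exI[of _ n]) (auto simp: ennreal_leI)
  next
    have "norm (4 powr (-t) * 4) < 1"
    proof -
      have "4 powr (- t) * 4 = 4 powr (1 - t)" by (simp add: powr_diff powr_minus field_simps)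
      also have "\<dots> < 4 powr (0::real)" using t by (intro powr_less_mono) auto
      finally show ?thesis by simp
    qed
    hence "summable (\<lambda>n. 4 * (4 powr (-t) * 4) ^ n)" by (intro summable_mult summable_geometric)
    moreover have "(4 powr (-t)) ^ n * (2 ^ Suc n)\<^sup>2 = 4 * (4 powr (-t) * 4) ^ n" for n
    proof -
      have "((2::real) ^ Suc n)\<^sup>2 = (2\<^sup>2) ^ Suc n" by (simp only: power_mult[symmetric] mult.commute)
      hence "(2 ^ Suc n)\<^sup>2 = (4::real) * 4 ^ n" by simp
      thus ?thesis by (simp add: power_mult_distrib)
    qed
    ultimately show "summable (\<lambda>n. (4 powr (-t)) ^ n * (2 ^ Suc n)\<^sup>2)" by (simp only:)
  qed auto
  moreover have "(\<integral>\<^sup>+ v. ennreal (radk t v) \<partial>lborel) = (\<integral>\<^sup>+ v. ennreal (radk t v) * indicator (cball 0 1) v \<partial>lborel) +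
      (\<integral>\<^sup>+ v. ennreal (radk t v) * indicator (- cball 0 1) v \<partial>lborel)"
    by (subst nn_integral_add[symmetric]) (auto intro!: nn_integral_cong simp: indicator_def)
  ultimately show ?thesis by (simp add: less_top)
qed

lemma nn_integral_lborel_affine_complex:
  fixes f :: "complex \<Rightarrow> ennreal"
  assumes [measurable]: "f \<in> borel_measurable borel" and d: "d \<noteq> 0"
  shows "(\<integral>\<^sup>+ w. f w \<partial>lborel) = ennreal (d\<^sup>2) * (\<integral>\<^sup>+ v. f (z + of_real d * v) \<partial>lborel)"
proof -
  have "(\<integral>\<^sup>+ w. f w \<partial>lborel) = (\<integral>\<^sup>+ w. f w \<partial>(density (distr lborel borel (\<lambda>x. z + d *\<^sub>R x)) (\<lambda>_. ennreal (\<bar>d\<bar> ^ DIM(complex)))))"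
    using lborel_affine[OF d, of z] by simp
  also have "\<dots> = (\<integral>\<^sup>+ v. ennreal (d\<^sup>2) * f (z + d *\<^sub>R v) \<partial>lborel)"
    by (subst nn_integral_density) (auto simp: nn_integral_distr)
  also have "\<dots> = ennreal (d\<^sup>2) * (\<integral>\<^sup>+ v. f (z + d *\<^sub>R v) \<partial>lborel)"
    by (rule nn_integral_cmult) simp
  finally show ?thesis by (simp add: scaleR_conv_of_real)
qed

lemma Young_powr:
  fixes a b q t :: real
  assumes "a \<ge> 0" "b \<ge> 0" "q > 1" "t > 1" "1/q + 1/t = 1"
  shows "a * b \<le> a powr q + b powr t"
proof -
  have "a * b \<le> a powr q / q + b powr t / t"
    using assms by (intro Youngs_inequality) auto
  also have "\<dots> \<le> a powr q / 1 + b powr t / 1" using assms by (intro add_mono divide_left_mono) auto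
  finally show ?thesis by simp
qed

text \<open>This controls the modulus of continuity of the Cauchy transform. By scaling, the distance of the two points may be taken
  to be \<open>1\<close>. One of the two points is then at distance at least \<open>1 / 2\<close> from \<open>w\<close>, and the integrand is bounded by
  the kernel \<open>radk\<close> centred at the other one.\<close>
lemma kernel_integral:
  fixes z z' :: complex
  assumes t: "1 < t" "t < 2" and zz: "z \<noteq> z'" and \<alpha>: "\<alpha> = 2 / t - 1"
  shows "(\<integral>\<^sup>+ w. ennreal ((norm (z - z') powr (1 - \<alpha>) / (norm (z - w) * norm (z' - w))) powr t) \<partial>lborel)
     \<le> 2 * (\<integral>\<^sup>+ v. ennreal (radk t v) \<partial>lborel)"
proof -
  define d where "d = norm (z - z')"
  have d: "d > 0" using zz by (simp add: d_def)
  define N where "N = (\<lambda>y w::complex. (d powr (1 - \<alpha>)) powr t * ((norm (y - w) * max (d / 2) (norm (y - w))) powr (- t)))"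
  have Nint: "(\<integral>\<^sup>+ w. ennreal (N y w) \<partial>lborel) = (\<integral>\<^sup>+ v. ennreal (radk t v) \<partial>lborel)" for y :: complex
  proof -
    have "(\<integral>\<^sup>+ w. ennreal (N y w) \<partial>lborel) = ennreal (d\<^sup>2) * (\<integral>\<^sup>+ v. ennreal (N y (y + of_real d * v)) \<partial>lborel)"
      unfolding N_def by (rule nn_integral_lborel_affine_complex) (use d in \<open>measurable, auto\<close>)
    also have "\<dots> = (\<integral>\<^sup>+ v. ennreal (d\<^sup>2) * ennreal (N y (y + of_real d * v)) \<partial>lborel)"
      by (rule nn_integral_cmult[symmetric]) (simp add: N_def, measurable)
    also have "\<dots> = (\<integral>\<^sup>+ v. ennreal (radk t v) \<partial>lborel)"
    proof (rule nn_integral_cong)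
      fix v :: complex
      have "norm (y - (y + of_real d * v)) = d * norm v" using d by (simp add: norm_mult)
      moreover have "max (d / 2) (d * norm v) = d * max (1/2) (norm v)" using d by (simp add: max_def field_simps)
      ultimately have "N y (y + of_real d * v) = (d powr (1 - \<alpha>)) powr t * ((d\<^sup>2 * (norm v * max (1/2) (norm v))) powr (- t))"
        by (simp add: N_def power2_eq_square algebra_simps)
      also have "\<dots> = (d powr ((1 - \<alpha>) * t)) * (d powr (- 2 * t)) * radk t v"
      proof -
        have "d\<^sup>2 = d powr 2" using d by simp
        hence 1: "(d\<^sup>2) powr (- t) = d powr (- 2 * t)" by (simp only: powr_powr) simp
        have "(d\<^sup>2 * (norm v * max (1/2) (norm v))) powr (- t) = (d\<^sup>2) powr (- t) * radk t v"
          unfolding radk_def by (rule powr_mult)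
        thus ?thesis unfolding 1 powr_powr by simp
      qed
      also have "\<dots> = d powr (- 2) * radk t v"
      proof -
        have "(1 - \<alpha>) * t + - 2 * t = - 2" using \<alpha> t by (simp add: field_simps)
        hence "d powr ((1 - \<alpha>) * t) * d powr (- 2 * t) = d powr (- 2)" by (simp only: powr_add[symmetric])
        thus ?thesis by simp
      qed
      also have "d powr (- 2) = 1 / d\<^sup>2" using d by (simp add: powr_minus powr_realpow divide_inverse)
      finally have "d\<^sup>2 * N y (y + of_real d * v) = radk t v" using d by simp
      thus "ennreal (d\<^sup>2) * ennreal (N y (y + of_real d * v)) = ennreal (radk t v)"
        by (metis ennreal_mult' zero_le_power2)
    qed
    finally show ?thesis .
  qed
  have pt: "(d powr (1 - \<alpha>) / (norm (z - w) * norm (z' - w))) powr t \<le> N z w + N z' w" if w: "w \<noteq> z" "w \<noteq> z'" for w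
  proof -
    have N0: "N y w \<ge> 0" for y by (simp add: N_def)
    have *: "(d powr (1 - \<alpha>) / (norm (y - w) * norm (y' - w))) powr t \<le> N y w"
      if le: "norm (y - w) \<le> norm (y' - w)" and dd: "d = norm (y - y')" and y: "w \<noteq> y" for y y'
    proof -
      have "d \<le> norm (y - w) + norm (y' - w)" using norm_triangle_ineq4[of "y - w" "y' - w"] dd by simp
      hence m: "max (d / 2) (norm (y - w)) \<le> norm (y' - w)" using le by simp
      have "(d powr (1 - \<alpha>) / (norm (y - w) * norm (y' - w))) powr t
          = (d powr (1 - \<alpha>)) powr t * (norm (y - w) * norm (y' - w)) powr (- t)"
        by (subst powr_divide) (auto simp: powr_minus_divide)
      also have "\<dots> \<le> N y w" unfolding N_def
      proof (intro mult_left_mono powr_mono2' mult_left_mono m)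
        show "0 < norm (y - w) * max (d / 2) (norm (y - w))" using y d by (auto intro!: mult_pos_pos simp: less_max_iff_disj)
      qed (use t in auto)
      finally show ?thesis .
    qed
    show ?thesis
    proof (cases "norm (z - w) \<le> norm (z' - w)")
      case True
      thus ?thesis using *[OF True d_def w(1)] N0[of z'] by linarith
    next
      case False
      hence "(d powr (1 - \<alpha>) / (norm (z' - w) * norm (z - w))) powr t \<le> N z' w"
        by (intro *) (use w in \<open>auto simp: d_def norm_minus_commute\<close>)
      thus ?thesis using N0[of z] by (simp add: mult.commute)
    qed
  qed
  have "(\<integral>\<^sup>+ w. ennreal ((d powr (1 - \<alpha>) / (norm (z - w) * norm (z' - w))) powr t) \<partial>lborel) \<le> (\<integral>\<^sup>+ w. ennreal (N z w) + ennreal (N z' w) \<partial>lborel)"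
  proof (rule nn_integral_mono)
    fix w
    show "ennreal ((d powr (1 - \<alpha>) / (norm (z - w) * norm (z' - w))) powr t) \<le> ennreal (N z w) + ennreal (N z' w)"
    proof (cases "w = z \<or> w = z'")
      case True
      hence "norm (z - w) * norm (z' - w) = 0" by auto
      thus ?thesis by (simp only: div_by_0 powr_zero_eq_one) simp
    next
      case False
      hence "ennreal ((d powr (1 - \<alpha>) / (norm (z - w) * norm (z' - w))) powr t) \<le> ennreal (N z w + N z' w)"
        using pt[of w] by (intro ennreal_leI) auto
      thus ?thesis by (simp add: N_def)
    qed
  qed
  also have "\<dots> = (\<integral>\<^sup>+ w. ennreal (N z w) \<partial>lborel) + (\<integral>\<^sup>+ w. ennreal (N z' w) \<partial>lborel)"
    unfolding N_def by (rule nn_integral_add; measurable)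
  also have "\<dots> = 2 * (\<integral>\<^sup>+ v. ennreal (radk t v) \<partial>lborel)" by (simp add: Nint mult_2)
  finally show ?thesis by (simp add: d_def)
qed

section \<open>Weyl's lemma\<close>

lemma dbar_eq: "(\<phi> has_derivative D) (at z) ==> dbar \<phi> z = (D 1 + \<i> * D \<i>) / 2"
  using frechet_derivative_at[of \<phi> D z] by (simp add: dbar_def)

lemma dbar_zero_imp_holomorphic:
  assumes S: "open S" and D: "\<And>z. z \<in> S ==> (\<phi> has_derivative D z) (at z)" and 0: "\<And>z. z \<in> S ==> dbar \<phi> z = 0"
  shows "\<phi> holomorphic_on S"
  unfolding holomorphic_on_open[OF S]
proof (intro ballI exI)
  fix z assume z: "z \<in> S"
  have lin: "linear (D z)" using D[OF z] has_derivative_linear by blast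
  have "D z 1 + \<i> * D z \<i> = 0" using 0[OF z] dbar_eq[OF D[OF z]] by simp
  hence i: "D z \<i> = \<i> * D z 1" by (simp add: complex_eq_iff)
  have "D z v = D z 1 * v" for v
  proof -
    have "D z v = D z (Re v *\<^sub>R 1 + Im v *\<^sub>R \<i>)" by (rule arg_cong[of _ _ "D z"]) (simp add: complex_eq_iff)
    also have "\<dots> = Re v *\<^sub>R D z 1 + Im v *\<^sub>R D z \<i>" unfolding linear_add[OF lin] linear_scale[OF lin] ..
    also have "\<dots> = D z 1 * v" by (simp add: i complex_eq_iff algebra_simps)
    finally show ?thesis .
  qed
  hence "D z = (*) (D z 1)" by (rule ext)
  thus "(\<phi> has_field_derivative D z 1) (at z)" using D[OF z] by (simp add: has_field_derivative_def)
qed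

lemma bump_zero: assumes "norm z \<ge> d" "d > 0" shows "bump d z = 0"
proof -
  have "d\<^sup>2 \<le> (norm z)\<^sup>2" using assms by (intro power_mono) auto
  thus ?thesis by (simp add: bump_def flat_def)
qed

lemma bump_pos: "norm z < d ==> flat 0 (d\<^sup>2 - (norm z)\<^sup>2) > 0"
  by (simp add: flat_def power_strict_mono)

lemma flat_nonneg: "flat m x \<ge> 0" by (simp add: flat_def)

lemma dbar_bump_zero: assumes "norm z > d" "d > 0" shows "dbar (bump d) z = 0"
proof -
  have "(bump d has_derivative (\<lambda>v. 0)) (at z)"
  proof (rule has_derivative_transform_within_open[of "\<lambda>_. 0"])
    show "open (- cball 0 d :: complex set)" by auto
  qed (use assms bump_zero in \<open>auto intro: less_imp_le\<close>)
  thus ?thesis by (simp add: dbar_eq)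
qed

lemma bump_integral:
  assumes d: "d > 0"
  obtains m where "m > 0" "\<And>z::complex. integrable lborel (\<lambda>w. flat 0 (d\<^sup>2 - (norm (z - w))\<^sup>2))" "\<And>z::complex. (LINT w|lborel. flat 0 (d\<^sup>2 - (norm (z - w))\<^sup>2)) = m"
proof -
  define h where "h = (\<lambda>w::complex. flat 0 (d\<^sup>2 - (norm w)\<^sup>2))"
  have ch: "continuous_on UNIV h"
  proof -
    have "continuous_on UNIV (bump d)" using Ck_fun_continuous[OF Ck_fun_bump[of 0]] .
    hence "continuous_on UNIV (\<lambda>z. Re (bump d z))" by (intro continuous_intros)
    thus ?thesis by (simp add: bump_def h_def)
  qed
  have h0: "h w = 0" if "w \<notin> cball 0 d" for w using that bump_zero[of d w] d by (simp add: bump_def h_def)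
  have hb: "h w \<le> 1" for w by (simp add: h_def flat_def)
  have int: "integrable lborel h"
  proof (rule Bochner_Integration.integrable_bound[of _ "\<lambda>w. indicator (cball 0 d) w :: real"])
    show "integrable lborel (\<lambda>w::complex. indicator (cball 0 d) w :: real)"
      using emeasure_bounded_finite[of "cball (0::complex) d"] by (intro integrable_real_indicator) (auto simp: less_top)
    show "h \<in> borel_measurable lborel" using borel_measurable_continuous_onI[OF ch] by simp
    show "AE w in lborel. norm (h w) \<le> norm (indicator (cball 0 d) w :: real)"
      using h0 hb by (intro AE_I2) (auto simp: indicator_def h_def flat_nonneg)
  qed
  define m where "m = (LINT w|lborel. h w)"
  have shift: "integrable lborel (\<lambda>w. h (z - w))" "(LINT w|lborel. h (z - w)) = m" for z
  proof -
    have eq: "h (z - w) = h (- z + w)" for w by (simp add: h_def norm_minus_commute)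
    have tr: "lborel = distr lborel borel (\<lambda>w. - z + w)" by (rule lborel_distr_plus[symmetric])
    have "integrable (distr lborel borel (\<lambda>w. - z + w)) h" using int tr by metis
    hence "integrable lborel (\<lambda>w. h (- z + w))" by (rule integrable_distr[rotated]) simp
    thus "integrable lborel (\<lambda>w. h (z - w))" by (simp add: eq)
    have "m = (LINT w|distr lborel borel (\<lambda>w. - z + w). h w)" unfolding m_def using tr by metis
    also have "\<dots> = (LINT w|lborel. h (- z + w))"
      by (rule integral_distr) (use borel_measurable_continuous_onI[OF ch] in auto)
    finally show "(LINT w|lborel. h (z - w)) = m" by (simp add: eq)
  qed
  have "m > 0"
  proof -
    have "m \<ge> 0" unfolding m_def by (intro Bochner_Integration.integral_nonneg) (simp add: h_def flat_nonneg)
    moreover have "m \<noteq> 0"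
    proof
      assume "m = 0"
      hence "AE w in lborel. h w = 0"
        unfolding m_def using int by (subst (asm) integral_nonneg_eq_0_iff_AE) (auto simp: h_def flat_nonneg)
      hence "AE w in lborel. w \<notin> ball (0::complex) d"
      proof (rule eventually_mono)
        fix w assume "h w = 0"
        thus "w \<notin> ball 0 d" using bump_pos[of w d] by (auto simp: h_def)
      qed
      hence "emeasure lborel (ball (0::complex) d) = 0" by (subst (asm) AE_iff_measurable[OF _ refl]) (auto simp: ball_def)
      moreover have "emeasure lborel (ball (0::complex) d) > 0" using d by (subst emeasure_ball) auto
      ultimately show False by simp
    qed
    ultimately show ?thesis by simp
  qed
  thus ?thesis using that[of m] shift by (simp add: h_def)
qed

text \<open>Convolution with a bump function turns the weak equation into the classical one, because a translate of a bump
  function is a test function. The smooth approximations are therefore holomorphic, and converge locally uniformly.\<close>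
lemma weyl:
  assumes H: "continuous_on (ball c R) H"
    and weak: "\<And>\<phi>. test_fun (ball c R) \<phi> ==> (LINT z|lborel. (if z \<in> ball c R then H z else 0) * dbar \<phi> z) = 0"
  shows "H holomorphic_on ball c R"
proof -
  have "H field_differentiable at z0" if z0: "z0 \<in> ball c R" for z0
  proof -
    obtain r' where r': "r' > 0" "cball z0 r' \<subseteq> ball c R" using z0 open_contains_cball_eq[OF open_ball] by blast
    define r where "r = r' / 3"
    have r: "r > 0" "cball z0 (3 * r) \<subseteq> ball c R" using r' by (auto simp: r_def)
    have cH: "continuous_on (cball z0 (2 * r)) H" by (rule continuous_on_subset[OF H]) (use r in \<open>auto simp: subset_eq\<close>)
    define b where "b = (\<lambda>z. if z \<in> cball z0 (2 * r) then H z else 0)"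
    have bint: "integrable lborel b"
    proof -
      have "integrable lborel (\<lambda>x. indicator (cball z0 (2*r)) x *\<^sub>R H x)"
        by (rule borel_integrable_compact[OF _ cH]) simp
      moreover have "(\<lambda>x. indicator (cball z0 (2*r)) x *\<^sub>R H x) = b" by (auto simp: b_def fun_eq_iff)
      ultimately show ?thesis by simp
    qed
    define L where "L = norm z0 + 2 * r"
    have bsupp: "b w = 0" if "w \<notin> cball 0 L" for w
    proof -
      have "w \<notin> cball z0 (2 * r)"
      proof
        assume "w \<in> cball z0 (2 * r)"
        hence "norm (w - z0) \<le> 2 * r" by (simp add: dist_norm norm_minus_commute)
        hence "norm w \<le> L" using norm_triangle_sub[of w z0] by (simp add: L_def)
        thus False using that by simp
      qed
      thus ?thesis by (simp add: b_def)
    qed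
    define \<delta> where "\<delta> = (\<lambda>n. r / real (Suc n))"
    have \<delta>: "\<delta> n > 0" "\<delta> n \<le> r" for n using r by (auto simp: \<delta>_def field_simps)
    define good where "good = (\<lambda>n m. m > 0 \<and> (\<forall>z::complex. integrable lborel (\<lambda>w. flat 0 ((\<delta> n)\<^sup>2 - (norm (z - w))\<^sup>2))) \<and>
         (\<forall>z::complex. (LINT w|lborel. flat 0 ((\<delta> n)\<^sup>2 - (norm (z - w))\<^sup>2)) = m))"
    have "\<exists>m. good n m" for n
    proof -
      obtain m where "m > 0" "\<And>z::complex. integrable lborel (\<lambda>w. flat 0 ((\<delta> n)\<^sup>2 - (norm (z - w))\<^sup>2))"
        "\<And>z::complex. (LINT w|lborel. flat 0 ((\<delta> n)\<^sup>2 - (norm (z - w))\<^sup>2)) = m"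
        using bump_integral[OF \<delta>(1)[of n]] by blast
      thus ?thesis unfolding good_def by blast
    qed
    then obtain m where good: "\<And>n. good n (m n)" using choice[of good] by blast
    have m: "\<And>n. m n > 0" "\<And>n (z::complex). integrable lborel (\<lambda>w. flat 0 ((\<delta> n)\<^sup>2 - (norm (z - w))\<^sup>2))"
         "\<And>n (z::complex). (LINT w|lborel. flat 0 ((\<delta> n)\<^sup>2 - (norm (z - w))\<^sup>2)) = m n"
      using good unfolding good_def by blast+
    define Hn where "Hn = (\<lambda>n z. conv b (bump (\<delta> n)) z)"
    have Hder: "(Hn n has_derivative (\<lambda>v. conv b (\<lambda>z. frechet_derivative (bump (\<delta> n)) (at z) v) z)) (at z)" for n z
      unfolding Hn_def by (rule conv_has_derivative[OF bint bsupp Ck_fun_bump])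
    have Hhol: "Hn n holomorphic_on ball z0 r" for n
    proof (rule dbar_zero_imp_holomorphic[OF open_ball Hder])
      fix z assume z: "z \<in> ball z0 r"
      have near: "w \<in> cball z0 (2 * r)" if "norm (z - w) \<le> \<delta> n" for w
      proof -
        have "dist z0 w \<le> dist z0 z + dist z w" by (rule dist_triangle)
        thus ?thesis using z that \<delta>[of n] by (simp add: dist_norm)
      qed
      define \<phi> where "\<phi> = (\<lambda>w. bump (\<delta> n) (z - w))"
      have "test_fun (ball c R) \<phi>"
        unfolding test_fun_def
      proof (intro conjI allI)
        show "Ck_fun k \<phi>" for k unfolding \<phi>_def by (rule Ck_fun_translate[OF Ck_fun_bump])
        have "{w. \<phi> w \<noteq> 0} \<subseteq> cball z (\<delta> n)"
          using bump_zero[OF _ \<delta>(1)[of n]] by (force simp: \<phi>_def dist_norm)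
        hence cl: "closure {w. \<phi> w \<noteq> 0} \<subseteq> cball z (\<delta> n)" by (intro closure_minimal) auto
        thus "compact (closure {w. \<phi> w \<noteq> 0})"
          by (meson bounded_cball bounded_subset closed_closure compact_eq_bounded_closed)
        have "cball z (\<delta> n) \<subseteq> cball z0 (2 * r)" using near by (auto simp: dist_norm)
        moreover have "cball z0 (2 * r) \<subseteq> cball z0 (3 * r)" using r by auto
        ultimately show "closure {w. \<phi> w \<noteq> 0} \<subseteq> ball c R" using cl r(2) by blast
      qed
      from weak[OF this] have "(LINT w|lborel. (if w \<in> ball c R then H w else 0) * dbar \<phi> w) = 0" .
      also have "(LINT w|lborel. (if w \<in> ball c R then H w else 0) * dbar \<phi> w) = (LINT w|lborel. - (b w * dbar (bump (\<delta> n)) (z - w)))"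
      proof (rule Bochner_Integration.integral_cong)
        fix w
        have d: "dbar \<phi> w = - dbar (bump (\<delta> n)) (z - w)" unfolding \<phi>_def by (rule dbar_translate[OF Ck_fun_bump])
        show "(if w \<in> ball c R then H w else 0) * dbar \<phi> w = - (b w * dbar (bump (\<delta> n)) (z - w))"
        proof (cases "norm (z - w) \<le> \<delta> n")
          case True
          hence "w \<in> cball z0 (2 * r)" by (rule near)
          moreover have "w \<in> ball c R" using calculation r by (auto simp: subset_eq)
          ultimately show ?thesis by (simp add: b_def d)
        next
          case False
          thus ?thesis using dbar_bump_zero[OF _ \<delta>(1)[of n], of "z - w"] by (simp add: d)
        qed
      qed simp
      finally have "conv b (dbar (bump (\<delta> n))) z = 0" by (simp add: conv_def)
      moreover have "dbar (conv b (bump (\<delta> n))) z = conv b (dbar (bump (\<delta> n))) z"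
        by (rule dbar_conv[OF bint bsupp Ck_fun_bump])
      moreover have "Hn n = conv b (bump (\<delta> n))" by (rule ext) (simp add: Hn_def)
      ultimately show "dbar (Hn n) z = 0" by simp
    qed
    have close: "norm (Hn n z / of_real (m n) - H z) \<le> e"
      if z: "z \<in> ball z0 r" and e: "\<And>w. w \<in> cball z0 (2 * r) ==> dist w z < \<delta> n ==> norm (H w - H z) \<le> e" for n z e
    proof -
      have e0: "e \<ge> 0" using e[of z] z \<delta>[of n] by auto
      have int1: "integrable lborel (\<lambda>w. b w * bump (\<delta> n) (z - w))"
        by (rule integrable_conv[OF bint bsupp Ck_fun_continuous[OF Ck_fun_bump[of 0]]])
      have int2: "integrable lborel (\<lambda>w. H z * bump (\<delta> n) (z - w))"
        unfolding bump_def using m(2)[of n z] by (intro integrable_mult_right integrable_of_real)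
      have eq: "(LINT w|lborel. H z * bump (\<delta> n) (z - w)) = H z * of_real (m n)"
        unfolding bump_def using m(2,3)[of n z] by simp
      have "Hn n z - H z * of_real (m n) = (LINT w|lborel. b w * bump (\<delta> n) (z - w) - H z * bump (\<delta> n) (z - w))"
        by (simp only: eq[symmetric] Bochner_Integration.integral_diff[OF int1 int2] Hn_def conv_def)
      also have "norm \<dots> \<le> (LINT w|lborel. e * flat 0 ((\<delta> n)\<^sup>2 - (norm (z - w))\<^sup>2))"
      proof (rule Bochner_Integration.integral_norm_bound_integral)
        show "integrable lborel (\<lambda>w. e * flat 0 ((\<delta> n)\<^sup>2 - (norm (z - w))\<^sup>2))" using m(2) by simp
        fix w
        show "norm (b w * bump (\<delta> n) (z - w) - H z * bump (\<delta> n) (z - w)) \<le> e * flat 0 ((\<delta> n)\<^sup>2 - (norm (z - w))\<^sup>2)"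
        proof (cases "norm (z - w) < \<delta> n")
          case True
          have "dist z0 w \<le> dist z0 z + dist z w" by (rule dist_triangle)
          hence w: "w \<in> cball z0 (2 * r)" using z True \<delta>[of n] by (simp add: dist_norm)
          have "norm (H w - H z) \<le> e" using e[OF w] True by (simp add: dist_norm norm_minus_commute)
          hence "norm ((H w - H z) * bump (\<delta> n) (z - w)) \<le> e * flat 0 ((\<delta> n)\<^sup>2 - (norm (z - w))\<^sup>2)"
            unfolding norm_mult bump_def norm_of_real abs_of_nonneg[OF flat_nonneg] by (intro mult_right_mono flat_nonneg)
          thus ?thesis using w by (simp add: b_def algebra_simps)
        next
          case False
          thus ?thesis using bump_zero[OF _ \<delta>(1)[of n], of "z - w"] e0 by (simp add: flat_nonneg)
        qed
      qed (use int1 int2 in auto)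
      also have "\<dots> = e * m n" using m(3) by simp
      finally have "norm (Hn n z - H z * of_real (m n)) \<le> e * m n" .
      moreover have "Hn n z / of_real (m n) - H z = (Hn n z - H z * of_real (m n)) / of_real (m n)"
        using m(1)[of n] by (simp add: field_simps)
      ultimately show ?thesis using m(1)[of n] by (simp add: norm_divide divide_le_eq)
    qed
    have ul: "uniform_limit (cball z0 (r/2)) (\<lambda>n z. Hn n z / of_real (m n)) H sequentially"
    proof (rule uniform_limitI)
      fix e :: real assume e: "e > 0"
      have "uniformly_continuous_on (cball z0 (2 * r)) H" by (rule compact_uniformly_continuous[OF cH]) simp
      then obtain d where d: "d > 0" "\<And>w z. w \<in> cball z0 (2 * r) ==> z \<in> cball z0 (2 * r) ==> dist w z < d ==> dist (H w) (H z) < e / 2"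
        unfolding uniformly_continuous_on_def using half_gt_zero[OF e] by metis
      have "\<delta> \<longlonglongrightarrow> 0" unfolding \<delta>_def using LIMSEQ_Suc[OF lim_const_over_n[of r]] by simp
      hence "\<forall>\<^sub>F n in sequentially. \<delta> n < d" using d(1) by (rule order_tendstoD)
      thus "\<forall>\<^sub>F n in sequentially. \<forall>z\<in>cball z0 (r/2). dist (Hn n z / of_real (m n)) (H z) < e"
      proof eventually_elim
        case (elim n)
        show ?case
        proof
          fix z assume z: "z \<in> cball z0 (r/2)"
          have "norm (Hn n z / of_real (m n) - H z) \<le> e / 2"
          proof (rule close)
            show "z \<in> ball z0 r" using z r by auto
            fix w assume "w \<in> cball z0 (2 * r)" "dist w z < \<delta> n"
            thus "norm (H w - H z) \<le> e / 2" using d(2)[of w z] z r elim by (auto simp: dist_norm intro: less_imp_le)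
          qed
          thus "dist (Hn n z / of_real (m n)) (H z) < e" using e by (simp add: dist_norm)
        qed
      qed
    qed
    have ev: "\<forall>\<^sub>F n in sequentially. continuous_on (cball z0 (r/2)) (\<lambda>z. Hn n z / of_real (m n)) \<and> (\<lambda>z. Hn n z / of_real (m n)) holomorphic_on ball z0 (r/2)"
    proof (intro always_eventually allI conjI)
      fix n
      have 1: "(\<lambda>z. Hn n z / of_real (m n)) holomorphic_on ball z0 r"
        using m(1)[of n] by (intro holomorphic_intros Hhol) auto
      show "continuous_on (cball z0 (r/2)) (\<lambda>z. Hn n z / of_real (m n))"
        by (rule continuous_on_subset[OF holomorphic_on_imp_continuous_on[OF 1]]) (use r in auto)
      show "(\<lambda>z. Hn n z / of_real (m n)) holomorphic_on ball z0 (r/2)"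
        by (rule holomorphic_on_subset[OF 1]) (use r in auto)
    qed
    have "H holomorphic_on ball z0 (r/2)" using holomorphic_uniform_limit[OF ev ul] by auto
    thus ?thesis using r by (simp add: holomorphic_on_imp_differentiable_at)
  qed
  thus ?thesis using field_differentiable_at_within holomorphic_on_def by blast
qed

section \<open>The regularised Cauchy kernel\<close>

text \<open>A smooth replacement for the kernel \<open>1 / z\<close>. Its \<open>dbar\<close> is a multiple of the Poisson kernel, that is, an
  approximate identity.\<close>
definition cker :: "real \<Rightarrow> complex \<Rightarrow> complex" where
  "cker e z = cnj z * inverse (z * cnj z + of_real (e\<^sup>2))"

text \<open>The stereographic area density; up to scaling it is the \<open>dbar\<close> of the regularised kernel.\<close>
definition poisson :: "complex \<Rightarrow> real" where "poisson v = 1 / (1 + (norm v)\<^sup>2)\<^sup>2"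

definition c0 :: real where "c0 = (LINT v|lborel. poisson v)"

lemma cker_denom: "z * cnj z + of_real (e\<^sup>2) = of_real ((norm z)\<^sup>2 + e\<^sup>2)"
  by (simp add: complex_norm_square[symmetric])

lemma cker_denom_nz: "e > 0 ==> z * cnj z + of_real (e\<^sup>2) \<noteq> 0"
  unfolding cker_denom of_real_eq_0_iff by (smt (verit) zero_less_power2 zero_le_power2)

lemma Ck_fun_cker: assumes "e > 0" shows "Ck_fun k (cker e)"
  unfolding cker_def[abs_def]
  by (intro Ck_fun_mult Ck_fun_inverse Ck_fun_add Ck_fun_const Ck_fun_linear bounded_linear_cnj bounded_linear_ident cker_denom_nz assms)

lemma dbar_cker: assumes e: "e > 0" shows "dbar (cker e) z = of_real (e\<^sup>2 / ((norm z)\<^sup>2 + e\<^sup>2)\<^sup>2)"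
proof -
  define N where "N = z * cnj z + of_real (e\<^sup>2)"
  have N: "N \<noteq> 0" unfolding N_def by (rule cker_denom_nz[OF e])
  have 1: "((\<lambda>z. z * cnj z + of_real (e\<^sup>2)) has_derivative (\<lambda>v. z * cnj v + v * cnj z)) (at z)"
    by (auto intro!: derivative_eq_intros bounded_linear_imp_has_derivative bounded_linear_cnj)
  have "(cker e has_derivative (\<lambda>v. cnj z * - (inverse N * (z * cnj v + v * cnj z) * inverse N) + cnj v * inverse N)) (at z)"
    unfolding cker_def[abs_def] N_def
    by (intro has_derivative_mult Deriv.has_derivative_inverse 1 cker_denom_nz e bounded_linear_imp_has_derivative bounded_linear_cnj)
  from dbar_eq[OF this] have "dbar (cker e) z = ((cnj z * - (inverse N * (z * cnj 1 + 1 * cnj z) * inverse N) + cnj 1 * inverse N)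
      + \<i> * (cnj z * - (inverse N * (z * cnj \<i> + \<i> * cnj z) * inverse N) + cnj \<i> * inverse N)) / 2" .
  also have "\<dots> = (inverse N * (N - z * cnj z)) * inverse N"
    using N by (simp add: field_simps) (simp add: algebra_simps)?
  also have "N - z * cnj z = of_real (e\<^sup>2)" by (simp add: N_def)
  also have "inverse N * of_real (e\<^sup>2) * inverse N = of_real (e\<^sup>2 / ((norm z)\<^sup>2 + e\<^sup>2)\<^sup>2)"
    unfolding N_def cker_denom by (simp add: power2_eq_square divide_inverse mult_ac)
  finally show ?thesis .
qed

text \<open>The bound is the modulus of \<open>1 / x - 1 / y\<close> and does not depend on \<open>e\<close>, so the estimates for the
  Cauchy transform hold uniformly for its regularisations.\<close>
lemma cker_lipschitz:
  assumes e: "e > 0" and xy: "x \<noteq> 0" "y \<noteq> 0"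
  shows "norm (cker e x - cker e y) \<le> norm (x - y) / (norm x * norm y)"
proof -
  define X where "X = (norm x)\<^sup>2 + e\<^sup>2"
  define Y where "Y = (norm y)\<^sup>2 + e\<^sup>2"
  define s where "s = norm x * norm y + e\<^sup>2"
  have X: "X > 0" and Y: "Y > 0" using e by (auto simp: X_def Y_def intro: add_nonneg_pos)
  have s: "s > 0" using e by (auto simp: s_def intro: add_nonneg_pos)
  have sXY: "s\<^sup>2 \<le> X * Y"
  proof -
    have "X * Y - s\<^sup>2 = e\<^sup>2 * (norm x - norm y)\<^sup>2" by (simp add: X_def Y_def s_def power2_eq_square algebra_simps)
    thus ?thesis by (smt (verit) zero_le_mult_iff zero_le_power2)
  qed
  have "cker e x - cker e y = (cnj x * of_real Y - cnj y * of_real X) / of_real (X * Y)"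
    using X Y unfolding cker_def cker_denom X_def[symmetric] Y_def[symmetric] by (simp add: field_simps)
  also have "cnj x * of_real Y - cnj y * of_real X = cnj x * cnj y * (y - x) + of_real (e\<^sup>2) * cnj (x - y)"
    unfolding X_def Y_def cker_denom[symmetric] by (simp add: algebra_simps)
  finally have "norm (cker e x - cker e y) = norm (cnj x * cnj y * (y - x) + of_real (e\<^sup>2) * cnj (x - y)) / (X * Y)"
    using X Y by (simp add: norm_divide norm_mult)
  also have "\<dots> \<le> (s * norm (x - y)) / (X * Y)"
  proof (rule divide_right_mono)
    have "norm (cnj x * cnj y * (y - x) + of_real (e\<^sup>2) * cnj (x - y)) \<le> norm (cnj x * cnj y * (y - x)) + norm (of_real (e\<^sup>2) * cnj (x - y))"
      by (rule norm_triangle_ineq)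
    also have "\<dots> = s * norm (x - y)" unfolding s_def norm_mult complex_mod_cnj norm_of_real
      by (simp add: algebra_simps norm_minus_commute)
    finally show "norm (cnj x * cnj y * (y - x) + of_real (e\<^sup>2) * cnj (x - y)) \<le> s * norm (x - y)" .
  qed (use X Y in auto)
  also have "\<dots> \<le> (s * norm (x - y)) / s\<^sup>2"
    using sXY s X Y by (intro divide_left_mono mult_pos_pos) auto
  also have "\<dots> = norm (x - y) / s" using s by (simp add: power2_eq_square)
  also have "\<dots> \<le> norm (x - y) / (norm x * norm y)"
    using xy e s by (intro divide_left_mono mult_pos_pos) (auto simp: s_def)
  finally show ?thesis .
qed

lemma poisson_measurable [measurable]: "poisson \<in> borel_measurable borel"
  unfolding poisson_def[abs_def] by measurable

lemma poisson_pos: "poisson v > 0"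
proof -
  have "1 + (norm v)\<^sup>2 > 0" by (simp add: add_pos_nonneg)
  thus ?thesis by (simp add: poisson_def)
qed

lemma poisson_integrable: "integrable lborel poisson"
proof -
  have le: "ennreal (poisson v) \<le> ennreal (radk (3/2) v)" if "v \<noteq> 0" for v
  proof (rule ennreal_leI)
    define x where "x = norm v * max (1/2) (norm v)"
    have x0: "x > 0" using that by (auto simp: x_def intro!: mult_pos_pos)
    have "norm v / 2 \<le> 1 + (norm v)\<^sup>2"
    proof -
      have "norm v * 2 \<le> 1 + (norm v)\<^sup>2" using sum_squares_bound[of "norm v" 1] by (simp add: mult.commute)
      moreover have "norm v \<ge> 0" "(norm v)\<^sup>2 \<ge> 0" by simp_all
      ultimately show ?thesis by linarith
    qed
    hence x1: "x \<le> 1 + (norm v)\<^sup>2" by (auto simp: x_def max_def power2_eq_square)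
    have g1: "1 + (norm v)\<^sup>2 \<ge> 1" by simp
    hence g0: "1 + (norm v)\<^sup>2 > 0" by linarith
    have "x powr (3/2) \<le> (1 + (norm v)\<^sup>2) powr (3/2)" using x0 x1 by (intro powr_mono2) auto
    also have "\<dots> \<le> (1 + (norm v)\<^sup>2) powr 2" using g1 by (intro powr_mono) auto
    also have "\<dots> = (1 + (norm v)\<^sup>2)\<^sup>2" using g1 by simp
    finally have "x powr (3/2) \<le> (1 + (norm v)\<^sup>2)\<^sup>2" .
    hence "1 / (1 + (norm v)\<^sup>2)\<^sup>2 \<le> 1 / x powr (3/2)" using x0 g0 by (intro divide_left_mono mult_pos_pos zero_less_power) auto
    thus "poisson v \<le> radk (3/2) v" by (simp add: poisson_def radk_def x_def[symmetric] powr_minus_divide)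
  qed
  have "(\<integral>\<^sup>+ v. ennreal (poisson v) \<partial>lborel) \<le> (\<integral>\<^sup>+ v. ennreal (radk (3/2) v) \<partial>lborel)"
    by (rule nn_integral_mono_AE) (use AE_lborel_singleton[of "0::complex"] le in \<open>auto elim!: eventually_mono\<close>)
  also have "\<dots> < \<infinity>" by (rule radk_integral_finite) auto
  finally show ?thesis
    by (intro integrableI_nonneg) (auto intro: less_imp_le[OF poisson_pos])
qed

lemma c0_pos: "c0 > 0"
proof -
  have "c0 \<ge> 0" unfolding c0_def by (intro Bochner_Integration.integral_nonneg) (simp add: less_imp_le[OF poisson_pos])
  moreover have "c0 \<noteq> 0"
  proof
    assume "c0 = 0"
    hence "AE v in lborel. poisson v = 0"
      unfolding c0_def using poisson_integrable
      by (subst (asm) integral_nonneg_eq_0_iff_AE) (auto simp: less_imp_le[OF poisson_pos])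
    hence "AE v::complex in lborel. False" by eventually_elim (use poisson_pos in \<open>simp add: less_le\<close>)
    hence "emeasure lborel (UNIV :: complex set) = 0" by (subst (asm) AE_iff_measurable[OF _ refl]) auto
    thus False by simp
  qed
  ultimately show ?thesis by simp
qed

lemma integral_lborel_affine_complex:
  fixes g :: "complex \<Rightarrow> complex"
  assumes [measurable]: "g \<in> borel_measurable borel" and d: "d \<noteq> 0"
  shows "(LINT w|lborel. g w) = of_real (d\<^sup>2) * (LINT v|lborel. g (z + of_real d * v))"
proof -
  have "(LINT w|lborel. g w) = (LINT w|(density (distr lborel borel (\<lambda>x. z + d *\<^sub>R x)) (\<lambda>_. ennreal (\<bar>d\<bar> ^ DIM(complex)))). g w)"
    using lborel_affine[OF d, of z] by simp
  also have "\<dots> = (LINT w|distr lborel borel (\<lambda>x. z + d *\<^sub>R x). (\<bar>d\<bar> ^ DIM(complex)) *\<^sub>R g w)"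
    by (rule integral_density) auto
  also have "\<dots> = (LINT v|lborel. (\<bar>d\<bar> ^ DIM(complex)) *\<^sub>R g (z + d *\<^sub>R v))"
    by (rule integral_distr) auto
  also have "\<dots> = (LINT v|lborel. of_real (d\<^sup>2) * g (z + of_real d * v))"
    by (simp add: scaleR_conv_of_real)
  also have "\<dots> = of_real (d\<^sup>2) * (LINT v|lborel. g (z + of_real d * v))" by simp
  finally show ?thesis .
qed

lemma dbar_cker_scale: assumes "e > 0" shows "of_real (e\<^sup>2) * dbar (cker e) (of_real e * v) = of_real (poisson v)"
proof -
  have "(norm (of_real e * v))\<^sup>2 + e\<^sup>2 = e\<^sup>2 * (1 + (norm v)\<^sup>2)" by (simp add: norm_mult power_mult_distrib algebra_simps)
  hence "e\<^sup>2 * (e\<^sup>2 / ((norm (of_real e * v))\<^sup>2 + e\<^sup>2)\<^sup>2) = poisson v"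
    using assms by (simp add: poisson_def power_mult_distrib power2_eq_square[of "e\<^sup>2"] )
  thus ?thesis unfolding dbar_cker[OF assms] by (metis of_real_mult)
qed

text \<open>By Fubini, pairing the smoothed function with a test function smooths the test function.\<close>
lemma conv_pairing:
  assumes A: "integrable lborel A" "\<And>w. w \<notin> cball 0 R ==> A w = 0"
    and \<psi>: "continuous_on UNIV \<psi>" "\<And>w. w \<notin> cball 0 R ==> \<psi> w = 0" and e: "e > 0"
  shows "(LINT z|lborel. conv A (dbar (cker e)) z * \<psi> z) = (LINT w|lborel. A w * (LINT v|lborel. of_real (poisson v) * \<psi> (w + of_real e * v)))"
proof -
  define \<kappa> where "\<kappa> = dbar (cker e)"
  have \<kappa>: "\<kappa> = (\<lambda>z. of_real (e\<^sup>2 / ((norm z)\<^sup>2 + e\<^sup>2)\<^sup>2))" by (rule ext) (simp add: \<kappa>_def dbar_cker[OF e])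
  have \<kappa>m [measurable]: "\<kappa> \<in> borel_measurable borel" unfolding \<kappa> by measurable
  have \<psi>m [measurable]: "\<psi> \<in> borel_measurable borel" using borel_measurable_continuous_onI[OF \<psi>(1)] .
  have Am [measurable]: "A \<in> borel_measurable borel" using A(1) by simp
  have \<kappa>b: "norm (\<kappa> z) \<le> 1 / e\<^sup>2" for z
  proof -
    have "e\<^sup>2 / ((norm z)\<^sup>2 + e\<^sup>2)\<^sup>2 \<le> e\<^sup>2 / (e\<^sup>2)\<^sup>2"
      using e by (intro divide_left_mono power_mono mult_pos_pos zero_less_power add_nonneg_pos) auto
    moreover have "norm (\<kappa> z) = e\<^sup>2 / ((norm z)\<^sup>2 + e\<^sup>2)\<^sup>2" unfolding \<kappa> norm_of_real by simp
    moreover have "e\<^sup>2 / (e\<^sup>2)\<^sup>2 = 1 / e\<^sup>2" using e by (simp add: power2_eq_square)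
    ultimately show ?thesis by simp
  qed
  have \<psi>i: "integrable lborel \<psi>"
  proof -
    have "integrable lborel (\<lambda>x. indicator (cball 0 R) x *\<^sub>R \<psi> x)"
      by (rule borel_integrable_compact) (auto intro: continuous_on_subset[OF \<psi>(1)])
    moreover have "(\<lambda>x. indicator (cball 0 R) x *\<^sub>R \<psi> x) = \<psi>" using \<psi>(2) by (auto simp: indicator_def fun_eq_iff)
    ultimately show ?thesis by simp
  qed
  have int: "integrable (lborel \<Otimes>\<^sub>M lborel) (\<lambda>(z, w). A w * \<kappa> (z - w) * \<psi> z)"
  proof (rule lborel_pair.Fubini_integrable)
    show "(\<lambda>(z, w). A w * \<kappa> (z - w) * \<psi> z) \<in> borel_measurable (lborel \<Otimes>\<^sub>M lborel)" by measurable
    have bd: "norm (A w * \<kappa> (z - w) * \<psi> z) \<le> norm (A w) * (1 / e\<^sup>2 * norm (\<psi> z))" for z w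
      unfolding norm_mult mult.assoc by (intro mult_left_mono mult_right_mono \<kappa>b) auto
    have iw: "integrable lborel (\<lambda>w. A w * \<kappa> (z - w) * \<psi> z)" for z
      by (rule Bochner_Integration.integrable_bound[of _ "\<lambda>w. norm (A w) * (1 / e\<^sup>2 * norm (\<psi> z))"])
         (use A(1) bd in \<open>auto intro!: AE_I2\<close>)
    show "AE z in lborel. integrable lborel (\<lambda>w. case (z, w) of (z, w) \<Rightarrow> A w * \<kappa> (z - w) * \<psi> z)" using iw by simp
    show "integrable lborel (\<lambda>z. LINT w|lborel. norm (case (z, w) of (z, w) \<Rightarrow> A w * \<kappa> (z - w) * \<psi> z))"
    proof (rule Bochner_Integration.integrable_bound[of _ "\<lambda>z. (LINT w|lborel. norm (A w)) * (1 / e\<^sup>2) * norm (\<psi> z)"])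
      show "integrable lborel (\<lambda>z. (LINT w|lborel. norm (A w)) * (1 / e\<^sup>2) * norm (\<psi> z))" using \<psi>i by simp
      show "AE z in lborel. norm (LINT w|lborel. norm (case (z, w) of (z, w) \<Rightarrow> A w * \<kappa> (z - w) * \<psi> z)) \<le> norm ((LINT w|lborel. norm (A w)) * (1 / e\<^sup>2) * norm (\<psi> z))"
      proof (rule AE_I2)
        fix z :: complex
        have "(LINT w|lborel. norm (A w * \<kappa> (z - w) * \<psi> z)) \<le> (LINT w|lborel. norm (A w) * (1 / e\<^sup>2 * norm (\<psi> z)))"
          using iw[of z] A(1) bd by (intro integral_mono) auto
        also have "\<dots> = (LINT w|lborel. norm (A w)) * (1 / e\<^sup>2 * norm (\<psi> z))" by simp
        finally show "norm (LINT w|lborel. norm (case (z, w) of (z, w) \<Rightarrow> A w * \<kappa> (z - w) * \<psi> z)) \<le> norm ((LINT w|lborel. norm (A w)) * (1 / e\<^sup>2) * norm (\<psi> z))"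
          by (simp add: mult.assoc abs_of_nonneg)
      qed
    qed measurable
  qed
  have "(LINT z|lborel. conv A \<kappa> z * \<psi> z) = (LINT z|lborel. (LINT w|lborel. A w * \<kappa> (z - w) * \<psi> z))"
    by (simp add: conv_def)
  also have "\<dots> = (LINT w|lborel. (LINT z|lborel. A w * \<kappa> (z - w) * \<psi> z))"
    using lborel_pair.Fubini_integral[OF int] by simp
  also have "\<dots> = (LINT w|lborel. A w * (LINT v|lborel. of_real (poisson v) * \<psi> (w + of_real e * v)))"
  proof (rule Bochner_Integration.integral_cong)
    fix w :: complex
    have "(LINT z|lborel. A w * \<kappa> (z - w) * \<psi> z) = A w * (LINT z|lborel. \<kappa> (z - w) * \<psi> z)"
      by (simp add: mult.assoc)
    also have "(LINT z|lborel. \<kappa> (z - w) * \<psi> z) = of_real (e\<^sup>2) * (LINT v|lborel. \<kappa> ((w + of_real e * v) - w) * \<psi> (w + of_real e * v))"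
      by (rule integral_lborel_affine_complex) (use e in \<open>measurable, auto\<close>)
    also have "\<dots> = (LINT v|lborel. of_real (e\<^sup>2) * (\<kappa> ((w + of_real e * v) - w) * \<psi> (w + of_real e * v)))" by simp
    also have "\<dots> = (LINT v|lborel. of_real (poisson v) * \<psi> (w + of_real e * v))"
      using dbar_cker_scale[OF e] by (simp add: \<kappa>_def mult.assoc[symmetric])
    finally show "(LINT z|lborel. A w * \<kappa> (z - w) * \<psi> z) = A w * (LINT v|lborel. of_real (poisson v) * \<psi> (w + of_real e * v))" .
  qed simp
  finally show ?thesis by (simp add: \<kappa>_def)
qed

lemma smoothing_limit:
  assumes A: "integrable lborel A" "\<And>w. w \<notin> cball 0 R ==> A w = 0"
    and \<psi>: "\<And>n. continuous_on UNIV (\<psi> n)" "\<And>n w. w \<notin> cball 0 R ==> \<psi> n w = 0"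
    and \<psi>': "continuous_on UNIV \<psi>'" and ul: "uniform_limit UNIV \<psi> \<psi>' sequentially" and bd: "\<And>n w. norm (\<psi> n w) \<le> B"
    and e: "\<And>n. e n > 0" "e \<longlonglongrightarrow> 0"
  shows "(\<lambda>n. LINT z|lborel. conv A (dbar (cker (e n))) z * \<psi> n z) \<longlonglongrightarrow> of_real c0 * (LINT w|lborel. A w * \<psi>' w)"
proof -
  have B: "B \<ge> 0" using bd[of 0 0] norm_ge_zero order_trans by blast
  have [measurable]: "\<psi> n \<in> borel_measurable borel" for n using borel_measurable_continuous_onI[OF \<psi>(1)] .
  have [measurable]: "\<psi>' \<in> borel_measurable borel" using borel_measurable_continuous_onI[OF \<psi>'] .
  have Am [measurable]: "A \<in> borel_measurable borel" using A(1) by simp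
  define J where "J = (\<lambda>n w. LINT v|lborel. of_real (poisson v) * \<psi> n (w + of_real (e n) * v))"
  have Jb: "norm (J n w) \<le> c0 * B" for n w
  proof -
    have "norm (J n w) \<le> (LINT v|lborel. poisson v * B)"
      unfolding J_def
    proof (rule Bochner_Integration.integral_norm_bound_integral)
      show "integrable lborel (\<lambda>v. complex_of_real (poisson v) * \<psi> n (w + complex_of_real (e n) * v))"
        by (rule Bochner_Integration.integrable_bound[of _ "\<lambda>v. poisson v * B"])
           (use poisson_integrable bd B in \<open>auto intro!: AE_I2 mult_left_mono simp: norm_mult abs_mult\<close>)
    qed (use poisson_integrable bd in \<open>auto simp: norm_mult abs_of_pos[OF poisson_pos] intro!: mult_left_mono less_imp_le[OF poisson_pos]\<close>)
    thus ?thesis by (simp add: c0_def)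
  qed
  have Jlim: "(\<lambda>n. J n w) \<longlonglongrightarrow> of_real c0 * \<psi>' w" for w
  proof -
    have "(\<lambda>n. J n w) \<longlonglongrightarrow> (LINT v|lborel. of_real (poisson v) * \<psi>' w)"
      unfolding J_def
    proof (rule integral_dominated_convergence[where w = "\<lambda>v. poisson v * B"])
      show "integrable lborel (\<lambda>v. poisson v * B)" using poisson_integrable by simp
      show "AE v in lborel. norm (complex_of_real (poisson v) * \<psi> n (w + complex_of_real (e n) * v)) \<le> poisson v * B" for n
        using bd by (auto intro!: AE_I2 mult_left_mono less_imp_le[OF poisson_pos] simp: norm_mult abs_of_pos[OF poisson_pos])
      show "AE v in lborel. (\<lambda>n. complex_of_real (poisson v) * \<psi> n (w + complex_of_real (e n) * v)) \<longlonglongrightarrow> complex_of_real (poisson v) * \<psi>' w"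
      proof (rule AE_I2)
        fix v :: complex
        have "(\<lambda>n. w + complex_of_real (e n) * v) \<longlonglongrightarrow> w + of_real 0 * v" by (intro tendsto_intros e)
        hence 1: "(\<lambda>n. w + complex_of_real (e n) * v) \<longlonglongrightarrow> w" by simp
        have "(\<lambda>n. \<psi>' (w + complex_of_real (e n) * v)) \<longlonglongrightarrow> \<psi>' w"
          by (rule continuous_on_tendsto_compose[OF \<psi>' 1]) auto
        moreover have "(\<lambda>n. \<psi> n (w + complex_of_real (e n) * v) - \<psi>' (w + complex_of_real (e n) * v)) \<longlonglongrightarrow> 0"
        proof (rule LIMSEQ_I)
          fix r :: real assume "r > 0"
          from uniform_limitD[OF ul this] obtain N where "\<And>n x. n \<ge> N ==> dist (\<psi> n x) (\<psi>' x) < r"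
            unfolding eventually_sequentially by auto
          thus "\<exists>no. \<forall>n\<ge>no. norm (\<psi> n (w + complex_of_real (e n) * v) - \<psi>' (w + complex_of_real (e n) * v) - 0) < r"
            by (auto simp: dist_norm)
        qed
        ultimately have "(\<lambda>n. (\<psi> n (w + complex_of_real (e n) * v) - \<psi>' (w + complex_of_real (e n) * v)) + \<psi>' (w + complex_of_real (e n) * v)) \<longlonglongrightarrow> 0 + \<psi>' w"
          by (intro tendsto_add)
        hence "(\<lambda>n. \<psi> n (w + complex_of_real (e n) * v)) \<longlonglongrightarrow> \<psi>' w" by simp
        thus "(\<lambda>n. complex_of_real (poisson v) * \<psi> n (w + complex_of_real (e n) * v)) \<longlonglongrightarrow> complex_of_real (poisson v) * \<psi>' w"
          by (intro tendsto_intros)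
      qed
    qed measurable
    also have "(LINT v|lborel. of_real (poisson v) * \<psi>' w) = of_real c0 * \<psi>' w"
      unfolding c0_def using poisson_integrable by simp
    finally show ?thesis .
  qed
  have "(\<lambda>n. LINT w|lborel. A w * J n w) \<longlonglongrightarrow> (LINT w|lborel. A w * (of_real c0 * \<psi>' w))"
  proof (rule integral_dominated_convergence[where w = "\<lambda>w. norm (A w) * (c0 * B)"])
    show "integrable lborel (\<lambda>w. norm (A w) * (c0 * B))" using A(1) by simp
    show "AE w in lborel. norm (A w * J n w) \<le> norm (A w) * (c0 * B)" for n
      using Jb by (auto intro!: AE_I2 mult_left_mono simp: norm_mult)
    show "AE w in lborel. (\<lambda>n. A w * J n w) \<longlonglongrightarrow> A w * (of_real c0 * \<psi>' w)"
      by (intro AE_I2 tendsto_intros Jlim)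
    show "(\<lambda>w. A w * J n w) \<in> borel_measurable lborel" for n
      unfolding J_def by measurable
  qed measurable
  also have "(LINT w|lborel. A w * (of_real c0 * \<psi>' w)) = of_real c0 * (LINT w|lborel. A w * \<psi>' w)"
    by (simp only: mult.left_commute[of _ "complex_of_real c0"] integral_mult_right_zero)
  finally show ?thesis unfolding J_def using conv_pairing[OF A \<psi> e(1)] by simp
qed

section \<open>Solving the equation on one line\<close>

definition hoelder_const :: "real \<Rightarrow> real \<Rightarrow> real" where
  "hoelder_const q K = (K + 2 * enn2real (\<integral>\<^sup>+ v. ennreal (radk (q / (q - 1)) v) \<partial>lborel)) / c0"

lemma conv_cker_hoelder:
  assumes A: "integrable lborel A" "\<And>w. w \<notin> cball 0 L ==> A w = 0" and q: "q > 2" and K: "K \<ge> 0"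
    and bd: "(\<integral>\<^sup>+ w. ennreal (norm (A w) powr q) \<partial>lborel) \<le> ennreal K" and e: "e > 0"
  shows "norm (conv A (cker e) z - conv A (cker e) z') \<le> hoelder_const q K * c0 * norm (z - z') powr (1 - 2 / q)"
proof (cases "z = z'")
  case False
  define t where "t = q / (q - 1)"
  define \<alpha> where "\<alpha> = 1 - 2 / q"
  have t: "1 < t" "t < 2" using q by (auto simp: t_def field_simps)
  have conj: "1/q + 1/t = 1" using q by (simp add: t_def field_simps)
  have \<alpha>t: "\<alpha> = 2 / t - 1" using q by (simp add: t_def \<alpha>_def field_simps)
  define d where "d = norm (z - z')"
  have d: "d > 0" using False by (simp add: d_def)
  have Am [measurable]: "A \<in> borel_measurable borel" using A(1) by simp
  have ck: "continuous_on UNIV (cker e)" using Ck_fun_continuous[OF Ck_fun_cker[OF e, of 0]] .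
  have int: "integrable lborel (\<lambda>w. A w * cker e (z - w))" for z by (rule integrable_conv[OF A ck])
  define I where "I = (\<integral>\<^sup>+ v. ennreal (radk t v) \<partial>lborel)"
  have I: "I < \<infinity>" unfolding I_def by (rule radk_integral_finite[OF t])
  have "conv A (cker e) z - conv A (cker e) z' = (LINT w|lborel. A w * cker e (z - w) - A w * cker e (z' - w))"
    unfolding conv_def using int by simp
  hence "ennreal (norm (conv A (cker e) z - conv A (cker e) z')) \<le> (\<integral>\<^sup>+ w. ennreal (norm (A w * cker e (z - w) - A w * cker e (z' - w))) \<partial>lborel)"
    using integral_norm_bound_ennreal[of lborel "\<lambda>w. A w * cker e (z - w) - A w * cker e (z' - w)"] int by simp
  also have "\<dots> \<le> (\<integral>\<^sup>+ w. ennreal (d powr \<alpha>) * (ennreal (norm (A w) powr q) + ennreal ((d powr (1 - \<alpha>) / (norm (z - w) * norm (z' - w))) powr t)) \<partial>lborel)"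
  proof (rule nn_integral_mono_AE)
    show "AE w in lborel. ennreal (norm (A w * cker e (z - w) - A w * cker e (z' - w))) \<le>
      ennreal (d powr \<alpha>) * (ennreal (norm (A w) powr q) + ennreal ((d powr (1 - \<alpha>) / (norm (z - w) * norm (z' - w))) powr t))"
      using AE_lborel_singleton[of z] AE_lborel_singleton[of z']
    proof eventually_elim
      case (elim w)
      have "norm (A w * cker e (z - w) - A w * cker e (z' - w)) = norm (A w) * norm (cker e (z - w) - cker e (z' - w))"
        by (simp add: norm_mult[symmetric] algebra_simps)
      also have "\<dots> \<le> norm (A w) * (d / (norm (z - w) * norm (z' - w)))"
        using cker_lipschitz[OF e, of "z - w" "z' - w"] elim by (intro mult_left_mono) (auto simp: d_def)
      also have "d = d powr \<alpha> * d powr (1 - \<alpha>)" using d by (simp add: powr_add[symmetric])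
      finally have "norm (A w * cker e (z - w) - A w * cker e (z' - w)) \<le> d powr \<alpha> * (norm (A w) * (d powr (1 - \<alpha>) / (norm (z - w) * norm (z' - w))))"
        by (simp add: mult_ac)
      also have "\<dots> \<le> d powr \<alpha> * (norm (A w) powr q + (d powr (1 - \<alpha>) / (norm (z - w) * norm (z' - w))) powr t)"
        using q t conj by (intro mult_left_mono Young_powr) auto
      finally have "ennreal (norm (A w * cker e (z - w) - A w * cker e (z' - w))) \<le> ennreal (d powr \<alpha> * (norm (A w) powr q + (d powr (1 - \<alpha>) / (norm (z - w) * norm (z' - w))) powr t))"
        by (rule ennreal_leI)
      thus ?case by (simp add: ennreal_mult)
    qed
  qed
  also have "\<dots> = ennreal (d powr \<alpha>) * ((\<integral>\<^sup>+ w. ennreal (norm (A w) powr q) \<partial>lborel) + (\<integral>\<^sup>+ w. ennreal ((d powr (1 - \<alpha>) / (norm (z - w) * norm (z' - w))) powr t) \<partial>lborel))"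
    by (subst nn_integral_cmult, measurable) (subst nn_integral_add, measurable)
  also have "\<dots> \<le> ennreal (d powr \<alpha>) * (ennreal K + 2 * I)"
    unfolding I_def d_def by (intro mult_left_mono add_mono bd kernel_integral[OF t False \<alpha>t]) auto
  also have "2 * I = ennreal (2 * enn2real I)" using I by (simp add: ennreal_mult)
  also have "ennreal K + ennreal (2 * enn2real I) = ennreal (K + 2 * enn2real I)"
    using K by (intro ennreal_plus[symmetric]) auto
  also have "ennreal (d powr \<alpha>) * ennreal (K + 2 * enn2real I) = ennreal (d powr \<alpha> * (K + 2 * enn2real I))"
    using K by (intro ennreal_mult[symmetric]) auto
  finally have "norm (conv A (cker e) z - conv A (cker e) z') \<le> d powr \<alpha> * (K + 2 * enn2real I)"
    using K by (subst (asm) ennreal_le_iff) auto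
  thus ?thesis using c0_pos by (simp add: hoelder_const_def I_def t_def d_def \<alpha>_def mult.commute)
qed simp

lemma extend_by_zero_continuous:
  fixes g \<phi> :: "complex \<Rightarrow> complex"
  assumes g: "continuous_on (ball c R) g" and \<phi>: "continuous_on UNIV \<phi>" and sub: "closure {z. \<phi> z \<noteq> 0} \<subseteq> ball c R"
  shows "continuous_on UNIV (\<lambda>z. (if z \<in> ball c R then g z else 0) * \<phi> z)"
proof -
  have "continuous_on (ball c R \<union> - closure {z. \<phi> z \<noteq> 0}) (\<lambda>z. (if z \<in> ball c R then g z else 0) * \<phi> z)"
  proof (rule continuous_on_open_Un)
    show "continuous_on (ball c R) (\<lambda>z. (if z \<in> ball c R then g z else 0) * \<phi> z)"
      by (rule continuous_on_eq[of _ "\<lambda>z. g z * \<phi> z"]) (auto intro!: continuous_intros g continuous_on_subset[OF \<phi>])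
    have "\<phi> z = 0" if "z \<in> - closure {z. \<phi> z \<noteq> 0}" for z using that closure_subset[of "{z. \<phi> z \<noteq> 0}"] by blast
    note \<phi>0 = this
    show "continuous_on (- closure {z. \<phi> z \<noteq> 0}) (\<lambda>z. (if z \<in> ball c R then g z else 0) * \<phi> z)"
    proof (rule continuous_on_eq[of _ "\<lambda>_. 0"])
      fix z assume "z \<in> - closure {z. \<phi> z \<noteq> 0}"
      hence "\<phi> z = 0" by (rule \<phi>0)
      thus "0 = (if z \<in> ball c R then g z else 0) * \<phi> z" by (simp only: mult_zero_right)
    qed (rule continuous_on_const)
  qed auto
  moreover have "ball c R \<union> - closure {z. \<phi> z \<noteq> 0} = UNIV" using sub by blast
  ultimately show ?thesis by simp
qed

lemma compact_support_integrable:
  fixes \<psi> :: "complex \<Rightarrow> complex"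
  assumes "continuous_on UNIV \<psi>" "\<And>w. w \<notin> cball c R ==> \<psi> w = 0"
  shows "integrable lborel \<psi>"
proof -
  have "integrable lborel (\<lambda>x. indicator (cball c R) x *\<^sub>R \<psi> x)"
    by (rule borel_integrable_compact) (auto intro: continuous_on_subset[OF assms(1)])
  moreover have "(\<lambda>x. indicator (cball c R) x *\<^sub>R \<psi> x) = \<psi>" using assms(2) by (auto simp: indicator_def fun_eq_iff)
  ultimately show ?thesis by simp
qed

lemma dbar_exp_mult:
  assumes v: "Ck_fun 1 v" and \<phi>: "Ck_fun 1 \<phi>"
  shows "dbar (\<lambda>z. exp (- v z) * \<phi> z) z = exp (- v z) * (dbar \<phi> z - dbar v z * \<phi> z)"
proof -
  have hv: "(v has_derivative frechet_derivative v (at z)) (at z)" and h\<phi>: "(\<phi> has_derivative frechet_derivative \<phi> (at z)) (at z)"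
    using v \<phi> by (auto intro!: Ck_fun_has_derivative[of 0])
  have he: "(exp has_derivative (\<lambda>h. exp (- v z) * h)) (at (- v z))"
    using DERIV_exp[of "- v z"] by (simp add: has_field_derivative_def)
  have "((\<lambda>z. exp (- v z)) has_derivative (\<lambda>h. exp (- v z) * - frechet_derivative v (at z) h)) (at z)"
    using has_derivative_compose[OF has_derivative_minus[OF hv] he] by simp
  from dbar_eq[OF has_derivative_mult[OF this h\<phi>]] show ?thesis
    unfolding dbar_eq[OF hv] dbar_eq[OF h\<phi>]
    by (elim ssubst) (simp add: diff_divide_distrib add_divide_distrib algebra_simps)
qed

lemma dbar_support: "closure {z. dbar \<phi> z \<noteq> 0} \<subseteq> closure {z. \<phi> z \<noteq> 0}"
proof (rule closure_minimal)
  show "{z. dbar \<phi> z \<noteq> 0} \<subseteq> closure {z. \<phi> z \<noteq> 0}"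
  proof
    fix z assume z: "z \<in> {z. dbar \<phi> z \<noteq> 0}"
    show "z \<in> closure {z. \<phi> z \<noteq> 0}"
    proof (rule ccontr)
      assume n: "z \<notin> closure {z. \<phi> z \<noteq> 0}"
      have "(\<phi> has_derivative (\<lambda>v. 0)) (at z)"
      proof (rule has_derivative_transform_within_open[of "\<lambda>_. 0"])
        show "open (- closure {z. \<phi> z \<noteq> 0})" by auto
      qed (use n closure_subset[of "{z. \<phi> z \<noteq> 0}"] in auto)
      hence "dbar \<phi> z = 0" by (simp add: dbar_eq)
      thus False using z by simp
    qed
  qed
qed simp

text \<open>The convolutions of \<open>A\<close> with the regularised kernels are smooth and uniformly Hoelder continuous. Hence a
  subsequence converges uniformly, and its limit serves as \<open>V\<close>; no integral with the singular kernel is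
  needed. Testing the weak equation with \<open>exp (- V\<^sub>n) * \<phi>\<close> and passing to the limit gives \<open>dbar (exp (- V) * g) = 0\<close>
  in the weak sense.\<close>
lemma weak_to_exp_borel:
  assumes A: "A \<in> borel_measurable borel" "\<And>w. w \<notin> ball c R ==> A w = 0" and q: "q > 2" and K: "K \<ge> 0"
    and bd: "(\<integral>\<^sup>+ w. ennreal (norm (A w) powr q) \<partial>lborel) \<le> ennreal K"
    and R: "R > 0" and g: "continuous_on (ball c R) g"
    and weak: "\<And>\<phi>. test_fun (ball c R) \<phi> ==>
       - (LINT z|lborel. (if z \<in> ball c R then g z else 0) * dbar \<phi> z) = (LINT z|lborel. A z * ((if z \<in> ball c R then g z else 0) * \<phi> z))"
  obtains V where "V c = 0" "\<And>x y. x \<in> ball c R ==> y \<in> ball c R ==> norm (V x - V y) \<le> hoelder_const q K * dist x y powr (1 - 2 / q)"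
    "(\<lambda>s. exp (- V s) * g s) holomorphic_on ball c R"
proof -
  define \<alpha> where "\<alpha> = 1 - 2 / q"
  have \<alpha>: "\<alpha> > 0" using q by (simp add: \<alpha>_def)
  define H where "H = hoelder_const q K"
  have H0: "H \<ge> 0" using K c0_pos by (simp add: H_def hoelder_const_def)
  define L where "L = norm c + R"
  have L: "ball c R \<subseteq> cball 0 L"
  proof
    fix w assume "w \<in> ball c R"
    hence "norm (w - c) < R" by (simp add: dist_norm norm_minus_commute)
    thus "w \<in> cball 0 L" using norm_triangle_sub[of w c] by (simp add: L_def)
  qed
  have Am [measurable]: "A \<in> borel_measurable borel" by fact
  have Asupp: "A w = 0" if "w \<notin> cball 0 L" for w using A(2) that L by blast
  have Aint: "integrable lborel A"
  proof (rule integrableI_bounded)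
    have "(\<integral>\<^sup>+ w. ennreal (norm (A w)) \<partial>lborel) \<le> (\<integral>\<^sup>+ w. indicator (ball c R) w + ennreal (norm (A w) powr q) \<partial>lborel)"
    proof (rule nn_integral_mono)
      fix w
      show "ennreal (norm (A w)) \<le> indicator (ball c R) w + ennreal (norm (A w) powr q)"
      proof (cases "w \<in> ball c R")
        case True
        have "norm (A w) \<le> 1 + norm (A w) powr q"
        proof (cases "norm (A w) \<le> 1")
          case False
          hence "norm (A w) powr 1 \<le> norm (A w) powr q" using q by (intro powr_mono) auto
          thus ?thesis using False by simp
        qed (simp add: add_increasing2)
        hence "ennreal (norm (A w)) \<le> ennreal (1 + norm (A w) powr q)" by (rule ennreal_leI)
        thus ?thesis using True by simp
      qed (use A(2) in simp)
    qed
    also have "\<dots> = emeasure lborel (ball c R) + (\<integral>\<^sup>+ w. ennreal (norm (A w) powr q) \<partial>lborel)"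
      by (subst nn_integral_add) (auto intro!: borel_measurable_indicator)
    also have "\<dots> < \<infinity>" using emeasure_bounded_finite[of "ball c R"] le_less_trans[OF bd ennreal_less_top]
      by (simp add: less_top ennreal_add_eq_top)
    finally show "(\<integral>\<^sup>+ w. ennreal (norm (A w)) \<partial>lborel) < \<infinity>" .
  qed simp
  define e where "e = (\<lambda>n. 1 / real (Suc n))"
  have e: "e n > 0" for n by (simp add: e_def)
  have elim: "e \<longlonglongrightarrow> 0" unfolding e_def using LIMSEQ_Suc[OF lim_const_over_n[of 1]] by simp
  define cc where "cc = complex_of_real c0"
  have cc: "cc \<noteq> 0" using c0_pos by (simp add: cc_def)
  define Vn where "Vn = (\<lambda>n z. inverse cc * conv A (cker (e n)) z + - (inverse cc * conv A (cker (e n)) c))"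
  have CV: "Ck_fun k (Vn n)" for k n
    unfolding Vn_def by (intro Ck_fun_add Ck_fun_mult Ck_fun_const Ck_fun_conv[OF Aint Asupp] Ck_fun_cker e)
  have dV: "dbar (Vn n) z = inverse cc * conv A (dbar (cker (e n))) z" for n z
  proof -
    have 1: "Ck_fun 1 (conv A (cker (e n)))" by (intro Ck_fun_conv[OF Aint Asupp] Ck_fun_cker e)
    have "(conv A (cker (e n)) has_derivative frechet_derivative (conv A (cker (e n))) (at z)) (at z)"
      by (rule Ck_fun_has_derivative[of 0]) (use 1 in simp)
    hence "(Vn n has_derivative (\<lambda>v. inverse cc * frechet_derivative (conv A (cker (e n))) (at z) v)) (at z)"
      unfolding Vn_def by (auto intro!: derivative_eq_intros)
    from dbar_eq[OF this] have "dbar (Vn n) z = inverse cc * dbar (conv A (cker (e n))) z"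
      by (elim ssubst) (simp add: dbar_def add_divide_distrib algebra_simps)
    thus ?thesis using dbar_conv[OF Aint Asupp Ck_fun_cker[OF e]] by simp
  qed
  have VH: "norm (Vn n x - Vn n y) \<le> H * norm (x - y) powr \<alpha>" for n x y
  proof -
    have "Vn n x - Vn n y = (conv A (cker (e n)) x - conv A (cker (e n)) y) / cc" by (simp add: Vn_def divide_inverse algebra_simps)
    hence "norm (Vn n x - Vn n y) = norm (conv A (cker (e n)) x - conv A (cker (e n)) y) / c0"
      using c0_pos by (simp add: norm_divide cc_def)
    also have "\<dots> \<le> (H * c0 * norm (x - y) powr \<alpha>) / c0"
      unfolding H_def \<alpha>_def using c0_pos by (intro divide_right_mono conv_cker_hoelder[OF Aint Asupp q K bd e]) auto
    finally show ?thesis using c0_pos by simp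
  qed
  have Vc: "Vn n c = 0" for n by (simp add: Vn_def)
  have Vb: "norm (Vn n x) \<le> H * R powr \<alpha>" if "x \<in> cball c R" for n x
  proof -
    have "norm (x - c) \<le> R" using that by (simp add: dist_norm norm_minus_commute)
    hence "norm (x - c) powr \<alpha> \<le> R powr \<alpha>" using \<alpha> by (intro powr_mono2) auto
    hence "H * norm (x - c) powr \<alpha> \<le> H * R powr \<alpha>" using H0 by (intro mult_left_mono) auto
    moreover have "norm (Vn n x) \<le> H * norm (x - c) powr \<alpha>" using VH[of n x c] by (simp add: Vc)
    ultimately show ?thesis by linarith
  qed
  obtain V \<rho> where V: "continuous_on (cball c R) V" "strict_mono (\<rho> :: nat \<Rightarrow> nat)"
    and Vlim: "\<And>e. 0 < e ==> \<exists>N. \<forall>n x. n \<ge> N \<and> x \<in> cball c R \<longrightarrow> norm (Vn (\<rho> n) x - V x) < e"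
  proof (rule Arzela_Ascoli[of "cball c R" Vn "H * R powr \<alpha>"])
    show "\<exists>d>0. \<forall>n y. y \<in> cball c R \<and> cmod (x - y) < d \<longrightarrow> cmod (Vn n x - Vn n y) < r" if "x \<in> cball c R" "0 < r" for x r
    proof (intro exI conjI allI impI)
      define d where "d = (r / (H + 1)) powr (1 / \<alpha>)"
      show "d > 0" using that H0 by (simp add: d_def)
      fix n y assume y: "y \<in> cball c R \<and> cmod (x - y) < d"
      have "norm (x - y) powr \<alpha> \<le> d powr \<alpha>" using y \<alpha> by (intro powr_mono2) auto
      also have "d powr \<alpha> = r / (H + 1)" using \<alpha> that H0 by (simp add: d_def powr_powr)
      finally have "H * norm (x - y) powr \<alpha> \<le> H * (r / (H + 1))" using H0 by (intro mult_left_mono) auto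
      also have "\<dots> < r" using that H0 by (simp add: field_simps)
      finally show "cmod (Vn n x - Vn n y) < r" using VH[of n x y] by linarith
    qed
  qed (use Vb that in auto)
  have Vpt: "(\<lambda>n. Vn (\<rho> n) x) \<longlonglongrightarrow> V x" if "x \<in> cball c R" for x
    by (rule LIMSEQ_I) (use Vlim that in blast)
  have "V c = 0" using LIMSEQ_unique[OF Vpt[of c] ] R by (simp add: Vc)
  moreover have "norm (V x - V y) \<le> H * dist x y powr \<alpha>" if "x \<in> ball c R" "y \<in> ball c R" for x y
  proof -
    have "(\<lambda>n. norm (Vn (\<rho> n) x - Vn (\<rho> n) y)) \<longlonglongrightarrow> norm (V x - V y)"
      using that by (intro tendsto_intros Vpt) (auto intro: less_imp_le)
    thus ?thesis by (rule LIMSEQ_le_const2) (use VH in \<open>auto simp: dist_norm\<close>)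
  qed
  moreover have "(\<lambda>s. exp (- V s) * g s) holomorphic_on ball c R"
  proof (rule weyl)
    have cV: "continuous_on (ball c R) V" by (rule continuous_on_subset[OF V(1)]) auto
    show ceg: "continuous_on (ball c R) (\<lambda>s. exp (- V s) * g s)" by (intro continuous_intros cV g)
    fix \<phi> assume \<phi>: "test_fun (ball c R) \<phi>"
    hence \<phi>C: "Ck_fun k \<phi>" for k by (simp add: test_fun_def)
    have \<phi>s: "closure {z. \<phi> z \<noteq> 0} \<subseteq> ball c R" "compact (closure {z. \<phi> z \<noteq> 0})" using \<phi> by (auto simp: test_fun_def)
    have \<phi>0: "\<phi> z = 0" if "z \<notin> ball c R" for z using \<phi>s that closure_subset[of "{z. \<phi> z \<noteq> 0}"] by blast
    have d\<phi>c: "continuous_on UNIV (dbar \<phi>)"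
    proof -
      have "continuous_on UNIV (\<lambda>z. frechet_derivative \<phi> (at z) v)" for v using \<phi>C[of 1] by simp
      thus ?thesis unfolding dbar_def[abs_def] by (intro continuous_intros) auto
    qed
    have d\<phi>s: "closure {z. dbar \<phi> z \<noteq> 0} \<subseteq> closure {z. \<phi> z \<noteq> 0}" by (rule dbar_support)
    define G where "G = (\<lambda>z. if z \<in> ball c R then g z else 0)"
    define En where "En = (\<lambda>n z. exp (- Vn (\<rho> n) z))"
    have En_cont: "continuous_on UNIV (En n)" for n
      unfolding En_def by (intro continuous_intros Ck_fun_continuous[OF CV])
    define \<psi> where "\<psi> = (\<lambda>n z. G z * \<phi> z * En n z)"
    define \<psi>' where "\<psi>' = (\<lambda>z. (if z \<in> ball c R then exp (- V z) * g z else 0) * \<phi> z)"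
    define \<theta> where "\<theta> = (\<lambda>n z. G z * dbar \<phi> z * En n z)"
    define \<theta>' where "\<theta>' = (\<lambda>z. (if z \<in> ball c R then exp (- V z) * g z else 0) * dbar \<phi> z)"
    have cG\<phi>: "continuous_on UNIV (\<lambda>z. G z * \<phi> z)" "continuous_on UNIV (\<lambda>z. G z * dbar \<phi> z)"
      unfolding G_def by (rule extend_by_zero_continuous[OF g Ck_fun_continuous[OF \<phi>C[of 0]] \<phi>s(1)],
        rule extend_by_zero_continuous[OF g d\<phi>c subset_trans[OF d\<phi>s \<phi>s(1)]])
    have c\<psi>: "continuous_on UNIV (\<psi> n)" "continuous_on UNIV (\<theta> n)" for n
      unfolding \<psi>_def \<theta>_def by (intro continuous_intros cG\<phi> En_cont)+
    have c\<psi>': "continuous_on UNIV \<psi>'" "continuous_on UNIV \<theta>'"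
      unfolding \<psi>'_def \<theta>'_def by (rule extend_by_zero_continuous[OF ceg Ck_fun_continuous[OF \<phi>C[of 0]] \<phi>s(1)],
        rule extend_by_zero_continuous[OF ceg d\<phi>c subset_trans[OF d\<phi>s \<phi>s(1)]])
    have G0: "G w = 0" if "w \<notin> ball c R" for w using that by (simp add: G_def)
    have \<psi>0: "\<psi> n w = 0" "\<theta> n w = 0" "\<psi>' w = 0" "\<theta>' w = 0" if "w \<notin> cball 0 L" for n w
    proof -
      have w: "w \<notin> ball c R" using that L by blast
      show "\<psi> n w = 0" "\<theta> n w = 0" "\<psi>' w = 0" "\<theta>' w = 0"
        using G0[OF w] w by (simp_all add: \<psi>_def \<theta>_def \<psi>'_def \<theta>'_def)
    qed
    have ulV: "uniform_limit (cball c R) (\<lambda>n. Vn (\<rho> n)) V sequentially"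
      unfolding uniform_limit_iff eventually_sequentially dist_norm using Vlim by metis
    have EnE: "uniform_limit (cball c R) En (\<lambda>z. exp (- V z)) sequentially"
      unfolding En_def
    proof (rule uniform_limit_compose_uniformly_continuous_on[OF ulV, of "cball 0 (H * R powr \<alpha>)"])
      show "uniformly_continuous_on (cball 0 (H * R powr \<alpha>)) (\<lambda>w::complex. exp (- w))"
        by (intro compact_uniformly_continuous continuous_intros) auto
    qed (use Vb in \<open>auto intro!: always_eventually\<close>)
    have ulim: "uniform_limit UNIV (\<lambda>n z. h z * En n z) (\<lambda>z. h z * exp (- V z)) sequentially"
      if h: "continuous_on UNIV h" "\<And>z. z \<notin> ball c R ==> h z = 0" for h :: "complex \<Rightarrow> complex"
    proof (rule uniform_limitI)
      fix r :: real assume r: "r > 0"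
      have "bounded (h ` cball c R)" by (intro compact_imp_bounded compact_continuous_image continuous_on_subset[OF h(1)]) auto
      then obtain B where B: "\<And>z. z \<in> cball c R ==> norm (h z) \<le> B" "B > 0" unfolding bounded_pos by (metis imageI)
      have "\<forall>\<^sub>F n in sequentially. \<forall>z\<in>cball c R. dist (En n z) (exp (- V z)) < r / B"
        using uniform_limitD[OF EnE, of "r / B"] r B by simp
      thus "\<forall>\<^sub>F n in sequentially. \<forall>z\<in>UNIV. dist (h z * En n z) (h z * exp (- V z)) < r"
      proof eventually_elim
        case (elim n)
        show ?case
        proof
          fix z
          show "dist (h z * En n z) (h z * exp (- V z)) < r"
          proof (cases "z \<in> cball c R")
            case True
            have "dist (h z * En n z) (h z * exp (- V z)) = norm (h z) * dist (En n z) (exp (- V z))"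
              by (simp add: dist_norm norm_mult[symmetric] algebra_simps)
            also have "\<dots> \<le> B * dist (En n z) (exp (- V z))" using B(1)[OF True] by (intro mult_right_mono) auto
            also have "\<dots> < B * (r / B)" using elim True B(2) by (intro mult_strict_left_mono) auto
            finally show ?thesis using B(2) by simp
          qed (use h(2)[of z] r in \<open>auto\<close>)
        qed
      qed
    qed
    have ul\<psi>: "uniform_limit UNIV \<psi> \<psi>' sequentially"
    proof -
      have "(\<lambda>z. G z * \<phi> z * exp (- V z)) = \<psi>'" by (auto simp: G_def \<psi>'_def fun_eq_iff)
      thus ?thesis using ulim[OF cG\<phi>(1)] G0 unfolding \<psi>_def by simp
    qed
    have ul\<theta>: "uniform_limit UNIV \<theta> \<theta>' sequentially"
    proof -
      have "(\<lambda>z. G z * dbar \<phi> z * exp (- V z)) = \<theta>'" by (auto simp: G_def \<theta>'_def fun_eq_iff)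
      thus ?thesis using ulim[OF cG\<phi>(2)] G0 unfolding \<theta>_def by simp
    qed
    have bnd: "\<exists>B. \<forall>n z. norm (h z * En n z) \<le> B"
      if h: "continuous_on UNIV h" "\<And>z. z \<notin> ball c R ==> h z = 0" for h :: "complex \<Rightarrow> complex"
    proof -
      have "bounded (h ` cball c R)" by (intro compact_imp_bounded compact_continuous_image continuous_on_subset[OF h(1)]) auto
      then obtain B where B: "\<And>z. z \<in> cball c R ==> norm (h z) \<le> B" "B > 0" unfolding bounded_pos by (metis imageI)
      have "norm (h z * En n z) \<le> B * exp (H * R powr \<alpha>)" for n z
      proof (cases "z \<in> cball c R")
        case True
        have "norm (En n z) \<le> exp (norm (- Vn (\<rho> n) z))" unfolding En_def by (rule norm_exp)
        also have "\<dots> \<le> exp (H * R powr \<alpha>)" using Vb[OF True] by simp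
        finally show ?thesis unfolding norm_mult using B True by (intro mult_mono) auto
      next
        case False
        hence "h z = 0" using h(2)[of z] by auto
        thus ?thesis using B(2) by simp
      qed
      thus ?thesis by blast
    qed
    obtain B1 where B1: "\<And>n z. norm (\<psi> n z) \<le> B1" using bnd[OF cG\<phi>(1)] G0 unfolding \<psi>_def by fastforce
    obtain B2 where B2: "\<And>n z. norm (\<theta> n z) \<le> B2" using bnd[OF cG\<phi>(2)] G0 unfolding \<theta>_def by fastforce
    have Cc: "continuous_on UNIV (conv A (dbar (cker (e n))))" for n
    proof -
      have "continuous_on UNIV (dbar (Vn n))"
      proof -
        have "continuous_on UNIV (\<lambda>z. frechet_derivative (Vn n) (at z) v)" for v using CV[of 1 n] by simp
        thus ?thesis unfolding dbar_def[abs_def] by (intro continuous_intros) auto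
      qed
      hence "continuous_on UNIV (\<lambda>z. cc * dbar (Vn n) z)" by (intro continuous_intros)
      moreover have "(\<lambda>z. cc * dbar (Vn n) z) = conv A (dbar (cker (e n)))" using cc by (simp add: dV fun_eq_iff mult.assoc[symmetric])
      ultimately show ?thesis by (simp only:)
    qed
    have key: "(LINT z|lborel. \<theta> n z) = inverse cc * (LINT z|lborel. conv A (dbar (cker (e (\<rho> n)))) z * \<psi> n z) - (LINT z|lborel. A z * \<psi> n z)" for n
    proof -
      define \<phi>n where "\<phi>n = (\<lambda>z. En n z * \<phi> z)"
      have set: "{z. \<phi>n z \<noteq> 0} = {z. \<phi> z \<noteq> 0}" by (auto simp: \<phi>n_def En_def)
      have "test_fun (ball c R) \<phi>n"
        unfolding test_fun_def set using \<phi>s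
        by (auto simp: \<phi>n_def En_def intro!: Ck_fun_mult Ck_fun_exp Ck_fun_uminus CV \<phi>C)
      from weak[OF this] have w: "- (LINT z|lborel. G z * dbar \<phi>n z) = (LINT z|lborel. A z * (G z * \<phi>n z))" by (simp add: G_def)
      have db: "dbar \<phi>n z = En n z * (dbar \<phi> z - inverse cc * conv A (dbar (cker (e (\<rho> n)))) z * \<phi> z)" for z
        unfolding \<phi>n_def En_def dbar_exp_mult[OF CV \<phi>C] dV ..
      have pe: "G z * dbar \<phi>n z = \<theta> n z - inverse cc * (conv A (dbar (cker (e (\<rho> n)))) z * \<psi> n z)" for z
        unfolding db \<theta>_def \<psi>_def by (simp add: algebra_simps)
      have "(LINT z|lborel. G z * dbar \<phi>n z) = (LINT z|lborel. \<theta> n z - inverse cc * (conv A (dbar (cker (e (\<rho> n)))) z * \<psi> n z))"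
        by (simp only: pe)
      also have "\<dots> = (LINT z|lborel. \<theta> n z) - (LINT z|lborel. inverse cc * (conv A (dbar (cker (e (\<rho> n)))) z * \<psi> n z))"
      proof (rule Bochner_Integration.integral_diff)
        show "integrable lborel (\<theta> n)" by (rule compact_support_integrable[OF c\<psi>(2), of 0 L]) (use \<psi>0 in auto)
        show "integrable lborel (\<lambda>z. inverse cc * (conv A (dbar (cker (e (\<rho> n)))) z * \<psi> n z))"
          by (rule compact_support_integrable[of _ 0 L]) (use \<psi>0 in \<open>auto intro!: continuous_intros c\<psi> Cc\<close>)
      qed
      finally have "(LINT z|lborel. G z * dbar \<phi>n z) = (LINT z|lborel. \<theta> n z) - inverse cc * (LINT z|lborel. conv A (dbar (cker (e (\<rho> n)))) z * \<psi> n z)"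
        by simp
      moreover have "(LINT z|lborel. A z * (G z * \<phi>n z)) = (LINT z|lborel. A z * \<psi> n z)"
        by (rule Bochner_Integration.integral_cong) (auto simp: \<phi>n_def \<psi>_def)
      ultimately have "- ((LINT z|lborel. \<theta> n z) - inverse cc * (LINT z|lborel. conv A (dbar (cker (e (\<rho> n)))) z * \<psi> n z)) = (LINT z|lborel. A z * \<psi> n z)"
        using w by (simp only:)
      thus ?thesis unfolding minus_diff_eq by (metis add_diff_cancel_left' diff_add_cancel diff_diff_eq2)
    qed
    have [measurable]: "\<psi> n \<in> borel_measurable borel" "\<theta> n \<in> borel_measurable borel" "\<psi>' \<in> borel_measurable borel" "\<theta>' \<in> borel_measurable borel" for n
      using borel_measurable_continuous_onI c\<psi> c\<psi>' by blast+
    have pt: "(\<lambda>n. \<psi> n z) \<longlonglongrightarrow> \<psi>' z" "(\<lambda>n. \<theta> n z) \<longlonglongrightarrow> \<theta>' z" for z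
      using tendsto_uniform_limitI[OF ul\<psi>] tendsto_uniform_limitI[OF ul\<theta>] by auto
    have "(\<lambda>n. LINT z|lborel. conv A (dbar (cker (e (\<rho> n)))) z * \<psi> n z) \<longlonglongrightarrow> of_real c0 * (LINT z|lborel. A z * \<psi>' z)"
    proof (rule smoothing_limit[OF Aint Asupp c\<psi>(1) _ c\<psi>'(1) ul\<psi> B1])
      show "(\<lambda>n. e (\<rho> n)) \<longlonglongrightarrow> 0" using LIMSEQ_subseq_LIMSEQ[OF elim V(2)] by (simp add: o_def)
    qed (use \<psi>0 e in auto)
    moreover have "(\<lambda>n. LINT z|lborel. A z * \<psi> n z) \<longlonglongrightarrow> (LINT z|lborel. A z * \<psi>' z)"
    proof (rule integral_dominated_convergence[where w = "\<lambda>z. norm (A z) * B1"])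
      show "AE z in lborel. norm (A z * \<psi> n z) \<le> norm (A z) * B1" for n
        using B1 by (auto intro!: AE_I2 mult_left_mono simp: norm_mult)
      show "AE z in lborel. (\<lambda>n. A z * \<psi> n z) \<longlonglongrightarrow> A z * \<psi>' z" by (intro AE_I2 tendsto_intros pt)
      show "integrable lborel (\<lambda>z. norm (A z) * B1)" using Aint by simp
    qed measurable
    ultimately have "(\<lambda>n. LINT z|lborel. \<theta> n z) \<longlonglongrightarrow> inverse cc * (of_real c0 * (LINT z|lborel. A z * \<psi>' z)) - (LINT z|lborel. A z * \<psi>' z)"
      unfolding key by (intro tendsto_intros)
    hence lim0: "(\<lambda>n. LINT z|lborel. \<theta> n z) \<longlonglongrightarrow> 0" using cc by (simp add: cc_def mult.assoc[symmetric])
    have "(\<lambda>n. LINT z|lborel. \<theta> n z) \<longlonglongrightarrow> (LINT z|lborel. \<theta>' z)"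
    proof (rule integral_dominated_convergence[where w = "\<lambda>z. indicator (cball 0 L) z * B2"])
      show "integrable lborel (\<lambda>z::complex. indicator (cball 0 L) z * B2)"
        using emeasure_bounded_finite[of "cball (0::complex) L"] by (intro integrable_mult_left integrable_real_indicator) (auto simp: less_top)
      show "AE z in lborel. norm (\<theta> n z) \<le> indicator (cball 0 L) z * B2" for n
        using B2 \<psi>0(2) by (auto intro!: AE_I2 simp: indicator_def)
      show "AE z in lborel. (\<lambda>n. \<theta> n z) \<longlonglongrightarrow> \<theta>' z" by (intro AE_I2 pt)
    qed measurable
    from LIMSEQ_unique[OF this lim0] show "(LINT z|lborel. (if z \<in> ball c R then exp (- V z) * g z else 0) * dbar \<phi> z) = 0"
      by (simp add: \<theta>'_def)
  qed
  ultimately show ?thesis using that[of V] by (simp add: H_def \<alpha>_def)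
qed

text \<open>The coefficient is only Lebesgue measurable, whereas the convolutions are formed with Borel functions.\<close>
lemma completion_ex_borel_measurable_complex:
  fixes g :: "'a \<Rightarrow> complex"
  assumes g: "g \<in> borel_measurable (completion M)"
  shows "\<exists>g'\<in>borel_measurable M. (AE x in M. g x = g' x)"
proof -
  have "(\<lambda>x. Re (g x)) \<in> borel_measurable (completion M)" "(\<lambda>x. Im (g x)) \<in> borel_measurable (completion M)"
    using g by measurable
  then obtain p q where pq: "p \<in> borel_measurable M" "AE x in M. Re (g x) = p x" "q \<in> borel_measurable M" "AE x in M. Im (g x) = q x"
    using completion_ex_borel_measurable_real by metis
  have "(\<lambda>x. Complex (p x) (q x)) \<in> borel_measurable M"
    unfolding Complex_eq
    by (intro borel_measurable_add borel_measurable_times borel_measurable_const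
        measurable_compose[OF pq(1)] measurable_compose[OF pq(3)] borel_measurable_continuous_onI continuous_intros)
  have "AE x in M. g x = Complex (p x) (q x)" using pq(2,4) by eventually_elim (simp add: complex_eq_iff)
  thus ?thesis using \<open>(\<lambda>x. Complex (p x) (q x)) \<in> borel_measurable M\<close> by (rule rev_bexI[rotated])
qed

text \<open>For \<open>p = \<infinity>\<close> the exponent \<open>q\<close> is free, and the area of the disc of radius \<open>R\<close> enters.\<close>
definition norm_bound :: "ennreal \<Rightarrow> real \<Rightarrow> real \<Rightarrow> real \<Rightarrow> real" where
  "norm_bound p M R q = (if p = \<infinity> then M powr q * (pi * R\<^sup>2) else M powr q)"

lemma nn_integral_powr_le_norm_bound:
  fixes a :: "complex \<Rightarrow> complex"
  assumes p: "if p = \<infinity> then q > 2 else q = enn2real p \<and> q > 0" and R: "R > 0" and sub: "ball c R \<subseteq> W" and W: "open W"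
    and a: "a \<in> borel_measurable (lebesgue_on W)" and Lp: "Lp_norm p (lebesgue_on W) a \<le> ennreal M" and M: "M > 0"
  shows "(\<integral>\<^sup>+ w. ennreal (norm (if w \<in> ball c R then a w else 0) powr q) \<partial>lebesgue) \<le> ennreal (norm_bound p M R q)"
proof (cases "p = \<infinity>")
  case True
  have q: "q > 2" using p True by simp
  have "AE x in lebesgue_on W. ennreal (norm (a x)) \<le> ennreal M"
    using esssup_AE[of "\<lambda>x. ennreal (norm (a x))" "lebesgue_on W"] Lp True
    unfolding Lp_norm_def by (auto elim: eventually_mono intro: order.trans)
  hence ae: "AE x in lebesgue. x \<in> W \<longrightarrow> ennreal (norm (a x)) \<le> ennreal M"
    using W by (subst (asm) AE_restrict_space_iff) auto
  have "(\<integral>\<^sup>+ w. ennreal (norm (if w \<in> ball c R then a w else 0) powr q) \<partial>lebesgue)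
     \<le> (\<integral>\<^sup>+ w. ennreal (M powr q) * indicator (ball c R) w \<partial>lebesgue)"
  proof (rule nn_integral_mono_AE)
    show "AE x in lebesgue. ennreal (norm (if x \<in> ball c R then a x else 0) powr q) \<le> ennreal (M powr q) * indicator (ball c R) x"
      using ae
    proof eventually_elim
      case (elim x)
      thus ?case using sub M q by (auto simp: indicator_def intro!: ennreal_leI powr_mono2)
    qed
  qed
  also have "\<dots> = ennreal (M powr q) * emeasure lborel (ball c R)"
    by (simp add: nn_integral_cmult_indicator)
  also have "\<dots> = ennreal (M powr q) * ennreal (pi * R\<^sup>2)"
    using R by (simp add: emeasure_ball unit_ball_vol_2)
  also have "\<dots> = ennreal (norm_bound p M R q)" using True by (simp add: norm_bound_def ennreal_mult)
  finally show ?thesis .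
next
  case False
  have q: "q = enn2real p" "q > 0" using p False by auto
  define I where "I = (\<integral>\<^sup>+ x. ennreal (norm (a x) powr q) \<partial>lebesgue_on W)"
  have L: "(if I = \<infinity> then \<infinity> else ennreal (enn2real I powr (1 / q))) \<le> ennreal M"
    using Lp False by (simp only: Lp_norm_def Let_def I_def q(1) if_False)
  have fin: "I \<noteq> \<infinity>" using L by (auto split: if_splits simp: top_unique)
  hence "enn2real I powr (1 / q) \<le> M" using L M by simp
  hence "(enn2real I powr (1 / q)) powr q \<le> M powr q" using q by (intro powr_mono2) auto
  hence "enn2real I \<le> M powr q" using q by (simp add: powr_powr)
  hence I: "I \<le> ennreal (M powr q)" using fin ennreal_leI[of "enn2real I" "M powr q"] by (simp add: ennreal_enn2real less_top)
  have "(\<integral>\<^sup>+ w. ennreal (norm (if w \<in> ball c R then a w else 0) powr q) \<partial>lebesgue)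
      \<le> (\<integral>\<^sup>+ w. ennreal (norm (a w) powr q) * indicator W w \<partial>lebesgue)"
    using sub by (intro nn_integral_mono) (auto simp: indicator_def)
  also have "\<dots> = I" unfolding I_def using W by (subst nn_integral_restrict_space) auto
  finally show ?thesis using I False by (simp add: norm_bound_def)
qed

lemma weak_to_exp:
  assumes p: "if p = \<infinity> then q > 2 else q = enn2real p \<and> q > 2" and R: "R > 0" and sub: "ball c R \<subseteq> W" and W: "open W"
    and g: "continuous_on W g"
    and a: "a \<in> borel_measurable (lebesgue_on W)" and weak: "has_weak_dbar W g (\<lambda>z. a z * g z)"
    and Lp: "Lp_norm p (lebesgue_on W) a \<le> ennreal M" and M: "M > 0"
  obtains V where "V c = 0"
    "\<And>x y. x \<in> ball c R ==> y \<in> ball c R ==> norm (V x - V y) \<le> hoelder_const q (norm_bound p M R q) * dist x y powr (1 - 2 / q)"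
    "(\<lambda>s. exp (- V s) * g s) holomorphic_on ball c R"
proof -
  define a1 where "a1 = (\<lambda>z. if z \<in> ball c R then a z else 0)"
  have q: "q > 2" using p by (auto split: if_splits)
  have p': "if p = \<infinity> then q > 2 else q = enn2real p \<and> q > 0" using p by (auto split: if_splits)
  have "a \<in> borel_measurable (lebesgue_on (ball c R))"
    by (rule measurable_restrict_mono[OF a sub])
  hence a1m: "a1 \<in> borel_measurable lebesgue" unfolding a1_def by (subst borel_measurable_if) auto
  from completion_ex_borel_measurable_complex[OF a1m]
  obtain A0 where A0: "A0 \<in> borel_measurable lborel" "AE x in lborel. a1 x = A0 x" by blast
  define A where "A = (\<lambda>z. if z \<in> ball c R then A0 z else 0)"
  have [measurable]: "A0 \<in> borel_measurable borel" using A0(1) by simp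
  have Am [measurable]: "A \<in> borel_measurable borel"
  proof -
    have "A = (\<lambda>z. indicator (ball c R) z *\<^sub>R A0 z)" by (auto simp: A_def fun_eq_iff)
    moreover have "(\<lambda>z. indicator (ball c R) z *\<^sub>R A0 z) \<in> borel_measurable borel"
      by (intro borel_measurable_scaleR borel_measurable_indicator) (simp_all add: borel_open)
    ultimately show ?thesis by (simp only:)
  qed
  have ae: "AE x in lborel. A x = a1 x" using A0(2) by eventually_elim (auto simp: A_def a1_def)
  have bd: "(\<integral>\<^sup>+ w. ennreal (norm (A w) powr q) \<partial>lborel) \<le> ennreal (norm_bound p M R q)"
  proof -
    have "(\<integral>\<^sup>+ w. ennreal (norm (A w) powr q) \<partial>lborel) = (\<integral>\<^sup>+ w. ennreal (norm (a1 w) powr q) \<partial>lborel)"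
      using ae by (intro nn_integral_cong_AE) (auto elim: eventually_mono)
    also have "\<dots> = (\<integral>\<^sup>+ w. ennreal (norm (a1 w) powr q) \<partial>lebesgue)" by (simp add: nn_integral_completion)
    also have "\<dots> \<le> ennreal (norm_bound p M R q)"
      unfolding a1_def by (rule nn_integral_powr_le_norm_bound[OF p' R sub W a Lp M])
    finally show ?thesis .
  qed
  have weak': "- (LINT z|lborel. (if z \<in> ball c R then g z else 0) * dbar \<phi> z) = (LINT z|lborel. A z * ((if z \<in> ball c R then g z else 0) * \<phi> z))"
    if \<phi>: "test_fun (ball c R) \<phi>" for \<phi>
  proof -
    have \<phi>s: "closure {z. \<phi> z \<noteq> 0} \<subseteq> ball c R" and \<phi>C: "\<And>k. Ck_fun k \<phi>" using \<phi> by (auto simp: test_fun_def)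
    have "test_fun W \<phi>" using \<phi> sub by (auto simp: test_fun_def)
    hence w: "- (LINT z|lebesgue_on W. g z * dbar \<phi> z) = (LINT z|lebesgue_on W. a z * g z * \<phi> z)"
      using weak by (simp add: has_weak_dbar_def)
    have gc: "continuous_on (ball c R) g" by (rule continuous_on_subset[OF g sub])
    have d\<phi>c: "continuous_on UNIV (dbar \<phi>)"
    proof -
      have "continuous_on UNIV (\<lambda>z. frechet_derivative \<phi> (at z) v)" for v using \<phi>C[of 1] by simp
      thus ?thesis unfolding dbar_def[abs_def] by (intro continuous_intros) auto
    qed
    have z1: "\<phi> z = 0" "dbar \<phi> z = 0" if "z \<notin> ball c R" for z
      using that \<phi>s closure_subset[of "{z. \<phi> z \<noteq> 0}"] dbar_support[of \<phi>] closure_subset[of "{z. dbar \<phi> z \<noteq> 0}"] by blast+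
    have c1: "continuous_on UNIV (\<lambda>z. (if z \<in> ball c R then g z else 0) * dbar \<phi> z)"
      by (rule extend_by_zero_continuous[OF gc d\<phi>c subset_trans[OF dbar_support \<phi>s]])
    have c2: "continuous_on UNIV (\<lambda>z. (if z \<in> ball c R then g z else 0) * \<phi> z)"
      by (rule extend_by_zero_continuous[OF gc Ck_fun_continuous[OF \<phi>C[of 0]] \<phi>s])
    have m1 [measurable]: "(\<lambda>z. (if z \<in> ball c R then g z else 0) * dbar \<phi> z) \<in> borel_measurable borel"
        "(\<lambda>z. (if z \<in> ball c R then g z else 0) * \<phi> z) \<in> borel_measurable borel"
      using borel_measurable_continuous_onI c1 c2 by blast+
    have "(LINT z|lebesgue_on W. g z * dbar \<phi> z) = (LINT z|lebesgue. indicator W z *\<^sub>R (g z * dbar \<phi> z))"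
      using W by (subst integral_restrict_space) auto
    also have "\<dots> = (LINT z|lebesgue. (if z \<in> ball c R then g z else 0) * dbar \<phi> z)"
      by (rule Bochner_Integration.integral_cong) (use sub z1 in \<open>auto simp: indicator_def\<close>)
    also have "\<dots> = (LINT z|lborel. (if z \<in> ball c R then g z else 0) * dbar \<phi> z)"
      by (rule integral_completion) (use m1 in simp)
    finally have l: "(LINT z|lebesgue_on W. g z * dbar \<phi> z) = (LINT z|lborel. (if z \<in> ball c R then g z else 0) * dbar \<phi> z)" .
    have "(LINT z|lebesgue_on W. a z * g z * \<phi> z) = (LINT z|lebesgue. indicator W z *\<^sub>R (a z * g z * \<phi> z))"
      using W by (subst integral_restrict_space) auto
    also have "\<dots> = (LINT z|lebesgue. a1 z * ((if z \<in> ball c R then g z else 0) * \<phi> z))"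
      by (rule Bochner_Integration.integral_cong) (use sub z1 in \<open>auto simp: indicator_def a1_def\<close>)
    also have "\<dots> = (LINT z|lebesgue. A z * ((if z \<in> ball c R then g z else 0) * \<phi> z))"
    proof (rule integral_cong_AE)
      show "AE x in lebesgue. a1 x * ((if x \<in> ball c R then g x else 0) * \<phi> x) = A x * ((if x \<in> ball c R then g x else 0) * \<phi> x)"
        using AE_completion[OF ae] by eventually_elim simp
      have m3: "(\<lambda>z. (if z \<in> ball c R then g z else 0) * \<phi> z) \<in> borel_measurable lebesgue" "A \<in> borel_measurable lebesgue"
        using m1(2) Am by (auto intro: measurable_completion)
      show "(\<lambda>x. a1 x * ((if x \<in> ball c R then g x else 0) * \<phi> x)) \<in> borel_measurable lebesgue"
        by (rule borel_measurable_times[OF a1m m3(1)])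
      show "(\<lambda>x. A x * ((if x \<in> ball c R then g x else 0) * \<phi> x)) \<in> borel_measurable lebesgue"
        by (rule borel_measurable_times[OF m3(2,1)])
    qed
    also have "\<dots> = (LINT z|lborel. A z * ((if z \<in> ball c R then g z else 0) * \<phi> z))"
      by (rule integral_completion) (use borel_measurable_times[OF Am m1(2)] in \<open>simp only: measurable_lborel1 measurable_lborel2\<close>)
    finally show ?thesis using w l by simp
  qed
  have K: "norm_bound p M R q \<ge> 0" by (simp add: norm_bound_def)
  have A0': "A w = 0" if "w \<notin> ball c R" for w using that by (simp add: A_def)
  from weak_to_exp_borel[OF Am A0' q K bd R continuous_on_subset[OF g sub] weak'] that show ?thesis by blast
qed

section \<open>Logarithms, parameter integrals and Cauchy integrals over circles\<close>

text \<open>Near a point the values \<open>m\<close> differ from the one there by less than \<open>\<pi>\<close>, so \<open>m\<close> is locally a branch of the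
  principal logarithm.\<close>
lemma holomorphic_continuous_log:
  assumes m: "continuous_on S m" and S: "open S" and h: "(\<lambda>z. exp (m z)) holomorphic_on S"
  shows "m holomorphic_on S"
proof -
  have "m field_differentiable at z" if z: "z \<in> S" for z
  proof -
    have "isCont m z" using m S z by (simp add: continuous_on_eq_continuous_at)
    then obtain d where d: "d > 0" "\<And>y. dist y z < d ==> dist (m y) (m z) < 1"
      unfolding continuous_at_eps_delta by (metis zero_less_one)
    obtain d' where d': "d' > 0" "ball z d' \<subseteq> S" using S z openE by blast
    define e where "e = min d d'"
    have e: "e > 0" "ball z e \<subseteq> S" using d d' by (auto simp: e_def)
    have close: "norm (m y - m z) < 1" if "y \<in> ball z e" for y
      using d(2)[of y] that by (simp add: e_def dist_norm norm_minus_commute)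
    define E where "E = (\<lambda>y. exp (m y))"
    have "(\<lambda>y. m z + Ln (E y * exp (- m z))) holomorphic_on ball z e"
    proof (intro holomorphic_intros holomorphic_on_subset[OF h[folded E_def] e(2)])
      fix y assume "y \<in> ball z e"
      hence n: "norm (m y - m z) < 1" by (rule close)
      have "\<bar>Im (m y - m z)\<bar> \<le> norm (m y - m z)" by (rule abs_Im_le_cmod)
      hence "\<bar>Im (m y - m z)\<bar> < pi / 2" using n pi_gt3 by linarith
      hence "- (pi / 2) < Im (m y - m z)" "Im (m y - m z) < pi / 2" by linarith+
      hence "Re (exp (m y - m z)) > 0" unfolding Re_exp by (intro mult_pos_pos cos_gt_zero_pi) simp_all
      thus "E y * exp (- m z) \<notin> \<real>\<^sub>\<le>\<^sub>0" by (auto simp: E_def exp_add[symmetric] complex_nonpos_Reals_iff)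
    qed
    hence lnh: "(\<lambda>y. m z + Ln (exp (m y) * exp (- m z))) holomorphic_on ball z e" by (simp add: E_def)
    have lne: "m z + Ln (exp (m y) * exp (- m z)) = m y" if "y \<in> ball z e" for y
    proof -
      have "\<bar>Im (m y - m z)\<bar> \<le> norm (m y - m z)" by (rule abs_Im_le_cmod)
      hence "\<bar>Im (m y - m z)\<bar> < pi" using close[OF that] pi_gt3 by linarith
      hence "- pi < Im (m y - m z)" "Im (m y - m z) \<le> pi" by linarith+
      hence "Ln (exp (m y - m z)) = m y - m z" by (rule Ln_exp)
      moreover have "exp (m y) * exp (- m z) = exp (m y - m z)" by (simp add: exp_add[symmetric])
      ultimately show ?thesis by simp
    qed
    have "m holomorphic_on ball z e" using holomorphic_transform[OF lnh, of m] lne by blast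
    thus ?thesis using e by (simp add: holomorphic_on_imp_differentiable_at)
  qed
  thus ?thesis using field_differentiable_at_within holomorphic_on_def by blast
qed

text \<open>Riemann's theorem at each of the isolated zeros; the bound survives as a limit.\<close>
lemma bounded_extension_across_zeros:
  assumes S: "open S" "connected S" and q: "q holomorphic_on S" and nz: "w \<in> S" "q w \<noteq> 0"
    and m: "m holomorphic_on {z\<in>S. q z \<noteq> 0}" and B: "\<And>z. z \<in> S ==> q z \<noteq> 0 ==> norm (m z) \<le> B"
  obtains m' where "m' holomorphic_on S" "\<And>z. z \<in> S ==> norm (m' z) \<le> B" "\<And>z. z \<in> S ==> q z \<noteq> 0 ==> m' z = m z"
proof -
  define m' where "m' = (\<lambda>z. if q z \<noteq> 0 then m z else Lim (at z) m)"
  have loc: "m' field_differentiable at z \<and> norm (m' z) \<le> B" if z: "z \<in> S" for z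
  proof -
    obtain e where e: "e > 0" "ball z e \<subseteq> S" "\<And>y. y \<in> ball z e - {z} ==> q y \<noteq> 0"
      using zero_free_punctured_ball[OF S q nz z] by blast
    have ev: "eventually (\<lambda>y. y \<in> ball z e - {z}) (at z)"
      by (rule eventually_at_in_open) (use e(1) in auto)
    have mh: "m holomorphic_on ball z e - {z}" by (rule holomorphic_on_subset[OF m]) (use e in auto)
    have evB: "eventually (\<lambda>y. norm (m y) \<le> B) (at z)"
      using ev by eventually_elim (use e B in blast)
    obtain g where g: "g holomorphic_on ball z e" "\<And>y. y \<in> ball z e - {z} ==> g y = m y"
      using holomorphic_on_extend_bounded[OF mh] e(1) evB by (auto simp: interior_open)
    have gl: "(g \<longlongrightarrow> g z) (at z)"
      using holomorphic_on_imp_continuous_on[OF g(1)] e(1) by (simp add: continuous_on_eq_continuous_at isCont_def)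
    have "eventually (\<lambda>y. g y = m y) (at z)" using ev by eventually_elim (use g in blast)
    from tendsto_cong[OF this] gl have ml: "(m \<longlongrightarrow> g z) (at z)" by simp
    have gz: "m' z = g z"
    proof (cases "q z = 0")
      case True thus ?thesis using ml by (simp add: m'_def tendsto_Lim)
    next
      case False
      have "open (S \<inter> q -` (-{0}))"
        using continuous_open_preimage[OF holomorphic_on_imp_continuous_on[OF q] S(1)] by auto
      moreover have "S \<inter> q -` (-{0}) = {z\<in>S. q z \<noteq> 0}" by auto
      ultimately have "isCont m z" using holomorphic_on_imp_continuous_on[OF m] z False by (simp add: continuous_on_eq_continuous_at)
      hence "m z = g z" using ml by (auto simp: isCont_def intro: LIM_unique)
      thus ?thesis using False by (simp add: m'_def)
    qed
    have eq: "g y = m' y" if "y \<in> ball z e" for y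
    proof (cases "y = z")
      case False
      hence y: "y \<in> ball z e - {z}" using that by blast
      show ?thesis using g(2)[OF y] e(3)[OF y] by (simp add: m'_def)
    qed (simp add: gz)
    have "m' holomorphic_on ball z e" by (rule holomorphic_transform[OF g(1) eq])
    moreover have "norm (g z) \<le> B" by (rule Lim_norm_ubound[OF _ ml evB]) simp
    ultimately show ?thesis using e gz by (simp add: holomorphic_on_imp_differentiable_at)
  qed
  show ?thesis
  proof (rule that[of m'])
    show "m' holomorphic_on S" using loc field_differentiable_at_within holomorphic_on_def by blast
  qed (use loc in \<open>auto simp: m'_def\<close>)
qed

lemma bounded_holomorphic_lipschitz:
  assumes h: "h holomorphic_on ball c r" and r: "r > 0" and B: "\<And>z. z \<in> ball c r ==> norm (h z) \<le> B"
    and x: "x \<in> ball c (r / 2)" and y: "y \<in> ball c (r / 2)"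
  shows "norm (h x - h y) \<le> 4 * B / r * norm (x - y)"
proof (rule field_differentiable_bound[of "ball c (r / 2)" h "deriv h"])
  fix z assume z: "z \<in> ball c (r / 2)"
  have sub: "cball z (r / 4) \<subseteq> ball c r"
  proof
    fix y assume "y \<in> cball z (r / 4)"
    thus "y \<in> ball c r" using z dist_triangle[of c y z] r by simp
  qed
  have "z \<in> ball c r" using z r by auto
  thus "(h has_field_derivative deriv h z) (at z within ball c (r / 2))"
    using holomorphic_derivI[OF h open_ball] by (blast intro: has_field_derivative_at_within)
  have "norm ((deriv ^^ 1) h z) \<le> fact 1 * B / (r / 4) ^ 1"
  proof (rule Cauchy_inequality)
    show "h holomorphic_on ball z (r / 4)" using sub by (intro holomorphic_on_subset[OF h]) auto
    show "continuous_on (cball z (r / 4)) h"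
      using sub by (intro holomorphic_on_imp_continuous_on holomorphic_on_subset[OF h])
    show "norm (h x) \<le> B" if "norm (z - x) = r / 4" for x
      using sub that by (intro B) (auto simp: dist_norm)
  qed (use r in simp)
  thus "norm (deriv h z) \<le> 4 * B / r" by (simp add: mult.commute)
qed (use x y in auto)

text \<open>For each parameter the integrand may be wrong on a null set that depends on the parameter. The difference
  quotients along a fixed sequence only see countably many parameters. They are dominated because a bounded
  holomorphic function is locally Lipschitz, so they converge to the integral of the derivative.\<close>
lemma holomorphic_parameter_integral:
  fixes \<phi> :: "complex \<Rightarrow> 'b \<Rightarrow> complex"
  assumes fin: "finite_measure \<mu>" and e: "e > 0" and B0: "B \<ge> 0"
    and meas: "\<And>z. z \<in> ball z0 e ==> \<phi> z \<in> borel_measurable \<mu>"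
    and hol: "AE t in \<mu>. m t holomorphic_on ball z0 e \<and> (\<forall>z\<in>ball z0 e. norm (m t z) \<le> B)"
    and eq: "\<And>z. z \<in> ball z0 e ==> AE t in \<mu>. \<phi> z t = m t z"
  shows "(\<lambda>z. LINT t|\<mu>. \<phi> z t) holomorphic_on ball z0 e"
proof -
  interpret finite_measure \<mu> by fact
  have int: "integrable \<mu> (\<phi> z)" if "z \<in> ball z0 e" for z
  proof (rule integrable_const_bound[where B = B])
    show "AE t in \<mu>. norm (\<phi> z t) \<le> B" using hol eq[OF that] by eventually_elim (use that in auto)
  qed (rule meas[OF that])
  define G where "G = (\<lambda>z. LINT t|\<mu>. \<phi> z t)"
  have "G field_differentiable at z" if z: "z \<in> ball z0 e" for z
  proof -
    obtain r where r: "r > 0" "ball z r \<subseteq> ball z0 e" using z openE[of "ball z0 e" z] by auto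
    define Q where "Q = (\<lambda>y t. (\<phi> y t - \<phi> z t) / (y - z))"
    have Qm: "Q y \<in> borel_measurable \<mu>" if "y \<in> ball z r" for y
      unfolding Q_def using meas[OF z] meas[of y] that r by (intro borel_measurable_divide borel_measurable_diff) auto
    have Qlim: "AE t in \<mu>. (\<lambda>n. Q (y n) t) \<longlonglongrightarrow> deriv (m t) z"
      if y: "\<And>n. y n \<in> ball z r - {z}" "y \<longlonglongrightarrow> z" for y
    proof -
      have "AE t in \<mu>. \<forall>n. \<phi> (y n) t = m t (y n)" using eq y r by (subst AE_all_countable) blast
      thus ?thesis using hol eq[OF z]
      proof eventually_elim
        case (elim t)
        have "(m t has_field_derivative deriv (m t) z) (at z)"
          using elim z by (intro holomorphic_derivI[of _ "ball z0 e"]) auto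
        hence "((\<lambda>y. (m t y - m t z) / (y - z)) \<longlongrightarrow> deriv (m t) z) (at z)" by (simp add: has_field_derivative_iff)
        hence "((\<lambda>y. (m t y - m t z) / (y - z)) \<circ> y) \<longlonglongrightarrow> deriv (m t) z"
          using y unfolding tendsto_at_iff_sequentially by blast
        thus ?case using elim by (simp add: Q_def o_def)
      qed
    qed
    have Qb: "AE t in \<mu>. norm (Q y t) \<le> 4 * B / r" if y: "y \<in> ball z (r / 2) - {z}" for y
    proof -
      have "y \<in> ball z r" using y r by simp
      hence yb: "y \<in> ball z0 e" using r by blast
      show ?thesis using hol eq[OF z] eq[OF yb]
      proof eventually_elim
        case (elim t)
        have "norm (m t y - m t z) \<le> 4 * B / r * norm (y - z)"
          by (rule bounded_holomorphic_lipschitz[of _ z r]) (use elim r y in \<open>auto intro: holomorphic_on_subset\<close>)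
        thus ?case using elim y by (simp add: Q_def norm_divide divide_le_eq)
      qed
    qed
    have bm: "ball z (r / 2) \<subseteq> ball z r" using r by auto
    define d where "d = (\<lambda>n. r / 2 * inverse (real (Suc (Suc n))))"
    have d: "0 < d n" "d n < r / 2" for n using r by (auto simp: d_def divide_simps)
    define y0 where "y0 = (\<lambda>n. z + of_real (d n))"
    have y0: "y0 n \<in> ball z (r / 2) - {z}" for n using d[of n] by (auto simp: y0_def dist_norm)
    have "(\<lambda>n. inverse (real (Suc (Suc n)))) \<longlonglongrightarrow> 0" using LIMSEQ_Suc[OF LIMSEQ_inverse_real_of_nat] .
    hence "y0 \<longlonglongrightarrow> z + of_real (r / 2 * 0)" unfolding y0_def d_def by (intro tendsto_intros)
    hence y0l: "y0 \<longlonglongrightarrow> z" by simp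
    define D where "D = (\<lambda>t. lim (\<lambda>n. Q (y0 n) t))"
    have Dm: "D \<in> borel_measurable \<mu>" unfolding D_def
      by (rule borel_measurable_lim_metric) (use Qm y0 bm in blast)
    have "AE t in \<mu>. (\<lambda>n. Q (y0 n) t) \<longlonglongrightarrow> deriv (m t) z" by (rule Qlim[OF _ y0l]) (use y0 bm in blast)
    hence Deq: "AE t in \<mu>. D t = deriv (m t) z" by eventually_elim (simp add: D_def limI)
    have "((\<lambda>y. (G y - G z) / (y - z)) \<longlongrightarrow> (LINT t|\<mu>. D t)) (at z)"
      unfolding tendsto_at_iff_sequentially
    proof (intro allI impI)
      fix y assume y: "\<forall>i. y i \<in> UNIV - {z}" "y \<longlonglongrightarrow> z"
      have "\<forall>\<^sub>F n in sequentially. dist (y n) z < r / 2" using tendstoD[OF y(2), of "r / 2"] r by simp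
      then obtain N where N: "\<And>n. n \<ge> N ==> dist (y n) z < r / 2" by (auto simp: eventually_sequentially)
      define x where "x = (\<lambda>n. y (n + N))"
      have x: "x n \<in> ball z (r / 2) - {z}" for n using y(1) N[of "n + N"] by (auto simp: x_def dist_commute)
      have xl: "x \<longlonglongrightarrow> z" unfolding x_def by (rule LIMSEQ_ignore_initial_segment[OF y(2)])
      have "(\<lambda>n. LINT t|\<mu>. Q (x n) t) \<longlonglongrightarrow> (LINT t|\<mu>. D t)"
      proof (rule integral_dominated_convergence[where w = "\<lambda>_. 4 * B / r"])
        have "AE t in \<mu>. (\<lambda>n. Q (x n) t) \<longlonglongrightarrow> deriv (m t) z" by (rule Qlim[OF _ xl]) (use x bm in blast)
        thus "AE t in \<mu>. (\<lambda>n. Q (x n) t) \<longlonglongrightarrow> D t" using Deq by eventually_elim simp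
        show "Q (x n) \<in> borel_measurable \<mu>" for n using x bm by (blast intro: Qm)
        show "AE t in \<mu>. norm (Q (x n) t) \<le> 4 * B / r" for n by (rule Qb[OF x])
      qed (simp_all add: Dm)
      moreover have "(LINT t|\<mu>. Q (x n) t) = (G (x n) - G z) / (x n - z)" for n
      proof -
        have "x n \<in> ball z0 e" using x bm r by blast
        thus ?thesis using int[OF z] int[of "x n"] by (simp add: Q_def G_def)
      qed
      ultimately have "(\<lambda>n. (G (x n) - G z) / (x n - z)) \<longlonglongrightarrow> (LINT t|\<mu>. D t)" by simp
      thus "((\<lambda>y. (G y - G z) / (y - z)) \<circ> y) \<longlonglongrightarrow> (LINT t|\<mu>. D t)"
        unfolding x_def o_def by (rule LIMSEQ_offset[where k = N])
    qed
    thus ?thesis by (auto simp: field_differentiable_def has_field_derivative_iff)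
  qed
  thus ?thesis unfolding G_def using field_differentiable_at_within holomorphic_on_def by blast
qed

definition circ_measure :: "real measure" where "circ_measure = restrict_space lborel {0..1}"

definition cauchy_kernel :: "complex \<Rightarrow> real \<Rightarrow> complex \<Rightarrow> real \<Rightarrow> complex" where
  "cauchy_kernel c r s t = (circlepath c r t - c) / (circlepath c r t - s)"

text \<open>The Cauchy integral as a Lebesgue integral over the parameter of the circle. The function that is integrated need only be
  bounded and measurable.\<close>
definition cauchy_int :: "complex \<Rightarrow> real \<Rightarrow> (complex \<Rightarrow> complex) \<Rightarrow> complex \<Rightarrow> complex" where
  "cauchy_int c r \<phi> s = (LINT t|circ_measure. \<phi> (circlepath c r t) * cauchy_kernel c r s t)"

lemma finite_circ_measure: "finite_measure circ_measure"
  by (rule finite_measureI) (simp add: circ_measure_def space_restrict_space emeasure_restrict_space)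

lemma borel_imp_circ_measurable: "g \<in> borel_measurable borel ==> g \<in> borel_measurable circ_measure"
  unfolding circ_measure_def by (rule measurable_restrict_space1) simp

lemma AE_circ_measure_finite: "finite N ==> AE t in circ_measure. t \<notin> N"
  unfolding circ_measure_def
  by (subst AE_restrict_space_iff) (auto intro: AE_mp[OF AE_not_in[of N lborel]] simp: finite_imp_null_set_lborel)

lemma circlepath_dist: "r > 0 ==> norm (circlepath c r t - c) = r"
  by (simp add: circlepath norm_mult)

lemma circlepath_in_sphere: "r > 0 ==> circlepath c r t \<in> sphere c r"
  using circlepath_dist[of r c t] by (simp add: dist_norm norm_minus_commute)

lemma continuous_circlepath: "continuous_on UNIV (circlepath c r)"
  unfolding circlepath by (intro continuous_intros)

lemma measurable_circlepath [measurable]: "circlepath c r \<in> borel_measurable borel"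
  by (rule borel_measurable_continuous_onI[OF continuous_circlepath])

lemma cauchy_kernel_bound:
  assumes "r > 0" "norm (s - c) \<le> r'" "r' < r"
  shows "norm (cauchy_kernel c r s t) \<le> r / (r - r')" "circlepath c r t \<noteq> s"
proof -
  have "norm (circlepath c r t - c) - norm (s - c) \<le> norm (circlepath c r t - s)"
    using norm_triangle_ineq2[of "circlepath c r t - c" "s - c"] by simp
  hence *: "r - r' \<le> norm (circlepath c r t - s)" using assms circlepath_dist[OF assms(1), of c t] by linarith
  show "norm (cauchy_kernel c r s t) \<le> r / (r - r')"
    unfolding cauchy_kernel_def norm_divide circlepath_dist[OF assms(1)] using * assms by (intro divide_left_mono mult_pos_pos) auto
  show "circlepath c r t \<noteq> s" using * assms by auto
qed

lemma cauchy_kernel_measurable [measurable]: "cauchy_kernel c r s \<in> borel_measurable borel"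
  unfolding cauchy_kernel_def[abs_def] by (intro borel_measurable_divide borel_measurable_diff measurable_circlepath) auto

lemma cauchy_kernel_holomorphic:
  assumes "r > 0" shows "(\<lambda>s. cauchy_kernel c r s t) holomorphic_on ball c r"
  unfolding cauchy_kernel_def
proof (intro holomorphic_intros)
  fix s assume "s \<in> ball c r"
  thus "circlepath c r t - s \<noteq> 0" using circlepath_in_sphere[OF assms, of c t] by auto
qed

lemma cauchy_int_integrable:
  assumes r: "r > 0" "norm (s - c) \<le> r'" "r' < r"
    and \<phi>: "(\<lambda>t. \<phi> (circlepath c r t)) \<in> borel_measurable circ_measure" "\<And>x. x \<in> sphere c r ==> norm (\<phi> x) \<le> B"
  shows "integrable circ_measure (\<lambda>t. \<phi> (circlepath c r t) * cauchy_kernel c r s t)" "norm (cauchy_int c r \<phi> s) \<le> B * (r / (r - r'))"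
proof -
  interpret finite_measure circ_measure by (rule finite_circ_measure)
  have b: "norm (\<phi> (circlepath c r t) * cauchy_kernel c r s t) \<le> B * (r / (r - r'))" for t
    unfolding norm_mult using cauchy_kernel_bound(1)[OF r, of t] \<phi>(2)[OF circlepath_in_sphere[OF r(1)]]
      order.trans[OF norm_ge_zero \<phi>(2)[OF circlepath_in_sphere[OF r(1)]]]
    by (intro mult_mono) auto
  show i: "integrable circ_measure (\<lambda>t. \<phi> (circlepath c r t) * cauchy_kernel c r s t)"
    by (rule integrable_const_bound[of _ "B * (r / (r - r'))"])
       (use b in simp, intro borel_measurable_times[OF \<phi>(1)] borel_imp_circ_measurable cauchy_kernel_measurable)
  have m: "measure circ_measure (space circ_measure) = 1"
    by (simp add: circ_measure_def space_restrict_space measure_restrict_space)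
  have "norm (cauchy_int c r \<phi> s) \<le> (LINT t|circ_measure. norm (\<phi> (circlepath c r t) * cauchy_kernel c r s t))"
    unfolding cauchy_int_def by (rule integral_norm_bound)
  also have "\<dots> \<le> (LINT t|circ_measure. B * (r / (r - r')))"
    by (rule integral_mono) (use i b in auto)
  finally show "norm (cauchy_int c r \<phi> s) \<le> B * (r / (r - r'))" by (simp add: m)
qed

lemma cauchy_int_holomorphic:
  assumes r: "r > 0" and \<phi>: "(\<lambda>t. \<phi> (circlepath c r t)) \<in> borel_measurable circ_measure" "\<And>x. x \<in> sphere c r ==> norm (\<phi> x) \<le> B"
  shows "cauchy_int c r \<phi> holomorphic_on ball c r"
proof -
  have B: "B \<ge> 0" using order.trans[OF norm_ge_zero \<phi>(2)[OF circlepath_in_sphere[OF r]]] .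
  have small: "cauchy_int c r \<phi> holomorphic_on ball c r'" if r': "0 < r'" "r' < r" for r'
    unfolding cauchy_int_def
  proof (rule holomorphic_parameter_integral[where m = "\<lambda>t s. \<phi> (circlepath c r t) * cauchy_kernel c r s t" and B = "B * (r / (r - r'))"])
    show "AE t in circ_measure. (\<lambda>s. \<phi> (circlepath c r t) * cauchy_kernel c r s t) holomorphic_on ball c r' \<and>
        (\<forall>s\<in>ball c r'. norm (\<phi> (circlepath c r t) * cauchy_kernel c r s t) \<le> B * (r / (r - r')))"
    proof (intro AE_I2 conjI ballI)
      fix t
      show "(\<lambda>s. \<phi> (circlepath c r t) * cauchy_kernel c r s t) holomorphic_on ball c r'"
        using r' by (intro holomorphic_intros holomorphic_on_subset[OF cauchy_kernel_holomorphic[OF r]]) auto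
      fix s assume "s \<in> ball c r'"
      hence s: "norm (s - c) \<le> r'" by (simp add: dist_norm norm_minus_commute)
      show "norm (\<phi> (circlepath c r t) * cauchy_kernel c r s t) \<le> B * (r / (r - r'))"
        unfolding norm_mult using cauchy_kernel_bound(1)[OF r s r'(2), of t] \<phi>(2)[OF circlepath_in_sphere[OF r]] B
        by (intro mult_mono) auto
    qed
    show "(\<lambda>t. \<phi> (circlepath c r t) * cauchy_kernel c r s t) \<in> borel_measurable circ_measure" for s
      by (intro borel_measurable_times \<phi>(1) borel_imp_circ_measurable cauchy_kernel_measurable)
  qed (use r r' B in \<open>auto intro: finite_circ_measure\<close>)
  have "cauchy_int c r \<phi> field_differentiable at s" if "s \<in> ball c r" for s
  proof -
    have "dist c s < r" using that by simp
    then obtain r' where r': "dist c s < r'" "r' < r" using dense by blast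
    hence "0 < r'" using zero_le_dist[of c s] by linarith
    from small[OF this r'(2)] show ?thesis
      by (rule holomorphic_on_imp_differentiable_at) (use r' in auto)
  qed
  thus ?thesis using field_differentiable_at_within holomorphic_on_def by blast
qed

lemma cauchy_int_reproduces:
  assumes r: "r > 0" and h: "h holomorphic_on cball c r" and s: "s \<in> ball c r"
  shows "cauchy_int c r h s = h s"
proof -
  have ns: "circlepath c r t \<noteq> s" for t using circlepath_in_sphere[OF r, of c t] s by auto
  have hc: "continuous_on UNIV (\<lambda>t. h (circlepath c r t))"
    by (rule continuous_on_compose2[OF holomorphic_on_imp_continuous_on[OF h] continuous_circlepath])
       (use circlepath_in_sphere[OF r] sphere_cball in auto)
  have cont: "continuous_on UNIV (\<lambda>t. h (circlepath c r t) * cauchy_kernel c r s t)"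
    unfolding cauchy_kernel_def by (intro continuous_intros hc continuous_circlepath) (use ns in auto)
  have "((\<lambda>u. h u / (u - s)) has_contour_integral (2 * of_real pi * \<i> * h s)) (circlepath c r)"
    using s by (intro Cauchy_integral_circlepath_simple[OF h]) (simp add: dist_norm norm_minus_commute)
  hence "((\<lambda>t. h (circlepath c r t) / (circlepath c r t - s) * vector_derivative (circlepath c r) (at t)) has_integral 2 * of_real pi * \<i> * h s) {0..1}"
    unfolding has_contour_integral .
  moreover have "h (circlepath c r t) / (circlepath c r t - s) * vector_derivative (circlepath c r) (at t)
      = 2 * of_real pi * \<i> * (h (circlepath c r t) * cauchy_kernel c r s t)" for t
  proof -
    have "vector_derivative (circlepath c r) (at t) = 2 * of_real pi * \<i> * (circlepath c r t - c)"
      unfolding vector_derivative_circlepath by (simp add: circlepath)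
    thus ?thesis by (simp add: cauchy_kernel_def)
  qed
  ultimately have "((\<lambda>t. 2 * of_real pi * \<i> * (h (circlepath c r t) * cauchy_kernel c r s t)) has_integral 2 * of_real pi * \<i> * h s) {0..1}"
    by simp
  hence "((\<lambda>t. inverse (2 * of_real pi * \<i>) * (2 * of_real pi * \<i> * (h (circlepath c r t) * cauchy_kernel c r s t))) has_integral
      inverse (2 * of_real pi * \<i>) * (2 * of_real pi * \<i> * h s)) {0..1}"
    by (rule has_integral_mult_right)
  hence hi: "((\<lambda>t. h (circlepath c r t) * cauchy_kernel c r s t) has_integral h s) {0..1}"
    by (simp add: field_simps)
  have si: "set_integrable lborel {0..1} (\<lambda>t. h (circlepath c r t) * cauchy_kernel c r s t)"
    by (rule borel_integrable_atLeastAtMost') (rule continuous_on_subset[OF cont], simp)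
  have "cauchy_int c r h s = (LINT t:{0..1}|lborel. h (circlepath c r t) * cauchy_kernel c r s t)"
    unfolding cauchy_int_def circ_measure_def set_lebesgue_integral_def by (rule integral_restrict_space) simp
  also have "\<dots> = integral {0..1} (\<lambda>t. h (circlepath c r t) * cauchy_kernel c r s t)"
    by (rule set_borel_integral_eq_integral(2)[OF si])
  finally show ?thesis using integral_unique[OF hi] by simp
qed

lemma finite_circlepath_hits:
  assumes "r > 0" "finite Z" shows "finite {t\<in>{0..1}. circlepath c r t \<in> Z}"
proof -
  have fin: "finite ({0..1} \<inter> circlepath c r -` {b})" for b
  proof -
    have inj: "inj_on (circlepath c r) {0..<1}"
      using simple_path_circlepath[of c r] assms(1)
      by (auto simp: simple_path_def loop_free_def inj_on_def) (metis atLeastAtMost_iff less_eq_real_def less_irrefl zero_le_one)+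
    have "finite ({0..<1} \<inter> circlepath c r -` {b})"
      by (rule finite_vimage_IntI[OF _ inj, simplified Int_commute]) simp
    moreover have "{0..1} \<inter> circlepath c r -` {b} \<subseteq> insert 1 ({0..<1} \<inter> circlepath c r -` {b})" by auto
    ultimately show ?thesis by (meson finite.insertI finite_subset)
  qed
  have "{t\<in>{0..1}. circlepath c r t \<in> Z} = (\<Union>b\<in>Z. {0..1} \<inter> circlepath c r -` {b})" by auto
  moreover have "finite \<dots>" by (rule finite_UN_I[OF assms(2) fin])
  ultimately show ?thesis by (simp only:)
qed

section \<open>Removing the arbitrary holomorphic summand of a logarithm\<close>

lemma circle_borel:
  assumes "r > 0" "continuous_on (sphere c r) \<phi>"
  shows "(\<lambda>t. \<phi> (circlepath c r t)) \<in> borel_measurable borel"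
  by (rule borel_measurable_continuous_onI, rule continuous_on_compose2[OF assms(2) continuous_circlepath])
     (use circlepath_in_sphere[OF assms(1)] in auto)

text \<open>The part of \<open>V\<close> that does not depend on the holomorphic summands of \<open>V\<close>.\<close>
definition cauchy_defect :: "complex \<Rightarrow> real \<Rightarrow> (complex \<Rightarrow> complex) \<Rightarrow> complex \<Rightarrow> complex" where
  "cauchy_defect c r V s = V s - cauchy_int c r V s"

lemma cauchy_int_diff:
  assumes r: "r > 0" and s: "s \<in> ball c r"
    and \<phi>: "(\<lambda>t. \<phi> (circlepath c r t)) \<in> borel_measurable borel" "\<And>x. x \<in> sphere c r ==> norm (\<phi> x) \<le> B"
    and \<psi>: "(\<lambda>t. \<psi> (circlepath c r t)) \<in> borel_measurable borel" "\<And>x. x \<in> sphere c r ==> norm (\<psi> x) \<le> B'"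
  shows "cauchy_int c r (\<lambda>x. \<phi> x - \<psi> x) s = cauchy_int c r \<phi> s - cauchy_int c r \<psi> s"
proof -
  have s': "norm (s - c) \<le> dist c s" "dist c s < r" using s by (auto simp: dist_norm norm_minus_commute)
  show ?thesis
    using cauchy_int_integrable(1)[OF r s', of \<phi> B, OF borel_imp_circ_measurable[OF \<phi>(1)] \<phi>(2)]
      cauchy_int_integrable(1)[OF r s', of \<psi> B', OF borel_imp_circ_measurable[OF \<psi>(1)] \<psi>(2)]
    by (simp add: cauchy_int_def left_diff_distrib)
qed

lemma bounded_on_sphere:
  assumes "continuous_on (sphere c r) (\<phi> :: complex \<Rightarrow> complex)"
  obtains B where "\<And>x. x \<in> sphere c r ==> norm (\<phi> x) \<le> B"
proof -
  have "bounded (\<phi> ` sphere c r)" by (intro compact_imp_bounded compact_continuous_image assms) simp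
  thus ?thesis using that unfolding bounded_iff by blast
qed

lemma poly_hol: "poly p holomorphic_on S"
  by (rule poly_holomorphic_on[OF holomorphic_on_ident])

text \<open>Both \<open>V\<close> and \<open>L\<close> are logarithms of \<open>f\<close> up to holomorphic factors. Their difference is holomorphic, and
  the Cauchy integral reproduces it.\<close>
lemma cauchy_defect_eq:
  assumes r: "0 < r" "r < R" and k: "(\<lambda>s. exp (- V s) * f s) holomorphic_on ball c R"
    and f: "\<And>s. s \<in> ball c R ==> f s = poly p s * exp (L s)" and V: "continuous_on (ball c R) V" and L: "continuous_on (ball c R) L"
    and nz: "s1 \<in> ball c R" "f s1 \<noteq> 0" and s: "s \<in> ball c r"
  shows "cauchy_defect c r V s = cauchy_defect c r L s"
proof -
  define m where "m = (\<lambda>s. L s - V s)"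
  have mc: "continuous_on (ball c R) m" unfolding m_def by (intro continuous_intros V L)
  have op: "open {s\<in>ball c R. poly p s \<noteq> 0}"
  proof -
    have "open (ball c R \<inter> poly p -` (-{0}))"
      by (rule continuous_open_preimage) (auto intro!: continuous_intros)
    moreover have "ball c R \<inter> poly p -` (-{0}) = {s\<in>ball c R. poly p s \<noteq> 0}" by auto
    ultimately show ?thesis by simp
  qed
  have "m holomorphic_on {s\<in>ball c R. poly p s \<noteq> 0}"
  proof (rule holomorphic_continuous_log[OF _ op])
    show "continuous_on {s\<in>ball c R. poly p s \<noteq> 0} m" by (rule continuous_on_subset[OF mc]) auto
    have h: "(\<lambda>s. (exp (- V s) * f s) / poly p s) holomorphic_on {s\<in>ball c R. poly p s \<noteq> 0}"
      by (intro holomorphic_on_divide holomorphic_on_subset[OF k] poly_hol) auto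
    have e: "(exp (- V s) * f s) / poly p s = exp (m s)" if "s \<in> {s\<in>ball c R. poly p s \<noteq> 0}" for s
      using that f[of s] by (simp add: m_def exp_diff exp_minus field_simps)
    show "(\<lambda>s. exp (m s)) holomorphic_on {s\<in>ball c R. poly p s \<noteq> 0}" by (rule holomorphic_transform[OF h e])
  qed
  moreover have "poly p s1 \<noteq> 0" using f[OF nz(1)] nz(2) by auto
  ultimately have "m holomorphic_on ball c R"
    using holomorphic_across_zero_set[OF mc _ open_ball connected_ball poly_hol nz(1)] by blast
  hence "m holomorphic_on cball c r" by (rule holomorphic_on_subset) (use r in auto)
  hence ms: "cauchy_int c r m s = m s" using cauchy_int_reproduces r(1) s by blast
  have sub: "sphere c r \<subseteq> ball c R" using r by auto
  have c: "continuous_on (sphere c r) L" "continuous_on (sphere c r) V" using L V sub continuous_on_subset by blast+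
  obtain B where B: "\<And>x. x \<in> sphere c r ==> norm (L x) \<le> B" using bounded_on_sphere[OF c(1)] by blast
  obtain B' where B': "\<And>x. x \<in> sphere c r ==> norm (V x) \<le> B'" using bounded_on_sphere[OF c(2)] by blast
  have "cauchy_int c r m s = cauchy_int c r L s - cauchy_int c r V s" unfolding m_def
    by (rule cauchy_int_diff[OF r(1) s circle_borel[OF r(1) c(1)] B circle_borel[OF r(1) c(2)] B'])
  hence "cauchy_int c r L s - cauchy_int c r V s = L s - V s" using ms unfolding m_def by (simp only:)
  thus ?thesis by (simp add: cauchy_defect_def algebra_simps)
qed

lemma continuous_log_on_ball_times:
  fixes F :: "'a::real_normed_vector \<Rightarrow> complex \<Rightarrow> complex"
  assumes "continuous_on (ball z0 e \<times> ball c r) (\<lambda>(z, s). F z s)" "\<And>z s. z \<in> ball z0 e ==> s \<in> ball c r ==> F z s \<noteq> 0"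
  obtains L where "continuous_on (ball z0 e \<times> ball c r) (\<lambda>(z, s). L z s)" "\<And>z s. z \<in> ball z0 e ==> s \<in> ball c r ==> F z s = exp (L z s)"
proof -
  have "contractible (ball z0 e \<times> ball c r)" by (intro convex_imp_contractible convex_Times) auto
  moreover have "(\<lambda>(z, s). F z s) x \<noteq> 0" if "x \<in> ball z0 e \<times> ball c r" for x using that assms(2) by auto
  ultimately obtain g where g: "continuous_on (ball z0 e \<times> ball c r) g" "\<And>x. x \<in> ball z0 e \<times> ball c r ==> (\<lambda>(z, s). F z s) x = exp (g x)"
    using continuous_logarithm_on_contractible[OF assms(1)] by metis
  have "continuous_on (ball z0 e \<times> ball c r) (\<lambda>(z, s). g (z, s))" using g(1) by (simp add: case_prod_unfold)
  moreover have "F z s = exp (g (z, s))" if "z \<in> ball z0 e" "s \<in> ball c r" for z s using g(2)[of "(z, s)"] that by simp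
  ultimately show ?thesis using that[of "\<lambda>z s. g (z, s)"] by blast
qed

lemma (in line_family) finite_zeros_sphere:
  assumes z: "z \<in> X" and nz: "\<exists>s\<in>D. f z s \<noteq> 0" and r: "cball c r \<subseteq> D"
  shows "finite {s\<in>sphere c r. f z s = 0}"
proof -
  have "finite {s\<in>sphere c r. k z s = 0}"
    by (rule finite_zeros_in_compact[OF hol_k[OF z] D(1,2)]) (use nz r sphere_cball in auto)
  thus ?thesis by simp
qed

text \<open>The zeros on one line are isolated, so almost every circle avoids them.\<close>
lemma (in line_family) good_radius:
  assumes z: "z \<in> X" and nz: "\<exists>s\<in>D. f z s \<noteq> 0" and r: "cball c R2 \<subseteq> D" "R1 < R2"
  obtains r where "R1 < r" "r < R2" "z \<in> E c r"
proof -
  have "finite {s\<in>cball c R2. k z s = 0}"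
    by (rule finite_zeros_in_compact[OF hol_k[OF z] D(1,2) _ r(1)]) (use nz in auto)
  hence "finite (dist c ` {s\<in>cball c R2. f z s = 0})" by simp
  moreover have "infinite {R1<..<R2}" using r(2) by (rule infinite_Ioo)
  ultimately obtain r where "r \<in> {R1<..<R2}" "r \<notin> dist c ` {s\<in>cball c R2. f z s = 0}"
    by (meson finite_subset subsetI)
  thus ?thesis using z by (intro that[of r]) (auto simp: E_def)
qed

lemma cauchy_int_continuous:
  fixes L :: "'a::metric_space \<Rightarrow> complex \<Rightarrow> complex"
  assumes K: "compact K" and L: "continuous_on (K \<times> sphere c r) (\<lambda>(z, s). L z s)" and r: "r' < r" "0 < r"
  shows "continuous_on (K \<times> cball c r') (\<lambda>(z, s). cauchy_int c r (L z) s)"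
  unfolding continuous_on_sequentially
proof (intro allI ballI impI, elim conjE)
  fix x a assume a: "a \<in> K \<times> cball c r'" and x: "\<forall>n. x n \<in> K \<times> cball c r'" "x \<longlonglongrightarrow> a"
  have "bounded ((\<lambda>(z, s). L z s) ` (K \<times> sphere c r))"
    by (intro compact_imp_bounded compact_continuous_image L compact_Times K) simp
  then obtain B where B: "\<And>z s. z \<in> K ==> s \<in> sphere c r ==> norm (L z s) \<le> B" unfolding bounded_iff by fastforce
  have zK: "fst a \<in> K" "\<And>n. fst (x n) \<in> K" using a x(1) by (auto simp: mem_Times_iff)
  have sC: "norm (snd a - c) \<le> r'" "\<And>n. norm (snd (x n) - c) \<le> r'"
    using a x(1) by (auto simp: mem_Times_iff dist_norm norm_minus_commute)
  have cz: "continuous_on (sphere c r) (L z)" if "z \<in> K" for z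
  proof -
    have "continuous_on (sphere c r) (\<lambda>s. (\<lambda>(z, s). L z s) (z, s))"
      by (rule continuous_on_compose2[OF L]) (use that in \<open>auto intro!: continuous_intros\<close>)
    thus ?thesis by simp
  qed
  have m: "(\<lambda>t. L z (circlepath c r t) * cauchy_kernel c r s t) \<in> borel_measurable circ_measure" if "z \<in> K" for z s
    by (intro borel_measurable_times borel_imp_circ_measurable circle_borel r(2) cz that cauchy_kernel_measurable)
  have B0: "B \<ge> 0" using order.trans[OF norm_ge_zero B[OF zK(1) circlepath_in_sphere[OF r(2)]]] .
  have "(\<lambda>n. LINT t|circ_measure. L (fst (x n)) (circlepath c r t) * cauchy_kernel c r (snd (x n)) t)
     \<longlonglongrightarrow> (LINT t|circ_measure. L (fst a) (circlepath c r t) * cauchy_kernel c r (snd a) t)"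
  proof (rule integral_dominated_convergence[where w = "\<lambda>_. B * (r / (r - r'))"])
    interpret finite_measure circ_measure by (rule finite_circ_measure)
    show "integrable circ_measure (\<lambda>_. B * (r / (r - r')))" by simp
    show "AE t in circ_measure. norm (L (fst (x n)) (circlepath c r t) * cauchy_kernel c r (snd (x n)) t) \<le> B * (r / (r - r'))" for n
      unfolding norm_mult using cauchy_kernel_bound(1)[OF r(2) sC(2) r(1)] B[OF zK(2) circlepath_in_sphere[OF r(2)]] B0
      by (intro AE_I2 mult_mono) auto
    show "AE t in circ_measure. (\<lambda>n. L (fst (x n)) (circlepath c r t) * cauchy_kernel c r (snd (x n)) t)
          \<longlonglongrightarrow> L (fst a) (circlepath c r t) * cauchy_kernel c r (snd a) t"
    proof (intro AE_I2 tendsto_mult)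
      fix t
      have "(\<lambda>n. (\<lambda>(z, s). L z s) (fst (x n), circlepath c r t)) \<longlonglongrightarrow> (\<lambda>(z, s). L z s) (fst a, circlepath c r t)"
        by (rule continuous_on_tendsto_compose[OF L])
           (use zK circlepath_in_sphere[OF r(2)] in \<open>auto intro!: tendsto_intros tendsto_fst[OF x(2)]\<close>)
      thus "(\<lambda>n. L (fst (x n)) (circlepath c r t)) \<longlonglongrightarrow> L (fst a) (circlepath c r t)" by simp
      show "(\<lambda>n. cauchy_kernel c r (snd (x n)) t) \<longlonglongrightarrow> cauchy_kernel c r (snd a) t"
        unfolding cauchy_kernel_def using cauchy_kernel_bound(2)[OF r(2) sC(1) r(1), of t]
        by (intro tendsto_intros tendsto_snd[OF x(2)]) auto
    qed
  qed (use m zK in auto)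
  thus "((\<lambda>(z, s). cauchy_int c r (L z) s) \<circ> x) \<longlonglongrightarrow> (\<lambda>(z, s). cauchy_int c r (L z) s) a"
    by (simp add: o_def case_prod_unfold cauchy_int_def)
qed

text \<open>Although \<open>V\<close> depends arbitrarily on the line, its defect can be computed from the
  continuous logarithm of the zero-free factor of \<open>f\<close>.\<close>
lemma cauchy_defect_continuous:
  fixes X :: "'a::euclidean_space set"
  assumes lf: "line_family X (ball c R') f V C \<alpha> M" and R: "0 < R1" "R1 < R'"
  shows "continuous_on ({z\<in>X. \<exists>s\<in>ball c R'. f z s \<noteq> 0} \<times> ball c R1) (\<lambda>(z, s). cauchy_defect c R1 (V z) s)"
proof -
  interpret line_family X "ball c R'" f V C \<alpha> M by fact
  have "isCont (\<lambda>(z, s). cauchy_defect c R1 (V z) s) x" if x: "x \<in> {z\<in>X. \<exists>s\<in>ball c R'. f z s \<noteq> 0} \<times> ball c R1" for x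
  proof -
    obtain z0 s0 where zs: "x = (z0, s0)" "z0 \<in> X" "\<exists>s\<in>ball c R'. f z0 s \<noteq> 0" "s0 \<in> ball c R1" using x by (cases x) blast
    obtain R2 where R2: "R1 < R2" "R2 < R'" using R(2) dense by blast
    have "cball c R2 \<subseteq> ball c R'" using R2 by auto
    from good_radius[OF zs(2,3) this R2(1)] obtain r where r: "R1 < r" "r < R2" "z0 \<in> E c r" by blast
    have rD: "cball c r \<subseteq> ball c R'" "r > 0" using r R2 R by auto
    obtain e where e: "e > 0" "ball z0 e \<subseteq> E c r" using E_nhd[OF r(3) rD(1)] by blast
    have Fc: "continuous_on (ball z0 e \<times> ball c r) (\<lambda>(z, s). F c r z s)"
      by (rule continuous_on_subset[OF F_continuous[OF rD]]) (use e in auto)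
    have F0: "F c r z s \<noteq> 0" if "z \<in> ball z0 e" "s \<in> ball c r" for z s
      using F_props(2)[OF _ rD, of z s] that e by auto
    obtain L where L: "continuous_on (ball z0 e \<times> ball c r) (\<lambda>(z, s). L z s)"
      "\<And>z s. z \<in> ball z0 e ==> s \<in> ball c r ==> F c r z s = exp (L z s)"
      using continuous_log_on_ball_times[OF Fc F0] by blast
    obtain r' where r': "dist c s0 < r'" "r' < R1" using zs(4) dense[of "dist c s0" R1] by auto
    have "continuous_on (cball z0 (e / 2) \<times> cball c r') (\<lambda>(z, s). cauchy_int c R1 (L z) s)"
    proof (rule cauchy_int_continuous[OF compact_cball _ r'(2) R(1)])
      show "continuous_on (cball z0 (e / 2) \<times> sphere c R1) (\<lambda>(z, s). L z s)"
        by (rule continuous_on_subset[OF L(1)]) (use e r in auto)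
    qed
    hence "continuous_on (ball z0 (e / 2) \<times> ball c r') (\<lambda>(z, s). cauchy_int c R1 (L z) s)"
      by (rule continuous_on_subset) auto
    moreover have "continuous_on (ball z0 (e / 2) \<times> ball c r') (\<lambda>(z, s). L z s)"
      by (rule continuous_on_subset[OF L(1)]) (use e r r' in auto)
    ultimately have "continuous_on (ball z0 (e / 2) \<times> ball c r') (\<lambda>x. (\<lambda>(z, s). L z s) x - (\<lambda>(z, s). cauchy_int c R1 (L z) s) x)"
      by (intro continuous_on_diff)
    hence c1: "continuous_on (ball z0 (e / 2) \<times> ball c r') (\<lambda>(z, s). cauchy_defect c R1 (L z) s)"
      by (simp add: case_prod_unfold cauchy_defect_def)
    have eq: "cauchy_defect c R1 (L z) s = cauchy_defect c R1 (V z) s" if "z \<in> ball z0 (e / 2)" "s \<in> ball c r'" for z s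
    proof -
      have "z \<in> ball z0 e" using that e by auto
      moreover from this have "z \<in> E c r" using e(2) by blast
      ultimately have z: "z \<in> ball z0 e" "z \<in> E c r" "z \<in> X" using E_subset[of c r] by blast+
      have sub: "ball c r \<subseteq> ball c R'" using rD ball_subset_cball by blast
      obtain s1 where s1: "s1 \<in> ball c r" "f z s1 \<noteq> 0"
      proof -
        have nz: "\<exists>s\<in>ball c R'. k z s \<noteq> 0" by (rule k_not_0[OF z(2) rD])
        have "cball c R1 \<subseteq> ball c R'" using R by auto
        from finite_zeros_in_compact[OF hol_k[OF z(3)] D(1,2) compact_cball this nz]
        have "finite {s\<in>cball c R1. f z s = 0}" by simp
        moreover have "\<not> finite (ball c R1)" using uncountable_ball[of R1 c] R uncountable_infinite by blast
        ultimately have "\<not> ball c R1 \<subseteq> {s\<in>cball c R1. f z s = 0}" using finite_subset by blast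
        then obtain s1 where "s1 \<in> ball c R1" "f z s1 \<noteq> 0" using ball_subset_cball by blast
        thus ?thesis using r by (intro that[of s1]) auto
      qed
      have "cauchy_defect c R1 (V z) s = cauchy_defect c R1 (L z) s"
      proof (rule cauchy_defect_eq[OF R(1) r(1)])
        show "(\<lambda>s. exp (- V z s) * f z s) holomorphic_on ball c r" using hol_k[OF z(3)] sub by (simp add: k_def[abs_def] holomorphic_on_subset)
        show "f z s = poly (W c r z) s * exp (L z s)" if "s \<in> ball c r" for s
          using F_props(1)[OF z(2) rD, of s] L(2)[OF z(1) that] that sub by auto
        show "continuous_on (ball c r) (V z)" by (rule continuous_on_subset[OF cont_V[OF z(3)] sub])
        have "continuous_on (ball c r) (\<lambda>s. (\<lambda>(z, s). L z s) (z, s))"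
          by (rule continuous_on_compose2[OF L(1)]) (use z in \<open>auto intro!: continuous_intros\<close>)
        thus "continuous_on (ball c r) (L z)" by simp
      qed (use s1 that r' in auto)
      thus ?thesis by simp
    qed
    have "continuous_on (ball z0 (e / 2) \<times> ball c r') (\<lambda>(z, s). cauchy_defect c R1 (V z) s)"
      by (rule continuous_on_eq[OF c1]) (use eq in auto)
    moreover have "open (ball z0 (e / 2) \<times> ball c r')" by (intro open_Times) auto
    moreover have "x \<in> ball z0 (e / 2) \<times> ball c r'" using zs e r' by auto
    ultimately show ?thesis using continuous_on_eq_continuous_at by blast
  qed
  thus ?thesis by (intro continuous_at_imp_continuous_on) blast
qed

section \<open>The two-dimensional step\<close>

text \<open>The quotient of \<open>h\<close> and \<open>q\<close> has a bounded logarithm, so it is bounded from both sides. The singularities of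
  the logarithm at the zeros of \<open>q\<close> are removable.\<close>
lemma log_ratio_extension:
  assumes S: "open S" "connected S" and q: "q holomorphic_on S" and h: "h holomorphic_on S" and nz: "w \<in> S" "q w \<noteq> 0"
    and m: "\<And>z. z \<in> S ==> q z \<noteq> 0 ==> isCont m z" and hm: "\<And>z. z \<in> S ==> q z \<noteq> 0 ==> h z = q z * exp (m z)"
    and B: "\<And>z. z \<in> S ==> q z \<noteq> 0 ==> norm (m z) \<le> B"
  obtains m' where "m' holomorphic_on S" "\<And>z. z \<in> S ==> norm (m' z) \<le> B" "\<And>z. z \<in> S ==> q z \<noteq> 0 ==> m' z = m z"
proof -
  have "open (S \<inter> q -` (-{0}))"
    using continuous_open_preimage[OF holomorphic_on_imp_continuous_on[OF q] S(1)] by auto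
  moreover have "S \<inter> q -` (-{0}) = {z\<in>S. q z \<noteq> 0}" by auto
  ultimately have op: "open {z\<in>S. q z \<noteq> 0}" by simp
  have mh: "m holomorphic_on {z\<in>S. q z \<noteq> 0}"
  proof (rule holomorphic_continuous_log[OF _ op])
    show "continuous_on {z\<in>S. q z \<noteq> 0} m" by (intro continuous_at_imp_continuous_on ballI m) auto
    have hq: "(\<lambda>z. h z / q z) holomorphic_on {z\<in>S. q z \<noteq> 0}"
      by (intro holomorphic_on_divide holomorphic_on_subset[OF h] holomorphic_on_subset[OF q]) auto
    show "(\<lambda>z. exp (m z)) holomorphic_on {z\<in>S. q z \<noteq> 0}"
      by (rule holomorphic_transform[OF hq]) (use hm in auto)
  qed
  show ?thesis using bounded_extension_across_zeros[OF S q nz mh B] that by blast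
qed

text \<open>Near \<open>z0\<close> one has \<open>f = W * exp L\<close> with \<open>W\<close> holomorphic in \<open>z\<close>, and the defects of \<open>V\<close> and \<open>L\<close> agree. Thus
  \<open>u' = L - G\<close>, where \<open>G\<close> is the Cauchy integral of \<open>L - u\<close>. For all but finitely many points of the circle the function
  \<open>L - u\<close> is holomorphic in \<open>z\<close> off the zeros of \<open>f\<close>, and extends across them. Hence \<open>G\<close> is holomorphic.\<close>
lemma cross_line_step:
  assumes clf: "cross_line_family (ball a R) (ball c R') f V C \<alpha> M U" and R1: "0 < R1" "R1 < R'"
    and uB: "\<And>z s. z \<in> ball a R ==> s \<in> sphere c R1 ==> norm (u z s) \<le> B"
    and um: "\<And>z. z \<in> ball a R ==> (\<lambda>t. u z (circlepath c R1 t)) \<in> borel_measurable borel"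
    and uh: "\<And>s. s \<in> sphere c R1 ==> (\<lambda>z. exp (- u z s) * f z s) holomorphic_on ball a R"
    and uc: "\<And>z s. z \<in> ball a R ==> s \<in> sphere c R1 ==> f z s \<noteq> 0 ==> isCont (\<lambda>z. u z s) z"
    and z0: "z0 \<in> ball a R" and s1: "s1 \<in> ball c R1" and nz: "f z0 s1 \<noteq> 0"
  defines "u' \<equiv> (\<lambda>z. cauchy_defect c R1 (V z) s1 + cauchy_int c R1 (u z) s1)"
  obtains e where "e > 0" "ball z0 e \<subseteq> ball a R" "continuous_on (ball z0 e) u'" "(\<lambda>z. exp (- u' z) * f z s1) holomorphic_on ball z0 e"
proof -
  interpret cross_line_family "ball a R" "ball c R'" f V C \<alpha> M U by fact
  have s1D: "s1 \<in> ball c R'" using s1 R1 by auto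
  have nz0: "\<exists>s\<in>ball c R'. f z0 s \<noteq> 0" using s1D nz by blast
  obtain R2 where R2: "R1 < R2" "R2 < R'" using R1(2) dense by blast
  have "cball c R2 \<subseteq> ball c R'" using R2 by auto
  from good_radius[OF z0 nz0 this R2(1)] obtain r where r: "R1 < r" "r < R2" "z0 \<in> E c r" by blast
  have rD: "cball c r \<subseteq> ball c R'" "r > 0" using r R2 R1 by auto
  have bD: "ball c r \<subseteq> ball c R'" using rD ball_subset_cball by blast
  obtain e1 where e1: "e1 > 0" "ball z0 e1 \<subseteq> E c r" "\<And>s. (\<lambda>z. poly (W c r z) s) holomorphic_on ball z0 e1"
    using W_holomorphic[OF r(3) rD] by blast
  have Fc: "continuous_on (ball z0 e1 \<times> ball c r) (\<lambda>(z, s). F c r z s)"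
    by (rule continuous_on_subset[OF F_continuous[OF rD]]) (use e1 in auto)
  have F0: "F c r z s \<noteq> 0" if "z \<in> ball z0 e1" "s \<in> ball c r" for z s
    using F_props(2)[OF _ rD, of z s] that e1 by auto
  obtain L where L: "continuous_on (ball z0 e1 \<times> ball c r) (\<lambda>(z, s). L z s)"
    "\<And>z s. z \<in> ball z0 e1 ==> s \<in> ball c r ==> F c r z s = exp (L z s)"
    using continuous_log_on_ball_times[OF Fc F0] by blast
  define e where "e = e1 / 2"
  have e: "e > 0" "ball z0 e \<subseteq> ball z0 e1" "cball z0 e \<subseteq> ball z0 e1" using e1 by (auto simp: e_def)
  have eE: "ball z0 e \<subseteq> E c r" using e e1 by blast
  have eX: "ball z0 e \<subseteq> ball a R" using eE E_subset[of c r] by blast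
  have fW: "f z s = poly (W c r z) s * exp (L z s)" if "z \<in> ball z0 e" "s \<in> ball c r" for z s
  proof -
    have "z \<in> E c r" "z \<in> ball z0 e1" "s \<in> ball c R'" using that eE e(2) bD by blast+
    thus ?thesis using F_props(1)[OF _ rD, of z s] L(2)[of z s] that(2) by simp
  qed
  have Lz: "continuous_on (ball c r) (L z)" if "z \<in> ball z0 e1" for z
  proof -
    have "continuous_on (ball c r) (\<lambda>s. (\<lambda>(z, s). L z s) (z, s))"
      by (rule continuous_on_compose2[OF L(1)]) (use that in \<open>auto intro!: continuous_intros\<close>)
    thus ?thesis by simp
  qed
  have Ls: "continuous_on (ball z0 e1) (\<lambda>z. L z s)" if "s \<in> ball c r" for s
  proof -
    have "continuous_on (ball z0 e1) (\<lambda>z. (\<lambda>(z, s). L z s) (z, s))"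
      by (rule continuous_on_compose2[OF L(1)]) (use that in \<open>auto intro!: continuous_intros\<close>)
    thus ?thesis by simp
  qed
  have sph: "sphere c R1 \<subseteq> ball c r" "sphere c R1 \<subseteq> ball c R'" using r R1 by auto
  have "bounded ((\<lambda>(z, s). L z s) ` (cball z0 e \<times> sphere c R1))"
    by (intro compact_imp_bounded compact_continuous_image compact_Times continuous_on_subset[OF L(1)]) (use e sph in auto)
  then obtain B1 where B1: "\<And>z s. z \<in> cball z0 e ==> s \<in> sphere c R1 ==> norm (L z s) \<le> B1" unfolding bounded_iff by fastforce
  have mB: "norm (L z s - u z s) \<le> B1 + B" if "z \<in> ball z0 e" "s \<in> sphere c R1" for z s
    using norm_triangle_ineq4[of "L z s" "u z s"] B1[of z s] uB[of z s] that eX by fastforce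
  have cp: "circlepath c R1 t \<in> sphere c R1" for t by (rule circlepath_in_sphere[OF R1(1)])
  have mm: "(\<lambda>t. L z (circlepath c R1 t) - u z (circlepath c R1 t)) \<in> borel_measurable borel" if "z \<in> ball z0 e" for z
    using that e eX sph by (intro borel_measurable_diff um circle_borel R1 continuous_on_subset[OF Lz]) auto
  define G where "G = (\<lambda>z. LINT t|circ_measure. (L z (circlepath c R1 t) - u z (circlepath c R1 t)) * cauchy_kernel c R1 s1 t)"
  have finN: "finite {t\<in>{0..1}. circlepath c R1 t \<in> {s\<in>sphere c R1. f z s = 0}}" if "z \<in> ball z0 e" for z
  proof (rule finite_circlepath_hits[OF R1(1) finite_zeros_sphere])
    show "z \<in> ball a R" using that eX by blast
    have "k z s \<noteq> 0 ==> f z s \<noteq> 0" for s by simp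
    thus "\<exists>s\<in>ball c R'. f z s \<noteq> 0" using k_not_0[OF _ rD, of z] that eE by blast
  qed (use R1 in auto)
  define N where "N = (\<lambda>z. {t\<in>{0..1}. f z (circlepath c R1 t) = 0})"
  have finN: "finite (N z)" if "z \<in> ball z0 e" for z
    using finN[OF that] cp by (simp add: N_def)
  have "\<exists>m. m holomorphic_on ball z0 e \<and> (\<forall>z\<in>ball z0 e. norm (m z) \<le> B1 + B) \<and>
     (\<forall>z\<in>ball z0 e. f z (circlepath c R1 t) \<noteq> 0 \<longrightarrow> m z = L z (circlepath c R1 t) - u z (circlepath c R1 t))"
    if t: "f z0 (circlepath c R1 t) \<noteq> 0" for t
  proof -
    define \<sigma> where "\<sigma> = circlepath c R1 t"
    have \<sigma>: "\<sigma> \<in> sphere c R1" "\<sigma> \<in> ball c r" using cp sph unfolding \<sigma>_def by blast+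
    have qf: "poly (W c r z) \<sigma> \<noteq> 0 \<longleftrightarrow> f z \<sigma> \<noteq> 0" if "z \<in> ball z0 e" for z using fW[OF that \<sigma>(2)] by simp
    obtain m where "m holomorphic_on ball z0 e" "\<And>z. z \<in> ball z0 e ==> norm (m z) \<le> B1 + B"
      "\<And>z. z \<in> ball z0 e ==> poly (W c r z) \<sigma> \<noteq> 0 ==> m z = L z \<sigma> - u z \<sigma>"
    proof (rule log_ratio_extension[of "ball z0 e" "\<lambda>z. poly (W c r z) \<sigma>" "\<lambda>z. exp (- u z \<sigma>) * f z \<sigma>" z0 "\<lambda>z. L z \<sigma> - u z \<sigma>" "B1 + B"])
      show "(\<lambda>z. poly (W c r z) \<sigma>) holomorphic_on ball z0 e" by (rule holomorphic_on_subset[OF e1(3) e(2)])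
      show "(\<lambda>z. exp (- u z \<sigma>) * f z \<sigma>) holomorphic_on ball z0 e" by (rule holomorphic_on_subset[OF uh[OF \<sigma>(1)] eX])
      show "poly (W c r z0) \<sigma> \<noteq> 0" using qf[of z0] e t by (simp add: \<sigma>_def)
    next
      fix z assume z: "z \<in> ball z0 e" "poly (W c r z) \<sigma> \<noteq> 0"
      have "z \<in> ball z0 e1" using z(1) e(2) by blast
      hence "isCont (\<lambda>z. L z \<sigma>) z" using Ls[OF \<sigma>(2)] by (simp add: continuous_on_eq_continuous_at)
      moreover have "isCont (\<lambda>z. u z \<sigma>) z" using uc[OF _ \<sigma>(1), of z] z eX qf by blast
      ultimately show "isCont (\<lambda>z. L z \<sigma> - u z \<sigma>) z" by (intro continuous_intros)
      show "exp (- u z \<sigma>) * f z \<sigma> = poly (W c r z) \<sigma> * exp (L z \<sigma> - u z \<sigma>)"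
        unfolding fW[OF z(1) \<sigma>(2)] by (simp add: exp_diff exp_minus field_simps)
      show "norm (L z \<sigma> - u z \<sigma>) \<le> B1 + B" using mB z \<sigma> by blast
    qed (use e in auto)
    thus ?thesis using qf unfolding \<sigma>_def by blast
  qed
  then obtain m where m: "\<And>t. f z0 (circlepath c R1 t) \<noteq> 0 ==> m t holomorphic_on ball z0 e \<and> (\<forall>z\<in>ball z0 e. norm (m t z) \<le> B1 + B) \<and>
     (\<forall>z\<in>ball z0 e. f z (circlepath c R1 t) \<noteq> 0 \<longrightarrow> m t z = L z (circlepath c R1 t) - u z (circlepath c R1 t))"
    by metis
  obtain r' where r': "norm (s1 - c) \<le> r'" "r' < R1"
    using s1 by (intro that[of "norm (s1 - c)"]) (auto simp: dist_norm norm_minus_commute)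
  have spc: "space circ_measure = {0..1}" by (simp add: circ_measure_def space_restrict_space)
  have ae: "AE t in circ_measure. f z (circlepath c R1 t) \<noteq> 0" if "z \<in> ball z0 e" for z
    using AE_circ_measure_finite[OF finN[OF that]] AE_space by eventually_elim (simp add: N_def spc)
  have z0e: "z0 \<in> ball z0 e" using e by simp
  have B0: "B1 + B \<ge> 0" using order.trans[OF norm_ge_zero mB[OF z0e cp]] .
  have "G holomorphic_on ball z0 e"
    unfolding G_def
  proof (rule holomorphic_parameter_integral[OF finite_circ_measure e(1), where m = "\<lambda>t z. m t z * cauchy_kernel c R1 s1 t" and B = "(B1 + B) * (R1 / (R1 - r'))"])
    show "AE t in circ_measure. (\<lambda>z. m t z * cauchy_kernel c R1 s1 t) holomorphic_on ball z0 e \<and>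
        (\<forall>z\<in>ball z0 e. norm (m t z * cauchy_kernel c R1 s1 t) \<le> (B1 + B) * (R1 / (R1 - r')))"
      using ae[OF z0e]
    proof eventually_elim
      case (elim t)
      have "norm (m t z * cauchy_kernel c R1 s1 t) \<le> (B1 + B) * (R1 / (R1 - r'))" if "z \<in> ball z0 e" for z
        unfolding norm_mult using m[OF elim] that cauchy_kernel_bound(1)[OF R1(1) r', of t] B0 by (intro mult_mono) auto
      moreover have "(\<lambda>z. m t z * cauchy_kernel c R1 s1 t) holomorphic_on ball z0 e"
        using m[OF elim] by (intro holomorphic_on_mult holomorphic_on_const) auto
      ultimately show ?case by blast
    qed
    show "AE t in circ_measure. (L z (circlepath c R1 t) - u z (circlepath c R1 t)) * cauchy_kernel c R1 s1 t = m t z * cauchy_kernel c R1 s1 t"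
      if z: "z \<in> ball z0 e" for z
      using ae[OF z0e] ae[OF z] by eventually_elim (use m z in auto)
    show "(\<lambda>t. (L z (circlepath c R1 t) - u z (circlepath c R1 t)) * cauchy_kernel c R1 s1 t) \<in> borel_measurable circ_measure"
      if z: "z \<in> ball z0 e" for z
      by (intro borel_imp_circ_measurable borel_measurable_times mm[OF z] cauchy_kernel_measurable)
  qed (use B0 R1 r' in auto)
  have u'_eq: "u' z = L z s1 - G z" if z: "z \<in> ball z0 e" for z
  proof -
    have z': "z \<in> ball z0 e1" "z \<in> E c r" "z \<in> ball a R" using z e eE eX by blast+
    have s1r: "s1 \<in> ball c r" using s1 r by auto
    obtain t where t: "f z (circlepath c R1 t) \<noteq> 0"
    proof -
      have "infinite {0..1::real}" by simp
      hence "\<not> {0..1} \<subseteq> N z" using finN[OF z] finite_subset by blast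
      thus ?thesis using that by (auto simp: N_def)
    qed
    have "cauchy_defect c R1 (V z) s1 = cauchy_defect c R1 (L z) s1"
    proof (rule cauchy_defect_eq[OF R1(1) r(1)])
      show "(\<lambda>s. exp (- V z s) * f z s) holomorphic_on ball c r"
        using holomorphic_on_subset[OF hol_k[OF z'(3)] bD] by (simp add: k_def[abs_def])
      show "f z s = poly (W c r z) s * exp (L z s)" if "s \<in> ball c r" for s by (rule fW[OF z that])
      show "continuous_on (ball c r) (V z)" by (rule continuous_on_subset[OF cont_V[OF z'(3)] bD])
      show "continuous_on (ball c r) (L z)" by (rule Lz[OF z'(1)])
      show "circlepath c R1 t \<in> ball c r" using cp sph by blast
    qed (use s1 t in auto)
    moreover have "cauchy_int c R1 (\<lambda>s. L z s - u z s) s1 = cauchy_int c R1 (L z) s1 - cauchy_int c R1 (u z) s1"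
    proof (rule cauchy_int_diff[OF R1(1) s1])
      show "(\<lambda>t. L z (circlepath c R1 t)) \<in> borel_measurable borel"
        by (rule circle_borel[OF R1(1) continuous_on_subset[OF Lz[OF z'(1)] sph(1)]])
      show "norm (L z x) \<le> B1" if "x \<in> sphere c R1" for x using B1 that z by auto
    qed (use um uB z' in blast)+
    moreover have "cauchy_int c R1 (\<lambda>s. L z s - u z s) s1 = G z" by (simp add: cauchy_int_def G_def)
    ultimately show ?thesis by (simp add: u'_def cauchy_defect_def)
  qed
  have s1r: "s1 \<in> ball c r" using s1 r by auto
  show ?thesis
  proof (rule that[OF e(1) eX])
    have cc: "continuous_on (ball z0 e) (\<lambda>z. L z s1 - G z)"
      by (intro continuous_on_diff continuous_on_subset[OF Ls[OF s1r] e(2)] holomorphic_on_imp_continuous_on) fact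
    show "continuous_on (ball z0 e) u'" by (rule continuous_on_eq[OF cc]) (simp add: u'_eq)
    have "(\<lambda>z. poly (W c r z) s1 * exp (G z)) holomorphic_on ball z0 e"
      by (intro holomorphic_on_mult holomorphic_on_subset[OF e1(3) e(2)] holomorphic_on_exp' \<open>G holomorphic_on ball z0 e\<close>)
    thus "(\<lambda>z. exp (- u' z) * f z s1) holomorphic_on ball z0 e"
    proof (rule holomorphic_transform)
      fix z assume z: "z \<in> ball z0 e"
      show "poly (W c r z) s1 * exp (G z) = exp (- u' z) * f z s1"
        unfolding u'_eq[OF z] fW[OF z s1r] by (simp add: exp_diff exp_minus field_simps)
    qed
  qed
qed

section \<open>Recursion over the coordinates\<close>

lemma on_line_nth [simp]: "on_line j w s $ i = (if i = j then s else w $ i)"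
  by (simp add: on_line_def)

lemma on_line_same [simp]: "on_line j (on_line j w s) t = on_line j w t"
  by (simp add: vec_eq_iff)

lemma on_line_id [simp]: "on_line j w (w $ j) = w"
  by (simp add: vec_eq_iff)

lemma on_line_commute: "i \<noteq> j ==> on_line i (on_line j w s) z = on_line j (on_line i w z) s"
  by (auto simp: vec_eq_iff)

lemma continuous_on_on_line [continuous_intros]:
  assumes "continuous_on S g" "continuous_on S h"
  shows "continuous_on S (\<lambda>p. on_line j (g p) (h p))"
  unfolding on_line_def
proof (rule continuous_on_vec_lambda)
  fix i show "continuous_on S (\<lambda>p. if i = j then h p else g p $ i)"
    using assms by (cases "i = j") (auto intro!: continuous_intros)
qed

text \<open>The function tends to \<open>0\<close> at the zeros of \<open>h\<close>, so Rado's theorem applies although \<open>v\<close> may be discontinuous there.\<close>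
lemma Rado_bounded_exponent:
  assumes S: "open S" and h: "continuous_on S h" and B: "\<And>z. z \<in> S ==> norm (v z) \<le> B"
    and d: "\<And>z. z \<in> S ==> h z \<noteq> 0 ==> (\<lambda>z. exp (- v z) * h z) field_differentiable at z"
  shows "(\<lambda>z. exp (- v z) * h z) holomorphic_on S"
proof (rule Rado[OF _ S])
  show "(\<lambda>z. exp (- v z) * h z) holomorphic_on {z\<in>S. exp (- v z) * h z \<noteq> 0}"
    unfolding holomorphic_on_def using d by (auto intro: field_differentiable_at_within)
  have "isCont (\<lambda>z. exp (- v z) * h z) z" if z: "z \<in> S" for z
  proof (cases "h z = 0")
    case True
    have "isCont h z" using h S z by (simp add: continuous_on_eq_continuous_at)
    hence hc: "(h \<longlongrightarrow> 0) (at z)" using True by (simp add: isCont_def)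
    have "((\<lambda>z. exp (- v z) * h z) \<longlongrightarrow> 0) (at z)"
    proof (rule Lim_null_comparison)
      have "eventually (\<lambda>y. y \<in> S) (at z)" using S z eventually_at_in_open' by blast
      thus "eventually (\<lambda>y. norm (exp (- v y) * h y) \<le> exp B * norm (h y)) (at z)"
      proof eventually_elim
        case (elim y)
        have "norm (exp (- v y)) \<le> exp (norm (- v y))" by (rule norm_exp)
        also have "\<dots> \<le> exp B" using B[OF elim] by simp
        finally show ?case unfolding norm_mult by (rule mult_right_mono) simp
      qed
      have "((\<lambda>y. exp B * norm (h y)) \<longlongrightarrow> exp B * norm (0::complex)) (at z)" by (intro tendsto_intros hc)
      thus "((\<lambda>y. exp B * norm (h y)) \<longlongrightarrow> 0) (at z)" by simp
    qed
    thus ?thesis using True by (simp add: isCont_def)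
  qed (use d[OF z] field_differentiable_imp_continuous_at in blast)
  thus "continuous_on S (\<lambda>z. exp (- v z) * h z)" by (intro continuous_at_imp_continuous_on) blast
qed

lemma open_polydisc:
  fixes x :: "complex ^ 'n"
  shows "open {w :: complex ^ 'n. \<forall>i. dist (x $ i) (w $ i) < r i}"
proof -
  have "{w :: complex ^ 'n. \<forall>i. dist (x $ i) (w $ i) < r i} = (\<Inter>i. {w. dist (x $ i) (w $ i) < r i})" by auto
  moreover have "open (\<Inter>i. {w :: complex ^ 'n. dist (x $ i) (w $ i) < r i})"
    by (intro open_INT) (auto intro!: open_Collect_less continuous_intros)
  ultimately show ?thesis by (simp only:)
qed

definition polybox :: "complex ^ 'n \<Rightarrow> real \<Rightarrow> (complex ^ 'n) set" where
  "polybox x r = {w. \<forall>i. dist (x $ i) (w $ i) < r}"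

lemma polybox_nth: "w \<in> polybox x r ==> w $ i \<in> ball (x $ i) r"
  by (simp add: polybox_def)

lemma polybox_mono: "r \<le> r' ==> polybox x r \<subseteq> polybox x r'"
  unfolding polybox_def by (auto intro: order.strict_trans2)

lemma polybox_on_line: "w \<in> polybox x r ==> s \<in> ball (x $ i) r ==> on_line i w s \<in> polybox x r"
  by (simp add: polybox_def)

lemma open_polybox: "open (polybox x r)"
  unfolding polybox_def by (rule open_polydisc)

text \<open>\<open>VV j w\<close> is the logarithm on the \<open>j\<close>-th line through \<open>w\<close>; it depends on the line only.\<close>
locale polydisc_data =
  fixes x :: "complex ^ 'n" and f :: "complex ^ 'n \<Rightarrow> complex" and VV :: "'n \<Rightarrow> complex ^ 'n \<Rightarrow> complex \<Rightarrow> complex"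
    and R' C \<alpha> M :: real
  assumes R': "R' > 0" and cont: "continuous_on (polybox x R') f" and \<alpha>: "\<alpha> > 0"
    and VV_line: "\<And>j w s. VV j (on_line j w s) = VV j w"
    and VV_bound: "\<And>j w s. w \<in> polybox x R' ==> s \<in> ball (x $ j) R' ==> norm (VV j w s) \<le> M"
    and VV_hoelder: "\<And>j w s t. w \<in> polybox x R' ==> s \<in> ball (x $ j) R' ==> t \<in> ball (x $ j) R' ==> norm (VV j w s - VV j w t) \<le> C * dist s t powr \<alpha>"
    and VV_hol: "\<And>j w. w \<in> polybox x R' ==> (\<lambda>s. exp (- VV j w s) * f (on_line j w s)) holomorphic_on ball (x $ j) R'"
begin

abbreviation Q where "Q \<equiv> polybox x R'"

lemma open_Q: "open Q" by (rule open_polybox)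

lemma on_line_Q: "w \<in> Q ==> s \<in> ball (x $ j) R' ==> on_line j w s \<in> Q"
  by (auto simp: polybox_def)

lemma f_line_cont: assumes "w \<in> Q" shows "continuous_on (ball (x $ j) R') (\<lambda>s. f (on_line j w s))"
  by (rule continuous_on_compose2[OF cont]) (use assms on_line_Q in \<open>auto intro!: continuous_intros\<close>)

lemma line_family_Q: "line_family Q (ball (x $ j) R') (\<lambda>w s. f (on_line j w s)) (VV j) C \<alpha> M"
proof
  show "continuous_on (Q \<times> ball (x $ j) R') (\<lambda>(z, s). f (on_line j z s))"
    unfolding case_prod_unfold
    by (rule continuous_on_compose2[OF cont]) (auto intro!: continuous_intros on_line_Q)
qed (use open_Q VV_bound VV_hoelder VV_hol \<alpha> in auto)

lemma line_family_cross:
  assumes ij: "i \<noteq> j" and w: "w \<in> Q" and R: "R \<le> R'"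
  shows "cross_line_family (ball (x $ i) R) (ball (x $ j) R') (\<lambda>z s. f (on_line j (on_line i w z) s))
    (\<lambda>z. VV j (on_line i w z)) C \<alpha> M (\<lambda>s. VV i (on_line j w s))"
proof -
  have sub: "ball (x $ i) R \<subseteq> ball (x $ i) R'" using R by auto
  have wz: "on_line i w z \<in> Q" if "z \<in> ball (x $ i) R" for z using on_line_Q[OF w] that sub by blast
  have wzs: "on_line j (on_line i w z) s \<in> Q" if "z \<in> ball (x $ i) R" "s \<in> ball (x $ j) R'" for z s
    using on_line_Q[OF wz] that by blast
  show ?thesis
  proof
    show "continuous_on (ball (x $ i) R \<times> ball (x $ j) R') (\<lambda>(z, s). f (on_line j (on_line i w z) s))"
      unfolding case_prod_unfold
      by (rule continuous_on_compose2[OF cont]) (use wzs in \<open>auto intro!: continuous_intros\<close>)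
    fix s assume s: "s \<in> ball (x $ j) R'"
    have ws: "on_line j w s \<in> Q" by (rule on_line_Q[OF w s])
    interpret li: line_family Q "ball (x $ i) R'" "\<lambda>w s. f (on_line i w s)" "VV i" C \<alpha> M by (rule line_family_Q)
    show "continuous_on (ball (x $ i) R) (VV i (on_line j w s))"
      by (rule continuous_on_subset[OF li.cont_V[OF ws] sub])
    have "(\<lambda>z. exp (- VV i (on_line j w s) z) * f (on_line i (on_line j w s) z)) holomorphic_on ball (x $ i) R"
      by (rule holomorphic_on_subset[OF VV_hol[OF ws] sub])
    thus "(\<lambda>z. exp (- VV i (on_line j w s) z) * f (on_line j (on_line i w z) s)) holomorphic_on ball (x $ i) R"
      by (simp add: on_line_commute[OF ij])
  qed (use VV_bound VV_hoelder VV_hol \<alpha> wz in auto)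
qed

text \<open>The processed coordinates lose a little radius, since the Cauchy integrals are bounded only inside the circle of
  integration; the other coordinates keep the full disc, which contains that circle.\<close>
definition PJ :: "real \<Rightarrow> 'n set \<Rightarrow> (complex ^ 'n) set" where
  "PJ R J = {w. \<forall>i. dist (x $ i) (w $ i) < (if i \<in> J then R else R')}"

text \<open>Continuity is demanded only at points where \<open>f\<close> does not vanish: at the other points the construction gives none. Measurability in all
  variables is what the Cauchy integrals of the next step require.\<close>
definition solves_along :: "real \<Rightarrow> 'n set \<Rightarrow> (complex ^ 'n \<Rightarrow> complex) \<Rightarrow> bool" where
  "solves_along R J u \<longleftrightarrow> u \<in> borel_measurable borel \<and> (\<exists>B. \<forall>w. norm (u w) \<le> B) \<and>
    (\<forall>i\<in>J. \<forall>w\<in>PJ R J. (\<lambda>s. exp (- u (on_line i w s)) * f (on_line i w s)) holomorphic_on ball (x $ i) R) \<and>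
    (\<forall>i\<in>J. \<forall>w\<in>PJ R J. f w \<noteq> 0 \<longrightarrow> isCont (\<lambda>s. u (on_line i w s)) (w $ i))"

lemma PJ_Q: "R \<le> R' ==> PJ R J \<subseteq> Q"
  unfolding PJ_def polybox_def by (force split: if_splits)

lemma PJ_nth: "w \<in> PJ R J ==> dist (x $ i) (w $ i) < (if i \<in> J then R else R')"
  unfolding PJ_def by blast

lemma PJ_line:
  assumes "w \<in> PJ R J" "\<And>k. k \<in> J' - J ==> k = i" "J - {i} \<subseteq> J'" "s \<in> ball (x $ i) (if i \<in> J' then R else R')"
  shows "on_line i w s \<in> PJ R J'"
  unfolding PJ_def
proof (intro CollectI allI)
  fix k
  show "dist (x $ k) (on_line i w s $ k) < (if k \<in> J' then R else R')"
  proof (cases "k = i")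
    case False
    hence "k \<in> J' \<longleftrightarrow> k \<in> J" using assms(2,3) by blast
    thus ?thesis using PJ_nth[OF assms(1), of k] False by simp
  qed (use assms(4) in simp)
qed

lemma cauchy_int_line_measurable:
  fixes u :: "complex ^ 'n \<Rightarrow> complex"
  assumes "u \<in> borel_measurable borel"
  shows "(\<lambda>w. cauchy_int c r (\<lambda>\<sigma>. u (on_line j w \<sigma>)) (w $ j)) \<in> borel_measurable borel"
  unfolding cauchy_int_def
proof (rule sigma_finite_measure.borel_measurable_lebesgue_integral)
  interpret finite_measure circ_measure by (rule finite_circ_measure)
  show "sigma_finite_measure circ_measure" ..
  have id: "(\<lambda>p. (fst p, snd p)) \<in> (borel \<Otimes>\<^sub>M circ_measure) \<rightarrow>\<^sub>M (borel :: ((complex ^ 'n) \<times> real) measure)"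
    unfolding borel_prod[symmetric]
    by (intro measurable_Pair measurable_fst measurable_compose[OF measurable_snd] borel_imp_circ_measurable) simp
  have c1: "(\<lambda>p :: (complex ^ 'n) \<times> real. on_line j (fst p) (circlepath c r (snd p))) \<in> borel_measurable borel"
    by (intro borel_measurable_continuous_onI continuous_intros continuous_on_compose2[OF continuous_circlepath]) auto
  have c2: "(\<lambda>p :: (complex ^ 'n) \<times> real. circlepath c r (snd p) - c) \<in> borel_measurable borel"
    "(\<lambda>p :: (complex ^ 'n) \<times> real. circlepath c r (snd p) - fst p $ j) \<in> borel_measurable borel"
    by (intro borel_measurable_continuous_onI continuous_intros continuous_on_compose2[OF continuous_circlepath]; simp)+
  have "(\<lambda>p :: (complex ^ 'n) \<times> real. u (on_line j (fst p) (circlepath c r (snd p))) * cauchy_kernel c r (fst p $ j) (snd p)) \<in> borel_measurable borel"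
    unfolding cauchy_kernel_def by (intro borel_measurable_times borel_measurable_divide c2 measurable_compose[OF c1]) fact
  from measurable_compose[OF id this]
  show "(\<lambda>(w, t). u (on_line j w (circlepath c r t)) * cauchy_kernel c r (w $ j) t) \<in> borel_measurable (borel \<Otimes>\<^sub>M circ_measure)"
    by (simp add: case_prod_unfold)
qed

text \<open>The new exponent is \<open>(V - K V) + K u\<close>, with \<open>0\<close> in place of \<open>V - K V\<close> on lines in the zero set of \<open>f\<close>, where the
  defect has no meaning. The other lines form an open set on which the defect is continuous, so the whole is Borel.\<close>
lemma solves_along_insert:
  assumes R: "0 < R" "R < R1" "R1 < R'" and u: "solves_along R J u" and j: "j \<notin> J"
  shows "\<exists>u'. solves_along R (insert j J) u'"
proof -
  define c where "c = x $ j"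
  have R1: "0 < R1" using R by simp
  have um: "u \<in> borel_measurable borel" using u by (simp add: solves_along_def)
  obtain B where B: "\<And>w. norm (u w) \<le> B" using u by (auto simp: solves_along_def)
  have uhol: "\<And>i w. i \<in> J ==> w \<in> PJ R J ==> (\<lambda>s. exp (- u (on_line i w s)) * f (on_line i w s)) holomorphic_on ball (x $ i) R"
    and ucont: "\<And>i w. i \<in> J ==> w \<in> PJ R J ==> f w \<noteq> 0 ==> isCont (\<lambda>s. u (on_line i w s)) (w $ i)"
    using u by (auto simp: solves_along_def)
  define G0 where "G0 = {w\<in>Q. \<exists>s\<in>ball c R'. f (on_line j w s) \<noteq> 0}"
  define Gd where "Gd = {w\<in>G0. w $ j \<in> ball c R1}"
  define P' where "P' = PJ R (insert j J)"
  define S where "S = (\<lambda>w. cauchy_defect c R1 (VV j w) (w $ j))"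
  define K where "K = (\<lambda>w. cauchy_int c R1 (\<lambda>\<sigma>. u (on_line j w \<sigma>)) (w $ j))"
  define u' where "u' = (\<lambda>w. indicator P' w *\<^sub>R (indicator Gd w *\<^sub>R S w + K w))"
  interpret lj: line_family Q "ball c R'" "\<lambda>w s. f (on_line j w s)" "VV j" C \<alpha> M
    unfolding c_def by (rule line_family_Q)
  have P'Q: "P' \<subseteq> Q" unfolding P'_def using R by (intro PJ_Q) simp
  have P'c: "w $ j \<in> ball c R" if "w \<in> P'" for w using PJ_nth[OF that[unfolded P'_def], of j] by (simp add: c_def)
  have sub: "ball c R \<subseteq> ball c R1" "ball c R \<subseteq> ball c R'" "sphere c R1 \<subseteq> ball c R'" "ball c R1 \<subseteq> ball c R'" using R by auto
  have uline: "(\<lambda>t. u (on_line j w (circlepath c R1 t))) \<in> borel_measurable borel" for w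
    by (rule measurable_compose[OF borel_measurable_continuous_onI um]) (intro continuous_intros continuous_circlepath)
  have G0_open: "open G0"
  proof -
    have "open (\<Union>s\<in>ball c R'. Q \<inter> (\<lambda>w. f (on_line j w s)) -` (- {0}))"
      by (intro open_UN ballI continuous_open_preimage lj.cont_z open_Q) auto
    moreover have "(\<Union>s\<in>ball c R'. Q \<inter> (\<lambda>w. f (on_line j w s)) -` (- {0})) = G0" by (auto simp: G0_def)
    ultimately show ?thesis by simp
  qed
  have "open (G0 \<inter> (\<lambda>w. w $ j) -` ball c R1)"
    by (intro continuous_open_preimage G0_open continuous_intros) auto
  moreover have "G0 \<inter> (\<lambda>w. w $ j) -` ball c R1 = Gd" by (auto simp: Gd_def)
  ultimately have Gd_open: "open Gd" by simp
  have "continuous_on Gd (\<lambda>w. (\<lambda>(z, s). cauchy_defect c R1 (VV j z) s) (w, w $ j))"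
    by (rule continuous_on_compose2[OF cauchy_defect_continuous[OF lj.line_family_axioms R1 R(3)]])
      (auto intro!: continuous_intros simp: Gd_def G0_def)
  hence S_cont: "continuous_on Gd S" by (simp add: S_def)
  have u'm: "u' \<in> borel_measurable borel"
  proof -
    have km: "K \<in> borel_measurable borel" unfolding K_def by (rule cauchy_int_line_measurable[OF um])
    have sm: "(\<lambda>w. indicator Gd w *\<^sub>R S w) \<in> borel_measurable borel"
      by (rule borel_measurable_continuous_on_indicator[OF _ S_cont]) (simp add: borel_open Gd_open)
    have "P' \<in> sets borel" unfolding P'_def PJ_def by (intro borel_open open_polydisc)
    thus ?thesis unfolding u'_def
      by (rule borel_measurable_scaleR[OF borel_measurable_indicator borel_measurable_add[OF sm km]])
  qed
  define B' where "B' = (M + M * (R1 / (R1 - R))) + B * (R1 / (R1 - R))"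
  have M0: "M \<ge> 0"
  proof -
    have "x \<in> Q" using R' by (simp add: polybox_def)
    hence "norm (VV j x c) \<le> M" by (rule VV_bound) (use R' in \<open>simp add: c_def\<close>)
    thus ?thesis using norm_ge_zero order.trans by blast
  qed
  have B0: "B \<ge> 0" using B[of x] norm_ge_zero order.trans by blast
  have Vsph: "(\<lambda>t. VV j w (circlepath c R1 t)) \<in> borel_measurable borel" "\<And>s. s \<in> sphere c R1 ==> norm (VV j w s) \<le> M" if "w \<in> Q" for w
  proof -
    show "(\<lambda>t. VV j w (circlepath c R1 t)) \<in> borel_measurable borel"
      by (rule circle_borel[OF R1 continuous_on_subset[OF lj.cont_V[OF that] sub(3)]])
    show "norm (VV j w s) \<le> M" if "s \<in> sphere c R1" for s using VV_bound[OF \<open>w \<in> Q\<close>] that sub unfolding c_def by blast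
  qed
  have u'b: "norm (u' w) \<le> B'" for w
  proof (cases "w \<in> P'")
    case True
    have wc: "norm (w $ j - c) \<le> R" using P'c[OF True] by (simp add: dist_norm norm_minus_commute)
    have wQ: "w \<in> Q" using True P'Q by blast
    have "norm (S w) \<le> norm (VV j w (w $ j)) + norm (cauchy_int c R1 (VV j w) (w $ j))"
      unfolding S_def cauchy_defect_def by (rule norm_triangle_ineq4)
    also have "\<dots> \<le> M + M * (R1 / (R1 - R))"
    proof (rule add_mono)
      show "norm (VV j w (w $ j)) \<le> M" using VV_bound[OF wQ] P'c[OF True] sub unfolding c_def by blast
      show "norm (cauchy_int c R1 (VV j w) (w $ j)) \<le> M * (R1 / (R1 - R))"
        by (rule cauchy_int_integrable(2)[OF R1 wc R(2) borel_imp_circ_measurable]) (use Vsph[OF wQ] in auto)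
    qed
    finally have 1: "norm (S w) \<le> M + M * (R1 / (R1 - R))" .
    have 2: "norm (K w) \<le> B * (R1 / (R1 - R))" unfolding K_def
      by (rule cauchy_int_integrable(2)[OF R1 wc R(2) borel_imp_circ_measurable]) (use B uline in auto)
    have "norm (u' w) \<le> norm (indicator Gd w *\<^sub>R S w) + norm (K w)"
    proof -
      have eq: "u' w = indicator Gd w *\<^sub>R S w + K w" using True by (simp add: u'_def)
      show ?thesis unfolding eq by (rule norm_triangle_ineq)
    qed
    also have "norm (indicator Gd w *\<^sub>R S w) \<le> M + M * (R1 / (R1 - R))"
      using 1 M0 R by (auto simp: indicator_def intro!: add_nonneg_nonneg mult_nonneg_nonneg)
    finally show ?thesis using 2 by (simp add: B'_def)
  next
    case False
    thus ?thesis using M0 B0 R by (auto simp: u'_def B'_def intro!: add_nonneg_nonneg mult_nonneg_nonneg divide_nonneg_nonneg)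
  qed
  have P'_line: "on_line i w s \<in> P'" if "w \<in> P'" "i \<in> insert j J" "s \<in> ball (x $ i) R" for i w s
    unfolding P'_def by (rule PJ_line) (use that in \<open>auto simp: P'_def\<close>)
  have nzG: "w \<in> Gd" if "w \<in> P'" "f w \<noteq> 0" for w
    using that P'Q P'c[OF that(1)] sub by (auto simp: Gd_def G0_def intro!: bexI[of _ "w $ j"])
  \<comment> \<open>On a line that is not contained in the zero set, \<open>u'\<close> is \<open>V\<close> plus a holomorphic function;
    on the other lines the twisted function vanishes identically.\<close>
  have new: "(\<lambda>s. exp (- u' (on_line j w s)) * f (on_line j w s)) holomorphic_on ball c R \<and>
      (f w \<noteq> 0 \<longrightarrow> isCont (\<lambda>s. u' (on_line j w s)) (w $ j))" if w: "w \<in> P'" for w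
  proof (cases "\<exists>s\<in>ball c R'. f (on_line j w s) \<noteq> 0")
    case True
    have wQ: "w \<in> Q" using w P'Q by blast
    define A where "A = cauchy_int c R1 (VV j w)"
    define A' where "A' = cauchy_int c R1 (\<lambda>\<sigma>. u (on_line j w \<sigma>))"
    have Ah: "A holomorphic_on ball c R" unfolding A_def
      by (rule holomorphic_on_subset[OF cauchy_int_holomorphic[OF R1 borel_imp_circ_measurable] sub(1)]) (use Vsph[OF wQ] in auto)
    have Ah': "A' holomorphic_on ball c R" unfolding A'_def
      by (rule holomorphic_on_subset[OF cauchy_int_holomorphic[OF R1 borel_imp_circ_measurable] sub(1)]) (use B uline in auto)
    have eq: "u' (on_line j w s) = VV j w s - A s + A' s" if s: "s \<in> ball c R" for s
    proof -
      have "on_line j w s \<in> P'" using P'_line[OF w, of j s] s by (simp add: c_def)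
      moreover have "on_line j w s \<in> Gd" using True on_line_Q[OF wQ, of s j] s sub by (auto simp: Gd_def G0_def c_def)
      ultimately show ?thesis by (simp add: u'_def S_def K_def cauchy_defect_def A_def A'_def VV_line)
    qed
    have kh: "(\<lambda>s. exp (- VV j w s) * f (on_line j w s)) holomorphic_on ball c R"
      using holomorphic_on_subset[OF lj.hol_k[OF wQ] sub(2)] by (simp add: lj.k_def[abs_def])
    have eh: "(\<lambda>s. exp (A s - A' s)) holomorphic_on ball c R" by (intro holomorphic_intros Ah Ah')
    have 1: "(\<lambda>s. exp (- u' (on_line j w s)) * f (on_line j w s)) holomorphic_on ball c R"
    proof (rule holomorphic_transform[OF holomorphic_on_mult[OF kh eh]])
      fix s assume s: "s \<in> ball c R"
      show "exp (- VV j w s) * f (on_line j w s) * exp (A s - A' s) = exp (- u' (on_line j w s)) * f (on_line j w s)"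
        unfolding eq[OF s] by (simp add: exp_diff exp_minus exp_add field_simps)
    qed
    have "continuous_on (ball c R) (\<lambda>s. VV j w s - A s + A' s)"
      using continuous_on_subset[OF lj.cont_V[OF wQ] sub(2)] holomorphic_on_imp_continuous_on[OF Ah] holomorphic_on_imp_continuous_on[OF Ah']
      by (intro continuous_intros) auto
    hence "continuous_on (ball c R) (\<lambda>s. u' (on_line j w s))" by (rule continuous_on_eq) (simp add: eq)
    hence "isCont (\<lambda>s. u' (on_line j w s)) (w $ j)" using P'c[OF w] by (simp add: continuous_on_eq_continuous_at)
    with 1 show ?thesis by blast
  next
    case False
    hence z: "f (on_line j w s) = 0" if "s \<in> ball c R" for s using that sub by blast
    have "(\<lambda>s. exp (- u' (on_line j w s)) * f (on_line j w s)) holomorphic_on ball c R"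
      by (rule holomorphic_transform[OF holomorphic_on_const[of 0]]) (simp add: z)
    moreover have "f w = 0" using z[OF P'c[OF w]] by simp
    ultimately show ?thesis by blast
  qed
  \<comment> \<open>Along an old coordinate only the points with \<open>f \<noteq> 0\<close> matter; Rado's theorem supplies the others.\<close>
  have old_local: "(\<lambda>s. exp (- u' (on_line i w s)) * f (on_line i w s)) field_differentiable at z0 \<and> isCont (\<lambda>s. u' (on_line i w s)) z0"
    if w: "w \<in> P'" and i: "i \<in> J" and z0: "z0 \<in> ball (x $ i) R" and nz: "f (on_line i w z0) \<noteq> 0" for w i z0
  proof -
    have ij: "i \<noteq> j" using i j by blast
    have wQ: "w \<in> Q" using w P'Q by blast
    have wj: "w $ j \<in> ball c R1" using P'c[OF w] sub by blast
    have PJ': "on_line j w s \<in> PJ R J" if "s \<in> sphere c R1" for s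
      by (rule PJ_line[OF w[unfolded P'_def]]) (use that sub(3) j in \<open>auto simp: c_def\<close>)
    have PJz: "on_line i (on_line j w s) z \<in> PJ R J" if "s \<in> sphere c R1" "z \<in> ball (x $ i) R" for s z
      by (rule PJ_line[OF PJ'[OF that(1)]]) (use that(2) i in auto)
    define v where "v = (\<lambda>z. cauchy_defect c R1 (VV j (on_line i w z)) (w $ j) + cauchy_int c R1 (\<lambda>\<sigma>. u (on_line j (on_line i w z) \<sigma>)) (w $ j))"
    have clf: "cross_line_family (ball (x $ i) R) (ball c R') (\<lambda>z s. f (on_line j (on_line i w z) s))
        (\<lambda>z. VV j (on_line i w z)) C \<alpha> M (\<lambda>s. VV i (on_line j w s))"
      unfolding c_def using R by (intro line_family_cross ij wQ) simp
    obtain e where e: "e > 0" "ball z0 e \<subseteq> ball (x $ i) R" "continuous_on (ball z0 e) v"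
      "(\<lambda>z. exp (- v z) * f (on_line j (on_line i w z) (w $ j))) holomorphic_on ball z0 e"
      unfolding v_def
    proof (rule cross_line_step[OF clf R1 R(3), where u = "\<lambda>z \<sigma>. u (on_line j (on_line i w z) \<sigma>)" and B = B])
      show "(\<lambda>z. exp (- u (on_line j (on_line i w z) s)) * f (on_line j (on_line i w z) s)) holomorphic_on ball (x $ i) R"
        if "s \<in> sphere c R1" for s
        using uhol[OF i PJ'[OF that]] by (simp add: on_line_commute[OF ij])
      show "isCont (\<lambda>z. u (on_line j (on_line i w z) s)) z"
        if "z \<in> ball (x $ i) R" "s \<in> sphere c R1" "f (on_line j (on_line i w z) s) \<noteq> 0" for z s
        using ucont[OF i PJz[OF that(2,1)]] that(3) by (simp add: on_line_commute[OF ij] ij)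
      have "on_line j (on_line i w z0) (w $ j) = on_line i w z0" using ij by (auto simp: vec_eq_iff)
      thus "f (on_line j (on_line i w z0) (w $ j)) \<noteq> 0" using nz by simp
    qed (use B uline wj z0 in auto)
    have line: "on_line j (on_line i w z) (w $ j) = on_line i w z" for z using ij by (auto simp: vec_eq_iff)
    have "continuous_on (ball (x $ i) R) (\<lambda>z. f (on_line i w z))"
      by (rule continuous_on_subset[OF f_line_cont[OF wQ]]) (use R in auto)
    hence "open (ball (x $ i) R \<inter> (\<lambda>z. f (on_line i w z)) -` (- {0}))" by (rule continuous_open_preimage) auto
    hence op: "open (ball z0 e \<inter> (ball (x $ i) R \<inter> (\<lambda>z. f (on_line i w z)) -` (- {0})))" by (rule open_Int[OF open_ball])
    define T where "T = ball z0 e \<inter> (ball (x $ i) R \<inter> (\<lambda>z. f (on_line i w z)) -` (- {0}))"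
    have T: "open T" "z0 \<in> T" "T \<subseteq> ball z0 e" using op e z0 nz by (auto simp: T_def)
    have eq: "v z = u' (on_line i w z)" if "z \<in> T" for z
    proof -
      have "on_line i w z \<in> P'" by (rule P'_line[OF w]) (use that i in \<open>auto simp: T_def\<close>)
      moreover from this have "on_line i w z \<in> Gd" by (rule nzG) (use that in \<open>auto simp: T_def\<close>)
      ultimately show ?thesis using ij by (simp add: u'_def v_def S_def K_def)
    qed
    have "continuous_on T (\<lambda>z. u' (on_line i w z))"
      by (rule continuous_on_eq[OF continuous_on_subset[OF e(3) T(3)]]) (rule eq)
    hence 1: "isCont (\<lambda>z. u' (on_line i w z)) z0" using T by (simp add: continuous_on_eq_continuous_at)
    have "(\<lambda>z. exp (- u' (on_line i w z)) * f (on_line i w z)) holomorphic_on T"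
      by (rule holomorphic_transform[OF holomorphic_on_subset[OF e(4) T(3)]]) (simp add: eq line)
    with 1 show ?thesis using T by (simp add: holomorphic_on_imp_differentiable_at)
  qed
  have old: "(\<lambda>s. exp (- u' (on_line i w s)) * f (on_line i w s)) holomorphic_on ball (x $ i) R \<and>
      (f w \<noteq> 0 \<longrightarrow> isCont (\<lambda>s. u' (on_line i w s)) (w $ i))" if w: "w \<in> P'" and i: "i \<in> J" for w i
  proof (intro conjI impI)
    have wQ: "w \<in> Q" using w P'Q by blast
    show "(\<lambda>s. exp (- u' (on_line i w s)) * f (on_line i w s)) holomorphic_on ball (x $ i) R"
    proof (rule Rado_bounded_exponent[OF open_ball])
      show "continuous_on (ball (x $ i) R) (\<lambda>s. f (on_line i w s))"
        by (rule continuous_on_subset[OF f_line_cont[OF wQ]]) (use R in auto)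
    qed (use u'b old_local[OF w i] in auto)
    assume "f w \<noteq> 0"
    moreover have "w $ i \<in> ball (x $ i) R" using PJ_nth[OF w[unfolded P'_def], of i] i by simp
    ultimately show "isCont (\<lambda>s. u' (on_line i w s)) (w $ i)" using old_local[OF w i, of "w $ i"] by simp
  qed
  have "solves_along R (insert j J) u'"
    unfolding solves_along_def P'_def[symmetric]
    using u'm u'b new old unfolding c_def by blast
  thus ?thesis by blast
qed

lemma solution_exists:
  assumes R: "0 < R" "R < R'"
  shows "\<exists>u. solves_along R UNIV u"
proof -
  obtain R1 where R1: "R < R1" "R1 < R'" using R(2) dense by blast
  have "\<exists>u. solves_along R J u" if "finite J" for J :: "'n set" using that
  proof induction
    case empty
    have "solves_along R {} (\<lambda>_. 0)" by (auto simp: solves_along_def)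
    thus ?case by blast
  next
    case (insert j J)
    thus ?case using solves_along_insert[OF R(1) R1] by blast
  qed
  thus ?thesis by simp
qed

end

section \<open>From separately to jointly holomorphic\<close>

lemma polybox_center: "r > 0 ==> x \<in> polybox x r"
  by (simp add: polybox_def)

lemma convex_polybox:
  fixes x :: "complex ^ 'n"
  shows "convex (polybox x r)"
proof -
  have "polybox x r = (\<Inter>i. (\<lambda>w. w $ i) -` ball (x $ i) r)" by (auto simp: polybox_def)
  moreover have "convex (\<Inter>i. (\<lambda>w :: complex ^ 'n. w $ i) -` ball (x $ i) r)"
    by (intro convex_INT ballI convex_linear_vimage) (auto simp: linear_iff)
  ultimately show ?thesis by simp
qed

lemma polybox_inside_open:
  fixes x :: "complex ^ 'n"
  assumes "open U" "x \<in> U"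
  obtains r where "r > 0" "polybox x r \<subseteq> U"
proof -
  obtain e where e: "e > 0" "ball x e \<subseteq> U" using assms openE by blast
  define r where "r = e / (2 * real CARD('n))"
  have r: "r > 0" using e by (simp add: r_def)
  have "polybox x r \<subseteq> U"
  proof
    fix w assume w: "w \<in> polybox x r"
    have "dist x w \<le> (\<Sum>i\<in>UNIV. dist (x $ i) (w $ i))" unfolding dist_vec_def by (rule L2_set_le_sum) simp
    also have "\<dots> \<le> (\<Sum>i\<in>(UNIV :: 'n set). r)" using w by (intro sum_mono) (auto simp: polybox_def less_imp_le)
    also have "\<dots> = e / 2" by (simp add: r_def)
    finally show "w \<in> U" using e by auto
  qed
  thus ?thesis using that r by blast
qed

text \<open>The corners of the box spanned by \<open>y\<close> and \<open>y'\<close>.\<close>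
definition mix :: "'n set \<Rightarrow> complex ^ 'n \<Rightarrow> complex ^ 'n \<Rightarrow> complex ^ 'n" where
  "mix J y y' = (\<chi> i. if i \<in> J then y' $ i else y $ i)"

lemma mix_nth [simp]: "mix J y y' $ i = (if i \<in> J then y' $ i else y $ i)"
  by (simp add: mix_def)

lemma mix_polybox: "y \<in> polybox x r ==> y' \<in> polybox x r ==> mix J y y' \<in> polybox x r"
  by (simp add: polybox_def)

lemma mix_insert: "mix (insert i J) y y' = on_line i (mix J y y') (y' $ i)"
  by (auto simp: vec_eq_iff)

text \<open>Pass from \<open>y\<close> to \<open>y'\<close> by changing one coordinate at a time.\<close>
lemma telescope:
  fixes G :: "complex ^ 'n \<Rightarrow> complex" and b :: "'n \<Rightarrow> real"
  assumes step: "\<And>i J. i \<notin> J ==> norm (G (on_line i (mix J y y') (y' $ i)) - G (mix J y y')) \<le> b i"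
  shows "norm (G y' - G y) \<le> (\<Sum>i\<in>UNIV. b i)"
proof -
  have "norm (G (mix J y y') - G y) \<le> (\<Sum>i\<in>J. b i)" if "finite J" for J using that
  proof induction
    case empty
    have "mix {} y y' = y" by (simp add: vec_eq_iff)
    thus ?case by simp
  next
    case (insert i J)
    have "norm (G (mix (insert i J) y y') - G y) \<le> norm (G (mix (insert i J) y y') - G (mix J y y')) + norm (G (mix J y y') - G y)"
      using norm_triangle_ineq[of "G (mix (insert i J) y y') - G (mix J y y')" "G (mix J y y') - G y"] by simp
    also have "\<dots> \<le> b i + (\<Sum>i\<in>J. b i)" using step[OF insert(2)] insert.IH unfolding mix_insert by (intro add_mono) auto
    finally show ?case using insert by simp
  qed
  from this[of UNIV] show ?thesis by (simp add: mix_def vec_nth_inverse)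
qed

lemma dist_mix_le: "dist (mix J y y') y \<le> dist y' y"
  unfolding dist_vec_def by (rule L2_set_mono) auto

text \<open>Cauchy estimates make \<open>g\<close> Lipschitz. In the telescoping sum for \<open>g y - g w\<close>, the step in
  direction \<open>i\<close> starts at a corner instead of \<open>w\<close>. The difference between the restrictions of \<open>g\<close> to the two lines is a
  holomorphic function of size \<open>norm (y - w)\<close>, so by Cauchy estimates again the resulting error is quadratic.\<close>
lemma bounded_separately_holomorphic:
  fixes x :: "complex ^ 'n" and g :: "complex ^ 'n \<Rightarrow> complex"
  assumes hol: "\<And>i w. w \<in> polybox x R ==> (\<lambda>s. g (on_line i w s)) holomorphic_on ball (x $ i) R"
    and B: "\<And>w. w \<in> polybox x R ==> norm (g w) \<le> B"
  shows "holo_on g (polybox x R)"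
  unfolding holo_on_def
proof (intro conjI ballI open_polybox)
  fix w assume w: "w \<in> polybox x R"
  obtain r where r: "r > 0" "polybox w r \<subseteq> polybox x R" using polybox_inside_open[OF open_polybox w] by blast
  have B0: "B \<ge> 0" using order.trans[OF norm_ge_zero B[OF w]] .
  have wnth: "ball (w $ i) r \<subseteq> ball (x $ i) R" for i
  proof
    fix s assume s: "s \<in> ball (w $ i) r"
    have "on_line i w s \<in> polybox w r" by (rule polybox_on_line[OF polybox_center[OF r(1)] s])
    hence "on_line i w s \<in> polybox x R" using r(2) by blast
    from polybox_nth[OF this, of i] show "s \<in> ball (x $ i) R" by simp
  qed
  have hol': "(\<lambda>s. g (on_line i y s)) holomorphic_on ball (w $ i) r" if "y \<in> polybox w r" for y i
    using holomorphic_on_subset[OF hol wnth] that r(2) by blast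
  define Lc where "Lc = 4 * B / r"
  have L0: "Lc \<ge> 0" using B0 r by (simp add: Lc_def)
  define N where "N = real CARD('n)"
  have N0: "N > 0" by (simp add: N_def)
  have lip: "norm (g y' - g y) \<le> N * Lc * dist y' y" if y: "y \<in> polybox w (r / 2)" "y' \<in> polybox w (r / 2)" for y y'
  proof -
    have "norm (g y' - g y) \<le> (\<Sum>i\<in>(UNIV :: 'n set). Lc * dist y' y)"
    proof (rule telescope)
      fix i J assume i: "i \<notin> (J :: 'n set)"
      have m: "mix J y y' \<in> polybox w r" using mix_polybox[OF y] polybox_mono[of "r / 2" r w] r by auto
      have b: "norm (g (on_line i (mix J y y') s)) \<le> B" if "s \<in> ball (w $ i) r" for s
        using polybox_on_line[OF m that] r(2) by (intro B) blast
      have "norm (g (on_line i (mix J y y') (y' $ i)) - g (on_line i (mix J y y') (y $ i))) \<le> 4 * B / r * norm (y' $ i - y $ i)"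
        by (rule bounded_holomorphic_lipschitz[OF hol'[OF m] r(1) b polybox_nth[OF y(2)] polybox_nth[OF y(1)]])
      also have "on_line i (mix J y y') (y $ i) = mix J y y'" using i by (auto simp: vec_eq_iff)
      also have "4 * B / r * norm (y' $ i - y $ i) \<le> Lc * dist y' y"
        using L0 Finite_Cartesian_Product.norm_nth_le[of "y' - y" i] unfolding Lc_def by (intro mult_left_mono) (simp_all add: dist_norm)
      finally show "norm (g (on_line i (mix J y y') (y' $ i)) - g (mix J y y')) \<le> Lc * dist y' y" .
    qed
    thus ?thesis by (simp add: N_def)
  qed
  define d where "d = (\<lambda>i. deriv (\<lambda>s. g (on_line i w s)) (w $ i))"
  define D where "D = (\<lambda>v :: complex ^ 'n. \<Sum>i\<in>UNIV. d i * v $ i)"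
  have "linear D" unfolding D_def
    by (rule linearI) (simp_all add: sum.distrib algebra_simps scaleR_sum_right)
  hence bl: "bounded_linear D" by (simp add: linear_conv_bounded_linear)
  have "(g has_derivative D) (at w)"
    unfolding has_derivative_at_alt
  proof (intro conjI bl allI impI)
    fix e :: real assume e: "e > 0"
    define \<epsilon> where "\<epsilon> = e / (2 * N)"
    have \<epsilon>: "\<epsilon> > 0" using e N0 by (simp add: \<epsilon>_def)
    have "\<exists>\<delta>>0. \<forall>s. norm (s - w $ i) < \<delta> \<longrightarrow> norm (g (on_line i w s) - g w - d i * (s - w $ i)) \<le> \<epsilon> * norm (s - w $ i)" for i
    proof -
      have "((\<lambda>s. g (on_line i w s)) has_field_derivative d i) (at (w $ i))"
        unfolding d_def using r by (intro holomorphic_derivI[OF hol'[OF polybox_center]]) auto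
      hence "((\<lambda>s. g (on_line i w s)) has_derivative (*) (d i)) (at (w $ i))" by (simp add: has_field_derivative_def)
      thus ?thesis using \<epsilon> unfolding has_derivative_at_alt by simp
    qed
    then obtain \<delta> where \<delta>: "\<And>i. \<delta> i > 0" "\<And>i s. norm (s - w $ i) < \<delta> i ==> norm (g (on_line i w s) - g w - d i * (s - w $ i)) \<le> \<epsilon> * norm (s - w $ i)"
      by metis
    define C where "C = 4 * (N * Lc) / (r / 2)"
    have C0: "C \<ge> 0" using N0 L0 r by (simp add: C_def)
    define \<eta> where "\<eta> = Min (insert (r / 4) (insert (\<epsilon> / (C + 1)) (range \<delta>)))"
    have \<eta>: "\<eta> > 0" using \<delta>(1) r \<epsilon> C0 by (auto simp: \<eta>_def)
    have \<eta>l: "\<eta> \<le> r / 4" "\<eta> \<le> \<epsilon> / (C + 1)" "\<And>i. \<eta> \<le> \<delta> i" unfolding \<eta>_def by (intro Min_le; simp)+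
    have "norm (g y - g w - D (y - w)) \<le> e * norm (y - w)" if y: "norm (y - w) < \<eta>" for y
    proof -
      have comp: "norm (y $ i - w $ i) \<le> norm (y - w)" for i using Finite_Cartesian_Product.norm_nth_le[of "y - w" i] by simp
      have yr: "y \<in> polybox w (r / 4)"
        unfolding polybox_def
      proof (intro CollectI allI)
        fix i
        have "dist (y $ i) (w $ i) < r / 4" unfolding dist_norm using comp[of i] y \<eta>l(1) by linarith
        thus "dist (w $ i) (y $ i) < r / 4" by (simp only: dist_commute)
      qed
      define G where "G = (\<lambda>z. g z - D (z - w))"
      have "norm (G y - G w) \<le> (\<Sum>i\<in>(UNIV :: 'n set). 2 * \<epsilon> * norm (y - w))"
      proof (rule telescope)
        fix i J assume i: "i \<notin> (J :: 'n set)"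
        define z where "z = mix J w y"
        have zi: "z $ i = w $ i" using i by (simp add: z_def)
        have zr: "z \<in> polybox w (r / 4)" unfolding z_def by (rule mix_polybox[OF polybox_center yr]) (use r in simp)
        have zw: "dist z w \<le> norm (y - w)" unfolding z_def using dist_mix_le[of J w y] by (simp add: dist_norm)
        define h where "h = (\<lambda>s. g (on_line i z s) - g (on_line i w s))"
        have Dd: "D (on_line i z (y $ i) - w) - D (z - w) = d i * (y $ i - w $ i)"
        proof -
          have "D (on_line i z (y $ i) - w) - D (z - w) = D (on_line i z (y $ i) - z)"
            using \<open>linear D\<close> by (simp add: linear_diff)
          also have "\<dots> = (\<Sum>k\<in>UNIV. if k = i then d i * (y $ i - w $ i) else 0)"
            unfolding D_def by (rule sum.cong) (auto simp: zi)
          finally show ?thesis by simp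
        qed
        have hh: "h holomorphic_on ball (w $ i) (r / 2)" unfolding h_def
          using zr polybox_mono[of "r / 4" r w] r
          by (intro holomorphic_on_diff holomorphic_on_subset[OF hol']) (auto intro: polybox_center)
        have hb: "norm (h s) \<le> N * Lc * norm (y - w)" if s: "s \<in> ball (w $ i) (r / 2)" for s
        proof -
          have wc: "w \<in> polybox w (r / 2)" using r by (intro polybox_center) simp
          have "z \<in> polybox w (r / 2)" using zr polybox_mono[of "r / 4" "r / 2" w] r by auto
          hence "norm (h s) \<le> N * Lc * dist (on_line i z s) (on_line i w s)"
            unfolding h_def by (intro lip polybox_on_line[OF _ s] wc)
          also have "dist (on_line i z s) (on_line i w s) \<le> dist z w" unfolding dist_vec_def by (rule L2_set_mono) auto
          finally show ?thesis using zw N0 L0 by (meson mult_left_mono mult_nonneg_nonneg less_imp_le order_trans)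
        qed
        have yi: "y $ i \<in> ball (w $ i) (r / 2 / 2)" using polybox_nth[OF yr, of i] by simp
        have wi: "w $ i \<in> ball (w $ i) (r / 2 / 2)" using r by simp
        have "norm (h (y $ i) - h (w $ i)) \<le> 4 * (N * Lc * norm (y - w)) / (r / 2) * norm (y $ i - w $ i)"
          by (rule bounded_holomorphic_lipschitz[OF hh _ hb yi wi]) (use r in auto)
        also have "\<dots> = (C * norm (y - w)) * norm (y $ i - w $ i)" by (simp add: C_def)
        also have "\<dots> \<le> \<epsilon> * norm (y - w)"
        proof (rule mult_mono)
          have "C * norm (y - w) \<le> (C + 1) * (\<epsilon> / (C + 1))" using y \<eta>l(2) C0 \<epsilon> by (intro mult_mono) auto
          thus "C * norm (y - w) \<le> \<epsilon>" using C0 by simp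
        qed (use comp \<epsilon> in auto)
        finally have 1: "norm (h (y $ i) - h (w $ i)) \<le> \<epsilon> * norm (y - w)" .
        have "norm (y $ i - w $ i) < \<delta> i" using comp[of i] y \<eta>l(3)[of i] by linarith
        from \<delta>(2)[OF this] have "norm (g (on_line i w (y $ i)) - g w - d i * (y $ i - w $ i)) \<le> \<epsilon> * norm (y $ i - w $ i)" .
        also have "\<dots> \<le> \<epsilon> * norm (y - w)" using comp \<epsilon> by (intro mult_left_mono) auto
        finally have 2: "norm (g (on_line i w (y $ i)) - g w - d i * (y $ i - w $ i)) \<le> \<epsilon> * norm (y - w)" .
        have oz: "on_line i z (w $ i) = z" using zi on_line_id[of i z] by simp
        have eqG: "G (on_line i z (y $ i)) - G z = (h (y $ i) - h (w $ i)) + (g (on_line i w (y $ i)) - g w - d i * (y $ i - w $ i))"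
          using Dd by (simp add: G_def h_def oz algebra_simps)
        have "norm (G (on_line i z (y $ i)) - G z) \<le> \<epsilon> * norm (y - w) + \<epsilon> * norm (y - w)"
          unfolding eqG by (rule norm_triangle_mono[OF 1 2])
        thus "norm (G (on_line i (mix J w y) (y $ i)) - G (mix J w y)) \<le> 2 * \<epsilon> * norm (y - w)" by (simp add: z_def)
      qed
      also have "\<dots> = e * norm (y - w)" using N0 by (simp add: \<epsilon>_def N_def)
      finally have "norm (G y - G w) \<le> e * norm (y - w)" .
      moreover have "D 0 = 0" by (simp add: D_def)
      ultimately show ?thesis by (simp add: G_def algebra_simps)
    qed
    thus "\<exists>d>0. \<forall>y. norm (y - w) < d \<longrightarrow> norm (g y - g w - D (y - w)) \<le> e * norm (y - w)" using \<eta> by blast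
  qed
  moreover have "D (c *s v) = c * D v" for c v by (simp add: D_def sum_distrib_left mult_ac)
  ultimately show "\<exists>D. (g has_derivative D) (at w) \<and> (\<forall>c v. D (c *s v) = c * D v)" by blast
qed

lemma holo_on_imp_continuous_on: "holo_on g U ==> continuous_on U g"
  unfolding holo_on_def by (blast intro: continuous_at_imp_continuous_on has_derivative_continuous)

lemma holo_on_subset: "holo_on g U ==> V \<subseteq> U ==> open V ==> holo_on g V"
  unfolding holo_on_def by blast

lemma holo_on_cong:
  assumes "holo_on g U" "\<And>z. z \<in> U ==> g z = h z"
  shows "holo_on h U"
  unfolding holo_on_def
proof (intro conjI ballI)
  show U: "open U" using assms by (simp add: holo_on_def)
  fix z assume z: "z \<in> U"
  then obtain D where D: "(g has_derivative D) (at z)" "\<forall>c v. D (c *s v) = c * D v" using assms(1) unfolding holo_on_def by blast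
  have "(h has_derivative D) (at z)"
    by (rule has_derivative_transform_within_open[OF D(1) U z assms(2)])
  with D(2) show "\<exists>D. (h has_derivative D) (at z) \<and> (\<forall>c v. D (c *s v) = c * D v)" by blast
qed

lemma holo_on_affine_line:
  assumes g: "holo_on g U" and S: "\<And>\<tau>. \<tau> \<in> S ==> a + \<tau> *s b \<in> U"
  shows "(\<lambda>\<tau>. g (a + \<tau> *s b)) holomorphic_on S"
  unfolding holomorphic_on_def
proof
  fix \<tau> assume "\<tau> \<in> S"
  then obtain D where D: "(g has_derivative D) (at (a + \<tau> *s b))" "\<And>c v. D (c *s v) = c * D v"
    using g S unfolding holo_on_def by blast
  have "linear (\<lambda>\<tau>. \<tau> *s b)" by (rule linearI) (simp_all add: vec_eq_iff algebra_simps)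
  hence "((\<lambda>\<tau>. \<tau> *s b) has_derivative (\<lambda>\<tau>. \<tau> *s b)) (at \<tau>)"
    by (intro bounded_linear_imp_has_derivative) (simp add: linear_conv_bounded_linear)
  hence "((\<lambda>\<tau>. a + \<tau> *s b) has_derivative (\<lambda>\<tau>. \<tau> *s b)) (at \<tau>)" by (auto intro!: derivative_eq_intros)
  from diff_chain_at[OF this D(1)] have "((\<lambda>\<tau>. g (a + \<tau> *s b)) has_derivative (\<lambda>\<tau>. D (\<tau> *s b))) (at \<tau>)" by (simp add: o_def)
  hence "((\<lambda>\<tau>. g (a + \<tau> *s b)) has_field_derivative D b) (at \<tau>)" by (simp add: D(2) has_field_derivative_def mult.commute[of _ "D b"])
  thus "(\<lambda>\<tau>. g (a + \<tau> *s b)) field_differentiable at \<tau> within S"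
    by (meson field_differentiable_def field_differentiable_at_within)
qed

section \<open>Hoelder estimates for the quotient on a line\<close>

lemma exp_diff_bound:
  fixes a b :: complex
  assumes "norm a \<le> M" "norm b \<le> M"
  shows "norm (exp a - exp b) \<le> exp M * norm (a - b)"
proof (rule field_differentiable_bound[of "cball 0 M" exp exp])
  fix z :: complex assume z: "z \<in> cball 0 M"
  show "(exp has_field_derivative exp z) (at z within cball 0 M)" by (rule DERIV_subset[OF DERIV_exp]) simp
  have "norm (exp z) \<le> exp (norm z)" by (rule norm_exp)
  also have "\<dots> \<le> exp M" using z by simp
  finally show "norm (exp z) \<le> exp M" .
qed (use assms in auto)

lemma norm_le_norm_exp_minus_1:
  fixes \<zeta> :: complex
  assumes "norm \<zeta> \<le> 1 / 4"
  shows "norm \<zeta> \<le> 2 * norm (exp \<zeta> - 1)"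
proof -
  have "exp (1 / 4 :: real) \<le> 1 + 1 / 4 + (1 / 4)\<^sup>2" by (rule exp_bound) auto
  hence e: "exp (1 / 4 :: real) \<le> 21 / 16" by (simp add: power2_eq_square)
  have "norm (exp \<zeta> - exp 0) \<le> exp (1 / 4) * norm (\<zeta> - 0)" by (rule exp_diff_bound) (use assms in auto)
  also have "\<dots> \<le> 21 / 16 * (1 / 4)" using e assms by (intro mult_mono) auto
  finally have "norm (exp \<zeta> - 1) < 1 / 2" by simp
  hence "norm (Ln (1 + (exp \<zeta> - 1))) \<le> 2 * norm (exp \<zeta> - 1)" by (rule norm_Ln_le)
  moreover have "Ln (exp \<zeta>) = \<zeta>"
  proof -
    have "\<bar>Im \<zeta>\<bar> \<le> 1 / 4" using abs_Im_le_cmod[of \<zeta>] assms by linarith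
    thus ?thesis using pi_gt3 by (intro Ln_exp) linarith+
  qed
  ultimately show ?thesis by simp
qed

text \<open>The quotient \<open>exp (- V) * f / g = exp (u - V)\<close> is holomorphic and bounded off the zeros, so it extends to a bounded
  holomorphic \<open>\<theta>\<close>. Then \<open>exp u = exp V * \<theta>\<close> is as regular as \<open>V\<close>.\<close>
lemma line_quotient_hoelder:
  assumes R: "R > 0" and \<alpha>: "0 < \<alpha>" "\<alpha> < 1"
    and V: "\<And>s. s \<in> ball c R ==> norm (V s) \<le> M" "\<And>s t. s \<in> ball c R ==> t \<in> ball c R ==> norm (V s - V t) \<le> C * dist s t powr \<alpha>"
    and k: "(\<lambda>s. exp (- V s) * f s) holomorphic_on ball c R" and g: "g holomorphic_on ball c R"
    and gu: "\<And>s. s \<in> ball c R ==> g s = exp (- u s) * f s" and u: "\<And>s. s \<in> ball c R ==> norm (u s) \<le> B"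
    and s: "s \<in> ball c (R / 2)" "f s \<noteq> 0" and t: "t \<in> ball c (R / 2)" "f t \<noteq> 0"
  shows "norm (exp (u s) - exp (u t)) \<le> exp M * exp (M + B) * (4 / R * R powr (1 - \<alpha>) + C) * dist s t powr \<alpha>"
proof -
  have st: "s \<in> ball c R" "t \<in> ball c R" using s t R by auto
  have gf: "g z \<noteq> 0 \<longleftrightarrow> f z \<noteq> 0" if "z \<in> ball c R" for z using gu[OF that] by simp
  have eq: "exp (- V z) * f z / g z = exp (u z - V z)" if "z \<in> ball c R" "g z \<noteq> 0" for z
    using that gf[OF that(1)] unfolding gu[OF that(1)] by (simp add: exp_diff exp_minus field_simps)
  obtain \<theta> where \<theta>: "\<theta> holomorphic_on ball c R" "\<And>z. z \<in> ball c R ==> norm (\<theta> z) \<le> exp (M + B)"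
    "\<And>z. z \<in> ball c R ==> g z \<noteq> 0 ==> \<theta> z = exp (- V z) * f z / g z"
  proof (rule bounded_extension_across_zeros[OF open_ball connected_ball g, of s])
    show "(\<lambda>z. exp (- V z) * f z / g z) holomorphic_on {z \<in> ball c R. g z \<noteq> 0}"
      by (intro holomorphic_on_divide holomorphic_on_subset[OF k] holomorphic_on_subset[OF g]) auto
    show "norm (exp (- V z) * f z / g z) \<le> exp (M + B)" if "z \<in> ball c R" "g z \<noteq> 0" for z
    proof -
      have "norm (exp (u z - V z)) \<le> exp (norm (u z - V z))" by (rule norm_exp)
      also have "\<dots> \<le> exp (M + B)" using norm_triangle_ineq4[of "u z" "V z"] u[OF that(1)] V(1)[OF that(1)] by simp
      finally show ?thesis using eq[OF that] by simp
    qed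
  qed (use st s gf in auto)
  have F: "exp (u z) = exp (V z) * \<theta> z" if "z \<in> ball c R" "f z \<noteq> 0" for z
    using \<theta>(3)[OF that(1)] eq[OF that(1)] gf[OF that(1)] that(2) by (simp add: exp_diff)
  have eV: "norm (exp (V z)) \<le> exp M" if "z \<in> ball c R" for z
    using norm_exp[of "V z"] V(1)[OF that] by (meson exp_le_cancel_iff order.trans)
  have d: "dist s t \<le> R" using s t dist_triangle[of s t c] by (simp add: dist_commute)
  have "norm (\<theta> s - \<theta> t) \<le> 4 * exp (M + B) / R * norm (s - t)"
    by (rule bounded_holomorphic_lipschitz[OF \<theta>(1) R \<theta>(2) s(1) t(1)])
  moreover have "norm (s - t) \<le> R powr (1 - \<alpha>) * dist s t powr \<alpha>"
  proof (cases "s = t")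
    case False
    hence "norm (s - t) = dist s t powr (1 - \<alpha>) * dist s t powr \<alpha>" by (simp add: powr_add[symmetric] dist_norm)
    also have "\<dots> \<le> R powr (1 - \<alpha>) * dist s t powr \<alpha>" using d \<alpha> by (intro mult_right_mono powr_mono2) auto
    finally show ?thesis .
  qed simp
  moreover have "0 \<le> 4 * exp (M + B) / R" using R by simp
  ultimately have 1: "norm (\<theta> s - \<theta> t) \<le> 4 * exp (M + B) / R * (R powr (1 - \<alpha>) * dist s t powr \<alpha>)"
    using mult_left_mono order.trans by blast
  have 2: "norm (exp (V s) - exp (V t)) \<le> exp M * (C * dist s t powr \<alpha>)"
    using exp_diff_bound[OF V(1)[OF st(1)] V(1)[OF st(2)]] V(2)[OF st] by (meson exp_ge_zero mult_left_mono order.trans)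
  have "exp (u s) - exp (u t) = exp (V s) * (\<theta> s - \<theta> t) + (exp (V s) - exp (V t)) * \<theta> t"
    unfolding F[OF st(1) s(2)] F[OF st(2) t(2)] by (simp add: algebra_simps)
  hence "norm (exp (u s) - exp (u t)) \<le> norm (exp (V s)) * norm (\<theta> s - \<theta> t) + norm (exp (V s) - exp (V t)) * norm (\<theta> t)"
    by (metis norm_mult norm_triangle_ineq)
  also have "\<dots> \<le> exp M * (4 * exp (M + B) / R * (R powr (1 - \<alpha>) * dist s t powr \<alpha>)) + (exp M * (C * dist s t powr \<alpha>)) * exp (M + B)"
    using eV[OF st(1)] 1 2 \<theta>(2)[OF st(2)] order.trans[OF norm_ge_zero 2] by (intro add_mono mult_mono) auto
  also have "\<dots> = exp M * exp (M + B) * (4 / R * R powr (1 - \<alpha>) + C) * dist s t powr \<alpha>" by (simp add: algebra_simps)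
  finally show ?thesis .
qed

text \<open>Restrict to the complex line through \<open>a\<close> and \<open>p\<close>, where the zeros are isolated.\<close>
lemma nonzero_on_segment_near:
  assumes g: "holo_on g U" and U: "convex U" and a: "a \<in> U" and p: "p \<in> U" "g p \<noteq> 0"
  obtains \<delta> where "\<delta> > 0" "\<And>\<tau>. 0 < \<tau> ==> \<tau> < \<delta> ==> g (a + \<tau> *\<^sub>R (p - a)) \<noteq> 0"
proof -
  define S where "S = {\<tau>. a + \<tau> *s (p - a) \<in> U}"
  have lin: "linear (\<lambda>\<tau>. \<tau> *s (p - a))" by (rule linearI) (simp_all add: vec_eq_iff algebra_simps)
  have "continuous_on UNIV (\<lambda>\<tau>. a + \<tau> *s (p - a))"
    by (intro continuous_intros linear_continuous_on) (use lin in \<open>simp add: linear_conv_bounded_linear\<close>)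
  hence "open ((\<lambda>\<tau>. a + \<tau> *s (p - a)) -` U)" using g open_vimage unfolding holo_on_def by blast
  hence S_open: "open S" by (simp add: S_def vimage_def)
  have "convex S"
  proof (rule convexI)
    fix \<sigma> \<tau> :: complex and v w :: real
    assume st: "\<sigma> \<in> S" "\<tau> \<in> S" and vw: "0 \<le> v" "0 \<le> w" "v + w = 1"
    have "v *\<^sub>R (a + \<sigma> *s (p - a)) + w *\<^sub>R (a + \<tau> *s (p - a)) = (v + w) *\<^sub>R a + (v *\<^sub>R \<sigma> + w *\<^sub>R \<tau>) *s (p - a)"
      by (simp add: vec_eq_iff algebra_simps)
    moreover have "v *\<^sub>R (a + \<sigma> *s (p - a)) + w *\<^sub>R (a + \<tau> *s (p - a)) \<in> U"
      using st vw U by (intro convexD) (auto simp: S_def)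
    ultimately show "v *\<^sub>R \<sigma> + w *\<^sub>R \<tau> \<in> S" using vw by (simp add: S_def)
  qed
  hence S_conn: "connected S" by (rule convex_connected)
  have h: "(\<lambda>\<tau>. g (a + \<tau> *s (p - a))) holomorphic_on S" by (rule holo_on_affine_line[OF g]) (simp add: S_def)
  have 1: "1 \<in> S" "0 \<in> S" using a p by (simp_all add: S_def)
  have "g (a + 1 *s (p - a)) \<noteq> 0" using p by simp
  from zero_free_punctured_ball[OF S_open S_conn h 1(1) this 1(2)] obtain e where e: "e > 0" "\<And>\<tau>. \<tau> \<in> ball 0 e - {0} ==> g (a + \<tau> *s (p - a)) \<noteq> 0"
    by metis
  show ?thesis
  proof (rule that[OF e(1)])
    fix \<tau> :: real assume "0 < \<tau>" "\<tau> < e"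
    hence "of_real \<tau> \<in> ball 0 e - {0 :: complex}" by auto
    from e(2)[OF this] show "g (a + \<tau> *\<^sub>R (p - a)) \<noteq> 0"
      by (simp add: vector_scalar_mult_def scaleR_vec_def scaleR_conv_of_real)
  qed
qed

section \<open>Hoelder continuous logarithm of the quotient\<close>

definition line_log :: "(complex ^ 'n \<Rightarrow> complex) \<Rightarrow> complex ^ 'n \<Rightarrow> real \<Rightarrow> real \<Rightarrow> real \<Rightarrow> real \<Rightarrow> 'n \<Rightarrow> complex ^ 'n \<Rightarrow> (complex \<Rightarrow> complex) \<Rightarrow> bool" where
  "line_log f x R \<alpha> C M j w V \<longleftrightarrow> (\<forall>s\<in>ball (x $ j) R. norm (V s) \<le> M) \<and>
     (\<forall>s\<in>ball (x $ j) R. \<forall>t\<in>ball (x $ j) R. norm (V s - V t) \<le> C * dist s t powr \<alpha>) \<and>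
     (\<lambda>s. exp (- V s) * f (on_line j w s)) holomorphic_on ball (x $ j) R"

text \<open>The outcome of the one-dimensional theory for the exponent \<open>\<alpha>\<close>, with constants that do not depend on the line.\<close>
definition line_logs :: "(complex ^ 'n \<Rightarrow> complex) \<Rightarrow> complex ^ 'n \<Rightarrow> real \<Rightarrow> real \<Rightarrow> bool" where
  "line_logs f x R \<alpha> \<longleftrightarrow> (\<exists>C M. \<forall>j. \<forall>w\<in>polybox x R. \<exists>V. line_log f x R \<alpha> C M j w V)"

text \<open>Telescoping needs a corner path that avoids the zeros of \<open>f\<close>. Moving \<open>y'\<close> slightly towards \<open>y\<close> moves every corner
  towards \<open>y\<close> along a segment, on which the zeros are isolated because \<open>f y \<noteq> 0\<close>. The estimate for \<open>y'\<close> itself follows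
  by continuity.\<close>
lemma quotient_hoelder:
  fixes x :: "complex ^ 'n"
  assumes R: "R > 0" and \<alpha>: "0 < \<alpha>" "\<alpha> < 1" and logs: "line_logs f x R \<alpha>"
    and g: "holo_on g (polybox x R)" "\<And>i w. w \<in> polybox x R ==> (\<lambda>s. g (on_line i w s)) holomorphic_on ball (x $ i) R"
    and gu: "\<And>w. w \<in> polybox x R ==> g w = exp (- u w) * f w" and B: "\<And>w. w \<in> polybox x R ==> norm (u w) \<le> B"
    and f: "continuous_on (polybox x R) f"
  obtains L where "\<And>y y'. y \<in> polybox x (R / 2) ==> y' \<in> polybox x (R / 2) ==> f y \<noteq> 0 ==> f y' \<noteq> 0 ==>
     norm (exp (u y') - exp (u y)) \<le> L * dist y' y powr \<alpha>"
proof -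
  define P where "P = polybox x R"
  define P0 where "P0 = polybox x (R / 2)"
  have sub: "P0 \<subseteq> P" unfolding P_def P0_def using R by (intro polybox_mono) simp
  obtain C M where CM: "\<And>j w. w \<in> P ==> \<exists>V. line_log f x R \<alpha> C M j w V"
    using logs unfolding line_logs_def P_def by blast
  define L0 where "L0 = exp M * exp (M + B) * (4 / R * R powr (1 - \<alpha>) + C)"
  define L where "L = \<bar>L0\<bar>"
  have line: "norm (exp (u (on_line i m s)) - exp (u (on_line i m t))) \<le> L * dist s t powr \<alpha>"
    if m: "m \<in> P" and s: "s \<in> ball (x $ i) (R / 2)" "f (on_line i m s) \<noteq> 0" and t: "t \<in> ball (x $ i) (R / 2)" "f (on_line i m t) \<noteq> 0" for i m s t
  proof -
    obtain V where V: "\<And>s. s \<in> ball (x $ i) R ==> norm (V s) \<le> M"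
      "\<And>s t. s \<in> ball (x $ i) R ==> t \<in> ball (x $ i) R ==> norm (V s - V t) \<le> C * dist s t powr \<alpha>"
      "(\<lambda>s. exp (- V s) * f (on_line i m s)) holomorphic_on ball (x $ i) R"
      using CM[OF m, of i] unfolding line_log_def by blast
    have mP: "on_line i m s \<in> polybox x R" if "s \<in> ball (x $ i) R" for s using polybox_on_line that m by (simp add: P_def)
    have "norm (exp (u (on_line i m s)) - exp (u (on_line i m t))) \<le> L0 * dist s t powr \<alpha>"
      unfolding L0_def
      by (rule line_quotient_hoelder[OF R \<alpha> V g(2)[OF m[unfolded P_def]] gu[OF mP] B[OF mP] s t])
    also have "\<dots> \<le> L * dist s t powr \<alpha>" by (intro mult_right_mono) (auto simp: L_def)
    finally show ?thesis .
  qed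
  define N where "N = real CARD('n)"
  have reg: "norm (exp (u y') - exp (u y)) \<le> N * L * dist y' y powr \<alpha>"
    if y: "y \<in> P0" "y' \<in> P0" and nz: "\<And>J. f (mix J y y') \<noteq> 0" for y y'
  proof -
    have "norm (exp (u y') - exp (u y)) \<le> (\<Sum>i\<in>(UNIV :: 'n set). L * dist y' y powr \<alpha>)"
    proof (rule telescope)
      fix i J assume i: "i \<notin> (J :: 'n set)"
      have m: "mix J y y' \<in> P" using mix_polybox[of y x "R / 2" y' J] y sub by (auto simp: P0_def)
      have e: "on_line i (mix J y y') (y $ i) = mix J y y'" using i by (auto simp: vec_eq_iff)
      have "norm (exp (u (on_line i (mix J y y') (y' $ i))) - exp (u (on_line i (mix J y y') (y $ i)))) \<le> L * dist (y' $ i) (y $ i) powr \<alpha>"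
      proof (rule line[OF m])
        show "f (on_line i (mix J y y') (y' $ i)) \<noteq> 0" using nz[of "insert i J"] by (simp add: mix_insert)
        show "f (on_line i (mix J y y') (y $ i)) \<noteq> 0" unfolding e by (rule nz)
      qed (use y polybox_nth in \<open>auto simp: P0_def polybox_def\<close>)
      also have "\<dots> \<le> L * dist y' y powr \<alpha>"
        using \<alpha> by (intro mult_left_mono powr_mono2 dist_vec_nth_le) (auto simp: L_def)
      finally show "norm (exp (u (on_line i (mix J y y') (y' $ i))) - exp (u (mix J y y'))) \<le> L * dist y' y powr \<alpha>" unfolding e .
    qed
    thus ?thesis by (simp add: N_def)
  qed
  have gf: "g w \<noteq> 0 \<longleftrightarrow> f w \<noteq> 0" if "w \<in> P" for w using gu that by (simp add: P_def)
  show ?thesis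
  proof (rule that[of "N * L"])
    fix y y' assume y: "y \<in> polybox x (R / 2)" "y' \<in> polybox x (R / 2)" and nz: "f y \<noteq> 0" "f y' \<noteq> 0"
    have yP: "y \<in> P" "y' \<in> P" "y \<in> P0" "y' \<in> P0" using y sub by (auto simp: P0_def)
    have "\<exists>\<delta>>0. \<forall>\<tau>. 0 < \<tau> \<longrightarrow> \<tau> < \<delta> \<longrightarrow> g (mix J y y' + \<tau> *\<^sub>R (y - mix J y y')) \<noteq> 0" for J
    proof -
      have mP: "mix J y y' \<in> polybox x R" using mix_polybox[of y x R y' J] yP unfolding P_def by blast
      have "g y \<noteq> 0" using gf yP nz by blast
      from nonzero_on_segment_near[OF g(1) convex_polybox mP yP(1)[unfolded P_def] this] show ?thesis by metis
    qed
    then obtain \<delta> where \<delta>: "\<And>J. \<delta> J > 0" "\<And>J \<tau>. 0 < \<tau> ==> \<tau> < \<delta> J ==> g (mix J y y' + \<tau> *\<^sub>R (y - mix J y y')) \<noteq> 0"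
      by metis
    define d where "d = Min (insert 1 (range \<delta>))"
    have d: "d > 0" "d \<le> 1" using \<delta>(1) by (auto simp: d_def)
    have d3: "d \<le> \<delta> J" for J unfolding d_def by (rule Min_le) auto
    define z where "z = (\<lambda>n. y' + (d / real (n + 2)) *\<^sub>R (y - y'))"
    have \<tau>: "0 < d / real (n + 2)" "d / real (n + 2) < d" for n using d(1) by (auto simp: divide_simps)
    have zP: "z n \<in> P0" for n
    proof -
      have "(1 - d / real (n + 2)) *\<^sub>R y' + (d / real (n + 2)) *\<^sub>R y \<in> P0"
        using \<tau>[of n] d(2) yP convex_polybox[of x "R / 2"] unfolding P0_def by (intro convexD) auto
      thus ?thesis by (simp add: z_def algebra_simps)
    qed
    have mz: "mix J y (z n) = mix J y y' + (d / real (n + 2)) *\<^sub>R (y - mix J y y')" for J n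
      by (simp add: vec_eq_iff z_def)
    have bound: "norm (exp (u (z n)) - exp (u y)) \<le> N * L * dist y' y powr \<alpha>" for n
    proof -
      have "norm (exp (u (z n)) - exp (u y)) \<le> N * L * dist (z n) y powr \<alpha>"
      proof (rule reg[OF yP(3) zP])
        fix J
        have "g (mix J y (z n)) \<noteq> 0" unfolding mz by (rule \<delta>(2)) (use \<tau>[of n] d3[of J] in linarith)+
        moreover have "mix J y (z n) \<in> P" using mix_polybox[of y x "R / 2" "z n" J] yP zP sub unfolding P0_def by blast
        ultimately show "f (mix J y (z n)) \<noteq> 0" using gf by blast
      qed
      moreover have "dist (z n) y \<le> dist y' y"
      proof -
        have "z n - y = (1 - d / real (n + 2)) *\<^sub>R (y' - y)" by (simp add: z_def algebra_simps)
        hence "dist (z n) y = \<bar>1 - d / real (n + 2)\<bar> * dist y' y" by (simp only: dist_norm norm_scaleR)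
        thus ?thesis using \<tau>[of n] d(2) by (simp add: mult_left_le_one_le)
      qed
      hence "dist (z n) y powr \<alpha> \<le> dist y' y powr \<alpha>" using \<alpha> by (intro powr_mono2) auto
      hence "N * L * dist (z n) y powr \<alpha> \<le> N * L * dist y' y powr \<alpha>" by (rule mult_left_mono) (simp add: N_def L_def)
      ultimately show ?thesis by linarith
    qed
    have zl: "z \<longlonglongrightarrow> y'"
    proof -
      have "(\<lambda>n. d / real (n + 2)) \<longlonglongrightarrow> 0" by (rule LIMSEQ_ignore_initial_segment[OF lim_const_over_n])
      hence "z \<longlonglongrightarrow> y' + 0 *\<^sub>R (y - y')" unfolding z_def by (intro tendsto_intros)
      thus ?thesis by simp
    qed
    have fz: "f (z n) \<noteq> 0" for n
    proof -
      have "mix UNIV y (z n) = z n" by (simp add: vec_eq_iff)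
      moreover have "g (mix UNIV y (z n)) \<noteq> 0" unfolding mz by (rule \<delta>(2)) (use \<tau>[of n] d3[of UNIV] in linarith)+
      ultimately show ?thesis using gf[of "z n"] zP sub by auto
    qed
    have eu: "exp (u w) = f w / g w" if "w \<in> P" "f w \<noteq> 0" for w
    proof -
      have "exp (u w) * g w = f w" using gu[of w] that by (simp add: P_def exp_minus)
      thus ?thesis using gf[OF that(1)] that(2) by (simp add: eq_divide_eq)
    qed
    have "isCont f y'" "isCont g y'"
      using f holo_on_imp_continuous_on[OF g(1)] yP(2) open_polybox[of x R] by (simp_all add: continuous_on_eq_continuous_at P_def)
    hence "(\<lambda>n. f (z n) / g (z n)) \<longlonglongrightarrow> f y' / g y'"
      using gf[OF yP(2)] nz(2)
      by (intro tendsto_divide isCont_tendsto_compose[OF \<open>isCont f y'\<close> zl] isCont_tendsto_compose[OF \<open>isCont g y'\<close> zl]) auto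
    moreover have "f (z n) / g (z n) = exp (u (z n))" for n
    proof -
      have "z n \<in> P" using zP sub by blast
      from eu[OF this fz] show ?thesis by (rule sym)
    qed
    ultimately have "(\<lambda>n. exp (u (z n))) \<longlonglongrightarrow> exp (u y')" unfolding eu[OF yP(2) nz(2)] by (simp only:)
    hence "(\<lambda>n. norm (exp (u (z n)) - exp (u y))) \<longlonglongrightarrow> norm (exp (u y') - exp (u y))"
      by (rule tendsto_norm[OF tendsto_diff[OF _ tendsto_const]])
    thus "norm (exp (u y') - exp (u y)) \<le> N * L * dist y' y powr \<alpha>"
      by (rule LIMSEQ_le_const2) (intro exI allI impI bound)
  qed
qed

text \<open>One extension must serve all exponents at once, as is needed for an unbounded coefficient range of exponents.\<close>
lemma hoelder_extension:
  fixes F :: "'a::metric_space \<Rightarrow> complex"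
  assumes cl: "T \<subseteq> closure X" and ne: "A \<noteq> {}" and A: "\<And>\<alpha>. \<alpha> \<in> A ==> \<alpha> > 0"
    and H: "\<And>\<alpha>. \<alpha> \<in> A ==> \<exists>L. \<forall>y\<in>X. \<forall>y'\<in>X. dist (F y') (F y) \<le> L * dist y' y powr \<alpha>"
    and lb: "\<And>y. y \<in> X ==> norm (F y) \<ge> b"
  obtains G where "continuous_on T G" "\<And>y. y \<in> X ==> G y = F y" "\<And>y. y \<in> T ==> norm (G y) \<ge> b"
    "\<And>\<alpha>. \<alpha> \<in> A ==> \<exists>L. \<forall>y\<in>T. \<forall>y'\<in>T. dist (G y') (G y) \<le> L * dist y' y powr \<alpha>"
proof -
  obtain \<alpha>0 where \<alpha>0: "\<alpha>0 \<in> A" using ne by blast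
  obtain L0 where L0: "\<And>y y'. y \<in> X ==> y' \<in> X ==> dist (F y') (F y) \<le> L0 * dist y' y powr \<alpha>0" using H[OF \<alpha>0] by blast
  have "uniformly_continuous_on X F"
    unfolding uniformly_continuous_on_def
  proof (intro allI impI)
    fix e :: real assume e: "e > 0"
    define d where "d = (e / (\<bar>L0\<bar> + 1)) powr (1 / \<alpha>0)"
    have "d > 0" using e by (simp add: d_def)
    moreover have "dist (F y') (F y) < e" if "y \<in> X" "y' \<in> X" "dist y' y < d" for y y'
    proof -
      have "dist y' y powr \<alpha>0 \<le> d powr \<alpha>0" using that A[OF \<alpha>0] by (intro powr_mono2) auto
      also have "\<dots> = e / (\<bar>L0\<bar> + 1)" using e A[OF \<alpha>0] by (simp add: d_def powr_powr)
      finally have p: "dist y' y powr \<alpha>0 \<le> e / (\<bar>L0\<bar> + 1)" .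
      have "dist (F y') (F y) \<le> L0 * dist y' y powr \<alpha>0" by (rule L0[OF that(1,2)])
      also have "\<dots> \<le> \<bar>L0\<bar> * dist y' y powr \<alpha>0" by (intro mult_right_mono) auto
      also have "\<dots> \<le> \<bar>L0\<bar> * (e / (\<bar>L0\<bar> + 1))" by (rule mult_left_mono[OF p]) simp
      also have "\<dots> < e" using e by (simp add: field_simps)
      finally show ?thesis .
    qed
    ultimately show "\<exists>d>0. \<forall>y\<in>X. \<forall>y'\<in>X. dist y' y < d \<longrightarrow> dist (F y') (F y) < e" by blast
  qed
  from uniformly_continuous_on_extension_on_closure[OF this]
  obtain G where G: "uniformly_continuous_on (closure X) G" "\<And>y. y \<in> X ==> F y = G y" by metis
  have Gc: "continuous_on (closure X) G" by (rule uniformly_continuous_imp_continuous[OF G(1)])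
  have approx: "\<exists>z. (\<forall>n. z n \<in> X) \<and> z \<longlonglongrightarrow> y \<and> (\<lambda>n. F (z n)) \<longlonglongrightarrow> G y" if y: "y \<in> T" for y
  proof -
    have yc: "y \<in> closure X" using y cl by blast
    then obtain z where z: "\<And>n. z n \<in> X" "z \<longlonglongrightarrow> y" unfolding closure_sequential by blast
    have "(\<lambda>n. G (z n)) \<longlonglongrightarrow> G y"
      by (rule continuous_on_tendsto_compose[OF Gc z(2) yc always_eventually]) (use z(1) closure_subset in blast)
    hence "(\<lambda>n. F (z n)) \<longlonglongrightarrow> G y" by (simp add: G(2)[OF z(1)])
    thus ?thesis using z by blast
  qed
  show ?thesis
  proof (rule that[of G])
    show "continuous_on T G" by (rule continuous_on_subset[OF Gc cl])
    show "G y = F y" if "y \<in> X" for y using G(2)[OF that] by simp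
    show "norm (G y) \<ge> b" if y: "y \<in> T" for y
    proof -
      obtain z where z: "\<forall>n. z n \<in> X" "(\<lambda>n. F (z n)) \<longlonglongrightarrow> G y" using approx[OF y] by blast
      have "(\<lambda>n. norm (F (z n))) \<longlonglongrightarrow> norm (G y)" by (rule tendsto_norm[OF z(2)])
      thus ?thesis by (rule LIMSEQ_le_const) (use z lb in blast)
    qed
    fix \<alpha> assume \<alpha>: "\<alpha> \<in> A"
    obtain L where L: "\<And>y y'. y \<in> X ==> y' \<in> X ==> dist (F y') (F y) \<le> L * dist y' y powr \<alpha>" using H[OF \<alpha>] by blast
    have "dist (G y') (G y) \<le> L * dist y' y powr \<alpha>" if y: "y \<in> T" "y' \<in> T" for y y'
    proof -
      obtain z where z: "\<And>n. z n \<in> X" "z \<longlonglongrightarrow> y" "(\<lambda>n. F (z n)) \<longlonglongrightarrow> G y" using approx[OF y(1)] by blast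
      obtain z' where z': "\<And>n. z' n \<in> X" "z' \<longlonglongrightarrow> y'" "(\<lambda>n. F (z' n)) \<longlonglongrightarrow> G y'" using approx[OF y(2)] by blast
      have 1: "(\<lambda>n. dist (F (z' n)) (F (z n))) \<longlonglongrightarrow> dist (G y') (G y)" by (intro tendsto_intros z z')
      have 2: "(\<lambda>n. L * dist (z' n) (z n) powr \<alpha>) \<longlonglongrightarrow> L * dist y' y powr \<alpha>"
        by (intro tendsto_mult tendsto_const tendsto_powr' tendsto_dist z z') (use A[OF \<alpha>] in auto)
      show ?thesis by (rule LIMSEQ_le[OF 1 2]) (use L z(1) z'(1) in blast)
    qed
    thus "\<exists>L. \<forall>y\<in>T. \<forall>y'\<in>T. dist (G y') (G y) \<le> L * dist y' y powr \<alpha>" by blast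
  qed
qed

text \<open>The logarithm is Lipschitz on small neighbourhoods, with a constant controlled by the lower bound for \<open>G\<close>.\<close>
lemma holder_loc_log:
  fixes G v :: "'a::metric_space \<Rightarrow> complex"
  assumes T: "open T" and v: "continuous_on T v" and G: "\<And>y. y \<in> T ==> G y = exp (v y)"
    and lb: "\<And>y. y \<in> T ==> norm (G y) \<ge> b" "b > 0"
    and H: "\<And>y y'. y \<in> T ==> y' \<in> T ==> dist (G y') (G y) \<le> L * dist y' y powr \<alpha>"
  shows "holder_loc \<alpha> T v"
  unfolding holder_loc_def
proof
  fix a assume a: "a \<in> T"
  have "open (T \<inter> v -` ball (v a) (1 / 8))" by (rule continuous_open_preimage[OF v T]) simp
  moreover have "dist (v y) (v y') \<le> (2 * L / b) * dist y y' powr \<alpha>"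
    if y: "y \<in> T \<inter> v -` ball (v a) (1 / 8)" and y': "y' \<in> T \<inter> v -` ball (v a) (1 / 8)" for y y'
  proof -
    have "dist (v y) (v y') \<le> dist (v a) (v y) + dist (v a) (v y')" using dist_triangle[of "v y" "v y'" "v a"] by (simp add: dist_commute)
    hence "norm (v y - v y') \<le> 1 / 4" using y y' by (simp add: dist_norm)
    hence "norm (v y - v y') \<le> 2 * norm (exp (v y - v y') - 1)" by (rule norm_le_norm_exp_minus_1)
    also have "exp (v y - v y') - 1 = (G y - G y') / G y'" using y y' G by (simp add: exp_diff diff_divide_distrib)
    also have "2 * norm ((G y - G y') / G y') = 2 * dist (G y) (G y') / norm (G y')" by (simp add: norm_divide dist_norm)
    also have "\<dots> \<le> 2 * (L * dist y y' powr \<alpha>) / b"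
    proof (rule frac_le)
      have "dist (G y) (G y') \<le> L * dist y y' powr \<alpha>" using H[of y' y] y y' by blast
      moreover from this have "0 \<le> L * dist y y' powr \<alpha>" using zero_le_dist order.trans by blast
      ultimately show "0 \<le> 2 * (L * dist y y' powr \<alpha>)" "2 * dist (G y) (G y') \<le> 2 * (L * dist y y' powr \<alpha>)" by auto
    qed (use lb y' in auto)
    finally show ?thesis by (simp add: dist_norm)
  qed
  moreover have "a \<in> T \<inter> v -` ball (v a) (1 / 8)" using a by simp
  ultimately show "\<exists>V C. open V \<and> a \<in> V \<and> V \<subseteq> T \<and> (\<forall>y\<in>V. \<forall>y'\<in>V. dist (v y) (v y') \<le> C * dist y y' powr \<alpha>)" by blast
qed

text \<open>The function \<open>exp u = f / g\<close> extends from the dense set where \<open>f\<close> does not vanish. The extension is zero-free on a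
  convex set, so it has a continuous logarithm \<open>v\<close>.\<close>
lemma hoelder_logarithm:
  fixes x :: "complex ^ 'n"
  assumes R: "R > 0" and A: "A \<noteq> {}" "\<And>\<alpha>. \<alpha> \<in> A ==> 0 < \<alpha> \<and> \<alpha> < 1 \<and> line_logs f x R \<alpha>"
    and g: "holo_on g (polybox x R)" "\<And>i w. w \<in> polybox x R ==> (\<lambda>s. g (on_line i w s)) holomorphic_on ball (x $ i) R"
    and gu: "\<And>w. w \<in> polybox x R ==> g w = exp (- u w) * f w" and B: "\<And>w. w \<in> polybox x R ==> norm (u w) \<le> B"
    and f: "continuous_on (polybox x R) f" and p: "p \<in> polybox x R" "f p \<noteq> 0"
  obtains v where "\<And>\<alpha>. \<alpha> \<in> A ==> holder_loc \<alpha> (polybox x (R / 2)) v" "\<And>w. w \<in> polybox x (R / 2) ==> exp (- v w) * f w = g w"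
proof -
  define P0 where "P0 = polybox x (R / 2)"
  have sub: "P0 \<subseteq> polybox x R" unfolding P0_def using R by (intro polybox_mono) simp
  define X where "X = {w\<in>P0. f w \<noteq> 0}"
  have gf: "g w \<noteq> 0 \<longleftrightarrow> f w \<noteq> 0" if "w \<in> polybox x R" for w using gu[OF that] by simp
  have dense: "P0 \<subseteq> closure X"
  proof
    fix y assume y: "y \<in> P0"
    obtain \<delta> where \<delta>: "\<delta> > 0" "\<And>\<tau>. 0 < \<tau> ==> \<tau> < \<delta> ==> g (y + \<tau> *\<^sub>R (p - y)) \<noteq> 0"
      using nonzero_on_segment_near[OF g(1) convex_polybox _ p(1)] gf[OF p(1)] p(2) y sub by blast
    show "y \<in> closure X"
      unfolding closure_approachable
    proof (intro allI impI)
      fix e :: real assume e: "e > 0"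
      obtain e' where e': "e' > 0" "ball y e' \<subseteq> P0" using y open_polybox openE unfolding P0_def by blast
      define m where "m = min e e'"
      have m: "m > 0" "m \<le> e" "m \<le> e'" using e e' by (auto simp: m_def)
      define q where "q = norm (p - y) + 1"
      have n1: "q > 0" "norm (p - y) \<le> q" using norm_ge_zero[of "p - y"] by (simp_all add: q_def add_nonneg_pos)
      define \<tau> where "\<tau> = min (\<delta> / 2) (m / (2 * q))"
      have \<tau>: "\<tau> > 0" "\<tau> < \<delta>" using \<delta>(1) m n1 by (auto simp: \<tau>_def)
      have "\<tau> * norm (p - y) \<le> m / (2 * q) * q"
        using m n1 by (intro mult_mono) (auto simp: \<tau>_def)
      also have "\<dots> = m / 2" using n1 by simp
      also have "\<dots> < m" using m by simp
      finally have d: "dist (y + \<tau> *\<^sub>R (p - y)) y < m" using \<tau> by (simp add: dist_norm)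
      hence "y + \<tau> *\<^sub>R (p - y) \<in> ball y e'" using m by (simp add: dist_commute)
      hence in0: "y + \<tau> *\<^sub>R (p - y) \<in> P0" using e'(2) by blast
      hence "f (y + \<tau> *\<^sub>R (p - y)) \<noteq> 0" using \<delta>(2)[OF \<tau>] gf sub by blast
      thus "\<exists>w\<in>X. dist w y < e" using in0 d m by (intro bexI[of _ "y + \<tau> *\<^sub>R (p - y)"]) (auto simp: X_def)
    qed
  qed
  have H: "\<exists>L. \<forall>y\<in>X. \<forall>y'\<in>X. dist (exp (u y')) (exp (u y)) \<le> L * dist y' y powr \<alpha>" if "\<alpha> \<in> A" for \<alpha>
  proof -
    have \<alpha>: "0 < \<alpha>" "\<alpha> < 1" "line_logs f x R \<alpha>" using A(2)[OF that] by auto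
    obtain L where "\<And>y y'. y \<in> polybox x (R / 2) ==> y' \<in> polybox x (R / 2) ==> f y \<noteq> 0 ==> f y' \<noteq> 0 ==>
      norm (exp (u y') - exp (u y)) \<le> L * dist y' y powr \<alpha>"
      using quotient_hoelder[OF R \<alpha> g gu B f] by blast
    thus ?thesis by (auto simp: X_def P0_def dist_norm)
  qed
  have lb: "norm (exp (u y)) \<ge> exp (- B)" if "y \<in> X" for y
  proof -
    have "- B \<le> Re (u y)" using abs_Re_le_cmod[of "u y"] B[of y] that sub by (fastforce simp: X_def)
    thus ?thesis by simp
  qed
  have A0: "\<alpha> > 0" if "\<alpha> \<in> A" for \<alpha> using A(2)[OF that] by blast
  obtain G where G: "continuous_on P0 G" "\<And>y. y \<in> X ==> G y = exp (u y)" "\<And>y. y \<in> P0 ==> norm (G y) \<ge> exp (- B)"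
    "\<And>\<alpha>. \<alpha> \<in> A ==> \<exists>L. \<forall>y\<in>P0. \<forall>y'\<in>P0. dist (G y') (G y) \<le> L * dist y' y powr \<alpha>"
    using hoelder_extension[OF dense A(1) A0 H lb] by blast
  have G0: "G y \<noteq> 0" if "y \<in> P0" for y using G(3)[OF that] by auto
  have "contractible P0" unfolding P0_def by (intro convex_imp_contractible convex_polybox)
  then obtain v where v: "continuous_on P0 v" "\<And>y. y \<in> P0 ==> G y = exp (v y)"
    using continuous_logarithm_on_contractible[OF G(1) _ G0] by metis
  show ?thesis
  proof (rule that[of v])
    fix \<alpha> assume "\<alpha> \<in> A"
    then obtain L where L: "\<And>y y'. y \<in> P0 ==> y' \<in> P0 ==> dist (G y') (G y) \<le> L * dist y' y powr \<alpha>" using G(4) by blast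
    have "holder_loc \<alpha> P0 v"
      by (rule holder_loc_log[OF _ v G(3) _ L]) (auto simp: P0_def open_polybox)
    thus "holder_loc \<alpha> (polybox x (R / 2)) v" by (simp add: P0_def)
  next
    fix w assume "w \<in> polybox x (R / 2)"
    hence w: "w \<in> P0" "w \<in> polybox x R" using sub by (auto simp: P0_def)
    show "exp (- v w) * f w = g w"
    proof (cases "f w = 0")
      case False
      hence "exp (v w) = exp (u w)" using G(2)[of w] v(2)[OF w(1)] w by (simp add: X_def)
      thus ?thesis using gu[OF w(2)] by (simp add: exp_minus)
    qed (use gu[OF w(2)] in simp)
  qed
qed

section \<open>Local factorisation\<close>

lemma line_logs_mono:
  fixes x :: "complex ^ 'n"
  assumes "line_logs f x R' \<alpha>" "R \<le> R'"
  shows "line_logs f x R \<alpha>"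
proof -
  have sub: "polybox x R \<subseteq> polybox x R'" "\<And>j. ball (x $ j) R \<subseteq> ball (x $ j) R'" using assms(2) polybox_mono by auto
  obtain C M where CM: "\<And>j w. w \<in> polybox x R' ==> \<exists>V. line_log f x R' \<alpha> C M j w V"
    using assms(1) unfolding line_logs_def by blast
  show ?thesis unfolding line_logs_def
  proof (rule exI[of _ C], rule exI[of _ M], intro allI ballI)
    fix j w assume "w \<in> polybox x R"
    then obtain V where V: "line_log f x R' \<alpha> C M j w V" using CM[of w j] sub(1) by blast
    have "line_log f x R \<alpha> C M j w V"
      using V sub(2)[of j] holomorphic_on_subset[OF _ sub(2)] unfolding line_log_def by blast
    thus "\<exists>V. line_log f x R \<alpha> C M j w V" by blast
  qed
qed

lemma separately_holomorphic_twist: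
  fixes x :: "complex ^ 'n"
  assumes R: "0 < R" "R < R'" and \<alpha>: "\<alpha> > 0" and logs: "line_logs f x R' \<alpha>" and f: "continuous_on (polybox x R') f"
  obtains u B where "\<And>w. norm (u w) \<le> B"
    "\<And>i w. w \<in> polybox x R ==> (\<lambda>s. exp (- u (on_line i w s)) * f (on_line i w s)) holomorphic_on ball (x $ i) R"
proof -
  have R': "R' > 0" using R by simp
  obtain C M where CM: "\<And>j w. w \<in> polybox x R' ==> \<exists>V. line_log f x R' \<alpha> C M j w V"
    using logs unfolding line_logs_def by blast
  define V where "V = (\<lambda>j w. SOME V. line_log f x R' \<alpha> C M j w V)"
  have V: "line_log f x R' \<alpha> C M j w (V j w)" if "w \<in> polybox x R'" for j w
    unfolding V_def by (rule someI_ex[OF CM[OF that]])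
  \<comment> \<open>The choice is made at the base point of the line, so that it is the same for all points of the line.\<close>
  define VV where "VV = (\<lambda>j w. V j (on_line j w (x $ j)))"
  have b: "on_line j w (x $ j) \<in> polybox x R'" if "w \<in> polybox x R'" for j w
    using polybox_on_line[OF that, of "x $ j" j] R' by simp
  interpret polydisc_data x f VV R' C \<alpha> M
  proof
    fix j w assume w: "w \<in> polybox x R'"
    show "(\<lambda>s. exp (- VV j w s) * f (on_line j w s)) holomorphic_on ball (x $ j) R'"
      using V[OF b[OF w], of j j] unfolding line_log_def by (simp add: VV_def)
    fix s assume s: "s \<in> ball (x $ j) R'"
    show "norm (VV j w s) \<le> M" using V[OF b[OF w], of j j] s unfolding line_log_def by (simp add: VV_def)
    fix t assume "t \<in> ball (x $ j) R'"
    thus "norm (VV j w s - VV j w t) \<le> C * dist s t powr \<alpha>" using V[OF b[OF w], of j j] s unfolding line_log_def by (simp add: VV_def)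
  qed (use R' f \<alpha> in \<open>auto simp: VV_def\<close>)
  obtain u where u: "solves_along R UNIV u" using solution_exists[OF R] by blast
  have "PJ R UNIV = polybox x R" by (simp add: PJ_def polybox_def)
  hence hol: "(\<lambda>s. exp (- u (on_line i w s)) * f (on_line i w s)) holomorphic_on ball (x $ i) R" if "w \<in> polybox x R" for i w
    using u that unfolding solves_along_def by blast
  obtain B where "\<And>w. norm (u w) \<le> B" using u unfolding solves_along_def by blast
  from that[OF this hol] show ?thesis .
qed

text \<open>If \<open>f\<close> vanishes on the whole polydisc, nothing has to be done; otherwise its zero set has dense complement.\<close>
lemma local_factorisation:
  fixes x :: "complex ^ 'n"
  assumes R': "R' > 0" and f: "continuous_on (polybox x R') f" and Bf: "\<And>w. w \<in> polybox x R' ==> norm (f w) \<le> Bf"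
    and A: "A \<noteq> {}" "\<And>\<alpha>. \<alpha> \<in> A ==> 0 < \<alpha> \<and> \<alpha> < 1 \<and> line_logs f x R' \<alpha>"
  obtains U v where "open U" "x \<in> U" "U \<subseteq> polybox x R'" "\<And>\<alpha>. \<alpha> \<in> A ==> holder_loc \<alpha> U v" "holo_on (\<lambda>w. exp (- v w) * f w) U"
proof -
  define R where "R = R' / 2"
  have R: "0 < R" "R < R'" using R' by (auto simp: R_def)
  have sub: "polybox x R \<subseteq> polybox x R'" "polybox x (R / 2) \<subseteq> polybox x R" using R by (auto intro!: polybox_mono)
  obtain \<alpha>0 where \<alpha>0: "\<alpha>0 \<in> A" using A(1) by blast
  obtain u B where u: "\<And>w. norm (u w) \<le> B"
    "\<And>i w. w \<in> polybox x R ==> (\<lambda>s. exp (- u (on_line i w s)) * f (on_line i w s)) holomorphic_on ball (x $ i) R"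
    using separately_holomorphic_twist[OF R _ _ f, of \<alpha>0] A(2)[OF \<alpha>0] by blast
  define g where "g = (\<lambda>w. exp (- u w) * f w)"
  have gs: "(\<lambda>s. g (on_line i w s)) holomorphic_on ball (x $ i) R" if "w \<in> polybox x R" for i w
    unfolding g_def by (rule u(2)[OF that])
  have gB: "norm (g w) \<le> exp B * Bf" if "w \<in> polybox x R" for w
  proof -
    have "norm (exp (- u w)) \<le> exp (norm (- u w))" by (rule norm_exp)
    also have "\<dots> \<le> exp B" using u(1)[of w] by simp
    finally show ?thesis unfolding g_def norm_mult using Bf[of w] that sub by (intro mult_mono) auto
  qed
  have gh: "holo_on g (polybox x R)" by (rule bounded_separately_holomorphic[OF gs gB])
  show ?thesis
  proof (cases "\<exists>p\<in>polybox x R. f p \<noteq> 0")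
    case True
    then obtain p where p: "p \<in> polybox x R" "f p \<noteq> 0" by blast
    have A': "0 < \<alpha> \<and> \<alpha> < 1 \<and> line_logs f x R \<alpha>" if "\<alpha> \<in> A" for \<alpha> using A(2)[OF that] line_logs_mono[of f x R' \<alpha> R] R by auto
    have gu: "g w = exp (- u w) * f w" for w by (simp add: g_def)
    obtain v where v: "\<And>\<alpha>. \<alpha> \<in> A ==> holder_loc \<alpha> (polybox x (R / 2)) v" "\<And>w. w \<in> polybox x (R / 2) ==> exp (- v w) * f w = g w"
      using hoelder_logarithm[OF R(1) A(1) A' gh gs gu u(1) continuous_on_subset[OF f sub(1)] p] by blast
    show ?thesis
    proof (rule that[OF open_polybox _ _ v(1)])
      show "x \<in> polybox x (R / 2)" using R by (intro polybox_center) simp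
      show "polybox x (R / 2) \<subseteq> polybox x R'" using sub by blast
      have "holo_on g (polybox x (R / 2))" by (rule holo_on_subset[OF gh sub(2) open_polybox])
      thus "holo_on (\<lambda>w. exp (- v w) * f w) (polybox x (R / 2))" by (rule holo_on_cong) (simp add: v(2))
    qed
  next
    case False
    show ?thesis
    proof (rule that[OF open_polybox polybox_center[OF R(1)] sub(1), of "\<lambda>_. 0"])
      show "holo_on (\<lambda>w. exp (- 0) * f w) (polybox x R)"
        by (rule holo_on_cong[OF gh]) (use False in \<open>auto simp: g_def\<close>)
      show "holder_loc \<alpha> (polybox x R) (\<lambda>_. 0 :: complex)" for \<alpha>
        unfolding holder_loc_def
      proof
        fix a assume "a \<in> polybox x R"
        thus "\<exists>V C. open V \<and> a \<in> V \<and> V \<subseteq> polybox x R \<and> (\<forall>y\<in>V. \<forall>y'\<in>V. dist (0 :: complex) 0 \<le> C * dist y y' powr \<alpha>)"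
          by (intro exI[of _ "polybox x R"] exI[of _ 0] conjI open_polybox) auto
      qed
    qed
  qed
qed

text \<open>The logarithms of the one-dimensional theory vanish at the centre, so their Hoelder constants also bound them.\<close>
lemma line_logs_of_weak_dbar:
  fixes p :: ennreal and \<Omega> :: "(complex ^ 'n) set" and f :: "complex ^ 'n \<Rightarrow> complex" and M :: real
  assumes \<Omega>: "open \<Omega>" "continuous_on \<Omega> f" and M: "M > 0"
    and weak: "\<And>j w. line_slice j w \<Omega> \<noteq> {} ==>
           \<exists>a. a \<in> borel_measurable (lebesgue_on (line_slice j w \<Omega>)) \<and>
               has_weak_dbar (line_slice j w \<Omega>) (\<lambda>\<zeta>. f (on_line j w \<zeta>)) (\<lambda>\<zeta>. a \<zeta> * f (on_line j w \<zeta>)) \<and>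
               Lp_norm p (lebesgue_on (line_slice j w \<Omega>)) a \<le> ennreal M"
    and R: "R > 0" "polybox x R \<subseteq> \<Omega>" and q: "if p = \<infinity> then q > 2 else q = enn2real p \<and> q > 2"
  shows "line_logs f x R (1 - 2 / q)"
  unfolding line_logs_def
proof (rule exI[of _ "hoelder_const q (norm_bound p M R q)"],
    rule exI[of _ "\<bar>hoelder_const q (norm_bound p M R q)\<bar> * R powr (1 - 2 / q)"], intro allI ballI)
  define \<alpha> where "\<alpha> = 1 - 2 / q"
  have "q > 2" using q by (auto split: if_splits)
  hence \<alpha>: "\<alpha> > 0" by (simp add: \<alpha>_def)
  define C where "C = hoelder_const q (norm_bound p M R q)"
  fix j w assume w: "w \<in> polybox x R"
  define W where "W = line_slice j w \<Omega>"
  define c where "c = x $ j"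
  have cW: "ball c R \<subseteq> W" unfolding W_def line_slice_def c_def using polybox_on_line[OF w] R(2) by blast
  have c: "c \<in> ball c R" using R by simp
  have line: "continuous_on UNIV (on_line j w)" by (intro continuous_intros)
  have W_open: "open W" using open_vimage[OF \<Omega>(1) line] by (simp add: W_def line_slice_def vimage_def)
  have gW: "continuous_on W (\<lambda>\<zeta>. f (on_line j w \<zeta>))"
    by (rule continuous_on_compose2[OF \<Omega>(2) continuous_on_subset[OF line]]) (auto simp: W_def line_slice_def)
  have "W \<noteq> {}" using cW c by blast
  then obtain a where a: "a \<in> borel_measurable (lebesgue_on W)" "has_weak_dbar W (\<lambda>\<zeta>. f (on_line j w \<zeta>)) (\<lambda>\<zeta>. a \<zeta> * f (on_line j w \<zeta>))"
    "Lp_norm p (lebesgue_on W) a \<le> ennreal M" using weak[of j w] unfolding W_def by blast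
  obtain V where V0: "V c = 0"
    "\<And>x y. x \<in> ball c R ==> y \<in> ball c R ==> norm (V x - V y) \<le> hoelder_const q (norm_bound p M R q) * dist x y powr (1 - 2 / q)"
    "(\<lambda>s. exp (- V s) * f (on_line j w s)) holomorphic_on ball c R"
  proof (rule weak_to_exp[where g = "\<lambda>\<zeta>. f (on_line j w \<zeta>)" and a = a, OF q R(1) cW W_open gW a(1) a(2) a(3) M])
    fix V assume 1: "V c = 0" and 2: "\<And>x y. x \<in> ball c R ==> y \<in> ball c R ==>
        norm (V x - V y) \<le> hoelder_const q (norm_bound p M R q) * dist x y powr (1 - 2 / q)"
      and 3: "(\<lambda>s. exp (- V s) * f (on_line j w s)) holomorphic_on ball c R"
    show thesis by (rule that[OF 1 2 3])
  qed
  note V = V0[folded C_def \<alpha>_def]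
  have "norm (V s) \<le> \<bar>C\<bar> * R powr \<alpha>" if s: "s \<in> ball c R" for s
  proof -
    have "norm (V s) \<le> C * dist s c powr \<alpha>" using V(2)[OF s c] V(1) by simp
    also have "\<dots> \<le> \<bar>C\<bar> * dist s c powr \<alpha>" by (intro mult_right_mono) auto
    also have "dist s c powr \<alpha> \<le> R powr \<alpha>" using s \<alpha> by (intro powr_mono2) (auto simp: dist_commute)
    hence "\<bar>C\<bar> * dist s c powr \<alpha> \<le> \<bar>C\<bar> * R powr \<alpha>" by (intro mult_left_mono) auto
    finally show ?thesis .
  qed
  hence "line_log f x R \<alpha> C (\<bar>C\<bar> * R powr \<alpha>) j w V"
    using V(2,3) unfolding line_log_def c_def by blast
  hence "line_log f x R (1 - 2 / q) (hoelder_const q (norm_bound p M R q))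
      (\<bar>hoelder_const q (norm_bound p M R q)\<bar> * R powr (1 - 2 / q)) j w V" unfolding C_def \<alpha>_def .
  thus "\<exists>V. line_log f x R (1 - 2 / q) (hoelder_const q (norm_bound p M R q))
      (\<bar>hoelder_const q (norm_bound p M R q)\<bar> * R powr (1 - 2 / q)) j w V" by blast
qed

theorem theoremA:
  fixes p :: ennreal and \<Omega> :: "(complex ^ 'n) set" and f :: "complex ^ 'n \<Rightarrow> complex" and M :: real
  assumes "2 < p"
    and "open \<Omega>"
    and "continuous_on \<Omega> f"
    and "M > 0"
    and "\<And>j w. line_slice j w \<Omega> \<noteq> {} ==>
           \<exists>a. a \<in> borel_measurable (lebesgue_on (line_slice j w \<Omega>)) \<and>
               has_weak_dbar (line_slice j w \<Omega>) (\<lambda>\<zeta>. f (on_line j w \<zeta>)) (\<lambda>\<zeta>. a \<zeta> * f (on_line j w \<zeta>)) \<and>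
               Lp_norm p (lebesgue_on (line_slice j w \<Omega>)) a \<le> ennreal M"
  shows "analytic_subset \<Omega> {z\<in>\<Omega>. f z = 0} \<and>
         (\<forall>x\<in>\<Omega>. \<exists>U u. open U \<and> x \<in> U \<and> U \<subseteq> \<Omega> \<and>
            (if p = \<infinity> then \<forall>\<alpha>. 0 < \<alpha> \<and> \<alpha> < 1 \<longrightarrow> holder_loc \<alpha> U u
             else holder_loc (1 - 2 / enn2real p) U u) \<and>
            holo_on (\<lambda>z. exp (- u z) * f z) U)"
proof -
  define A where "A = (if p = \<infinity> then {0<..<1} else {1 - 2 / enn2real p})"
  have p2: "enn2real p > 2" if "p \<noteq> \<infinity>"
  proof -
    have "p = ennreal (enn2real p)" using that by (simp add: ennreal_enn2real less_top)
    hence "ennreal 2 < ennreal (enn2real p)" using assms(1) by simp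
    thus ?thesis by (simp add: ennreal_less_iff)
  qed
  have A_ne: "A \<noteq> {}" using dense[of 0 "1 :: real"] by (auto simp: A_def)
  have q: "0 < \<alpha> \<and> \<alpha> < 1 \<and> (if p = \<infinity> then 2 / (1 - \<alpha>) > 2 else 2 / (1 - \<alpha>) = enn2real p \<and> 2 / (1 - \<alpha>) > 2)" if "\<alpha> \<in> A" for \<alpha>
  proof (cases "p = \<infinity>")
    case False
    hence "enn2real p > 2" "\<alpha> = 1 - 2 / enn2real p" using that p2 by (auto simp: A_def)
    thus ?thesis using False by simp
  qed (use that in \<open>auto simp: A_def divide_simps\<close>)
  have main: "\<exists>U u. open U \<and> x \<in> U \<and> U \<subseteq> \<Omega> \<and> (\<forall>\<alpha>\<in>A. holder_loc \<alpha> U u) \<and> holo_on (\<lambda>z. exp (- u z) * f z) U" if x: "x \<in> \<Omega>" for x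
  proof -
    have "open (\<Omega> \<inter> f -` ball (f x) 1)" by (rule continuous_open_preimage[OF assms(3,2)]) simp
    moreover have "x \<in> \<Omega> \<inter> f -` ball (f x) 1" using x by simp
    ultimately obtain R where R: "R > 0" "polybox x R \<subseteq> \<Omega> \<inter> f -` ball (f x) 1" using polybox_inside_open by blast
    have sub: "polybox x R \<subseteq> \<Omega>" using R by blast
    have Bf: "norm (f w) \<le> norm (f x) + 1" if "w \<in> polybox x R" for w
    proof -
      have "f w \<in> ball (f x) 1" using that R(2) by blast
      thus ?thesis using norm_triangle_sub[of "f w" "f x"] by (simp add: dist_norm norm_minus_commute)
    qed
    have logs: "0 < \<alpha> \<and> \<alpha> < 1 \<and> line_logs f x R \<alpha>" if "\<alpha> \<in> A" for \<alpha>
    proof -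
      have "line_logs f x R (1 - 2 / (2 / (1 - \<alpha>)))"
        by (rule line_logs_of_weak_dbar[where f = f and \<Omega> = \<Omega> and p = p and M = M, OF assms(2-5) R(1) sub]) (use q[OF that] in auto)
      moreover have "1 - 2 / (2 / (1 - \<alpha>)) = \<alpha>" by (simp add: field_simps)
      ultimately have "line_logs f x R \<alpha>" by (simp only:)
      thus ?thesis using q[OF that] by blast
    qed
    obtain U v where "open U" "x \<in> U" "U \<subseteq> polybox x R" "\<And>\<alpha>. \<alpha> \<in> A ==> holder_loc \<alpha> U v" "holo_on (\<lambda>w. exp (- v w) * f w) U"
    proof (rule local_factorisation[where f = f and x = x and A = A, OF R(1) continuous_on_subset[OF assms(3) sub] Bf A_ne logs])
      fix U v assume 1: "open U" "x \<in> U" "U \<subseteq> polybox x R" and 2: "\<And>\<alpha>. \<alpha> \<in> A ==> holder_loc \<alpha> U v"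
        and 3: "holo_on (\<lambda>w. exp (- v w) * f w) U"
      show thesis by (rule that[OF 1 2 3])
    qed
    thus ?thesis using sub by blast
  qed
  have "analytic_subset \<Omega> {z\<in>\<Omega>. f z = 0}"
    unfolding analytic_subset_def
  proof (intro conjI ballI)
    fix a assume "a \<in> \<Omega>"
    then obtain U u where U: "open U" "a \<in> U" "U \<subseteq> \<Omega>" "holo_on (\<lambda>z. exp (- u z) * f z) U" using main by blast
    have "finite {\<lambda>z. exp (- u z) * f z}" "\<forall>g\<in>{\<lambda>z. exp (- u z) * f z}. holo_on g U"
      "{z\<in>\<Omega>. f z = 0} \<inter> U = {z\<in>U. \<forall>g\<in>{\<lambda>z. exp (- u z) * f z}. g z = 0}" using U by auto
    thus "\<exists>U G. open U \<and> a \<in> U \<and> U \<subseteq> \<Omega> \<and> finite G \<and> (\<forall>g\<in>G. holo_on g U) \<and> {z\<in>\<Omega>. f z = 0} \<inter> U = {z\<in>U. \<forall>g\<in>G. g z = 0}"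
      using U by blast
  qed auto
  moreover have "\<exists>U u. open U \<and> x \<in> U \<and> U \<subseteq> \<Omega> \<and>
            (if p = \<infinity> then \<forall>\<alpha>. 0 < \<alpha> \<and> \<alpha> < 1 \<longrightarrow> holder_loc \<alpha> U u
             else holder_loc (1 - 2 / enn2real p) U u) \<and>
            holo_on (\<lambda>z. exp (- u z) * f z) U" if x: "x \<in> \<Omega>" for x
  proof -
    obtain U u where U: "open U" "x \<in> U" "U \<subseteq> \<Omega>" "\<forall>\<alpha>\<in>A. holder_loc \<alpha> U u" "holo_on (\<lambda>z. exp (- u z) * f z) U"
      using main[OF x] by blast
    have "if p = \<infinity> then \<forall>\<alpha>. 0 < \<alpha> \<and> \<alpha> < 1 \<longrightarrow> holder_loc \<alpha> U u else holder_loc (1 - 2 / enn2real p) U u"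
      using U(4) by (simp add: A_def)
    with U show ?thesis by blast
  qed
  ultimately show ?thesis by blast
qed


end
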